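(* Let $\mu\in\mathcal M$ be any limiting distribution and let $\sigma=\sigma_\mu$. Let $n,r\ge 0$ and $m,q\ge 1$ be integers with $n\le m$, and let $C_1,\dots,C_q\subseteq\{1,\dots,m\}$ be arbitrary subsets. Put $C_l^1=C_l\cap\{1,\dots,n\}$, $C_l^2=C_l\cap\{n+1,\dots,m\}$, and for $l\le q$ $$U_l=\mathbb E'\,\mathrm{Av}_\varepsilon\prod_{i\in C_l^1}\varepsilon_i\,\exp\Big(\sum_{i\le n}A_i(\varepsilon_i)\Big)\prod_{i\in C_l^2}s_i\,\exp\Big(\sum_{k\le r}\hat\theta_k(\hat s_{1,k},\dots,\hat s_{p,k})\Big),$$ $$V=\mathbb E'\,\mathrm{Av}_\varepsilon\exp\Big(\sum_{i\le n}A_i(\varepsilon_i)\Big)\exp\Big(\sum_{k\le r}\hat\theta_k(\hat s_{1,k},\dots,\hat s_{p,k})\Big).$$ Then $$\mathbb E\prod_{l\le q}\prod_{i\in C_l}s_i^l=\mathbb E\prod_{l\le q}\mathbb E'\prod_{i\in C_l}s_i=\mathbb E\,\frac{\prod_{l\le q}U_l}{V^q}.$$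
   Context: Model. Let $p\ge 2$ be an even integer and $\alpha>0$. Let $\theta:\{-1,+1\}^p\to\mathbb R$ be a random function such that $\exp\theta(\sigma_1,\dots,\sigma_p)=a(1+bf_1(\sigma_1)\cdots f_p(\sigma_p))$, where $f_1,\dots,f_p$ are independent copies of a random function $f:\{-1,+1\}\to\mathbb R$, $b$ is a random variable independent of $f_1,\dots,f_p$ with $\mathbb E(-b)^n\ge 0$ for all $n\ge1$, and $a$ is a random variable with $\mathbb E|\log a|<\infty$. Assume $|bf_1(\sigma_1)\cdots f_p(\sigma_p)|<1$ a.s., and $-\infty<\mathbb E\min_\sigma\theta(\sigma_1,\dots,\sigma_p)$, $\mathbb E\max_\sigma\theta(\sigma_1,\dots,\sigma_p)<+\infty$. Throughout, $\pi(\lambda)$, $\pi_j(\lambda)$ denote Poisson random variables with mean $\lambda$; all random variables introduced are independent of each other unless stated otherwise; $\theta_k,\theta_{k,l},\hat\theta_k,\dots$ are independent copies of $\theta$; $\mathrm{Av}_\varepsilon$ is the uniform average over $\varepsilon\in\{-1,+1\}$, or over all signs $\varepsilon_i\in\{-1,+1\}$ if several are present. Let $(c_N)$ satisfy $c_N\to\infty$, $c_N/N\to0$, $|c_{N+1}-c_N|\to0$. For $\boldsymbol\sigma\in\Sigma_N=\{-1,+1\}^N$ let $$-H_N(\boldsymbol\sigma)=\sum_{k\le\pi(\alpha N)}\theta_k(\sigma_{i_{1,k}},\dots,\sigma_{i_{p,k}})+\sum_{l\le\pi(c_N)}\log\mathrm{Av}_\varepsilon\exp\sum_{k\le\pi_l(\alpha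 p)}\theta_{k,l}(\varepsilon,\sigma_{i_{1,k,l}},\dots,\sigma_{i_{p-1,k,l}}),$$ where all indices $i_{j,k},i_{j,k,l}$ are i.i.d. uniform on $\{1,\dots,N\}$. The Gibbs measure is $G_N(\boldsymbol\sigma)=Z_N^{-1}\exp(-H_N(\boldsymbol\sigma))$, $Z_N=\sum_{\boldsymbol\sigma}\exp(-H_N(\boldsymbol\sigma))$. Limiting distributions. Let $(\boldsymbol\sigma^l)_{l\ge1}$ be i.i.d. replicas from $G_N$ and let $\mu_N$ be the joint distribution of the array $(\sigma_i^l)_{1\le i\le N,\,l\ge1}$ under $\mathbb E G_N^{\otimes\infty}$, viewed as a distribution on arrays indexed by $i,l\ge1$ by setting $\sigma_i^l=0$ for $i>N$. $\mathcal M$ is the set of all limits (of finite-dimensional distributions) of $(\mu_N)$ over subsequences. Every $\mu\in\mathcal M$ is invariant under permutations of rows and of columns, so by Aldous–Hoover there is a measurable $\sigma_\mu:[0,1]^4\to\{-1,+1\}$ such that $\mu$ is the law of $s_i^l=\sigma_\mu(w,u_l,v_i,x_{i,l})$ with $w,(u_l),(v_i),(x_{i,l})$ i.i.d. uniform on $[0,1]$; $\sigma_\mu$ is any such function. Notation. Let $w,u$, and, for all $n\ge1$ and all multi-indices $(i_1,\dots,i_n)$, $v_{i_1,\dots,i_n},x_{i_1,\dots,i_n},\hat v_{i_1,\dots,i_n},\hat x_{i_1,\dots,i_n}$ be independent uniform on $[0,1]$, and put $s_{i_1,\dots,i_n}=\sigma(w,u,v_{i_1,\dots,i_n},x_{i_1,\dots,i_n})$,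 $\hat s_{i_1,\dots,i_n}=\sigma(w,u,\hat v_{i_1,\dots,i_n},\hat x_{i_1,\dots,i_n})$ (same $w,u$ in both). For $i\ge1$ and $\varepsilon\in\{-1,+1\}$, $A_i(\varepsilon)=\sum_{k\le\pi_i(p\alpha)}\theta_{k,i}(\varepsilon,s_{1,i,k},\dots,s_{p-1,i,k})$. $\mathbb E'$ denotes the expectation in $u$ and in all the variables $x,\hat x$ only; $\mathbb E$ is the expectation over all randomness. Empty sums are $0$ and empty products are $1$. *)

theory Defs
  imports "HOL-Probability.Probability"
begin

text \<open>
  Spins are reals in \<open>signs\<close>. A function of \<open>p\<close> spins takes a list of length \<open>p\<close>;
  random functions on a set \<open>A\<close> are random elements of the product space \<open>fun_space A\<close>,
  so their values are extensional on \<open>A\<close>.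
\<close>

definition signs :: "real set" where
  "signs = {-1, 1}"

definition cube :: "nat \<Rightarrow> real list set" where
  "cube p = {xs. length xs = p \<and> set xs \<subseteq> signs}"

definition configs :: "nat \<Rightarrow> (nat \<Rightarrow> real) set" where
  "configs N = (\<Pi>\<^sub>E i\<in>{1..N}. signs)"

definition fun_space :: "'b set \<Rightarrow> ('b \<Rightarrow> real) measure" where
  "fun_space A = (\<Pi>\<^sub>M x\<in>A. borel)"

definition Av :: "'b set \<Rightarrow> ('b \<Rightarrow> real) \<Rightarrow> real" where
  "Av A g = (\<Sum>x\<in>A. g x) / real (card A)"

definition unif01 :: "real measure" where
  "unif01 = restrict_space lborel {0..1}"

definition unif_site :: "nat \<Rightarrow> nat measure" where
  "unif_site N = measure_pmf (pmf_of_set {1..N})"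

definition poisson :: "real \<Rightarrow> nat measure" where
  "poisson rate = measure_pmf (poisson_pmf rate)"

text \<open>
  Below \<open>L\<close> is the law of \<open>\<theta>\<close> on \<open>fun_space (cube p)\<close>. The randomness of \<open>H\<^sub>N\<close> is a tuple
  \<open>(P, \<theta>, i, P', Q, \<theta>', i')\<close> consisting of
  \<open>\<pi>(\<alpha> N)\<close>, \<open>\<theta>\<^sub>k\<close>, \<open>i\<^sub>j\<^sub>,\<^sub>k\<close>, \<open>\<pi>(c\<^sub>N)\<close>, \<open>\<pi>\<^sub>l(\<alpha> p)\<close>, \<open>\<theta>\<^sub>k\<^sub>,\<^sub>l\<close>, \<open>i\<^sub>j\<^sub>,\<^sub>k\<^sub>,\<^sub>l\<close>.
\<close>

type_synonym interaction = "real list \<Rightarrow> real"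

type_synonym disorder =
  "nat \<times> (nat \<Rightarrow> interaction) \<times> (nat \<times> nat \<Rightarrow> nat) \<times>
   nat \<times> (nat \<Rightarrow> nat) \<times> (nat \<times> nat \<Rightarrow> interaction) \<times> (nat \<times> nat \<times> nat \<Rightarrow> nat)"

definition disorder_law ::
  "interaction measure \<Rightarrow> nat \<Rightarrow> real \<Rightarrow> (nat \<Rightarrow> real) \<Rightarrow> nat \<Rightarrow> disorder measure" where
  "disorder_law L p \<alpha> c N =
     poisson (\<alpha> * real N) \<Otimes>\<^sub>M (\<Pi>\<^sub>M k\<in>UNIV. L) \<Otimes>\<^sub>M (\<Pi>\<^sub>M jk\<in>UNIV. unif_site N) \<Otimes>\<^sub>M
     poisson (c N) \<Otimes>\<^sub>M (\<Pi>\<^sub>M l\<in>UNIV. poisson (\<alpha> * real p)) \<Otimes>\<^sub>M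
     (\<Pi>\<^sub>M kl\<in>UNIV. L) \<Otimes>\<^sub>M (\<Pi>\<^sub>M jkl\<in>UNIV. unif_site N)"

text \<open>This is \<open>-H\<^sub>N(\<sigma>)\<close>, sign included.\<close>

fun neg_H :: "nat \<Rightarrow> disorder \<Rightarrow> (nat \<Rightarrow> real) \<Rightarrow> real" where
  "neg_H p (P, \<theta>, i, P', Q, \<theta>', i') \<sigma> =
     (\<Sum>k=1..P. \<theta> k (map (\<lambda>j. \<sigma> (i (j, k))) [1..<Suc p])) +
     (\<Sum>l=1..P'. ln (Av signs (\<lambda>\<epsilon>.
        exp (\<Sum>k=1..Q l. \<theta>' (k, l) (\<epsilon> # map (\<lambda>j. \<sigma> (i' (j, k, l))) [1..<p])))))"

definition partition_fun :: "nat \<Rightarrow> nat \<Rightarrow> disorder \<Rightarrow> real" where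
  "partition_fun p N d = (\<Sum>\<sigma>\<in>configs N. exp (neg_H p d \<sigma>))"

definition gibbs :: "nat \<Rightarrow> nat \<Rightarrow> disorder \<Rightarrow> (nat \<Rightarrow> real) measure" where
  "gibbs p N d =
     point_measure (configs N) (\<lambda>\<sigma>. ennreal (exp (neg_H p d \<sigma>) / partition_fun p N d))"

text \<open>The entry \<open>(i, l)\<close> of an array is the spin at site \<open>i\<close> in replica \<open>l\<close>.\<close>

definition array_idx :: "(nat \<times> nat) set" where
  "array_idx = {1..} \<times> {1..}"

definition arrays :: "(nat \<times> nat \<Rightarrow> real) measure" where
  "arrays = (\<Pi>\<^sub>M il\<in>array_idx. borel)"

definition replica_array :: "nat \<Rightarrow> (nat \<Rightarrow> nat \<Rightarrow> real) \<Rightarrow> nat \<times> nat \<Rightarrow> real" where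
  "replica_array N s = (\<lambda>(i, l)\<in>array_idx. if i \<le> N then s l i else 0)"

definition array_law ::
  "interaction measure \<Rightarrow> nat \<Rightarrow> real \<Rightarrow> (nat \<Rightarrow> real) \<Rightarrow> nat \<Rightarrow> (nat \<times> nat \<Rightarrow> real) measure" where
  "array_law L p \<alpha> c N =
     disorder_law L p \<alpha> c N \<bind>
       (\<lambda>d. distr (\<Pi>\<^sub>M l\<in>{1..}. gibbs p N d) arrays (replica_array N))"

definition fdd_converges ::
  "(nat \<Rightarrow> (nat \<times> nat \<Rightarrow> real) measure) \<Rightarrow> (nat \<times> nat \<Rightarrow> real) measure \<Rightarrow> bool" where
  "fdd_converges \<mu> \<nu> \<longleftrightarrow>
     (\<forall>F g. finite F \<and> F \<subseteq> array_idx \<and>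
        continuous_map (product_topology (\<lambda>_. euclideanreal) F) euclideanreal g \<and>
        bounded (g ` (\<Pi>\<^sub>E il\<in>F. UNIV)) \<longrightarrow>
        (\<lambda>N. \<integral>s. g (restrict s F) \<partial>\<mu> N) \<longlonglongrightarrow> (\<integral>s. g (restrict s F) \<partial>\<nu>))"

text \<open>
  Since \<open>c\<^sub>N \<longrightarrow> \<infinity>\<close>, the finitely many \<open>N\<close> for which \<open>poisson (c N)\<close>, \<open>poisson (\<alpha> * N)\<close> or
  \<open>unif_site N\<close> has a degenerate parameter do not influence this set.
\<close>

definition limit_laws ::
  "interaction measure \<Rightarrow> nat \<Rightarrow> real \<Rightarrow> (nat \<Rightarrow> real) \<Rightarrow> (nat \<times> nat \<Rightarrow> real) measure set" where
  "limit_laws L p \<alpha> c =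
     {\<mu>. prob_space \<mu> \<and> sets \<mu> = sets arrays \<and>
         (\<exists>N. strict_mono N \<and> fdd_converges (\<lambda>k. array_law L p \<alpha> c (N k)) \<mu>)}"

text \<open>Law of \<open>(w, (u\<^sub>l), (v\<^sub>i), (x\<^sub>i\<^sub>,\<^sub>l))\<close>.\<close>

definition seeds ::
  "(real \<times> (nat \<Rightarrow> real) \<times> (nat \<Rightarrow> real) \<times> (nat \<times> nat \<Rightarrow> real)) measure" where
  "seeds = unif01 \<Otimes>\<^sub>M (\<Pi>\<^sub>M l\<in>{1..}. unif01) \<Otimes>\<^sub>M (\<Pi>\<^sub>M i\<in>{1..}. unif01) \<Otimes>\<^sub>M
             (\<Pi>\<^sub>M il\<in>array_idx. unif01)"

fun spin_array ::
  "(real \<times> real \<times> real \<times> real \<Rightarrow> real) \<Rightarrow>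
   real \<times> (nat \<Rightarrow> real) \<times> (nat \<Rightarrow> real) \<times> (nat \<times> nat \<Rightarrow> real) \<Rightarrow> nat \<times> nat \<Rightarrow> real" where
  "spin_array \<sigma> (w, u, v, x) = (\<lambda>(i, l)\<in>array_idx. \<sigma> (w, u l, v i, x (i, l)))"

definition represents ::
  "(real \<times> real \<times> real \<times> real \<Rightarrow> real) \<Rightarrow> (nat \<times> nat \<Rightarrow> real) measure \<Rightarrow> bool" where
  "represents \<sigma> \<mu> \<longleftrightarrow>
     \<sigma> \<in> borel_measurable (unif01 \<Otimes>\<^sub>M unif01 \<Otimes>\<^sub>M unif01 \<Otimes>\<^sub>M unif01) \<and>
     \<sigma> ` ({0..1} \<times> {0..1} \<times> {0..1} \<times> {0..1}) \<subseteq> signs \<and>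
     distr seeds arrays (spin_array \<sigma>) = \<mu>"

text \<open>
  Multi-indices \<open>(i\<^sub>1, \<dots>, i\<^sub>n)\<close> are lists, and the families are indexed by all lists. An \<open>inner\<close>
  value \<open>(u, x, xh)\<close> is the randomness averaged by the inner expectation; an \<open>outer\<close> value
  \<open>(w, v, vh, (\<pi>\<^sub>i(p \<alpha>)), (\<theta>\<^sub>k\<^sub>,\<^sub>i), (\<theta>h\<^sub>k))\<close> is everything else. The letter \<open>h\<close> stands for a hat.
\<close>

type_synonym inner = "real \<times> (nat list \<Rightarrow> real) \<times> (nat list \<Rightarrow> real)"

type_synonym outer =
  "real \<times> (nat list \<Rightarrow> real) \<times> (nat list \<Rightarrow> real) \<times> (nat \<Rightarrow> nat) \<times>
   (nat \<times> nat \<Rightarrow> interaction) \<times> (nat \<Rightarrow> interaction)"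

definition inner_law :: "inner measure" where
  "inner_law = unif01 \<Otimes>\<^sub>M (\<Pi>\<^sub>M I\<in>UNIV. unif01) \<Otimes>\<^sub>M (\<Pi>\<^sub>M I\<in>UNIV. unif01)"

definition outer_law :: "interaction measure \<Rightarrow> nat \<Rightarrow> real \<Rightarrow> outer measure" where
  "outer_law L p \<alpha> =
     unif01 \<Otimes>\<^sub>M (\<Pi>\<^sub>M I\<in>UNIV. unif01) \<Otimes>\<^sub>M (\<Pi>\<^sub>M I\<in>UNIV. unif01) \<Otimes>\<^sub>M
     (\<Pi>\<^sub>M i\<in>UNIV. poisson (real p * \<alpha>)) \<Otimes>\<^sub>M (\<Pi>\<^sub>M ki\<in>UNIV. L) \<Otimes>\<^sub>M (\<Pi>\<^sub>M k\<in>UNIV. L)"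

fun spin :: "(real \<times> real \<times> real \<times> real \<Rightarrow> real) \<Rightarrow> outer \<Rightarrow> inner \<Rightarrow> nat list \<Rightarrow> real" where
  "spin \<sigma> (w, v, vh, P, \<theta>, \<theta>h) (u, x, xh) I = \<sigma> (w, u, v I, x I)"

fun spin_hat :: "(real \<times> real \<times> real \<times> real \<Rightarrow> real) \<Rightarrow> outer \<Rightarrow> inner \<Rightarrow> nat list \<Rightarrow> real" where
  "spin_hat \<sigma> (w, v, vh, P, \<theta>, \<theta>h) (u, x, xh) I = \<sigma> (w, u, vh I, xh I)"

text \<open>
  \<open>cavity_A\<close> is \<open>A\<^sub>i(\<epsilon>)\<close>, and \<open>cavity_B\<close> is the sum over \<open>k \<le> r\<close> of the hatted interactions at
  the hatted spins with multi-indices \<open>(1, k), \<dots>, (p, k)\<close>.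
\<close>

fun cavity_A ::
  "nat \<Rightarrow> (real \<times> real \<times> real \<times> real \<Rightarrow> real) \<Rightarrow> outer \<Rightarrow> inner \<Rightarrow> nat \<Rightarrow> real \<Rightarrow> real" where
  "cavity_A p \<sigma> (w, v, vh, P, \<theta>, \<theta>h) y i \<epsilon> =
     (\<Sum>k=1..P i. \<theta> (k, i)
        (\<epsilon> # map (\<lambda>j. spin \<sigma> (w, v, vh, P, \<theta>, \<theta>h) y [j, i, k]) [1..<p]))"

fun cavity_B ::
  "nat \<Rightarrow> nat \<Rightarrow> (real \<times> real \<times> real \<times> real \<Rightarrow> real) \<Rightarrow> outer \<Rightarrow> inner \<Rightarrow> real" where
  "cavity_B p r \<sigma> (w, v, vh, P, \<theta>, \<theta>h) y =
     (\<Sum>k=1..r. \<theta>h k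
        (map (\<lambda>j. spin_hat \<sigma> (w, v, vh, P, \<theta>, \<theta>h) y [j, k]) [1..<Suc p]))"

definition cavity_U ::
  "nat \<Rightarrow> nat \<Rightarrow> nat \<Rightarrow> nat \<Rightarrow> (real \<times> real \<times> real \<times> real \<Rightarrow> real) \<Rightarrow> nat set \<Rightarrow> outer \<Rightarrow> real"
where
  "cavity_U p n r m \<sigma> D z =
     (\<integral>y. Av (configs n) (\<lambda>\<epsilon>.
        (\<Prod>i\<in>D \<inter> {1..n}. \<epsilon> i) * exp (\<Sum>i=1..n. cavity_A p \<sigma> z y i (\<epsilon> i)) *
        (\<Prod>i\<in>D \<inter> {n+1..m}. spin \<sigma> z y [i]) * exp (cavity_B p r \<sigma> z y)) \<partial>inner_law)"

definition cavity_V ::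
  "nat \<Rightarrow> nat \<Rightarrow> nat \<Rightarrow> (real \<times> real \<times> real \<times> real \<Rightarrow> real) \<Rightarrow> outer \<Rightarrow> real" where
  "cavity_V p n r \<sigma> z =
     (\<integral>y. Av (configs n) (\<lambda>\<epsilon>.
        exp (\<Sum>i=1..n. cavity_A p \<sigma> z y i (\<epsilon> i)) * exp (cavity_B p r \<sigma> z y)) \<partial>inner_law)"

end

theory Submission
  imports Defs "HOL-Combinatorics.Permutations" "HOL-Combinatorics.List_Permutation"
begin

text \<open>
  The Hamiltonian is a sum of Poisson many random terms. In the system with \<open>N + n\<close> sites the
  terms which involve one of the last \<open>n\<close> sites are, up to a small total variation distance,
  independent \<open>Poisson(\<alpha> p)\<close> many interactions of each of these sites with sites below \<open>N\<close>, while
  the other terms have nearly the law of the system with \<open>N\<close> sites. A cavity site which is not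
  observed acts on the rest like one term of the perturbation; as \<open>c\<^sub>N\<close> tends to infinity, boundedly
  many additional perturbation terms change the law by \<open>o(1)\<close>, and likewise for \<open>r\<close> additional
  interactions. So the moments of the systems with \<open>N\<close> and \<open>N + n\<close> sites agree asymptotically,
  and the latter are averages of ratios \<open>\<Prod>U\<^sub>l / V\<^sup>q\<close> of Gibbs averages of local functions. The
  denominators are bounded away from \<open>0\<close> for fixed interactions, and approximating \<open>1 / x\<^sup>q\<close>
  by polynomials turns the ratios into replica averages, which converge along the subsequence.

  Counting terms by the cavity sites they involve requires a law of \<open>\<theta>\<close> which is invariant under
  permutations of its arguments. The law of \<open>\<theta>\<close> need not be, as \<open>a\<close> may depend on the \<open>f\<^sub>j\<close>, but
  that of \<open>\<theta> - \<theta>(1, \<dots>, 1)\<close> is: it is a function of \<open>b\<close> and the \<open>f\<^sub>j\<close> only. Gibbs averages and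
  the ratios \<open>\<Prod>U\<^sub>l / V\<^sup>q\<close> do not change when constants are subtracted from the interactions.
\<close>

section \<open>Compound Poisson distributions on a commutative monoid\<close>

text \<open>Two kinds of randomness are kept apart. The numbers of terms and their sites are
  discrete and form a \<open>pmf\<close> on multisets of terms, where total variation bounds are
  elementary. The interactions have an arbitrary law and are integrated out term by term by the
  operators \<open>step\<close>; these commute, so a multiset records enough. The rate \<alpha> p
  arises from \<alpha> (N + n) interactions, each containing a given cavity site with probability
  about p / (N + n). Interactions with two cavity sites contribute O(1 / N) in total, and
  perturbation terms containing a cavity site O(c_N / N). A bounded change of a Poisson rate l costs
  O(1 / sqrt l). The sites in the ratios are random and may coincide, while the limit law speaks of
  fixed distinct rows. Invariance under permutations of sites is the bridge: with probability 1 -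
  O(1 / N) the sites are distinct and can be moved to numbers that code the multi-indices, odd ones
  without hat and even ones with hat, so that v and v-hat become disjoint sets of rows of one array.
  The middle expression of the theorem is the case n = r = 0 of the last one.\<close>

lemma integrable_pmf_bounded:
  fixes f :: "'a \<Rightarrow> real"
  assumes "\<And>x. \<bar>f x\<bar> \<le> B"
  shows "integrable (measure_pmf p) f"
  by (rule measure_pmf.integrable_const_bound[where B=B]) (use assms in auto)

lemma expectation_bind_pmf:
  fixes f :: "'b \<Rightarrow> real"
  assumes "\<And>x. \<bar>f x\<bar> \<le> B"
  shows "measure_pmf.expectation (bind_pmf p k) f =
    measure_pmf.expectation p (\<lambda>x. measure_pmf.expectation (k x) f)"
  unfolding measure_pmf_bind
  by (rule integral_bind[where K="count_space UNIV" and B=B and B'=1])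
    (use assms in \<open>auto simp: measure_pmf_in_subprob_algebra measure_pmf.emeasure_eq_measure\<close>)

lemma abs_expectation_le:
  fixes f :: "'a \<Rightarrow> real"
  assumes "\<And>x. \<bar>f x\<bar> \<le> B"
  shows "\<bar>measure_pmf.expectation p f\<bar> \<le> B"
proof -
  have "\<bar>measure_pmf.expectation p f\<bar> \<le> measure_pmf.expectation p (\<lambda>x. \<bar>f x\<bar>)"
    by (rule integral_abs_bound)
  also have "\<dots> \<le> measure_pmf.expectation p (\<lambda>_. B)"
    by (rule integral_mono) (use assms integrable_pmf_bounded[of "\<lambda>x. \<bar>f x\<bar>" B] in auto)
  finally show ?thesis by simp
qed

text \<open>The dual form of the distance, with test functions bounded by 1; the optimal e is twice
  the usual total variation distance. Only expectations of bounded functions are compared later, so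
  neither densities nor couplings appear.\<close>

definition tv_le :: "'a pmf \<Rightarrow> 'a pmf \<Rightarrow> real \<Rightarrow> bool" where
  "tv_le p q e \<longleftrightarrow> (\<forall>f. (\<forall>x. \<bar>f x\<bar> \<le> (1::real)) \<longrightarrow>
     \<bar>measure_pmf.expectation p f - measure_pmf.expectation q f\<bar> \<le> e)"

lemma tv_leD: "tv_le p q e \<Longrightarrow> (\<And>x. \<bar>f x\<bar> \<le> 1) \<Longrightarrow>
    \<bar>measure_pmf.expectation p f - measure_pmf.expectation q f\<bar> \<le> e"
  unfolding tv_le_def by auto

lemma tv_le_refl [simp]: "0 \<le> e \<Longrightarrow> tv_le p p e"
  unfolding tv_le_def by auto

lemma tv_le_sym: "tv_le p q e \<Longrightarrow> tv_le q p e"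
  unfolding tv_le_def by (simp add: abs_minus_commute)

lemma tv_le_trans: "tv_le p q e \<Longrightarrow> tv_le q s e' \<Longrightarrow> tv_le p s (e + e')"
  unfolding tv_le_def
proof (intro allI impI)
  fix f :: "'a \<Rightarrow> real"
  assume a: "\<forall>f. (\<forall>x. \<bar>f x\<bar> \<le> 1) \<longrightarrow> \<bar>measure_pmf.expectation p f - measure_pmf.expectation q f\<bar> \<le> e"
    "\<forall>f. (\<forall>x. \<bar>f x\<bar> \<le> 1) \<longrightarrow> \<bar>measure_pmf.expectation q f - measure_pmf.expectation s f\<bar> \<le> e'"
    "\<forall>x. \<bar>f x\<bar> \<le> 1"
  then show "\<bar>measure_pmf.expectation p f - measure_pmf.expectation s f\<bar> \<le> e + e'"
    using a(1)[rule_format, of f] a(2)[rule_format, of f] by fastforce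
qed

lemma tv_le_mono: "tv_le p q e \<Longrightarrow> e \<le> e' \<Longrightarrow> tv_le p q e'"
  unfolding tv_le_def by (meson order_trans)

lemma tv_le_bind_left:
  assumes "tv_le p q e" shows "tv_le (bind_pmf p k) (bind_pmf q k) e"
  unfolding tv_le_def
proof (intro allI impI)
  fix f :: "'b \<Rightarrow> real" assume f: "\<forall>x. \<bar>f x\<bar> \<le> 1"
  show "\<bar>measure_pmf.expectation (bind_pmf p k) f - measure_pmf.expectation (bind_pmf q k) f\<bar> \<le> e"
    using f by (simp add: expectation_bind_pmf[where B=1] tv_leD[OF assms] abs_expectation_le)
qed

text \<open>The error may depend on the first variable and is then averaged. With a Poisson number
  of summands it grows linearly in their number, so only the mean of that number enters.\<close>

lemma tv_le_bind_right:
  assumes "\<And>x. tv_le (k x) (k' x) (e x)" "integrable (measure_pmf p) e"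
  shows "tv_le (bind_pmf p k) (bind_pmf p k') (measure_pmf.expectation p e)"
  unfolding tv_le_def
proof (intro allI impI)
  fix f :: "'b \<Rightarrow> real" assume f: "\<forall>x. \<bar>f x\<bar> \<le> 1"
  have i: "integrable (measure_pmf p) (\<lambda>x. measure_pmf.expectation (k x) f)" for k
    using f by (intro integrable_pmf_bounded[where B=1] abs_expectation_le) auto
  have "\<bar>measure_pmf.expectation (bind_pmf p k) f - measure_pmf.expectation (bind_pmf p k') f\<bar> =
     \<bar>measure_pmf.expectation p (\<lambda>x. measure_pmf.expectation (k x) f - measure_pmf.expectation (k' x) f)\<bar>"
    using f by (simp add: expectation_bind_pmf[where B=1] Bochner_Integration.integral_diff i)
  also have "\<dots> \<le> measure_pmf.expectation p (\<lambda>x. \<bar>measure_pmf.expectation (k x) f - measure_pmf.expectation (k' x) f\<bar>)"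
    by (rule integral_abs_bound)
  also have "\<dots> \<le> measure_pmf.expectation p e"
    by (rule integral_mono) (use assms f i in \<open>auto intro!: integrable_abs Bochner_Integration.integrable_diff tv_leD\<close>)
  finally show "\<bar>measure_pmf.expectation (bind_pmf p k) f - measure_pmf.expectation (bind_pmf p k') f\<bar>
     \<le> measure_pmf.expectation p e" .
qed

lemma tv_le_bind_right_const:
  assumes "\<And>x. tv_le (k x) (k' x) e"
  shows "tv_le (bind_pmf p k) (bind_pmf p k') e"
  using tv_le_bind_right[of k k' "\<lambda>_. e" p] assms by simp

lemma tv_le_map: "tv_le p q e \<Longrightarrow> tv_le (map_pmf g p) (map_pmf g q) e"
  unfolding map_pmf_def by (rule tv_le_bind_left)

section \<open>Convolutions and compound Poisson laws\<close>

definition conv_pmf :: "'m::comm_monoid_add pmf \<Rightarrow> 'm pmf \<Rightarrow> 'm pmf" where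
  "conv_pmf p q = bind_pmf p (\<lambda>x. bind_pmf q (\<lambda>y. return_pmf (x + y)))"

lemma conv_pmf_commute: "conv_pmf p q = conv_pmf q p"
  unfolding conv_pmf_def by (subst bind_commute_pmf) (simp add: add.commute)

lemma conv_pmf_assoc: "conv_pmf (conv_pmf p q) s = conv_pmf p (conv_pmf q s)"
  unfolding conv_pmf_def by (simp add: bind_assoc_pmf bind_return_pmf add.assoc)

lemma conv_pmf_return [simp]: "conv_pmf (return_pmf 0) p = p" "conv_pmf p (return_pmf 0) = p"
  unfolding conv_pmf_def by (simp_all add: bind_return_pmf bind_return_pmf')

lemma conv_pmf_left_commute: "conv_pmf p (conv_pmf q s) = conv_pmf q (conv_pmf p s)"
  by (metis conv_pmf_assoc conv_pmf_commute)

lemmas conv_pmf_ac = conv_pmf_assoc conv_pmf_commute conv_pmf_left_commute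

lemma conv_bind_left: "conv_pmf (bind_pmf p k) q = bind_pmf p (\<lambda>x. conv_pmf (k x) q)"
  unfolding conv_pmf_def by (simp add: bind_assoc_pmf)

lemma conv_bind_right: "conv_pmf q (bind_pmf p k) = bind_pmf p (\<lambda>x. conv_pmf q (k x))"
  by (metis (no_types, lifting) conv_bind_left conv_pmf_commute bind_pmf_cong)

text \<open>The two factors are exchanged one after the other, so the errors add up.\<close>

lemma tv_le_conv:
  assumes "tv_le p q e" "tv_le p' q' e'"
  shows "tv_le (conv_pmf p p') (conv_pmf q q') (e + e')"
proof (rule tv_le_trans)
  show "tv_le (conv_pmf p p') (conv_pmf q p') e"
    unfolding conv_pmf_def by (rule tv_le_bind_left) fact
  show "tv_le (conv_pmf q p') (conv_pmf q q') e'"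
    unfolding conv_pmf_def by (intro tv_le_bind_right_const tv_le_bind_left) fact
qed

lemma expectation_conv:
  fixes f :: "'m::comm_monoid_add \<Rightarrow> real"
  assumes "\<And>x. \<bar>f x\<bar> \<le> B"
  shows "measure_pmf.expectation (conv_pmf p q) f =
    measure_pmf.expectation p (\<lambda>x. measure_pmf.expectation q (\<lambda>y. f (x + y)))"
  unfolding conv_pmf_def using assms
  by (simp add: expectation_bind_pmf[where B=B] integral_return)

primrec isum_pmf :: "nat \<Rightarrow> 'm::comm_monoid_add pmf \<Rightarrow> 'm pmf" where
  "isum_pmf 0 D = return_pmf 0"
| "isum_pmf (Suc n) D = conv_pmf D (isum_pmf n D)"

lemma tv_le_isum:
  assumes "tv_le D D' e"
  shows "tv_le (isum_pmf n D) (isum_pmf n D') (real n * e)"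
proof (induction n)
  case (Suc n)
  have "real (Suc n) * e = e + real n * e" by (simp add: algebra_simps)
  then show ?case using tv_le_conv[OF assms Suc] by simp
qed simp

text \<open>The compound Poisson law with rate \<open>l\<close> and summand law \<open>D\<close>.
  When the values are singleton multisets it describes a Poisson number of independent terms, which
  is how the Hamiltonian enters.\<close>

definition cpois :: "real \<Rightarrow> 'm::comm_monoid_add pmf \<Rightarrow> 'm pmf" where
  "cpois l D = bind_pmf (poisson_pmf l) (\<lambda>n. isum_pmf n D)"

lemma map_conv_pmf:
  assumes "\<And>x y. h (x + y) = h x + h y"
  shows "map_pmf h (conv_pmf p q) = conv_pmf (map_pmf h p) (map_pmf h q)"
  unfolding conv_pmf_def by (simp add: map_bind_pmf bind_map_pmf assms)

lemma map_isum_pmf: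
  assumes "\<And>x y. h (x + y) = h x + h y" "h 0 = 0"
  shows "map_pmf h (isum_pmf n D) = isum_pmf n (map_pmf h D)"
  by (induction n) (simp_all add: map_conv_pmf assms)

lemma map_cpois:
  assumes "\<And>x y. h (x + y) = h x + h y" "h 0 = 0"
  shows "map_pmf h (cpois l D) = cpois l (map_pmf h D)"
  unfolding cpois_def by (simp add: map_bind_pmf map_isum_pmf assms)

definition mix_pmf :: "real \<Rightarrow> 'm pmf \<Rightarrow> 'm pmf \<Rightarrow> 'm pmf" where
  "mix_pmf q D D' = bind_pmf (bernoulli_pmf q) (\<lambda>b. if b then D else D')"

text \<open>Each summand tosses its own coin with success probability \<open>q\<close>. The number
  of successes is binomial, and since addition commutes the summands of law \<open>D\<close> may be
  collected in front. The induction reveals the coin of the new summand.\<close>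

lemma isum_mix:
  assumes q: "0 \<le> q" "q \<le> 1"
  shows "isum_pmf n (mix_pmf q D D') =
    bind_pmf (binomial_pmf n q) (\<lambda>k. conv_pmf (isum_pmf k D) (isum_pmf (n - k) D'))"
proof (induction n)
  case 0
  then show ?case using q by (simp add: binomial_pmf_0 bind_return_pmf)
next
  case (Suc n)
  have "isum_pmf (Suc n) (mix_pmf q D D') = bind_pmf (bernoulli_pmf q) (\<lambda>b.
     bind_pmf (binomial_pmf n q) (\<lambda>k. conv_pmf (if b then D else D')
       (conv_pmf (isum_pmf k D) (isum_pmf (n - k) D'))))"
    unfolding isum_pmf.simps Suc unfolding mix_pmf_def conv_bind_left unfolding conv_bind_right ..
  also have "\<dots> = bind_pmf (bernoulli_pmf q) (\<lambda>b.
     bind_pmf (binomial_pmf n q) (\<lambda>k. conv_pmf (isum_pmf ((if b then 1 else 0) + k) D)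
        (isum_pmf (Suc n - ((if b then 1 else 0) + k)) D')))"
  proof (intro bind_pmf_cong refl)
    fix b k assume "k \<in> set_pmf (binomial_pmf n q)"
    then have "k \<le> n" using q by (auto simp: set_pmf_binomial_eq split: if_splits)
    then show "conv_pmf (if b then D else D') (conv_pmf (isum_pmf k D) (isum_pmf (n - k) D')) =
      conv_pmf (isum_pmf ((if b then 1 else 0) + k) D)
        (isum_pmf (Suc n - ((if b then 1 else 0) + k)) D')"
      by (cases b) (auto simp: conv_pmf_assoc Suc_diff_le conv_pmf_left_commute)
  qed
  also have "\<dots> = bind_pmf (binomial_pmf (Suc n) q)
      (\<lambda>k. conv_pmf (isum_pmf k D) (isum_pmf (Suc n - k) D'))"
    using q by (simp add: binomial_pmf_Suc bind_assoc_pmf bind_return_pmf)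
  finally show ?case .
qed

text \<open>A Poisson number of coin tosses has independent Poisson numbers of successes and
  failures. Point masses are compared: only n = i + j contributes at (i, j), so the mixture over n
  collapses to a single product.\<close>

lemma poisson_thinning:
  assumes "0 < a" "0 < b"
  shows "bind_pmf (poisson_pmf (a + b)) (\<lambda>n. map_pmf (\<lambda>k. (k, n - k)) (binomial_pmf n (a / (a + b)))) =
     pair_pmf (poisson_pmf a) (poisson_pmf b)"
proof (rule pmf_eqI, safe)
  fix i j :: nat
  define q where "q = a / (a + b)"
  have q: "0 \<le> q" "q \<le> 1" and q1: "1 - q = b / (a + b)" using assms by (auto simp: q_def field_simps)
  have pm: "pmf (map_pmf (\<lambda>k. (k, n - k)) (binomial_pmf n q)) (i, j) =
    (if n = i + j then pmf (binomial_pmf n q) i else 0)" for n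
  proof (cases "n = i + j")
    case True
    have "pmf (map_pmf (\<lambda>k. (k, n - k)) (binomial_pmf n q)) ((\<lambda>k. (k, n - k)) i) = pmf (binomial_pmf n q) i"
      by (rule pmf_map_inj') (auto simp: inj_on_def)
    then show ?thesis using True by simp
  next
    case False
    have "(i, j) \<notin> set_pmf (map_pmf (\<lambda>k. (k, n - k)) (binomial_pmf n q))"
      using False q by (auto simp: set_pmf_binomial_eq split: if_splits)
    then have "pmf (map_pmf (\<lambda>k. (k, n - k)) (binomial_pmf n q)) (i, j) = 0" by (simp only: set_pmf_iff) simp
    then show ?thesis using False by simp
  qed
  have "pmf (bind_pmf (poisson_pmf (a + b)) (\<lambda>n. map_pmf (\<lambda>k. (k, n - k)) (binomial_pmf n q))) (i, j) =
    measure_pmf.expectation (poisson_pmf (a + b)) (\<lambda>n. if n = i + j then pmf (binomial_pmf n q) i else 0)"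
    by (simp add: pmf_bind pm)
  also have "\<dots> = (\<Sum>n\<in>{i+j}. pmf (poisson_pmf (a + b)) n *\<^sub>R (if n = i + j then pmf (binomial_pmf n q) i else 0))"
    by (rule integral_measure_pmf) (auto split: if_splits)
  also have "\<dots> = (a + b) ^ (i + j) / fact (i + j) * exp (- (a + b)) * (real ((i + j) choose i) * q ^ i * (1 - q) ^ j)"
    using assms q by simp
  also have "real ((i + j) choose i) = fact (i + j) / (fact i * fact j)"
    by (subst binomial_fact) auto
  also have "(a + b) ^ (i + j) / fact (i + j) * exp (- (a + b)) * (fact (i + j) / (fact i * fact j) * q ^ i * (1 - q) ^ j) =
     (a ^ i / fact i * exp (-a)) * (b ^ j / fact j * exp (-b))"
    unfolding q1 using assms by (simp add: q_def power_add power_divide field_simps exp_add[symmetric] mult_exp_exp)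
  also have "\<dots> = pmf (pair_pmf (poisson_pmf a) (poisson_pmf b)) (i, j)"
    using assms by (simp add: pmf_pair)
  finally show "pmf (bind_pmf (poisson_pmf (a + b)) (\<lambda>n. map_pmf (\<lambda>k. (k, n - k)) (binomial_pmf n (a / (a + b))))) (i, j)
    = pmf (pair_pmf (poisson_pmf a) (poisson_pmf b)) (i, j)" by (simp add: q_def)
qed

text \<open>The tool for sorting terms by kind: if the summand law is a mixture, the summands of the
  two kinds form independent compound Poisson sums with rates proportional to the mixture
  weights.\<close>

lemma cpois_mix:
  assumes "0 < a" "0 < b"
  shows "cpois (a + b) (mix_pmf (a / (a + b)) D D') = conv_pmf (cpois a D) (cpois b D')"
proof -
  have q: "0 \<le> a / (a + b)" "a / (a + b) \<le> 1" using assms by auto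
  have "cpois (a + b) (mix_pmf (a / (a + b)) D D') =
     bind_pmf (bind_pmf (poisson_pmf (a + b)) (\<lambda>n. map_pmf (\<lambda>k. (k, n - k)) (binomial_pmf n (a / (a + b)))))
      (\<lambda>(k, l). conv_pmf (isum_pmf k D) (isum_pmf l D'))"
    unfolding cpois_def isum_mix[OF q] by (simp add: bind_assoc_pmf bind_map_pmf)
  also have "\<dots> = conv_pmf (cpois a D) (cpois b D')"
    unfolding poisson_thinning[OF assms] cpois_def pair_pmf_def
    by (simp add: bind_assoc_pmf bind_return_pmf conv_bind_left) (simp add: conv_bind_right)
  finally show ?thesis .
qed

lemma mix_pmf_same: "mix_pmf q D D = D"
  unfolding mix_pmf_def by simp

lemma cpois_add: "0 < a \<Longrightarrow> 0 < b \<Longrightarrow> cpois (a + b) D = conv_pmf (cpois a D) (cpois b D)"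
  using cpois_mix[of a b D D] by (simp add: mix_pmf_same)


text \<open>The Stein-Chen identity. It rests on (n + 1) p(n + 1) = l p(n) for the Poisson mass
  function p, summed against f after dropping the vanishing term at 0.\<close>

lemma expectation_poisson_shift:
  fixes f :: "nat \<Rightarrow> real"
  assumes l: "0 < l" and int: "integrable (measure_pmf (poisson_pmf l)) (\<lambda>n. f (Suc n))"
  shows "integrable (measure_pmf (poisson_pmf l)) (\<lambda>n. real n * f n)"
    and "measure_pmf.expectation (poisson_pmf l) (\<lambda>n. real n * f n) =
      l * measure_pmf.expectation (poisson_pmf l) (\<lambda>n. f (Suc n))"
proof -
  let ?p = "pmf (poisson_pmf l)"
  have dens: "measure_pmf (poisson_pmf l) = density (count_space UNIV) (\<lambda>n. ennreal (?p n))"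
    by (rule measure_pmf_eq_density)
  have iff: "integrable (measure_pmf (poisson_pmf l)) g \<longleftrightarrow> summable (\<lambda>n. \<bar>?p n * g n\<bar>)" for g :: "nat \<Rightarrow> real"
    unfolding dens by (subst integrable_density) (auto simp: integrable_count_space_nat_iff)
  have ex: "measure_pmf.expectation (poisson_pmf l) g = (\<Sum>n. ?p n * g n)"
    if "integrable (measure_pmf (poisson_pmf l)) g" for g :: "nat \<Rightarrow> real"
  proof -
    have "integrable (count_space UNIV) (\<lambda>n. ?p n * g n)"
      using that unfolding iff by (simp add: integrable_count_space_nat_iff)
    then show ?thesis
      unfolding dens by (subst integral_density) (auto simp: integral_count_space_nat)
  qed
  have key: "?p (Suc n) * (real (Suc n) * f (Suc n)) = l * (?p n * f (Suc n))" for n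
  proof -
    have "?p (Suc n) * real (Suc n) = l * ?p n"
    proof -
      define r where "r = real (Suc n)"
      have "r \<noteq> 0" "fact (Suc n) = r * fact n" unfolding r_def by (simp_all del: of_nat_Suc)
      then show ?thesis using l unfolding r_def[symmetric] by simp
    qed
    then show ?thesis by (simp only: mult.assoc[symmetric])
  qed
  have "summable (\<lambda>n. l * \<bar>?p n * f (Suc n)\<bar>)"
    using int unfolding iff by (rule summable_mult)
  then have "summable (\<lambda>n. \<bar>?p (Suc n) * (real (Suc n) * f (Suc n))\<bar>)"
    unfolding key using l by (simp add: abs_mult)
  then have s: "summable (\<lambda>n. \<bar>?p n * (real n * f n)\<bar>)"
    by (subst (asm) summable_Suc_iff[of "\<lambda>n. \<bar>?p n * (real n * f n)\<bar>"])
  then show i: "integrable (measure_pmf (poisson_pmf l)) (\<lambda>n. real n * f n)"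
    unfolding iff .
  have "(\<Sum>n. ?p n * (real n * f n)) = (\<Sum>n. ?p (Suc n) * (real (Suc n) * f (Suc n)))"
    using suminf_split_head[OF summable_rabs_cancel[OF s]] by simp
  also have "\<dots> = l * (\<Sum>n. ?p n * f (Suc n))"
    unfolding key by (rule suminf_mult, rule summable_rabs_cancel) (use int iff in auto)
  finally show "measure_pmf.expectation (poisson_pmf l) (\<lambda>n. real n * f n) =
      l * measure_pmf.expectation (poisson_pmf l) (\<lambda>n. f (Suc n))"
    by (simp add: ex[OF i] ex[OF int])
qed

lemma poisson_moments:
  assumes l: "0 < l"
  shows "integrable (measure_pmf (poisson_pmf l)) real"
    and "measure_pmf.expectation (poisson_pmf l) real = l"
    and "integrable (measure_pmf (poisson_pmf l)) (\<lambda>n. (real n)\<^sup>2)"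
    and "measure_pmf.expectation (poisson_pmf l) (\<lambda>n. (real n)\<^sup>2) = l * (l + 1)"
proof -
  show 1: "integrable (measure_pmf (poisson_pmf l)) real" and 2: "measure_pmf.expectation (poisson_pmf l) real = l"
    using expectation_poisson_shift[OF l, of "\<lambda>_. 1"] by simp_all
  have "integrable (measure_pmf (poisson_pmf l)) (\<lambda>n. real (Suc n))" using 1 by simp
  from expectation_poisson_shift[OF l, of real, OF this] 1 2
  show "integrable (measure_pmf (poisson_pmf l)) (\<lambda>n. (real n)\<^sup>2)"
    "measure_pmf.expectation (poisson_pmf l) (\<lambda>n. (real n)\<^sup>2) = l * (l + 1)"
    by (simp_all add: power2_eq_square)
qed

text \<open>
  Since \<open>E g (X + 1) = E (X / l) g X\<close> for a Poisson variable \<open>X\<close> of mean \<open>l\<close>, the total variation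
  distance of \<open>X\<close> and \<open>X + 1\<close> is at most \<open>E \<bar>1 - X / l\<bar>\<close>.
\<close>
lemma poisson_smoothing:
  fixes g :: "nat \<Rightarrow> real"
  assumes l: "0 < l" and g: "\<And>n. \<bar>g n\<bar> \<le> 1"
  shows "\<bar>measure_pmf.expectation (poisson_pmf l) g -
     measure_pmf.expectation (poisson_pmf l) (\<lambda>n. g (Suc n))\<bar> \<le> 1 / sqrt l"
proof -
  let ?E = "measure_pmf.expectation (poisson_pmf l)"
  note [simp] = poisson_moments[OF l]
  note ig[simp] = integrable_pmf_bounded[of g 1, OF g]
  have i1: "integrable (measure_pmf (poisson_pmf l)) (\<lambda>n. g (Suc n))"
    by (rule integrable_pmf_bounded[of _ 1]) (rule g)
  note sh = expectation_poisson_shift[OF l, of g, OF i1]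
  have "?E g - ?E (\<lambda>n. g (Suc n)) = ?E (\<lambda>n. g n - real n * g n / l)"
    using sh l by (subst Bochner_Integration.integral_diff) auto
  also have "\<bar>\<dots>\<bar> \<le> ?E (\<lambda>n. \<bar>g n - real n * g n / l\<bar>)" by (rule integral_abs_bound)
  \<comment> \<open>In place of the Cauchy-Schwarz inequality, \<bar>y\<bar> \<le> (sqrt l y^2 + 1 /
    sqrt l) / 2 is used pointwise. The weight sqrt l balances the two halves, as y = 1 - n / l has
    second moment 1 / l.\<close>
  also have "\<dots> \<le> ?E (\<lambda>n. (sqrt l * (1 - 2 * real n / l + (real n)\<^sup>2 / l\<^sup>2) + 1 / sqrt l) / 2)"
  proof (rule integral_mono)
    fix n
    define y where "y = 1 - real n / l"
    have "g n - real n * g n / l = g n * y" by (simp add: y_def algebra_simps)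
    then have "\<bar>g n - real n * g n / l\<bar> \<le> \<bar>y\<bar>"
      using g[of n] by (simp add: abs_mult mult_left_le_one_le)
    also have "\<dots> \<le> (sqrt l * y\<^sup>2 + 1 / sqrt l) / 2"
    proof -
      have "0 \<le> (sqrt l * \<bar>y\<bar> - 1)\<^sup>2 / sqrt l" using l by simp
      also have "\<dots> = sqrt l * y\<^sup>2 + 1 / sqrt l - 2 * \<bar>y\<bar>"
        using l by (simp add: power2_eq_square field_simps)
      finally show ?thesis by simp
    qed
    also have "y\<^sup>2 = 1 - 2 * real n / l + (real n)\<^sup>2 / l\<^sup>2"
      by (simp add: y_def power2_eq_square algebra_simps)
    finally show "\<bar>g n - real n * g n / l\<bar> \<le> (sqrt l * (1 - 2 * real n / l + (real n)\<^sup>2 / l\<^sup>2) + 1 / sqrt l) / 2" .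
  qed (use sh in auto)
  also have "\<dots> = (sqrt l * (1 - 2 * l / l + l * (l + 1) / l\<^sup>2) + 1 / sqrt l) / 2"
    by simp
  also have "\<dots> = 1 / sqrt l"
  proof -
    have "1 - 2 * l / l + l * (l + 1) / l\<^sup>2 = 1 / l"
      using l by (simp add: field_simps power2_eq_square)
    then have "sqrt l * (1 - 2 * l / l + l * (l + 1) / l\<^sup>2) = sqrt l / l" by (simp only:) simp
    also have "\<dots> = 1 / sqrt l" using l by (simp only: sqrt_divide_self_eq inverse_eq_divide less_imp_le)
    finally show ?thesis by (simp only:) simp
  qed
  finally show ?thesis .
qed

text \<open>An additional independent summand of law \<open>D\<close> replaces the number n of
  summands by n + 1, so the bound is that for the Poisson law of this number, whatever
  \<open>D\<close> is.\<close>

lemma cpois_smoothing: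
  assumes l: "0 < l"
  shows "tv_le (conv_pmf D (cpois l D)) (cpois l D) (1 / sqrt l)"
proof (rule tv_le_sym, unfold tv_le_def, intro allI impI)
  fix f :: "'a \<Rightarrow> real" assume f: "\<forall>x. \<bar>f x\<bar> \<le> 1"
  have "conv_pmf D (cpois l D) = bind_pmf (poisson_pmf l) (\<lambda>n. isum_pmf (Suc n) D)"
    unfolding cpois_def by (simp add: conv_bind_right)
  then show "\<bar>measure_pmf.expectation (cpois l D) f - measure_pmf.expectation (conv_pmf D (cpois l D)) f\<bar>
    \<le> 1 / sqrt l"
    using poisson_smoothing[OF l, of "\<lambda>n. measure_pmf.expectation (isum_pmf n D) f"] f
    by (simp add: cpois_def expectation_bind_pmf[where B=1] abs_expectation_le del: isum_pmf.simps)
qed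

lemma cpois_smoothing_isum:
  assumes l: "0 < l"
  shows "tv_le (conv_pmf (isum_pmf k D) (cpois l D)) (cpois l D) (real k / sqrt l)"
proof (induction k)
  case (Suc k)
  have "tv_le (conv_pmf D (conv_pmf (isum_pmf k D) (cpois l D))) (conv_pmf D (cpois l D)) (0 + real k / sqrt l)"
    by (intro tv_le_conv Suc) simp
  from tv_le_trans[OF this cpois_smoothing[OF l]] show ?case
    by (simp add: conv_pmf_assoc add_divide_distrib add.commute)
qed simp

text \<open>The additional rate d amounts to Poisson(d) many additional summands. Each of them costs
  1 / sqrt l, and their mean number is d.\<close>

lemma cpois_smoothing_rate:
  assumes l: "0 < l" and d: "0 \<le> d"
  shows "tv_le (cpois (l + d) D) (cpois l D) (d / sqrt l)"
proof (cases "d = 0")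
  case False
  then have d: "0 < d" using d by simp
  have "cpois (l + d) D = bind_pmf (poisson_pmf d) (\<lambda>k. conv_pmf (isum_pmf k D) (cpois l D))"
    using cpois_add[OF d l, of D] unfolding cpois_def[of d] conv_bind_left by (simp add: add.commute)
  moreover have "tv_le (bind_pmf (poisson_pmf d) (\<lambda>k. conv_pmf (isum_pmf k D) (cpois l D)))
      (bind_pmf (poisson_pmf d) (\<lambda>k. cpois l D)) (measure_pmf.expectation (poisson_pmf d) (\<lambda>k. real k / sqrt l))"
    by (rule tv_le_bind_right) (use cpois_smoothing_isum[OF l] poisson_moments[OF d] in auto)
  ultimately show ?thesis using poisson_moments[OF d] by simp
qed simp

lemma tv_le_cpois:
  assumes "tv_le D D' e" and l: "0 < l"
  shows "tv_le (cpois l D) (cpois l D') (l * e)"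
proof -
  have "tv_le (cpois l D) (cpois l D') (measure_pmf.expectation (poisson_pmf l) (\<lambda>n. real n * e))"
    unfolding cpois_def
    by (rule tv_le_bind_right) (use assms poisson_moments[OF l] in \<open>auto intro!: tv_le_isum\<close>)
  then show ?thesis using poisson_moments[OF l] by simp
qed

lemma tv_le_replicate:
  assumes "tv_le p q e"
  shows "tv_le (replicate_pmf n p) (replicate_pmf n q) (real n * e)"
proof (induction n)
  case (Suc n)
  have "tv_le (replicate_pmf (Suc n) p) (bind_pmf p (\<lambda>x. bind_pmf (replicate_pmf n q) (\<lambda>xs. return_pmf (x # xs)))) (real n * e)"
    unfolding replicate_pmf.simps by (intro tv_le_bind_right_const tv_le_bind_left Suc)
  moreover have "tv_le (bind_pmf p (\<lambda>x. bind_pmf (replicate_pmf n q) (\<lambda>xs. return_pmf (x # xs)))) (replicate_pmf (Suc n) q) e"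
    unfolding replicate_pmf.simps by (intro tv_le_bind_left assms)
  ultimately show ?case using tv_le_trans by (fastforce simp: algebra_simps)
qed simp

section \<open>Product measures\<close>

lemma bounded_Fubini:
  fixes f :: "'a \<times> 'b \<Rightarrow> real"
  assumes "prob_space A" "prob_space B" and f[measurable]: "f \<in> borel_measurable (A \<Otimes>\<^sub>M B)"
    and b: "\<And>x y. \<bar>f (x, y)\<bar> \<le> c"
  shows "(\<integral>z. f z \<partial>(A \<Otimes>\<^sub>M B)) = (\<integral>x. \<integral>y. f (x, y) \<partial>B \<partial>A)"
    and "(\<integral>z. f z \<partial>(A \<Otimes>\<^sub>M B)) = (\<integral>y. \<integral>x. f (x, y) \<partial>A \<partial>B)"
proof -
  interpret A: prob_space A by fact
  interpret B: prob_space B by fact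
  interpret AB: pair_prob_space A B ..
  have "integrable (A \<Otimes>\<^sub>M B) f"
    by (rule AB.P.integrable_const_bound[where B=c]) (use b in auto)
  then have i: "integrable (A \<Otimes>\<^sub>M B) (case_prod (\<lambda>x y. f (x, y)))" by simp
  from AB.integral_fst[OF i] AB.integral_snd[OF i]
  show "(\<integral>z. f z \<partial>(A \<Otimes>\<^sub>M B)) = (\<integral>x. \<integral>y. f (x, y) \<partial>B \<partial>A)"
    "(\<integral>z. f z \<partial>(A \<Otimes>\<^sub>M B)) = (\<integral>y. \<integral>x. f (x, y) \<partial>A \<partial>B)" by simp_all
qed

lemma (in prob_space) abs_integral_bounded:
  assumes "\<And>x. \<bar>f x\<bar> \<le> (c::real)" shows "\<bar>\<integral>x. f x \<partial>M\<bar> \<le> c"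
proof (cases "integrable M f")
  case True
  have "\<bar>\<integral>x. f x \<partial>M\<bar> \<le> (\<integral>x. \<bar>f x\<bar> \<partial>M)" by (rule integral_abs_bound)
  also have "\<dots> \<le> (\<integral>x. c \<partial>M)" by (rule integral_mono) (use True assms in auto)
  finally show ?thesis by (simp add: prob_space)
next
  case False
  then show ?thesis using assms[of undefined] by (simp add: not_integrable_integral_eq)
qed

lemma pair_prob: "prob_space A \<Longrightarrow> prob_space B \<Longrightarrow> prob_space (A \<Otimes>\<^sub>M B)"
  by (simp add: prob_space_pair)

text \<open>Resampling the coordinates in \<open>B\<close> from an independent copy does not change
  a product law. This expresses the independence of disjoint blocks of coordinates without splitting
  the index set, which stays the same in every integral.\<close>

lemma distr_PiM_merge:
  assumes M: "\<And>i. i \<in> I \<Longrightarrow> prob_space (M i)"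
  shows "distr (PiM I M \<Otimes>\<^sub>M PiM I M) (PiM I M) (\<lambda>(\<omega>, \<omega>'). \<lambda>i\<in>I. if i \<in> B then \<omega>' i else \<omega> i) = PiM I M"
    (is "?L = _")
proof (rule measure_eqI_PiM_infinite[symmetric, OF refl])
  interpret I: prob_space "PiM I M" using M by (rule prob_space_PiM)
  show "finite_measure (PiM I M)" by unfold_locales
  let ?t = "\<lambda>(\<omega>, \<omega>'). \<lambda>i\<in>I. if i \<in> B then \<omega>' i else \<omega> i"
  have t: "?t \<in> PiM I M \<Otimes>\<^sub>M PiM I M \<rightarrow>\<^sub>M PiM I M"
    unfolding case_prod_beta
  proof (rule measurable_restrict)
    fix i assume [measurable]: "i \<in> I"
    show "(\<lambda>x. if i \<in> B then snd x i else fst x i) \<in> Pi\<^sub>M I M \<Otimes>\<^sub>M Pi\<^sub>M I M \<rightarrow>\<^sub>M M i"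
      by (cases "i \<in> B") simp_all
  qed
  fix A J assume J: "finite J" "J \<subseteq> I" and A: "\<And>i. i \<in> J \<Longrightarrow> A i \<in> sets (M i)"
  let ?X = "prod_emb I M J (Pi\<^sub>E J A)"
  let ?Y = "\<lambda>J. prod_emb I M J (Pi\<^sub>E J A)"
  have "PiM I M ?X = (\<Prod>i\<in>J. M i (A i))"
    using J A by (intro emeasure_PiM_emb M) auto
  \<comment> \<open>A cylinder factors into its coordinates outside and inside \<open>B\<close>,
    which are read from the first and the second copy respectively.\<close>
  also have "\<dots> = (\<Prod>i\<in>J - B. M i (A i)) * (\<Prod>i\<in>J \<inter> B. M i (A i))"
    using J by (simp add: prod.Int_Diff[of J _ B] mult.commute)
  also have "(\<Prod>i\<in>J - B. M i (A i)) = PiM I M (?Y (J - B))"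
    using J A by (intro emeasure_PiM_emb[symmetric] M) auto
  also have "(\<Prod>i\<in>J \<inter> B. M i (A i)) = PiM I M (?Y (J \<inter> B))"
    using J A by (intro emeasure_PiM_emb[symmetric] M) auto
  also have "PiM I M (?Y (J - B)) * PiM I M (?Y (J \<inter> B)) =
     (PiM I M \<Otimes>\<^sub>M PiM I M) (?Y (J - B) \<times> ?Y (J \<inter> B))"
    using J A by (intro I.emeasure_pair_measure_Times[symmetric] sets_PiM_I) auto
  also have "?Y (J - B) \<times> ?Y (J \<inter> B) = ?t -` ?X \<inter> space (PiM I M \<Otimes>\<^sub>M PiM I M)"
    using J(2) by (auto simp: prod_emb_def space_pair_measure space_PiM PiE_iff extensional_def split: if_splits) (metis subsetD)+
  finally show "PiM I M ?X = ?L ?X"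
    using J A by (subst emeasure_distr[OF t]) (auto intro!: sets_PiM_I)
qed simp

lemma measurable_merge_PiM [measurable]:
  "(\<lambda>(\<omega>, \<omega>'). \<lambda>i\<in>I. if i \<in> B then \<omega>' i else \<omega> i) \<in> PiM I M \<Otimes>\<^sub>M PiM I M \<rightarrow>\<^sub>M PiM I M"
  unfolding case_prod_beta
proof (rule measurable_restrict)
  fix i assume [measurable]: "i \<in> I"
  show "(\<lambda>x. if i \<in> B then snd x i else fst x i) \<in> Pi\<^sub>M I M \<Otimes>\<^sub>M Pi\<^sub>M I M \<rightarrow>\<^sub>M M i"
    by (cases "i \<in> B") simp_all
qed

text \<open>The working form of resampling: the outer integral governs the block \<open>B\<close>,
  the inner one the remaining coordinates. Choosing \<open>B\<close> as the block that belongs to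
  one term or one replica peels it off in an induction.\<close>

lemma integral_PiM_merge:
  fixes f :: "('i \<Rightarrow> 'a) \<Rightarrow> real"
  assumes M: "\<And>i. i \<in> I \<Longrightarrow> prob_space (M i)"
    and f[measurable]: "f \<in> borel_measurable (PiM I M)" and b: "\<And>x. \<bar>f x\<bar> \<le> c"
  shows "(\<integral>\<omega>. f \<omega> \<partial>PiM I M) =
    (\<integral>\<omega>'. \<integral>\<omega>. f (\<lambda>i\<in>I. if i \<in> B then \<omega>' i else \<omega> i) \<partial>PiM I M \<partial>PiM I M)"
proof -
  have p: "prob_space (PiM I M)" using M by (rule prob_space_PiM)
  have "(\<integral>\<omega>. f \<omega> \<partial>PiM I M) = (\<integral>\<omega>. f \<omega> \<partial>distr (PiM I M \<Otimes>\<^sub>M PiM I M) (PiM I M)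
      (\<lambda>(\<omega>, \<omega>'). \<lambda>i\<in>I. if i \<in> B then \<omega>' i else \<omega> i))"
    by (simp add: distr_PiM_merge M)
  also have "\<dots> = (\<integral>z. f ((\<lambda>(\<omega>, \<omega>'). \<lambda>i\<in>I. if i \<in> B then \<omega>' i else \<omega> i) z) \<partial>(PiM I M \<Otimes>\<^sub>M PiM I M))"
    by (rule integral_distr) measurable
  also have "\<dots> = (\<integral>\<omega>'. \<integral>\<omega>. f (\<lambda>i\<in>I. if i \<in> B then \<omega>' i else \<omega> i) \<partial>PiM I M \<partial>PiM I M)"
    by (subst bounded_Fubini(2)[OF p p, where c=c]) (measurable, use b in auto)
  finally show ?thesis .
qed

text \<open>Two injective selections of coordinates with disjoint ranges are independent: after the
  range of \<open>g\<close> has been resampled, the selections read from different copies.\<close>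

lemma distr_PiM_split:
  assumes M: "prob_space M"
    and inj: "inj_on f J" "f \<in> J \<rightarrow> I" "inj_on g K" "g \<in> K \<rightarrow> I" "f ` J \<inter> g ` K = {}"
  shows "distr (PiM I (\<lambda>_. M)) (PiM J (\<lambda>_. M) \<Otimes>\<^sub>M PiM K (\<lambda>_. M)) (\<lambda>\<omega>. (\<lambda>j\<in>J. \<omega> (f j), \<lambda>k\<in>K. \<omega> (g k))) =
    PiM J (\<lambda>_. M) \<Otimes>\<^sub>M PiM K (\<lambda>_. M)"
proof -
  interpret P: prob_space "PiM I (\<lambda>_. M)" by (intro prob_space_PiM M)
  interpret K: prob_space "PiM K (\<lambda>_. M)" by (intro prob_space_PiM M)
  have [measurable]: "j \<in> J \<Longrightarrow> f j \<in> I" "k \<in> K \<Longrightarrow> g k \<in> I" for j k using inj by auto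
  let ?h = "\<lambda>\<omega>. (\<lambda>j\<in>J. \<omega> (f j), \<lambda>k\<in>K. \<omega> (g k))"
  have h[measurable]: "?h \<in> PiM I (\<lambda>_. M) \<rightarrow>\<^sub>M PiM J (\<lambda>_. M) \<Otimes>\<^sub>M PiM K (\<lambda>_. M)"
    by measurable
  have "distr (PiM I (\<lambda>_. M)) (PiM J (\<lambda>_. M) \<Otimes>\<^sub>M PiM K (\<lambda>_. M)) ?h =
    distr (distr (PiM I (\<lambda>_. M) \<Otimes>\<^sub>M PiM I (\<lambda>_. M)) (PiM I (\<lambda>_. M))
      (\<lambda>(\<omega>, \<omega>'). \<lambda>i\<in>I. if i \<in> g ` K then \<omega>' i else \<omega> i)) (PiM J (\<lambda>_. M) \<Otimes>\<^sub>M PiM K (\<lambda>_. M)) ?h"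
    by (simp add: distr_PiM_merge M)
  also have "\<dots> = distr (PiM I (\<lambda>_. M) \<Otimes>\<^sub>M PiM I (\<lambda>_. M)) (PiM J (\<lambda>_. M) \<Otimes>\<^sub>M PiM K (\<lambda>_. M))
      (\<lambda>(\<omega>, \<omega>'). (\<lambda>j\<in>J. \<omega> (f j), \<lambda>k\<in>K. \<omega>' (g k)))"
    by (subst distr_distr) (measurable, use inj in \<open>fastforce intro!: distr_cong simp: fun_eq_iff restrict_def\<close>)
  also have "\<dots> = distr (PiM I (\<lambda>_. M)) (PiM J (\<lambda>_. M)) (\<lambda>\<omega>. \<lambda>j\<in>J. \<omega> (f j)) \<Otimes>\<^sub>M
      distr (PiM I (\<lambda>_. M)) (PiM K (\<lambda>_. M)) (\<lambda>\<omega>. \<lambda>k\<in>K. \<omega> (g k))"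
    using inj M by (subst pair_measure_distr)
      (auto simp: distr_PiM_reindex[where M="\<lambda>_. M"] intro!: K.sigma_finite_measure_axioms)
  also have "\<dots> = PiM J (\<lambda>_. M) \<Otimes>\<^sub>M PiM K (\<lambda>_. M)"
    using inj M by (simp add: distr_PiM_reindex[where M="\<lambda>_. M"])
  finally show ?thesis .
qed

lemma integral_PiM_component:
  fixes f :: "'a \<Rightarrow> real"
  assumes M: "\<And>i. i \<in> I \<Longrightarrow> prob_space (M i)" and i: "i \<in> I" and f: "f \<in> borel_measurable (M i)"
  shows "(\<integral>\<omega>. f (\<omega> i) \<partial>PiM I M) = (\<integral>x. f x \<partial>M i)"
proof -
  have "(\<integral>x. f x \<partial>M i) = (\<integral>x. f x \<partial>distr (PiM I M) (M i) (\<lambda>\<omega>. \<omega> i))"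
    using M i by (simp add: distr_PiM_component)
  also have "\<dots> = (\<integral>\<omega>. f (\<omega> i) \<partial>PiM I M)"
    using i f by (intro integral_distr) auto
  finally show ?thesis by simp
qed

lemma integral_PiM_reindex:
  fixes h :: "('j \<Rightarrow> 'a) \<Rightarrow> real"
  assumes M: "prob_space M" and f: "inj_on f J" "f \<in> J \<rightarrow> I" and h: "h \<in> borel_measurable (PiM J (\<lambda>_. M))"
  shows "(\<integral>\<omega>. h (\<lambda>j\<in>J. \<omega> (f j)) \<partial>PiM I (\<lambda>_. M)) = (\<integral>\<omega>. h \<omega> \<partial>PiM J (\<lambda>_. M))"
proof -
  have [measurable]: "j \<in> J \<Longrightarrow> f j \<in> I" for j using f by auto
  have "(\<integral>\<omega>. h \<omega> \<partial>PiM J (\<lambda>_. M)) = (\<integral>\<omega>. h \<omega> \<partial>distr (PiM I (\<lambda>_. M)) (PiM J (\<lambda>_. M)) (\<lambda>\<omega>. \<lambda>j\<in>J. \<omega> (f j)))"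
    using distr_PiM_reindex[of I "\<lambda>_. M" f J] M f by simp
  also have "\<dots> = (\<integral>\<omega>. h (\<lambda>j\<in>J. \<omega> (f j)) \<partial>PiM I (\<lambda>_. M))"
    using h by (intro integral_distr) measurable
  finally show ?thesis by simp
qed

lemma integral_PiM_prod:
  fixes f :: "'i \<Rightarrow> 'a \<Rightarrow> real"
  assumes M: "\<And>i. i \<in> I \<Longrightarrow> prob_space (M i)" and J: "finite J" "J \<subseteq> I"
    and f: "\<And>i. i \<in> J \<Longrightarrow> f i \<in> borel_measurable (M i)" and b: "\<And>i x. \<bar>f i x\<bar> \<le> 1"
  shows "(\<integral>\<omega>. (\<Prod>i\<in>J. f i (\<omega> i)) \<partial>PiM I M) = (\<Prod>i\<in>J. \<integral>x. f i x \<partial>M i)"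
  using J f
proof (induction J rule: finite_induct)
  case empty
  interpret prob_space "PiM I M" using M by (rule prob_space_PiM)
  show ?case by (simp add: prob_space)
next
  case (insert j J)
  have b': "\<bar>\<Prod>i\<in>A. f i (\<omega> i)\<bar> \<le> 1" for A \<omega>
    unfolding abs_prod by (rule prod_le_1) (use b in auto)
  have m: "i \<in> insert j J \<Longrightarrow> (\<lambda>\<omega>. f i (\<omega> i)) \<in> borel_measurable (PiM I M)" for i
    using insert.prems by (intro measurable_compose[OF measurable_component_singleton]) auto
  have "(\<integral>\<omega>. (\<Prod>i\<in>insert j J. f i (\<omega> i)) \<partial>PiM I M) =
    (\<integral>\<omega>'. \<integral>\<omega>. (\<Prod>i\<in>insert j J. f i ((\<lambda>i\<in>I. if i \<in> {j} then \<omega>' i else \<omega> i) i)) \<partial>PiM I M \<partial>PiM I M)"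
    by (rule integral_PiM_merge[where c=1, OF M]) (use m b' in \<open>auto intro!: borel_measurable_prod\<close>)
  also have "(\<lambda>\<omega>' \<omega>. (\<Prod>i\<in>insert j J. f i ((\<lambda>i\<in>I. if i \<in> {j} then \<omega>' i else \<omega> i) i))) =
     (\<lambda>\<omega>' \<omega>. f j (\<omega>' j) * (\<Prod>i\<in>J. f i (\<omega> i)))"
    using insert by (intro ext) (auto intro!: prod.cong arg_cong2[where f="(*)"] split: if_splits)
  also have "(\<integral>\<omega>'. \<integral>\<omega>. f j (\<omega>' j) * (\<Prod>i\<in>J. f i (\<omega> i)) \<partial>PiM I M \<partial>PiM I M) =
      (\<integral>\<omega>. f j (\<omega> j) \<partial>PiM I M) * (\<Prod>i\<in>J. \<integral>x. f i x \<partial>M i)"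
    using insert by simp
  also have "(\<integral>\<omega>. f j (\<omega> j) \<partial>PiM I M) = (\<integral>x. f j x \<partial>M j)"
    using insert M by (intro integral_PiM_component) auto
  finally show ?case using insert by simp
qed

lemma measurable_map_list:
  fixes X :: "'j \<Rightarrow> 'a \<Rightarrow> 'b::countable"
  assumes "\<And>j. j \<in> set js \<Longrightarrow> X j \<in> M \<rightarrow>\<^sub>M count_space UNIV"
  shows "(\<lambda>\<omega>. map (\<lambda>j. X j \<omega>) js) \<in> M \<rightarrow>\<^sub>M count_space UNIV"
  using assms
proof (induction js)
  case (Cons j js)
  have "(\<lambda>\<omega>. (X j \<omega>, map (\<lambda>j. X j \<omega>) js)) \<in> M \<rightarrow>\<^sub>M count_space UNIV \<Otimes>\<^sub>M count_space UNIV"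
    using Cons by (intro measurable_Pair) auto
  then have "(\<lambda>\<omega>. (X j \<omega>, map (\<lambda>j. X j \<omega>) js)) \<in> M \<rightarrow>\<^sub>M count_space UNIV"
    by (simp add: pair_measure_countable)
  from measurable_compose[OF this, of "\<lambda>(x, xs). x # xs" "count_space UNIV"] show ?case by simp
qed simp

lemma measurable_PiM_pmf_component:
  "(\<lambda>\<omega>. \<omega> j) \<in> PiM UNIV (\<lambda>_. measure_pmf u) \<rightarrow>\<^sub>M count_space UNIV"
  using measurable_component_singleton[of j UNIV "\<lambda>_. measure_pmf u"]
  by (simp add: measurable_def)

text \<open>The passage from an infinite family of i.i.d. variables to a \<open>pmf\<close>:
  coordinates read along a list without repetitions are independent draws. The head is resampled
  separately, and this is where distinctness enters.\<close>

lemma integral_sample_list: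
  fixes h :: "'a::countable list \<Rightarrow> real"
  assumes "distinct js" and b: "\<And>xs. \<bar>h xs\<bar> \<le> c"
  shows "(\<integral>\<omega>. h (map \<omega> js) \<partial>PiM UNIV (\<lambda>_. measure_pmf u)) = measure_pmf.expectation (replicate_pmf (length js) u) h"
  using assms
proof (induction js arbitrary: h)
  case Nil
  interpret prob_space "PiM UNIV (\<lambda>_. measure_pmf u)" by (intro prob_space_PiM prob_space_measure_pmf)
  show ?case by (simp add: prob_space integral_return)
next
  case (Cons j js)
  let ?P = "PiM UNIV (\<lambda>_. measure_pmf u)"
  have m: "(\<lambda>\<omega>. h (map \<omega> js)) \<in> borel_measurable ?P" for h :: "'a list \<Rightarrow> real" and js
    by (rule measurable_compose[OF measurable_map_list]) (auto intro: measurable_PiM_pmf_component)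
  have "(\<integral>\<omega>. h (map \<omega> (j # js)) \<partial>?P) = (\<integral>\<omega>'. \<integral>\<omega>. h (map (\<lambda>i\<in>UNIV. if i \<in> {j} then \<omega>' i else \<omega> i) (j # js)) \<partial>?P \<partial>?P)"
    by (rule integral_PiM_merge[where c=c]) (use Cons m in \<open>auto intro: prob_space_measure_pmf simp del: list.map\<close>)
  also have "\<dots> = (\<integral>\<omega>'. \<integral>\<omega>. h (\<omega>' j # map \<omega> js) \<partial>?P \<partial>?P)"
  proof -
    have "map (\<lambda>i\<in>UNIV. if i \<in> {j} then \<omega>' i else \<omega> i) (j # js) = \<omega>' j # map \<omega> js" for \<omega> \<omega>' :: "'b \<Rightarrow> 'a"
      using Cons.prems by (auto intro!: map_cong)
    then show ?thesis by (simp only:)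
  qed
  also have "\<dots> = (\<integral>\<omega>'. measure_pmf.expectation (replicate_pmf (length js) u) (\<lambda>xs. h (\<omega>' j # xs)) \<partial>?P)"
    using Cons.prems by (intro Bochner_Integration.integral_cong refl Cons.IH) auto
  also have "\<dots> = measure_pmf.expectation u (\<lambda>x. measure_pmf.expectation (replicate_pmf (length js) u) (\<lambda>xs. h (x # xs)))"
    by (rule integral_PiM_component) (auto intro: prob_space_measure_pmf)
  also have "\<dots> = measure_pmf.expectation (replicate_pmf (length (j # js)) u) h"
    using Cons.prems by (simp add: expectation_bind_pmf[where B=c] integral_return)
  finally show ?case .
qed

lemma integral_sample_nested_list:
  fixes h :: "'a::countable list list \<Rightarrow> real"
  assumes "distinct (concat jss)" "\<And>js. js \<in> set jss \<Longrightarrow> length js = a" and b: "\<And>xs. \<bar>h xs\<bar> \<le> c"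
  shows "(\<integral>\<omega>. h (map (map \<omega>) jss) \<partial>PiM UNIV (\<lambda>_. measure_pmf u)) =
    measure_pmf.expectation (replicate_pmf (length jss) (replicate_pmf a u)) h"
  using assms
proof (induction jss arbitrary: h)
  case Nil
  interpret prob_space "PiM UNIV (\<lambda>_. measure_pmf u)" by (intro prob_space_PiM prob_space_measure_pmf)
  show ?case by (simp add: prob_space integral_return)
next
  case (Cons js jss)
  let ?P = "PiM UNIV (\<lambda>_. measure_pmf u)"
  have m: "(\<lambda>\<omega>. h (map (map \<omega>) jss)) \<in> borel_measurable ?P" for h :: "'a list list \<Rightarrow> real" and jss
    by (rule measurable_compose[OF measurable_map_list])
      (auto intro!: measurable_map_list measurable_PiM_pmf_component)
  have "(\<integral>\<omega>. h (map (map \<omega>) (js # jss)) \<partial>?P) =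
      (\<integral>\<omega>'. \<integral>\<omega>. h (map (map (\<lambda>i\<in>UNIV. if i \<in> set js then \<omega>' i else \<omega> i)) (js # jss)) \<partial>?P \<partial>?P)"
    by (rule integral_PiM_merge[where c=c]) (use Cons m in \<open>auto intro: prob_space_measure_pmf simp del: list.map\<close>)
  also have "\<dots> = (\<integral>\<omega>'. \<integral>\<omega>. h (map \<omega>' js # map (map \<omega>) jss) \<partial>?P \<partial>?P)"
  proof -
    have "map (map (\<lambda>i\<in>UNIV. if i \<in> set js then \<omega>' i else \<omega> i)) (js # jss) = map \<omega>' js # map (map \<omega>) jss"
      for \<omega> \<omega>' :: "'b \<Rightarrow> 'a"
      using Cons.prems by (auto intro!: map_cong)
    then show ?thesis by (simp only:)
  qed
  also have "\<dots> = (\<integral>\<omega>'. measure_pmf.expectation (replicate_pmf (length jss) (replicate_pmf a u)) (\<lambda>xs. h (map \<omega>' js # xs)) \<partial>?P)"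
    using Cons.prems by (intro Bochner_Integration.integral_cong refl Cons.IH) auto
  also have "\<dots> = measure_pmf.expectation (replicate_pmf (length js) u)
      (\<lambda>x. measure_pmf.expectation (replicate_pmf (length jss) (replicate_pmf a u)) (\<lambda>xs. h (x # xs)))"
    by (rule integral_sample_list[where c=c]) (use Cons in \<open>auto intro!: abs_expectation_le\<close>)
  also have "\<dots> = measure_pmf.expectation (replicate_pmf (length (js # jss)) (replicate_pmf a u)) h"
    using Cons.prems by (simp add: expectation_bind_pmf[where B=c] integral_return)
  finally show ?case .
qed

section \<open>Interaction terms and their action on weights\<close>

lemma finite_signs [simp]: "finite signs" and card_signs [simp]: "card signs = 2"
  and signs_nonempty [simp]: "signs \<noteq> {}"
  by (auto simp: signs_def)

lemma finite_configs [simp]: "finite (configs N)"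
  unfolding configs_def by (intro finite_PiE) auto

lemma configs_nonempty [simp]: "configs N \<noteq> {}"
  unfolding configs_def by (simp add: PiE_eq_empty_iff)

lemma map_in_cube: "\<sigma> \<in> configs N \<Longrightarrow> set I \<subseteq> {1..N} \<Longrightarrow> length I = p \<Longrightarrow> map \<sigma> I \<in> cube p"
  by (auto simp: cube_def configs_def PiE_iff)

text \<open>
  \<open>Th I\<close> is one interaction at the sites \<open>I\<close>; \<open>Pt [J\<^sub>1, \<dots>, J\<^sub>q]\<close> is one perturbation term with
  \<open>q\<close> interactions, that is, the field of an auxiliary spin which is averaged out.
\<close>
datatype 's trm = Th "'s list" | Pt "'s list list"

text \<open>Every term receives a whole sequence of interactions, of which \<open>Th\<close> reads
  entry 0 and \<open>Pt\<close> the entries from 1 on. Thus all terms integrate over the same space,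
  however many interactions they contain. Positions in \<open>Js\<close> start at 0, whence the
  shift by 1.\<close>

fun bweight :: "'s trm \<Rightarrow> (nat \<Rightarrow> interaction) \<Rightarrow> ('s \<Rightarrow> real) \<Rightarrow> real" where
  "bweight (Th I) \<theta> \<sigma> = exp (\<theta> 0 (map \<sigma> I))"
| "bweight (Pt Js) \<theta> \<sigma> = Av signs (\<lambda>\<epsilon>. exp (\<Sum>k=1..length Js. \<theta> k (\<epsilon> # map \<sigma> (Js ! (k - 1)))))"

lemma bweight_cong: "(\<And>i. i \<in> set_trm t \<Longrightarrow> \<sigma> i = \<sigma>' i) \<Longrightarrow> bweight t \<theta> \<sigma> = bweight t \<theta> \<sigma>'"
proof (cases t)
  case (Th I)
  assume "\<And>i. i \<in> set_trm t \<Longrightarrow> \<sigma> i = \<sigma>' i"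
  then have "map \<sigma> I = map \<sigma>' I" using Th by simp
  then show ?thesis using Th by (simp only: bweight.simps)
next
  case (Pt Js)
  assume "\<And>i. i \<in> set_trm t \<Longrightarrow> \<sigma> i = \<sigma>' i"
  then have "map \<sigma> (Js ! (k - 1)) = map \<sigma>' (Js ! (k - 1))" if "k \<in> {1..length Js}" for k
  proof -
    have "Js ! (k - 1) \<in> set Js" using that by (intro nth_mem) auto
    then show ?thesis using \<open>\<And>i. i \<in> set_trm t \<Longrightarrow> \<sigma> i = \<sigma>' i\<close> Pt by auto
  qed
  then have "(\<Sum>k=1..length Js. \<theta> k (\<epsilon> # map \<sigma> (Js ! (k - 1)))) =
      (\<Sum>k=1..length Js. \<theta> k (\<epsilon> # map \<sigma>' (Js ! (k - 1))))" for \<epsilon>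
    by (intro sum.cong refl) (simp only:)
  then show ?thesis by (simp only: Pt bweight.simps)
qed

lemma bweight_map: "bweight (map_trm \<pi> t) \<theta> \<sigma> = bweight t \<theta> (\<lambda>i. \<sigma> (\<pi> i))"
proof (cases t)
  case (Pt Js)
  have "(\<Sum>k=1..length Js. \<theta> k (\<epsilon> # map \<sigma> (map (map \<pi>) Js ! (k - 1)))) =
      (\<Sum>k=1..length Js. \<theta> k (\<epsilon> # map (\<lambda>i. \<sigma> (\<pi> i)) (Js ! (k - 1))))" for \<epsilon>
    by (intro sum.cong refl) (auto simp: nth_map comp_def)
  then show ?thesis using Pt by simp
qed (simp add: comp_def)

section \<open>Weights on configurations and bounded functions of them\<close>

definition weights :: "nat \<Rightarrow> ((nat \<Rightarrow> real) \<Rightarrow> real) measure" where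
  "weights N = (\<Pi>\<^sub>M \<sigma>\<in>configs N. borel)"

text \<open>Unnormalised weights are the state: on them a term acts by multiplication with a
  function of the configuration, so that the actions of different terms commute. Normalisation is
  left to \<open>gav\<close>.\<close>

definition act :: "nat \<Rightarrow> nat trm \<Rightarrow> (nat \<Rightarrow> interaction) \<Rightarrow> ((nat \<Rightarrow> real) \<Rightarrow> real) \<Rightarrow> (nat \<Rightarrow> real) \<Rightarrow> real" where
  "act N t \<theta> w = (\<lambda>\<sigma>\<in>configs N. w \<sigma> * bweight t \<theta> \<sigma>)"

definition one_weight :: "nat \<Rightarrow> (nat \<Rightarrow> real) \<Rightarrow> real" where
  "one_weight N = (\<lambda>\<sigma>\<in>configs N. 1)"

definition good :: "nat \<Rightarrow> (((nat \<Rightarrow> real) \<Rightarrow> real) \<Rightarrow> real) \<Rightarrow> bool" where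
  "good N \<Phi> \<longleftrightarrow> \<Phi> \<in> borel_measurable (weights N) \<and> (\<forall>w. \<bar>\<Phi> w\<bar> \<le> 1)"

lemma goodD: "good N \<Phi> \<Longrightarrow> \<Phi> \<in> borel_measurable (weights N)" "good N \<Phi> \<Longrightarrow> \<bar>\<Phi> w\<bar> \<le> 1"
  by (auto simp: good_def)

lemma good_zero: "good N (\<lambda>_. 0)"
  by (simp add: good_def)

text \<open>
  The absolute values make the Gibbs average total: it is bounded by \<open>sup \<bar>f\<bar>\<close> for every
  \<open>w\<close>, also for \<open>w = 0\<close>.
\<close>
definition gav :: "nat \<Rightarrow> ((nat \<Rightarrow> real) \<Rightarrow> real) \<Rightarrow> ((nat \<Rightarrow> real) \<Rightarrow> real) \<Rightarrow> real" where
  "gav N w f = (\<Sum>\<sigma>\<in>configs N. \<bar>w \<sigma>\<bar> * f \<sigma>) / (\<Sum>\<sigma>\<in>configs N. \<bar>w \<sigma>\<bar>)"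

lemma abs_gav_le:
  assumes "\<And>\<sigma>. \<sigma> \<in> configs N \<Longrightarrow> \<bar>f \<sigma>\<bar> \<le> c" "0 \<le> c"
  shows "\<bar>gav N w f\<bar> \<le> c"
proof -
  have "\<bar>\<Sum>\<sigma>\<in>configs N. \<bar>w \<sigma>\<bar> * f \<sigma>\<bar> \<le> (\<Sum>\<sigma>\<in>configs N. \<bar>w \<sigma>\<bar> * c)"
    by (rule order_trans[OF sum_abs]) (use assms in \<open>auto intro!: sum_mono mult_left_mono simp: abs_mult\<close>)
  also have "\<dots> = c * (\<Sum>\<sigma>\<in>configs N. \<bar>w \<sigma>\<bar>)" by (simp add: sum_distrib_left mult.commute)
  finally show ?thesis
    unfolding gav_def using assms(2) order.strict_iff_order[of 0 "\<Sum>\<sigma>\<in>configs N. \<bar>w \<sigma>\<bar>"]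
      sum_nonneg[of "configs N" "\<lambda>\<sigma>. \<bar>w \<sigma>\<bar>"]
    by (cases "(\<Sum>\<sigma>\<in>configs N. \<bar>w \<sigma>\<bar>) = 0") (auto simp: abs_divide divide_le_eq)
qed

lemma measurable_gav [measurable]: "(\<lambda>w. gav N w f) \<in> borel_measurable (weights N)"
proof -
  have [measurable]: "\<sigma> \<in> configs N \<Longrightarrow> (\<lambda>w. w \<sigma>) \<in> borel_measurable (weights N)" for \<sigma>
    unfolding weights_def by simp
  show ?thesis unfolding gav_def by measurable
qed

lemma good_gav_prod:
  assumes "\<And>l \<sigma>. l \<in> A \<Longrightarrow> \<sigma> \<in> configs N \<Longrightarrow> \<bar>f l \<sigma>\<bar> \<le> 1"
  shows "good N (\<lambda>w. \<Prod>l\<in>A. gav N w (f l))"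
proof -
  have "\<bar>\<Prod>l\<in>A. gav N w (f l)\<bar> \<le> 1" for w
    unfolding abs_prod by (rule prod_le_1) (use assms in \<open>auto intro!: abs_gav_le\<close>)
  then show ?thesis by (auto simp: good_def intro!: borel_measurable_prod)
qed

lemma measurable_comp_weights:
  assumes "\<And>\<sigma>. \<sigma> \<in> configs N \<Longrightarrow> (\<lambda>x. h x \<sigma>) \<in> borel_measurable M"
  shows "(\<lambda>x. \<lambda>\<sigma>\<in>configs N. h x \<sigma>) \<in> M \<rightarrow>\<^sub>M weights N"
  unfolding weights_def by (rule measurable_restrict) (use assms in auto)

lemma weights_component: "\<sigma> \<in> configs N \<Longrightarrow> (\<lambda>w. w \<sigma>) \<in> borel_measurable (weights N)"
  unfolding weights_def by simp

text \<open>The additional \<open>n\<close> spins start out free: the weight does not depend on them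
  until terms containing them act.\<close>

definition lift_weight :: "nat \<Rightarrow> nat \<Rightarrow> ((nat \<Rightarrow> real) \<Rightarrow> real) \<Rightarrow> (nat \<Rightarrow> real) \<Rightarrow> real" where
  "lift_weight N n w = (\<lambda>\<sigma>\<in>configs (N + n). w (restrict \<sigma> {1..N}))"

lemma restrict_configs: "\<sigma> \<in> configs (N + n) \<Longrightarrow> restrict \<sigma> {1..N} \<in> configs N"
  by (auto simp: configs_def PiE_iff)

lemmas restrict_configs' [simp] = restrict_configs restrict_configs[simplified]

lemma lift_act:
  assumes "set_trm t \<subseteq> {1..N}"
  shows "act (N + n) t \<theta> (lift_weight N n w) = lift_weight N n (act N t \<theta> w)"
proof -
  have "bweight t \<theta> \<sigma> = bweight t \<theta> (restrict \<sigma> {1..N})" for \<sigma>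
    using assms by (intro bweight_cong) auto
  then show ?thesis by (auto simp: act_def lift_weight_def fun_eq_iff restrict_configs)
qed

lemma good_lift: "good (N + n) \<Phi> \<Longrightarrow> good N (\<lambda>w. \<Phi> (lift_weight N n w))"
  unfolding good_def lift_weight_def
  by (auto intro!: measurable_compose[OF measurable_comp_weights] weights_component simp del: restrict_apply)

definition perm_weight :: "nat \<Rightarrow> (nat \<Rightarrow> nat) \<Rightarrow> ((nat \<Rightarrow> real) \<Rightarrow> real) \<Rightarrow> (nat \<Rightarrow> real) \<Rightarrow> real" where
  "perm_weight N \<pi> w = (\<lambda>\<sigma>\<in>configs N. w (\<lambda>i. \<sigma> (\<pi> i)))"

lemma perm_configs: "\<pi> permutes {1..N} \<Longrightarrow> \<sigma> \<in> configs N \<Longrightarrow> (\<lambda>i. \<sigma> (\<pi> i)) \<in> configs N"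
  by (auto simp: configs_def PiE_iff extensional_def permutes_in_image permutes_not_in dest: permutes_in_image)

lemma perm_act:
  assumes "\<pi> permutes {1..N}"
  shows "act N (map_trm \<pi> t) \<theta> (perm_weight N \<pi> w) = perm_weight N \<pi> (act N t \<theta> w)"
  using assms by (auto simp: act_def perm_weight_def bweight_map perm_configs fun_eq_iff)

lemma good_perm: "\<pi> permutes {1..N} \<Longrightarrow> good N \<Phi> \<Longrightarrow> good N (\<lambda>w. \<Phi> (perm_weight N \<pi> w))"
  unfolding good_def perm_weight_def
  by (auto intro!: measurable_compose[OF measurable_comp_weights] weights_component perm_configs)

text \<open>\<open>gav\<close> and \<open>sum_out\<close> see only absolute values of weights,
  whereas \<open>act\<close> keeps signs. Functions with this property do not notice the
  difference.\<close>

definition abs_inv :: "nat \<Rightarrow> (((nat \<Rightarrow> real) \<Rightarrow> real) \<Rightarrow> real) \<Rightarrow> bool" where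
  "abs_inv N \<Phi> \<longleftrightarrow> (\<forall>w w'. (\<forall>\<sigma>\<in>configs N. \<bar>w \<sigma>\<bar> = \<bar>w' \<sigma>\<bar>) \<longrightarrow> \<Phi> w = \<Phi> w')"

text \<open>The marginal weight of the first \<open>N\<close> spins, up to the factor 2 hidden in
  \<open>Av\<close>. The average is taken instead of the sum so that the result matches a
  perturbation term exactly; Gibbs averages do not feel the factor.\<close>

definition sum_out :: "nat \<Rightarrow> ((nat \<Rightarrow> real) \<Rightarrow> real) \<Rightarrow> (nat \<Rightarrow> real) \<Rightarrow> real" where
  "sum_out N w = (\<lambda>\<sigma>\<in>configs N. Av signs (\<lambda>\<epsilon>. \<bar>w (\<sigma>(Suc N := \<epsilon>))\<bar>))"

lemma upd_configs: "\<sigma> \<in> configs N \<Longrightarrow> \<epsilon> \<in> signs \<Longrightarrow> \<sigma>(Suc N := \<epsilon>) \<in> configs (Suc N)"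
  by (auto simp: configs_def PiE_iff extensional_def le_Suc_eq)

lemma good_sum_out: "good N \<Phi> \<Longrightarrow> good (Suc N) (\<lambda>w. \<Phi> (sum_out N w))"
proof -
  assume g: "good N \<Phi>"
  have "sum_out N \<in> weights (Suc N) \<rightarrow>\<^sub>M weights N"
    unfolding sum_out_def Av_def
    by (rule measurable_comp_weights borel_measurable_divide borel_measurable_sum borel_measurable_abs
        weights_component upd_configs borel_measurable_const | assumption)+
  from measurable_compose[OF this goodD(1)[OF g]] show ?thesis
    using goodD(2)[OF g] by (auto simp: good_def)
qed

text \<open>Under a symmetric law the effect of a \<open>Th\<close> term does not depend on the
  order of its sites. Sorting picks a representative, so that laws of terms which agree only up to
  reordering become close in total variation.\<close>

fun canon :: "nat trm \<Rightarrow> nat trm" where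
  "canon (Th I) = Th (sort I)"
| "canon (Pt Js) = Pt Js"

fun wf_term :: "nat \<Rightarrow> nat \<Rightarrow> nat trm \<Rightarrow> bool" where
  "wf_term p N (Th I) \<longleftrightarrow> length I = p \<and> set I \<subseteq> {1..N}"
| "wf_term p N (Pt Js) \<longleftrightarrow> (\<forall>J\<in>set Js. length J = p - 1 \<and> set J \<subseteq> {1..N})"

section \<open>Averaging over the interactions, term by term\<close>

locale interaction_law =
  fixes L :: "interaction measure" and p :: nat
  assumes L_prob: "prob_space L" and L_sets: "sets L = sets (fun_space (cube p))"
begin

sublocale L: prob_space L by (rule L_prob)

lemma prob_PiM_L: "prob_space (PiM I (\<lambda>_. L))"
  by (intro prob_space_PiM L_prob)

lemma space_L: "space L = space (fun_space (cube p))"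
  using sets_eq_imp_space_eq[OF L_sets] .

lemma measurable_eval_L [measurable]: "(\<lambda>\<theta>. \<theta> xs) \<in> borel_measurable L"
proof (cases "xs \<in> cube p")
  case True
  then have "(\<lambda>\<theta>. \<theta> xs) \<in> borel_measurable (fun_space (cube p))"
    unfolding fun_space_def by simp
  then show ?thesis using L_sets by (simp cong: measurable_cong_sets)
next
  case False
  \<comment> \<open>Off the cube an extensional function has the constant value
    \<open>undefined\<close>, so evaluation there is measurable too. This spares a cube condition in
    every later use.\<close>
  then have "\<theta> xs = undefined" if "\<theta> \<in> space L" for \<theta>
    using that by (auto simp: space_L fun_space_def space_PiM PiE_iff extensional_def)
  then have "(\<lambda>\<theta>. \<theta> xs) \<in> borel_measurable L \<longleftrightarrow> (\<lambda>_. undefined::real) \<in> borel_measurable L"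
    by (intro measurable_cong)
  then show ?thesis by simp
qed

lemma measurable_eval_PiM_L: "(\<lambda>\<theta>. \<theta> k xs) \<in> borel_measurable (PiM UNIV (\<lambda>_. L))"
  by (rule measurable_compose[where g="\<lambda>\<theta>. \<theta> xs" and f="\<lambda>\<theta>. \<theta> k" and N=L]) auto

definition Ls :: "(nat \<Rightarrow> interaction) measure" where
  "Ls = PiM UNIV (\<lambda>_. L)"

sublocale Ls: prob_space Ls unfolding Ls_def by (rule prob_PiM_L)

lemma measurable_bweight [measurable]: "(\<lambda>\<theta>. bweight t \<theta> \<sigma>) \<in> borel_measurable Ls"
proof -
  note [measurable] = measurable_eval_PiM_L
  show ?thesis by (cases t) (auto simp: Ls_def Av_def)
qed

lemma measurable_act [measurable]: "(\<lambda>(\<theta>, w). act N t \<theta> w) \<in> Ls \<Otimes>\<^sub>M weights N \<rightarrow>\<^sub>M weights N"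
  unfolding act_def case_prod_beta
  by (rule measurable_comp_weights)
    (intro borel_measurable_times measurable_compose[OF measurable_snd weights_component]
      measurable_compose[OF measurable_fst measurable_bweight])

lemma measurable_act1: "(\<lambda>\<theta>. act N t \<theta> w) \<in> Ls \<rightarrow>\<^sub>M weights N"
  unfolding act_def by (rule measurable_comp_weights) simp

text \<open>The expectation over the interactions of one term, as an operator on functions of the
  weight. Functions that are not \<open>good\<close> are sent to 0; this makes the operator total,
  so that commutation holds without side conditions and \<open>fold_mset\<close> over a multiset of
  terms is meaningful.\<close>

definition step :: "nat \<Rightarrow> nat trm \<Rightarrow> (((nat \<Rightarrow> real) \<Rightarrow> real) \<Rightarrow> real) \<Rightarrow> ((nat \<Rightarrow> real) \<Rightarrow> real) \<Rightarrow> real" where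
  "step N t \<Phi> = (if good N \<Phi> then (\<lambda>w. \<integral>\<theta>. \<Phi> (act N t \<theta> w) \<partial>Ls) else (\<lambda>_. 0))"

lemma good_step: "good N (step N t \<Phi>)"
proof (cases "good N \<Phi>")
  case True
  note [measurable] = goodD(1)[OF True]
  have "(\<lambda>w. \<integral>\<theta>. \<Phi> (act N t \<theta> w) \<partial>Ls) \<in> borel_measurable (weights N)"
    by measurable
  then show ?thesis using True by (auto simp: step_def good_def intro!: Ls.abs_integral_bounded)
qed (auto simp: step_def good_zero)

lemma step_eq: "good N \<Phi> \<Longrightarrow> step N t \<Phi> w = (\<integral>\<theta>. \<Phi> (act N t \<theta> w) \<partial>Ls)"
  by (simp add: step_def)

text \<open>The actions commute pointwise, and the two integrals over interactions are exchanged by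
  Fubini's theorem. For a function that is not \<open>good\<close> both sides are 0.\<close>

lemma step_commute: "step N t (step N s \<Phi>) = step N s (step N t \<Phi>)"
proof (cases "good N \<Phi>")
  case True
  note [measurable] = goodD(1)[OF True]
  note g = good_step
  have act2: "(\<lambda>(\<theta>, \<theta>'). act N s \<theta>' (act N t \<theta> w)) \<in> Ls \<Otimes>\<^sub>M Ls \<rightarrow>\<^sub>M weights N" for s t w
    unfolding act_def case_prod_beta
    by (rule measurable_comp_weights)
      (auto intro!: borel_measurable_times measurable_compose[OF measurable_snd measurable_bweight]
      measurable_compose[OF measurable_fst measurable_bweight])
  show ?thesis
  proof
    fix w
    have m: "(\<lambda>z. \<Phi> (act N s (snd z) (act N t (fst z) w))) \<in> borel_measurable (Ls \<Otimes>\<^sub>M Ls)" for s t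
      using measurable_compose[OF act2 goodD(1)[OF True]] by (simp add: case_prod_beta)
    have comm: "act N s \<theta>' (act N t \<theta> w) = act N t \<theta> (act N s \<theta>' w)" for \<theta> \<theta>'
      by (auto simp: act_def fun_eq_iff)
    have "step N t (step N s \<Phi>) w = (\<integral>\<theta>. \<integral>\<theta>'. \<Phi> (act N s \<theta>' (act N t \<theta> w)) \<partial>Ls \<partial>Ls)"
      using True by (simp add: step_eq g)
    also have "\<dots> = (\<integral>\<theta>'. \<integral>\<theta>. \<Phi> (act N s \<theta>' (act N t \<theta> w)) \<partial>Ls \<partial>Ls)"
      using bounded_Fubini[OF Ls.prob_space_axioms Ls.prob_space_axioms m[of s t], where c=1] goodD(2)[OF True]
      by simp
    also have "\<dots> = step N s (step N t \<Phi>) w"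
      using True by (simp add: step_eq g comm)
    finally show "step N t (step N s \<Phi>) w = step N s (step N t \<Phi>) w" .
  qed
next
  case False
  then show ?thesis by (simp add: step_def good_zero)
qed

lemma comp_fun_commute_step: "comp_fun_commute (step N)"
  by unfold_locales (auto simp: fun_eq_iff step_commute)

abbreviation steps :: "nat \<Rightarrow> (((nat \<Rightarrow> real) \<Rightarrow> real) \<Rightarrow> real) \<Rightarrow> nat trm multiset \<Rightarrow> ((nat \<Rightarrow> real) \<Rightarrow> real) \<Rightarrow> real" where
  "steps N \<Phi> M \<equiv> fold_mset (step N) \<Phi> M"

lemmas steps_add [simp] = comp_fun_commute.fold_mset_add_mset[OF comp_fun_commute_step]
  and steps_step = comp_fun_commute.fold_mset_fun_left_comm[OF comp_fun_commute_step]

lemma good_steps: "good N \<Phi> \<Longrightarrow> good N (steps N \<Phi> M)"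
  by (induction M) (auto simp: good_step)

lemma steps_union: "steps N \<Phi> (M + M') = steps N (steps N \<Phi> M') M"
  by (induction M) auto

lemma measurable_good_act: "good N \<Phi> \<Longrightarrow> (\<lambda>\<theta>. \<Phi> (act N t \<theta> w)) \<in> borel_measurable Ls"
  by (rule measurable_compose[OF measurable_act1 goodD(1)])

lemma step_Th:
  assumes "good N \<Phi>"
  shows "step N (Th I) \<Phi> w = (\<integral>\<theta>. \<Phi> (\<lambda>\<sigma>\<in>configs N. w \<sigma> * exp (\<theta> (map \<sigma> I))) \<partial>L)"
  unfolding step_eq[OF assms] act_def bweight.simps Ls_def
proof (rule integral_PiM_component)
  show "(\<lambda>x. \<Phi> (\<lambda>\<sigma>\<in>configs N. w \<sigma> * exp (x (map \<sigma> I)))) \<in> borel_measurable L"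
    by (rule measurable_compose[OF measurable_comp_weights goodD(1)[OF assms]]) auto
qed (auto intro: L_prob)

lemma steps_lift:
  assumes "good (N + n) \<Phi>" "\<And>t. t \<in># M \<Longrightarrow> set_trm t \<subseteq> {1..N}"
  shows "steps (N + n) \<Phi> M (lift_weight N n w) = steps N (\<lambda>w. \<Phi> (lift_weight N n w)) M w"
  using assms(2)
proof (induction M arbitrary: w)
  case (add t M)
  have g: "good (N + n) (steps (N + n) \<Phi> M)" "good N (steps N (\<lambda>w. \<Phi> (lift_weight N n w)) M)"
    using assms by (auto intro!: good_steps good_lift)
  show ?case using g add by (simp add: step_eq lift_act)
qed simp

lemma steps_perm:
  assumes "good N \<Phi>" "\<pi> permutes {1..N}"
  shows "steps N \<Phi> (image_mset (map_trm \<pi>) M) (perm_weight N \<pi> w) = steps N (\<lambda>w. \<Phi> (perm_weight N \<pi> w)) M w"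
proof (induction M arbitrary: w)
  case (add t M)
  have g: "good N (steps N \<Phi> (image_mset (map_trm \<pi>) M))" "good N (steps N (\<lambda>w. \<Phi> (perm_weight N \<pi> w)) M)"
    using assms by (auto intro!: good_steps good_perm)
  show ?case using g add assms by (simp add: step_eq perm_act)
qed simp

text \<open>The expectation of \<open>\<Phi>\<close> with the number of terms and their sites
  frozen. All dependence on the law \<open>L\<close> sits in this function; what remains random
  afterwards is a discrete multiset.\<close>

definition terms_avg :: "nat \<Rightarrow> (((nat \<Rightarrow> real) \<Rightarrow> real) \<Rightarrow> real) \<Rightarrow> nat trm multiset \<Rightarrow> real" where
  "terms_avg N \<Phi> M = steps N \<Phi> M (one_weight N)"

lemma abs_terms_avg_le: "good N \<Phi> \<Longrightarrow> \<bar>terms_avg N \<Phi> M\<bar> \<le> 1"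
  unfolding terms_avg_def using good_steps goodD by blast

lemma terms_avg_perm:
  assumes "good N \<Phi>" "\<pi> permutes {1..N}"
  shows "terms_avg N \<Phi> (image_mset (map_trm \<pi>) M) = terms_avg N (\<lambda>w. \<Phi> (perm_weight N \<pi> w)) M"
proof -
  have "perm_weight N \<pi> (one_weight N) = one_weight N"
    using assms by (auto simp: perm_weight_def one_weight_def perm_configs)
  then show ?thesis unfolding terms_avg_def using steps_perm[OF assms, where w="one_weight N" and M=M] by simp
qed

lemma terms_avg_union: "terms_avg N \<Phi> (M + M') = terms_avg N (steps N \<Phi> M') M"
  unfolding terms_avg_def steps_union ..

lemma terms_avg_lift:
  assumes "good (N + n) \<Phi>" "\<And>t. t \<in># M \<Longrightarrow> set_trm t \<subseteq> {1..N}"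
  shows "terms_avg (N + n) \<Phi> M = terms_avg N (\<lambda>w. \<Phi> (lift_weight N n w)) M"
proof -
  have "lift_weight N n (one_weight N) = one_weight (N + n)"
    by (auto simp: lift_weight_def one_weight_def restrict_configs)
  then show ?thesis unfolding terms_avg_def using steps_lift[OF assms, where w="one_weight N"] by simp
qed

lemma act_extensional [simp]: "act N t \<theta> w \<in> extensional (configs N)"
  by (simp add: act_def)

lemma measurable_Th_prod:
  "(\<lambda>\<theta>. \<lambda>\<sigma>\<in>configs N. w \<sigma> * (\<Prod>k\<in>A. exp (\<theta> k (map \<sigma> (I k))))) \<in> PiM UNIV (\<lambda>_. L) \<rightarrow>\<^sub>M weights N"
  by (rule measurable_comp_weights)
    (intro borel_measurable_times borel_measurable_prod borel_measurable_exp measurable_compose[OF measurable_eval_PiM_L borel_measurable_exp], simp_all)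

text \<open>Links a single integral over independent interactions, one per index, with the iterated
  operators. One index at a time is resampled and absorbed into the starting weight.\<close>

lemma steps_Th_set:
  fixes I :: "'i \<Rightarrow> nat list"
  assumes "finite A" "good N \<Phi>" "w \<in> extensional (configs N)"
  shows "(\<integral>\<theta>. \<Phi> (\<lambda>\<sigma>\<in>configs N. w \<sigma> * (\<Prod>k\<in>A. exp (\<theta> k (map \<sigma> (I k))))) \<partial>PiM UNIV (\<lambda>_. L)) =
    steps N \<Phi> (image_mset (\<lambda>k. Th (I k)) (mset_set A)) w"
  using assms
proof (induction A arbitrary: w)
  case empty
  interpret P: prob_space "PiM (UNIV::'i set) (\<lambda>_. L)" by (rule prob_PiM_L)
  show ?case using empty by (simp add: extensional_restrict P.prob_space)
next
  case (insert k A)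
  let ?P = "PiM (UNIV::'i set) (\<lambda>_. L)"
  let ?G = "\<lambda>w A \<theta>. \<Phi> (\<lambda>\<sigma>\<in>configs N. w \<sigma> * (\<Prod>k\<in>A. exp (\<theta> k (map \<sigma> (I k)))))"
  note g = good_steps[OF insert.prems(1)]
  have "(\<integral>\<theta>. ?G w (insert k A) \<theta> \<partial>?P) = (\<integral>\<theta>'. \<integral>\<theta>. ?G w (insert k A) (\<lambda>i\<in>UNIV. if i \<in> {k} then \<theta>' i else \<theta> i) \<partial>?P \<partial>?P)"
    by (rule integral_PiM_merge[where c=1])
      (use insert.prems in \<open>auto intro!: L_prob measurable_compose[OF measurable_Th_prod] dest: goodD\<close>)
  also have "\<dots> = (\<integral>\<theta>'. \<integral>\<theta>. ?G (\<lambda>\<sigma>\<in>configs N. w \<sigma> * exp (\<theta>' k (map \<sigma> (I k)))) A \<theta> \<partial>?P \<partial>?P)"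
  proof -
    have "(\<Prod>j\<in>insert k A. exp ((\<lambda>i\<in>UNIV. if i \<in> {k} then \<theta>' i else \<theta> i) j (map \<sigma> (I j)))) =
       exp (\<theta>' k (map \<sigma> (I k))) * (\<Prod>j\<in>A. exp (\<theta> j (map \<sigma> (I j))))"
      for \<theta> \<theta>' :: "'i \<Rightarrow> interaction" and \<sigma>
      using insert.hyps by (auto intro!: prod.cong arg_cong2[where f="(*)"])
    then show ?thesis by (simp add: mult.assoc cong: restrict_cong)
  qed
  also have "\<dots> = (\<integral>\<theta>'. steps N \<Phi> (image_mset (\<lambda>k. Th (I k)) (mset_set A)) (\<lambda>\<sigma>\<in>configs N. w \<sigma> * exp (\<theta>' k (map \<sigma> (I k)))) \<partial>?P)"
    by (intro Bochner_Integration.integral_cong refl insert.IH insert.prems(1) restrict_extensional)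
  also have "\<dots> = (\<integral>\<theta>. steps N \<Phi> (image_mset (\<lambda>k. Th (I k)) (mset_set A)) (\<lambda>\<sigma>\<in>configs N. w \<sigma> * exp (\<theta> (map \<sigma> (I k)))) \<partial>L)"
    by (rule integral_PiM_component[OF L_prob])
      (auto intro!: measurable_compose[OF measurable_comp_weights goodD(1)[OF g]])
  also have "\<dots> = steps N \<Phi> (image_mset (\<lambda>k. Th (I k)) (mset_set (insert k A))) w"
    using insert.hyps by (simp add: step_Th[OF g])
  finally show ?case .
qed

text \<open>
  A cavity spin which is not observed acts on the other spins like one perturbation term.
\<close>
lemma steps_cavity:
  assumes g: "good N \<Phi>" and inv: "abs_inv N \<Phi>" and Js: "\<And>J. J \<in> set Js \<Longrightarrow> set J \<subseteq> {1..N}"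
  shows "steps (Suc N) (\<lambda>w. \<Phi> (sum_out N w)) (image_mset (\<lambda>J. Th (Suc N # J)) (mset Js)) (lift_weight N 1 w) =
    step N (Pt Js) \<Phi> w"
proof -
  let ?I = "\<lambda>k. Suc N # (Js ! (k - 1))"
  \<comment> \<open>Interactions in \<open>bweight\<close> are numbered from 1 and list positions
    from 0; this chain only reconciles the two countings.\<close>
  have "image_mset (\<lambda>k. Th (?I k)) (mset_set {1..length Js}) = image_mset (\<lambda>J. Th (Suc N # J)) (image_mset (\<lambda>k. Js ! (k - 1)) (mset_set {1..length Js}))"
    by (simp add: multiset.map_comp comp_def)
  also have "image_mset (\<lambda>k. Js ! (k - 1)) (mset_set {1..length Js}) = image_mset (\<lambda>k. Js ! k) (mset_set {0..<length Js})"
  proof -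
    have "{1..length Js} = Suc ` {0..<length Js}" by (simp add: image_Suc_atLeastLessThan atLeastLessThanSuc_atLeastAtMost)
    then have "mset_set {1..length Js} = image_mset Suc (mset_set {0..<length Js})"
      by (simp add: image_mset_mset_set)
    then show ?thesis by (simp add: multiset.map_comp comp_def)
  qed
  also have "\<dots> = mset Js"
    by (metis map_nth mset_map mset_upt)
  finally have ms: "image_mset (\<lambda>k. Th (?I k)) (mset_set {1..length Js}) = image_mset (\<lambda>J. Th (Suc N # J)) (mset Js)" .
  have "steps (Suc N) (\<lambda>w. \<Phi> (sum_out N w)) (image_mset (\<lambda>J. Th (Suc N # J)) (mset Js)) (lift_weight N 1 w) =
    (\<integral>\<theta>. \<Phi> (sum_out N (\<lambda>\<sigma>\<in>configs (Suc N). lift_weight N 1 w \<sigma> * (\<Prod>k\<in>{1..length Js}. exp (\<theta> k (map \<sigma> (?I k)))))) \<partial>Ls)"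
    unfolding ms[symmetric] Ls_def
    by (rule steps_Th_set[symmetric]) (auto simp: good_sum_out g lift_weight_def)
  also have "\<dots> = (\<integral>\<theta>. \<Phi> (act N (Pt Js) \<theta> w) \<partial>Ls)"
  proof (rule Bochner_Integration.integral_cong[OF refl])
    fix \<theta> :: "nat \<Rightarrow> interaction"
    \<comment> \<open>Both sides agree only up to sign, since \<open>sum_out\<close> averages
      absolute weights over the cavity spin while \<open>act\<close> multiplies \<open>w\<close>
      itself; the assumption \<open>inv\<close> closes the gap.\<close>
    have "\<bar>sum_out N (\<lambda>\<sigma>\<in>configs (Suc N). lift_weight N 1 w \<sigma> * (\<Prod>k\<in>{1..length Js}. exp (\<theta> k (map \<sigma> (?I k))))) \<sigma>\<bar> =
      \<bar>act N (Pt Js) \<theta> w \<sigma>\<bar>" if \<sigma>: "\<sigma> \<in> configs N" for \<sigma>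
    proof -
      have r: "restrict (\<sigma>(Suc N := \<epsilon>)) {1..N} = \<sigma>" for \<epsilon>
        using \<sigma> by (auto simp: configs_def PiE_iff extensional_def fun_eq_iff)
      have m: "map (\<sigma>(Suc N := \<epsilon>)) (?I k) = \<epsilon> # map \<sigma> (Js ! (k - 1))" if "k \<in> {1..length Js}" for k \<epsilon>
      proof -
        have "Js ! (k - 1) \<in> set Js" using that by (intro nth_mem) auto
        then show ?thesis using Js by fastforce
      qed
      have e: "(\<lambda>\<sigma>\<in>configs (Suc N). lift_weight N 1 w \<sigma> * (\<Prod>k\<in>{1..length Js}. exp (\<theta> k (map \<sigma> (?I k))))) (\<sigma>(Suc N := \<epsilon>)) =
         w \<sigma> * exp (\<Sum>k=1..length Js. \<theta> k (\<epsilon> # map \<sigma> (Js ! (k - 1))))" if "\<epsilon> \<in> signs" for \<epsilon>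
      proof -
        have "(\<Prod>k\<in>{1..length Js}. exp (\<theta> k (map (\<sigma>(Suc N := \<epsilon>)) (?I k)))) = (\<Prod>k\<in>{1..length Js}. exp (\<theta> k (\<epsilon> # map \<sigma> (Js ! (k - 1)))))"
          by (intro prod.cong refl) (simp only: m)
        then show ?thesis
          using upd_configs[OF \<sigma> that] r[of \<epsilon>] unfolding lift_weight_def by (simp add: exp_sum)
      qed
      have "sum_out N (\<lambda>\<sigma>\<in>configs (Suc N). lift_weight N 1 w \<sigma> * (\<Prod>k\<in>{1..length Js}. exp (\<theta> k (map \<sigma> (?I k))))) \<sigma>
        = (\<Sum>\<epsilon>\<in>signs. \<bar>w \<sigma> * exp (\<Sum>k=1..length Js. \<theta> k (\<epsilon> # map \<sigma> (Js ! (k - 1))))\<bar>) / 2"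
      proof -
        have "sum_out N W \<sigma> = (\<Sum>\<epsilon>\<in>signs. \<bar>W (\<sigma>(Suc N := \<epsilon>))\<bar>) / 2" for W
          using \<sigma> by (simp add: sum_out_def Av_def)
        then show ?thesis using e by (simp only: cong: sum.cong)
      qed
      also have "\<dots> = \<bar>w \<sigma>\<bar> * bweight (Pt Js) \<theta> \<sigma>"
        by (simp add: Av_def abs_mult sum_distrib_left)
      finally show ?thesis
        using \<sigma> by (simp only:) (simp add: act_def abs_mult Av_def sum_nonneg)
    qed
    then show "\<Phi> (sum_out N (\<lambda>\<sigma>\<in>configs (Suc N). lift_weight N 1 w \<sigma> * (\<Prod>k\<in>{1..length Js}. exp (\<theta> k (map \<sigma> (?I k)))))) =
       \<Phi> (act N (Pt Js) \<theta> w)"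
      using inv unfolding abs_inv_def by blast
  qed
  also have "\<dots> = step N (Pt Js) \<Phi> w" by (simp add: step_eq[OF g])
  finally show ?thesis .
qed

lemma terms_avg_cavity:
  assumes g: "good N \<Phi>" and inv: "abs_inv N \<Phi>" and Js: "\<And>J. J \<in> set Js \<Longrightarrow> set J \<subseteq> {1..N}"
    and M: "\<And>t. t \<in># M \<Longrightarrow> set_trm t \<subseteq> {1..N}"
  shows "terms_avg (Suc N) (\<lambda>w. \<Phi> (sum_out N w)) (M + image_mset (\<lambda>J. Th (Suc N # J)) (mset Js)) = terms_avg N \<Phi> (M + {#Pt Js#})"
proof -
  have "terms_avg (Suc N) (\<lambda>w. \<Phi> (sum_out N w)) (M + image_mset (\<lambda>J. Th (Suc N # J)) (mset Js)) =
    terms_avg (N + 1) (steps (Suc N) (\<lambda>w. \<Phi> (sum_out N w)) (image_mset (\<lambda>J. Th (Suc N # J)) (mset Js))) M"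
    by (simp add: terms_avg_union)
  also have "\<dots> = terms_avg N (step N (Pt Js) \<Phi>) M"
    using M steps_cavity[OF g inv Js] by (subst terms_avg_lift) (auto intro!: good_steps good_sum_out g)
  also have "\<dots> = terms_avg N \<Phi> (M + {#Pt Js#})"
    by (subst terms_avg_union) simp
  finally show ?thesis .
qed

end

locale symmetric_interaction_law = interaction_law +
  assumes L_symmetric: "\<tau> permutes {..<p} \<Longrightarrow> distr L L (\<lambda>\<theta>. \<lambda>xs\<in>cube p. \<theta> (permute_list \<tau> xs)) = L"
begin

text \<open>Permuting the sites of an interaction amounts to permuting the arguments of the
  interaction function, and the law of the latter does not change under this.\<close>

lemma step_permute_Th:
  assumes g: "good N \<Phi>" and I: "length I = p" "set I \<subseteq> {1..N}" and \<tau>: "\<tau> permutes {..<p}"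
  shows "step N (Th (permute_list \<tau> I)) \<Phi> w = step N (Th I) \<Phi> w"
proof -
  let ?T = "\<lambda>\<theta>. \<lambda>xs\<in>cube p. \<theta> (permute_list \<tau> xs) :: real"
  have T: "?T \<in> L \<rightarrow>\<^sub>M L"
    by (subst measurable_cong_sets[OF refl L_sets], unfold fun_space_def)
      (rule measurable_restrict, rule measurable_eval_L)
  have m: "(\<lambda>\<theta>. \<Phi> (\<lambda>\<sigma>\<in>configs N. w \<sigma> * exp (\<theta> (map \<sigma> I)))) \<in> borel_measurable L"
    by (rule measurable_compose[OF measurable_comp_weights goodD(1)[OF g]]) auto
  have "step N (Th I) \<Phi> w = (\<integral>\<theta>. \<Phi> (\<lambda>\<sigma>\<in>configs N. w \<sigma> * exp (\<theta> (map \<sigma> I))) \<partial>distr L L ?T)"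
    by (simp add: step_Th[OF g] L_symmetric[OF \<tau>])
  also have "\<dots> = (\<integral>\<theta>. \<Phi> (\<lambda>\<sigma>\<in>configs N. w \<sigma> * exp (?T \<theta> (map \<sigma> I))) \<partial>L)"
    by (rule integral_distr[OF T m])
  also have "\<dots> = (\<integral>\<theta>. \<Phi> (\<lambda>\<sigma>\<in>configs N. w \<sigma> * exp (\<theta> (map \<sigma> (permute_list \<tau> I)))) \<partial>L)"
  proof -
    have "?T \<theta> (map \<sigma> I) = \<theta> (map \<sigma> (permute_list \<tau> I))" if "\<sigma> \<in> configs N" for \<sigma> \<theta>
      using that I \<tau> by (simp add: map_in_cube permute_list_map)
    then show ?thesis by (simp cong: restrict_cong)
  qed
  finally show ?thesis by (simp add: step_Th[OF g])
qed

abbreviation wf_trm :: "nat \<Rightarrow> nat trm \<Rightarrow> bool" where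
  "wf_trm \<equiv> wf_term p"

lemma step_canon:
  assumes g: "good N \<Phi>" and t: "wf_trm N t"
  shows "step N (canon t) \<Phi> = step N t \<Phi>"
proof (cases t)
  case (Th I)
  have "mset (sort I) = mset I" by simp
  then obtain \<tau> where "\<tau> permutes {..<length I}" "permute_list \<tau> I = sort I"
    by (rule mset_eq_permutation)
  then show ?thesis using step_permute_Th[OF g, of I \<tau>] t Th by (auto simp: fun_eq_iff)
qed simp

lemma terms_avg_canon:
  assumes g: "good N \<Phi>" and M: "\<And>t. t \<in># M \<Longrightarrow> wf_trm N t"
  shows "terms_avg N \<Phi> (image_mset canon M) = terms_avg N \<Phi> M"
proof -
  have "steps N \<Phi> (image_mset canon M) = steps N \<Phi> M"
    using M by (induction M) (auto simp: step_canon good_steps[OF g])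
  then show ?thesis by (simp add: terms_avg_def)
qed

end

section \<open>The Hamiltonian as a compound Poisson sum of terms\<close>

instance trm :: (countable) countable
  by countable_datatype

primrec seq_pmf :: "('b \<Rightarrow> 'a pmf) \<Rightarrow> 'b list \<Rightarrow> 'a list pmf" where
  "seq_pmf D [] = return_pmf []"
| "seq_pmf D (q # qs) = bind_pmf (D q) (\<lambda>x. bind_pmf (seq_pmf D qs) (\<lambda>xs. return_pmf (x # xs)))"

text \<open>In the disorder the numbers of interactions of all perturbation terms are drawn as one
  family and the sites as another. Drawing first all numbers and then all sites still yields an
  i.i.d. list of perturbation terms.\<close>

lemma bind_replicate_seq: "bind_pmf (replicate_pmf n r) (seq_pmf D) = replicate_pmf n (bind_pmf r D)"
proof (induction n)
  case (Suc n)
  have "bind_pmf (replicate_pmf (Suc n) r) (seq_pmf D) =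
    bind_pmf r (\<lambda>q. bind_pmf (replicate_pmf n r) (\<lambda>qs. bind_pmf (D q) (\<lambda>x. bind_pmf (seq_pmf D qs) (\<lambda>xs. return_pmf (x # xs)))))"
    by (simp add: bind_assoc_pmf bind_return_pmf)
  also have "\<dots> = bind_pmf r (\<lambda>q. bind_pmf (D q) (\<lambda>x. bind_pmf (bind_pmf (replicate_pmf n r) (seq_pmf D)) (\<lambda>xs. return_pmf (x # xs))))"
    by (subst bind_commute_pmf) (simp add: bind_assoc_pmf)
  also have "\<dots> = replicate_pmf (Suc n) (bind_pmf r D)"
    unfolding Suc by (simp add: bind_assoc_pmf)
  finally show ?case .
qed (simp add: bind_return_pmf)

lemma isum_map_single:
  "isum_pmf n (map_pmf (\<lambda>x. {#g x#}) D) = map_pmf (\<lambda>xs. mset (map g xs)) (replicate_pmf n D)"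
proof (induction n)
  case (Suc n)
  show ?case unfolding isum_pmf.simps Suc
    by (simp add: conv_pmf_def map_pmf_def bind_assoc_pmf bind_return_pmf)
qed simp

lemma integral_sample_seq:
  fixes h :: "'a::countable list list list \<Rightarrow> real"
  assumes "distinct (concat (concat jsss))" "\<And>js. js \<in> set (concat jsss) \<Longrightarrow> length js = a" and b: "\<And>xs. \<bar>h xs\<bar> \<le> c"
  shows "(\<integral>\<omega>. h (map (map (map \<omega>)) jsss) \<partial>PiM UNIV (\<lambda>_. measure_pmf u)) =
    measure_pmf.expectation (seq_pmf (\<lambda>n. replicate_pmf n (replicate_pmf a u)) (map length jsss)) h"
  using assms
proof (induction jsss arbitrary: h)
  case Nil
  interpret prob_space "PiM UNIV (\<lambda>_. measure_pmf u)" by (intro prob_space_PiM prob_space_measure_pmf)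
  show ?case by (simp add: prob_space integral_return)
next
  case (Cons jss jsss)
  let ?P = "PiM UNIV (\<lambda>_. measure_pmf u)"
  let ?S = "seq_pmf (\<lambda>n. replicate_pmf n (replicate_pmf a u))"
  have m: "(\<lambda>\<omega>. h (map (map (map \<omega>)) jss)) \<in> borel_measurable ?P" for h :: "'a list list list \<Rightarrow> real" and jss
    by (rule measurable_compose[OF measurable_map_list])
      (auto intro!: measurable_map_list measurable_PiM_pmf_component)
  have "(\<integral>\<omega>. h (map (map (map \<omega>)) (jss # jsss)) \<partial>?P) =
      (\<integral>\<omega>'. \<integral>\<omega>. h (map (map (map (\<lambda>i\<in>UNIV. if i \<in> set (concat jss) then \<omega>' i else \<omega> i))) (jss # jsss)) \<partial>?P \<partial>?P)"
    by (rule integral_PiM_merge[where c=c]) (use Cons m in \<open>auto intro: prob_space_measure_pmf simp del: list.map\<close>)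
  also have "\<dots> = (\<integral>\<omega>'. \<integral>\<omega>. h (map (map \<omega>') jss # map (map (map \<omega>)) jsss) \<partial>?P \<partial>?P)"
  proof -
    have "map (map (map (\<lambda>i\<in>UNIV. if i \<in> set (concat jss) then \<omega>' i else \<omega> i))) (jss # jsss) =
       map (map \<omega>') jss # map (map (map \<omega>)) jsss"
      for \<omega> \<omega>' :: "'b \<Rightarrow> 'a"
      using Cons.prems(1) by (auto intro!: map_cong)
    then show ?thesis by (simp only:)
  qed
  also have "\<dots> = (\<integral>\<omega>'. measure_pmf.expectation (?S (map length jsss)) (\<lambda>xs. h (map (map \<omega>') jss # xs)) \<partial>?P)"
    using Cons.prems by (intro Bochner_Integration.integral_cong refl Cons.IH) auto
  also have "\<dots> = measure_pmf.expectation (replicate_pmf (length jss) (replicate_pmf a u))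
      (\<lambda>x. measure_pmf.expectation (?S (map length jsss)) (\<lambda>xs. h (x # xs)))"
    by (rule integral_sample_nested_list[where c=c]) (use Cons in \<open>auto intro!: abs_expectation_le\<close>)
  also have "\<dots> = measure_pmf.expectation (?S (map length (jss # jsss))) h"
    using Cons.prems by (simp add: expectation_bind_pmf[where B=c] integral_return)
  finally show ?case .
qed

lemma measurable_random_sum:
  fixes X :: "nat \<Rightarrow> 'a \<Rightarrow> real"
  assumes "Q \<in> M \<rightarrow>\<^sub>M count_space UNIV" "\<And>k. X k \<in> borel_measurable M"
  shows "(\<lambda>d. \<Sum>k=1..Q d. X k d) \<in> borel_measurable M"
  by (rule measurable_compose_countable[where g=Q and f="\<lambda>q d. \<Sum>k=1..q. X k d"]) (use assms in auto)

lemma prob_poisson: "prob_space (poisson l)" and prob_unif_site: "prob_space (unif_site N)"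
  by (auto simp: poisson_def unif_site_def intro: prob_space_measure_pmf)

lemma sets_poisson [measurable_cong]: "sets (poisson l) = sets (count_space UNIV)"
  and sets_unif_site [measurable_cong]: "sets (unif_site N) = sets (count_space UNIV)"
  by (auto simp: poisson_def unif_site_def)

text \<open>Collected in one statement because iterated integration over the seven factors of the
  disorder needs, at every stage, the integral formula together with measurability and boundedness
  of the partial integrals.\<close>

lemma Fubini_abs_le_1:
  fixes f :: "'x \<times> 'y \<Rightarrow> real"
  assumes "prob_space A" "prob_space B" "f \<in> borel_measurable (A \<Otimes>\<^sub>M B)" "\<And>z. \<bar>f z\<bar> \<le> 1"
  shows "(\<integral>z. f z \<partial>(A \<Otimes>\<^sub>M B)) = (\<integral>x. \<integral>y. f (x, y) \<partial>B \<partial>A)"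
    and "(\<integral>z. f z \<partial>(A \<Otimes>\<^sub>M B)) = (\<integral>y. \<integral>x. f (x, y) \<partial>A \<partial>B)"
    and "x \<in> space A \<Longrightarrow> (\<lambda>y. f (x, y)) \<in> borel_measurable B"
    and "(\<lambda>y. \<integral>x. f (x, y) \<partial>A) \<in> borel_measurable B"
    and "\<And>y. \<bar>\<integral>x. f (x, y) \<partial>A\<bar> \<le> 1"
proof -
  interpret A: prob_space A by fact
  interpret B: prob_space B by fact
  note [measurable] = assms(3)
  show "(\<integral>z. f z \<partial>(A \<Otimes>\<^sub>M B)) = (\<integral>x. \<integral>y. f (x, y) \<partial>B \<partial>A)"
    "(\<integral>z. f z \<partial>(A \<Otimes>\<^sub>M B)) = (\<integral>y. \<integral>x. f (x, y) \<partial>A \<partial>B)"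
    using bounded_Fubini[OF assms(1-3), of 1] assms(4) by auto
  show "x \<in> space A \<Longrightarrow> (\<lambda>y. f (x, y)) \<in> borel_measurable B" by measurable
  show "(\<lambda>y. \<integral>x. f (x, y) \<partial>A) \<in> borel_measurable B" by measurable
  show "\<bar>\<integral>x. f (x, y) \<partial>A\<bar> \<le> 1" for y by (rule A.abs_integral_bounded) (rule assms(4))
qed

section \<open>Disorder and Gibbs weight of a finite system\<close>

definition "dP = (\<lambda>d::disorder. fst d)"
definition "dT = (\<lambda>d::disorder. fst (snd d))"
definition "dI = (\<lambda>d::disorder. fst (snd (snd d)))"
definition "dP' = (\<lambda>d::disorder. fst (snd (snd (snd d))))"
definition "dQ = (\<lambda>d::disorder. fst (snd (snd (snd (snd d)))))"
definition "dT' = (\<lambda>d::disorder. fst (snd (snd (snd (snd (snd d))))))"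
definition "dI' = (\<lambda>d::disorder. snd (snd (snd (snd (snd (snd d))))))"

lemmas d_defs = dP_def dT_def dI_def dP'_def dQ_def dT'_def dI'_def

lemma neg_H_components:
  "neg_H p d \<sigma> = (\<Sum>k=1..dP d. dT d k (map \<sigma> (map (\<lambda>j. dI d (j, k)) [1..<Suc p]))) +
     (\<Sum>l=1..dP' d. ln (Av signs (\<lambda>\<epsilon>. exp (\<Sum>k=1..dQ d l. dT' d (k, l) (\<epsilon> # map \<sigma> (map (\<lambda>j. dI' d (j, k, l)) [1..<p]))))))"
  by (cases d) (simp add: d_defs comp_def)

definition wt :: "nat \<Rightarrow> nat \<Rightarrow> disorder \<Rightarrow> (nat \<Rightarrow> real) \<Rightarrow> real" where
  "wt p N d = (\<lambda>\<sigma>\<in>configs N. exp (neg_H p d \<sigma>))"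

abbreviation site_pmf :: "nat \<Rightarrow> nat pmf" where "site_pmf N \<equiv> pmf_of_set {1..N}"

context interaction_law
begin

text \<open>The argument list is itself random. As it takes countably many values, the function is
  glued from the measurable evaluations at fixed lists.\<close>

lemma measurable_random_eval:
  assumes T: "T \<in> M \<rightarrow>\<^sub>M PiM UNIV (\<lambda>_. L)" and I: "I \<in> M \<rightarrow>\<^sub>M count_space (UNIV::nat list set)"
  shows "(\<lambda>d. T d k (F (I d))) \<in> borel_measurable M"
  by (rule measurable_compose_countable[where g=I and f="\<lambda>I d. T d k (F I)"])
    (use assms in \<open>auto intro: measurable_compose[OF T measurable_eval_PiM_L]\<close>)

lemma measurable_disorder:
  shows "dP \<in> disorder_law L p \<alpha> c N \<rightarrow>\<^sub>M count_space UNIV"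
    and "dT \<in> disorder_law L p \<alpha> c N \<rightarrow>\<^sub>M PiM UNIV (\<lambda>_. L)"
    and "(\<lambda>d. dI d jk) \<in> disorder_law L p \<alpha> c N \<rightarrow>\<^sub>M count_space UNIV"
    and "dP' \<in> disorder_law L p \<alpha> c N \<rightarrow>\<^sub>M count_space UNIV"
    and "(\<lambda>d. dQ d l) \<in> disorder_law L p \<alpha> c N \<rightarrow>\<^sub>M count_space UNIV"
    and "dT' \<in> disorder_law L p \<alpha> c N \<rightarrow>\<^sub>M PiM UNIV (\<lambda>_. L)"
    and "(\<lambda>d. dI' d jkl) \<in> disorder_law L p \<alpha> c N \<rightarrow>\<^sub>M count_space UNIV"
  unfolding d_defs disorder_law_def by measurable

lemma measurable_neg_H [measurable]:
  "(\<lambda>d. neg_H p d \<sigma>) \<in> borel_measurable (disorder_law L p \<alpha> c N)"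
proof -
  note m = measurable_disorder[where \<alpha>=\<alpha> and c=c and N=N]
  have 1: "(\<lambda>d. dT d k (map \<sigma> (map (\<lambda>j. dI d (j, k)) [1..<Suc p]))) \<in> borel_measurable (disorder_law L p \<alpha> c N)" for k
    by (rule measurable_random_eval[OF m(2)]) (intro measurable_map_list m(3))
  have 2: "(\<lambda>d. dT' d (k, l) (\<epsilon> # map \<sigma> (map (\<lambda>j. dI' d (j, k, l)) [1..<p]))) \<in> borel_measurable (disorder_law L p \<alpha> c N)" for k l \<epsilon>
    by (rule measurable_random_eval[OF m(6), where F="\<lambda>I. \<epsilon> # map \<sigma> I"]) (intro measurable_map_list m(7))
  note 3 = measurable_compose[OF measurable_random_sum[OF m(5) 2] borel_measurable_exp]
  show ?thesis
    unfolding neg_H_components Av_def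
    by (intro borel_measurable_add measurable_random_sum m 1 borel_measurable_ln borel_measurable_divide
        borel_measurable_sum 3 borel_measurable_const)
qed

lemma measurable_wt [measurable]: "wt p N \<in> disorder_law L p \<alpha> c N \<rightarrow>\<^sub>M weights N"
  unfolding wt_def by (rule measurable_comp_weights) simp

lemma prob_disorder: "prob_space (disorder_law L p \<alpha> c N)"
  unfolding disorder_law_def
  by (intro pair_prob prob_poisson prob_space_PiM prob_unif_site L_prob)

lemma measurable_Pt_prod:
  "(\<lambda>\<theta>. \<lambda>\<sigma>\<in>configs N. w \<sigma> * (\<Prod>l\<in>A. bweight (Pt (Js l)) (\<lambda>k. \<theta> (k, l)) \<sigma>)) \<in> PiM UNIV (\<lambda>_. L) \<rightarrow>\<^sub>M weights N"
proof (rule measurable_comp_weights)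
  note [measurable] = measurable_eval_PiM_L
  fix \<sigma>
  show "(\<lambda>\<theta>. w \<sigma> * (\<Prod>l\<in>A. bweight (Pt (Js l)) (\<lambda>k. \<theta> (k, l)) \<sigma>)) \<in> borel_measurable (PiM UNIV (\<lambda>_. L))"
    unfolding bweight.simps Av_def by measurable
qed

text \<open>The analogue of \<open>steps_Th_set\<close>, except that a perturbation term owns a
  whole column of interactions: the block resampled for term l consists of all pairs (k, l).\<close>

lemma steps_Pt_set:
  assumes "finite A" "good N \<Phi>" "w \<in> extensional (configs N)"
  shows "(\<integral>\<theta>. \<Phi> (\<lambda>\<sigma>\<in>configs N. w \<sigma> * (\<Prod>l\<in>A. bweight (Pt (Js l)) (\<lambda>k. \<theta> (k, l)) \<sigma>)) \<partial>PiM UNIV (\<lambda>_. L)) =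
    steps N \<Phi> (image_mset (\<lambda>l. Pt (Js l)) (mset_set A)) w"
  using assms
proof (induction A arbitrary: w)
  case empty
  interpret P: prob_space "PiM (UNIV::(nat \<times> 'a) set) (\<lambda>_. L)" by (rule prob_PiM_L)
  show ?case using empty by (simp add: extensional_restrict P.prob_space)
next
  case (insert l A)
  let ?P = "PiM (UNIV::(nat \<times> 'a) set) (\<lambda>_. L)"
  let ?G = "\<lambda>w A \<theta>. \<Phi> (\<lambda>\<sigma>\<in>configs N. w \<sigma> * (\<Prod>l\<in>A. bweight (Pt (Js l)) (\<lambda>k. \<theta> (k, l)) \<sigma>))"
  note g = good_steps[OF insert.prems(1)]
  have "(\<integral>\<theta>. ?G w (insert l A) \<theta> \<partial>?P) = (\<integral>\<theta>'. \<integral>\<theta>. ?G w (insert l A) (\<lambda>i\<in>UNIV. if i \<in> UNIV \<times> {l} then \<theta>' i else \<theta> i) \<partial>?P \<partial>?P)"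
    by (rule integral_PiM_merge[where c=1])
      (use insert.prems in \<open>auto intro!: L_prob measurable_compose[OF measurable_Pt_prod] dest: goodD simp del: bweight.simps\<close>)
  also have "\<dots> = (\<integral>\<theta>'. \<integral>\<theta>. ?G (act N (Pt (Js l)) (\<lambda>k. \<theta>' (k, l)) w) A \<theta> \<partial>?P \<partial>?P)"
  proof -
    have "(\<Prod>j\<in>insert l A. bweight (Pt (Js j)) (\<lambda>k. (\<lambda>i\<in>UNIV. if i \<in> UNIV \<times> {l} then \<theta>' i else \<theta> i) (k, j)) \<sigma>) =
       bweight (Pt (Js l)) (\<lambda>k. \<theta>' (k, l)) \<sigma> * (\<Prod>j\<in>A. bweight (Pt (Js j)) (\<lambda>k. \<theta> (k, j)) \<sigma>)"
      for \<theta> \<theta>' :: "nat \<times> 'a \<Rightarrow> interaction" and \<sigma>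
    proof -
      have "bweight (Pt (Js j)) (\<lambda>k. (\<lambda>i\<in>UNIV. if i \<in> UNIV \<times> {l} then \<theta>' i else \<theta> i) (k, j)) \<sigma> =
        bweight (Pt (Js j)) (\<lambda>k. \<theta> (k, j)) \<sigma>" if "j \<in> A" for j
      proof -
        have "j \<noteq> l" using that insert.hyps by auto
        then show ?thesis by (simp del: bweight.simps)
      qed
      then show ?thesis using insert.hyps by (simp del: bweight.simps cong: prod.cong)
    qed
    then show ?thesis by (simp add: mult.assoc act_def del: bweight.simps cong: restrict_cong)
  qed
  also have "\<dots> = (\<integral>\<theta>'. steps N \<Phi> (image_mset (\<lambda>k. Pt (Js k)) (mset_set A)) (act N (Pt (Js l)) (\<lambda>k. \<theta>' (k, l)) w) \<partial>?P)"
    by (intro Bochner_Integration.integral_cong refl insert.IH insert.prems(1) act_extensional)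
  also have "\<dots> = (\<integral>\<theta>'. steps N \<Phi> (image_mset (\<lambda>k. Pt (Js k)) (mset_set A)) (act N (Pt (Js l)) (\<lambda>k\<in>UNIV. \<theta>' (k, l)) w) \<partial>?P)"
    by (simp only: restrict_UNIV)
  also have "\<dots> = (\<integral>\<theta>. steps N \<Phi> (image_mset (\<lambda>k. Pt (Js k)) (mset_set A)) (act N (Pt (Js l)) \<theta> w) \<partial>Ls)"
    unfolding Ls_def
    by (rule integral_PiM_reindex[OF L_prob])
     (use measurable_good_act[OF g] in \<open>auto simp: inj_on_def Ls_def\<close>)
  also have "\<dots> = steps N \<Phi> (image_mset (\<lambda>k. Pt (Js k)) (mset_set (insert l A))) w"
    using insert.hyps by (simp add: step_eq[OF g])
  finally show ?case .
qed

text \<open>A single term is a singleton multiset, so that sums of terms are unions of multisets and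
  compound Poisson laws apply.\<close>

definition th_law :: "nat \<Rightarrow> nat trm multiset pmf" where
  "th_law N = map_pmf (\<lambda>I. {#Th I#}) (replicate_pmf p (site_pmf N))"

definition pt_law :: "real \<Rightarrow> nat \<Rightarrow> nat trm multiset pmf" where
  "pt_law \<alpha> N = map_pmf (\<lambda>Js. {#Pt Js#})
     (bind_pmf (poisson_pmf (\<alpha> * real p)) (\<lambda>q. replicate_pmf q (replicate_pmf (p - 1) (site_pmf N))))"

definition terms_law :: "real \<Rightarrow> (nat \<Rightarrow> real) \<Rightarrow> nat \<Rightarrow> nat trm multiset pmf" where
  "terms_law \<alpha> c N = conv_pmf (cpois (\<alpha> * real N) (th_law N)) (cpois (c N) (pt_law \<alpha> N))"

text \<open>The Gibbs weight as two nested products, perturbation terms inside and ordinary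
  interactions outside, in the shape to which \<open>steps_Pt_set\<close> and
  \<open>steps_Th_set\<close> apply. The average under the logarithm is positive, so logarithm and
  exponential cancel.\<close>

lemma wt_eq:
  fixes \<theta> :: "nat \<Rightarrow> interaction" and \<theta>' :: "nat \<times> nat \<Rightarrow> interaction"
  shows "wt p N (P, \<theta>, i, P', Q, \<theta>', i') = (\<lambda>\<sigma>\<in>configs N.
    (\<lambda>\<sigma>\<in>configs N. one_weight N \<sigma> * (\<Prod>l\<in>{1..P'}. bweight (Pt (map (\<lambda>k. map (\<lambda>j. i' (j, k, l)) [1..<p]) [1..<Suc (Q l)])) (\<lambda>k. \<theta>' (k, l)) \<sigma>)) \<sigma>
     * (\<Prod>k\<in>{1..P}. exp (\<theta> k (map \<sigma> (map (\<lambda>j. i (j, k)) [1..<Suc p])))))"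
proof (unfold wt_def, rule restrict_ext)
  fix \<sigma> assume \<sigma>: "\<sigma> \<in> configs N"
  let ?X = "\<lambda>l. Av signs (\<lambda>\<epsilon>. exp (\<Sum>k=1..Q l. \<theta>' (k, l) (\<epsilon> # map (\<lambda>j. \<sigma> (i' (j, k, l))) [1..<p])))"
  have pos: "0 < ?X l" for l
    unfolding Av_def by (auto intro!: divide_pos_pos sum_pos)
  have b: "bweight (Pt (map (\<lambda>k. map (\<lambda>j. i' (j, k, l)) [1..<p]) [1..<Suc (Q l)])) (\<lambda>k. \<theta>' (k, l)) \<sigma> = ?X l" for l
  proof -
    have "(\<Sum>k=1..Q l. \<theta>' (k, l) (\<epsilon> # map \<sigma> (map (\<lambda>k. map (\<lambda>j. i' (j, k, l)) [1..<p]) [1..<Suc (Q l)] ! (k - 1)))) =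
      (\<Sum>k=1..Q l. \<theta>' (k, l) (\<epsilon> # map (\<lambda>j. \<sigma> (i' (j, k, l))) [1..<p]))" for \<epsilon>
      by (intro sum.cong refl) (auto simp: nth_map comp_def simp del: upt_Suc)
    then show ?thesis by (simp del: upt_Suc)
  qed
  have "exp (neg_H p (P, \<theta>, i, P', Q, \<theta>', i') \<sigma>) =
     (\<Prod>k\<in>{1..P}. exp (\<theta> k (map \<sigma> (map (\<lambda>j. i (j, k)) [1..<Suc p])))) * (\<Prod>l\<in>{1..P'}. exp (ln (?X l)))"
    by (simp add: exp_add exp_sum comp_def del: upt_Suc)
  also have "(\<Prod>l\<in>{1..P'}. exp (ln (?X l))) = (\<Prod>l\<in>{1..P'}. ?X l)"
    using pos by (intro prod.cong refl) (simp only: exp_ln)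
  finally show "exp (neg_H p (P, \<theta>, i, P', Q, \<theta>', i') \<sigma>) =
    (\<lambda>\<sigma>\<in>configs N. one_weight N \<sigma> * (\<Prod>l\<in>{1..P'}. bweight (Pt (map (\<lambda>k. map (\<lambda>j. i' (j, k, l)) [1..<p]) [1..<Suc (Q l)])) (\<lambda>k. \<theta>' (k, l)) \<sigma>)) \<sigma>
     * (\<Prod>k\<in>{1..P}. exp (\<theta> k (map \<sigma> (map (\<lambda>j. i (j, k)) [1..<Suc p]))))"
    using \<sigma> unfolding restrict_apply'[OF \<sigma>] b by (simp add: one_weight_def del: upt_Suc)
qed

lemma image_mset_upto: "image_mset f (mset_set {1..P}) = mset (map f [1..<Suc P])"
  by (simp add: atLeastLessThanSuc_atLeastAtMost del: upt_Suc)

text \<open>The gateway from the disorder measure to discrete laws. For given counts and sites the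
  interactions are integrated out, which yields \<open>terms_avg\<close> of the multiset of terms.
  Counts and sites are discrete and independent, and the multiset they produce has a convolution of
  two compound Poisson laws.\<close>

lemma disorder_expectation:
  assumes g: "good N \<Phi>"
  shows "(\<integral>d. \<Phi> (wt p N d) \<partial>disorder_law L p \<alpha> c N) = measure_pmf.expectation (terms_law \<alpha> c N) (terms_avg N \<Phi>)"
proof -
  define PP where "PP = poisson (\<alpha> * real N)"
  define MT where "MT = PiM (UNIV :: nat set) (\<lambda>_. L)"
  define MI where "MI = PiM (UNIV :: (nat \<times> nat) set) (\<lambda>_. unif_site N)"
  define PP' where "PP' = poisson (c N)"
  define MQ where "MQ = PiM (UNIV :: nat set) (\<lambda>_. poisson (\<alpha> * real p))"
  define MT' where "MT' = PiM (UNIV :: (nat \<times> nat) set) (\<lambda>_. L)"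
  define MI' where "MI' = PiM (UNIV :: (nat \<times> nat \<times> nat) set) (\<lambda>_. unif_site N)"
  have prob: "prob_space PP" "prob_space MT" "prob_space MI" "prob_space PP'" "prob_space MQ" "prob_space MT'" "prob_space MI'"
    unfolding PP_def MT_def MI_def PP'_def MQ_def MT'_def MI'_def
    by (intro prob_space_PiM prob_poisson prob_unif_site L_prob)+
  have D: "disorder_law L p \<alpha> c N = PP \<Otimes>\<^sub>M (MT \<Otimes>\<^sub>M (MI \<Otimes>\<^sub>M (PP' \<Otimes>\<^sub>M (MQ \<Otimes>\<^sub>M (MT' \<Otimes>\<^sub>M MI')))))"
    unfolding disorder_law_def PP_def MT_def MI_def PP'_def MQ_def MT'_def MI'_def ..
  define G where "G = (\<lambda>d. \<Phi> (wt p N d))"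
  have G: "G \<in> borel_measurable (disorder_law L p \<alpha> c N)"
    unfolding G_def by (rule measurable_compose[OF measurable_wt goodD(1)[OF g]])
  have Gb: "\<bar>G d\<bar> \<le> 1" for d unfolding G_def using g by (rule goodD)
  note Fub = Fubini_abs_le_1
  have prs: "prob_space (MT' \<Otimes>\<^sub>M MI')" "prob_space (MQ \<Otimes>\<^sub>M (MT' \<Otimes>\<^sub>M MI'))"
    "prob_space (PP' \<Otimes>\<^sub>M (MQ \<Otimes>\<^sub>M (MT' \<Otimes>\<^sub>M MI')))" "prob_space (MI \<Otimes>\<^sub>M (PP' \<Otimes>\<^sub>M (MQ \<Otimes>\<^sub>M (MT' \<Otimes>\<^sub>M MI'))))"
    "prob_space (MT \<Otimes>\<^sub>M (MI \<Otimes>\<^sub>M (PP' \<Otimes>\<^sub>M (MQ \<Otimes>\<^sub>M (MT' \<Otimes>\<^sub>M MI')))))"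
    by (intro pair_prob prob)+
  note pr = prob prs
  \<comment> \<open>The ordinary interactions are integrated first, because they form the outer
    factor in \<open>wt_eq\<close>; \<open>r\<close> collects the other components of the
    disorder.\<close>
  define H where "H = (\<lambda>P r. \<integral>T. G (P, T, r) \<partial>MT)"
  have Hb: "\<bar>H P r\<bar> \<le> 1" for P r
    unfolding H_def by (rule prob_space.abs_integral_bounded[OF prob(2)]) (rule Gb)
  define I where "I = (\<lambda>P i. map (\<lambda>k. map (\<lambda>j. i (j, k)) [1..<Suc p]) [1..<Suc P] :: nat list list)"
  define J where "J = (\<lambda>P' Q i'. map (\<lambda>l. map (\<lambda>k. map (\<lambda>j. i' (j, k, l)) [1..<p]) [1..<Suc (Q l)]) [1..<Suc P'] :: nat list list list)"
  have core: "(\<integral>T'. H P (i, P', Q, T', i') \<partial>MT') = terms_avg N \<Phi> (mset (map Th (I P i)) + mset (map Pt (J P' Q i')))" for P i P' Q i'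
  proof -
    let ?w = "\<lambda>T'. \<lambda>\<sigma>\<in>configs N. one_weight N \<sigma> * (\<Prod>l\<in>{1..P'}. bweight (Pt (map (\<lambda>k. map (\<lambda>j. i' (j, k, l)) [1..<p]) [1..<Suc (Q l)])) (\<lambda>k. T' (k, l)) \<sigma>)"
    have H: "H P (i, P', Q, T', i') = steps N \<Phi> (mset (map Th (I P i))) (?w T')" for T'
    proof -
      have "H P (i, P', Q, T', i') = steps N \<Phi> (image_mset (\<lambda>k. Th (map (\<lambda>j. i (j, k)) [1..<Suc p])) (mset_set {1..P})) (?w T')"
        unfolding H_def G_def wt_eq MT_def by (rule steps_Th_set[OF _ g]) (rule finite_atLeastAtMost restrict_extensional)+
      then show ?thesis by (simp only: image_mset_upto I_def map_map comp_def)
    qed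
    have "(\<integral>T'. H P (i, P', Q, T', i') \<partial>MT') =
      steps N (steps N \<Phi> (mset (map Th (I P i)))) (image_mset (\<lambda>l. Pt (map (\<lambda>k. map (\<lambda>j. i' (j, k, l)) [1..<p]) [1..<Suc (Q l)])) (mset_set {1..P'})) (one_weight N)"
      unfolding H MT'_def by (rule steps_Pt_set[OF _ good_steps[OF g]], rule finite_atLeastAtMost, unfold one_weight_def, rule restrict_extensional)
    also have "\<dots> = terms_avg N \<Phi> (mset (map Pt (J P' Q i')) + mset (map Th (I P i)))"
      by (simp only: terms_avg_def steps_union image_mset_upto J_def map_map comp_def)
    finally show ?thesis by (simp only: add.commute)
  qed
  let ?u = "site_pmf N"
  define X where "X = (\<lambda>Is. measure_pmf.expectation (cpois (c N) (pt_law \<alpha> N)) (\<lambda>M. terms_avg N \<Phi> (mset (map Th Is) + M)))"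
  note fb = abs_terms_avg_le[OF g]
  have Xb: "\<bar>X Is\<bar> \<le> 1" for Is unfolding X_def by (rule abs_expectation_le) (rule fb)
  have inner: "(\<integral>P'. \<integral>Q. \<integral>i'. terms_avg N \<Phi> (mset (map Th (I P i)) + mset (map Pt (J P' Q i'))) \<partial>MI' \<partial>MQ \<partial>PP') = X (I P i)" for P i
  proof -
    let ?h = "\<lambda>Jss. terms_avg N \<Phi> (mset (map Th (I P i)) + mset (map Pt Jss))"
    let ?S = "seq_pmf (\<lambda>n. replicate_pmf n (replicate_pmf (p - 1) ?u))"
    have 1: "(\<integral>i'. ?h (J P' Q i') \<partial>MI') = measure_pmf.expectation (?S (map Q [1..<Suc P'])) ?h" for P' Q
    proof -
      define js where "js = map (\<lambda>l. map (\<lambda>k. map (\<lambda>j. (j, k, l)) [1..<p]) [1..<Suc (Q l)]) [1..<Suc P']"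
      have Jjs: "J P' Q i' = map (map (map i')) js" for i'
        by (simp add: J_def js_def comp_def del: upt_Suc)
      have len: "map length js = map Q [1..<Suc P']" by (simp add: js_def comp_def del: upt_Suc)
      have d2: "distinct (concat (map (\<lambda>k. map (\<lambda>j. (j, k, l)) [1..<p]) [1..<n]))" for l n :: nat
        by (induction n) (auto simp: distinct_map inj_on_def)
      have d3: "distinct (concat (concat (map (\<lambda>l. map (\<lambda>k. map (\<lambda>j. (j, k, l)) [1..<p]) [1..<Suc (Q l)]) [1..<n])))" for n
      proof (induction n)
        case (Suc n)
        then show ?case using d2[of n "Suc (Q n)"] by (cases "1 \<le> n") (auto simp del: upt_Suc simp: upt_Suc_append)
      qed simp
      show ?thesis unfolding Jjs len[symmetric] MI'_def unif_site_def
        by (rule integral_sample_seq[where c=1]) (use d3 fb in \<open>auto simp: js_def simp del: upt_Suc\<close>)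
    qed
    have 2: "(\<integral>Q. \<integral>i'. ?h (J P' Q i') \<partial>MI' \<partial>MQ) = measure_pmf.expectation (isum_pmf P' (pt_law \<alpha> N)) (\<lambda>M. terms_avg N \<Phi> (mset (map Th (I P i)) + M))" for P'
    proof -
      have "(\<integral>Q. \<integral>i'. ?h (J P' Q i') \<partial>MI' \<partial>MQ) = measure_pmf.expectation (replicate_pmf (length [1..<Suc P']) (poisson_pmf (\<alpha> * real p))) (\<lambda>qs. measure_pmf.expectation (?S qs) ?h)"
        unfolding 1 MQ_def poisson_def
        by (rule integral_sample_list[where c=1]) (use fb in \<open>auto intro!: abs_expectation_le\<close>)
      also have "\<dots> = measure_pmf.expectation (replicate_pmf P' (bind_pmf (poisson_pmf (\<alpha> * real p)) (\<lambda>n. replicate_pmf n (replicate_pmf (p - 1) ?u)))) ?h"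
        unfolding bind_replicate_seq[symmetric] using fb by (subst expectation_bind_pmf[where B=1]) (auto simp del: upt_Suc)
      also have "\<dots> = measure_pmf.expectation (isum_pmf P' (pt_law \<alpha> N)) (\<lambda>M. terms_avg N \<Phi> (mset (map Th (I P i)) + M))"
        unfolding pt_law_def isum_map_single by simp
      finally show ?thesis .
    qed
    show ?thesis unfolding 2 X_def PP'_def poisson_def cpois_def
      by (rule expectation_bind_pmf[symmetric, where B=1]) (rule fb)
  qed
  have "(\<integral>d. \<Phi> (wt p N d) \<partial>disorder_law L p \<alpha> c N) = (\<integral>P. \<integral>y. G (P, y) \<partial>(MT \<Otimes>\<^sub>M (MI \<Otimes>\<^sub>M (PP' \<Otimes>\<^sub>M (MQ \<Otimes>\<^sub>M (MT' \<Otimes>\<^sub>M MI'))))) \<partial>PP)"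
    unfolding G_def[symmetric] D by (rule Fub) (use pr G Gb in \<open>auto simp: D\<close>)
  also have "\<dots> = (\<integral>P. \<integral>r. H P r \<partial>(MI \<Otimes>\<^sub>M (PP' \<Otimes>\<^sub>M (MQ \<Otimes>\<^sub>M (MT' \<Otimes>\<^sub>M MI')))) \<partial>PP)"
  proof (rule Bochner_Integration.integral_cong[OF refl])
    fix P assume P: "P \<in> space PP"
    show "(\<integral>y. G (P, y) \<partial>(MT \<Otimes>\<^sub>M (MI \<Otimes>\<^sub>M (PP' \<Otimes>\<^sub>M (MQ \<Otimes>\<^sub>M (MT' \<Otimes>\<^sub>M MI')))))) = (\<integral>r. H P r \<partial>(MI \<Otimes>\<^sub>M (PP' \<Otimes>\<^sub>M (MQ \<Otimes>\<^sub>M (MT' \<Otimes>\<^sub>M MI')))))"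
      unfolding H_def
      by (rule Fub) (use pr G Gb P in \<open>auto simp: D intro: measurable_compose_Pair1\<close>)
  qed
  also have "\<dots> = (\<integral>P. \<integral>i. \<integral>P'. \<integral>Q. \<integral>i'. \<integral>T'. H P (i, P', Q, T', i') \<partial>MT' \<partial>MI' \<partial>MQ \<partial>PP' \<partial>MI \<partial>PP)"
  proof (rule Bochner_Integration.integral_cong[OF refl])
    fix P assume P: "P \<in> space PP"
    have G1: "(\<lambda>y. G (P, y)) \<in> borel_measurable (MT \<Otimes>\<^sub>M (MI \<Otimes>\<^sub>M (PP' \<Otimes>\<^sub>M (MQ \<Otimes>\<^sub>M (MT' \<Otimes>\<^sub>M MI')))))"
      using G P unfolding D by (rule measurable_compose_Pair1[rotated])
    have m0: "H P \<in> borel_measurable (MI \<Otimes>\<^sub>M (PP' \<Otimes>\<^sub>M (MQ \<Otimes>\<^sub>M (MT' \<Otimes>\<^sub>M MI'))))"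
      unfolding H_def by (rule Fub(4)) (use pr Gb G1 in auto)
    have "(\<integral>r. H P r \<partial>(MI \<Otimes>\<^sub>M (PP' \<Otimes>\<^sub>M (MQ \<Otimes>\<^sub>M (MT' \<Otimes>\<^sub>M MI'))))) = (\<integral>i. \<integral>r. H P (i, r) \<partial>(PP' \<Otimes>\<^sub>M (MQ \<Otimes>\<^sub>M (MT' \<Otimes>\<^sub>M MI'))) \<partial>MI)"
      by (rule Fub) (use pr m0 Hb in auto)
    also have "\<dots> = (\<integral>i. \<integral>P'. \<integral>r. H P (i, P', r) \<partial>(MQ \<Otimes>\<^sub>M (MT' \<Otimes>\<^sub>M MI')) \<partial>PP' \<partial>MI)"
      by (intro Bochner_Integration.integral_cong refl, rule Fub)
        (use pr m0 Hb in \<open>auto intro: measurable_compose_Pair1\<close>)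
    also have "\<dots> = (\<integral>i. \<integral>P'. \<integral>Q. \<integral>r. H P (i, P', Q, r) \<partial>(MT' \<Otimes>\<^sub>M MI') \<partial>MQ \<partial>PP' \<partial>MI)"
      by (intro Bochner_Integration.integral_cong refl, rule Fub)
        (use pr m0 Hb in \<open>auto intro!: measurable_compose_Pair1\<close>)
    also have "\<dots> = (\<integral>i. \<integral>P'. \<integral>Q. \<integral>i'. \<integral>T'. H P (i, P', Q, T', i') \<partial>MT' \<partial>MI' \<partial>MQ \<partial>PP' \<partial>MI)"
      by (intro Bochner_Integration.integral_cong refl, rule Fub)
        (use pr m0 Hb in \<open>auto intro!: measurable_compose_Pair1\<close>)
    finally show "(\<integral>r. H P r \<partial>(MI \<Otimes>\<^sub>M (PP' \<Otimes>\<^sub>M (MQ \<Otimes>\<^sub>M (MT' \<Otimes>\<^sub>M MI'))))) = \<dots>" .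
  qed
  also have "\<dots> = (\<integral>P. \<integral>i. X (I P i) \<partial>MI \<partial>PP)"
    unfolding core inner ..
  also have "\<dots> = (\<integral>P. measure_pmf.expectation (isum_pmf P (th_law N)) (\<lambda>M'. measure_pmf.expectation (cpois (c N) (pt_law \<alpha> N)) (\<lambda>M. terms_avg N \<Phi> (M' + M))) \<partial>PP)"
  proof (rule Bochner_Integration.integral_cong[OF refl])
    fix P
    define js where "js = map (\<lambda>k. map (\<lambda>j. (j, k)) [1..<Suc p]) [1..<Suc P]"
    have Ijs: "I P i = map (map i) js" for i by (simp add: I_def js_def comp_def del: upt_Suc)
    have d2: "distinct (concat (map (\<lambda>k. map (\<lambda>j. (j, k)) xs) ys))" if "distinct xs" "distinct ys" for xs ys :: "nat list"
      using that by (induction ys) (auto simp: distinct_map inj_on_def)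
    have "(\<integral>i. X (I P i) \<partial>MI) = measure_pmf.expectation (replicate_pmf (length js) (replicate_pmf p ?u)) X"
      unfolding Ijs MI_def unif_site_def
      by (rule integral_sample_nested_list[where c=1]) (use d2 Xb in \<open>auto simp: js_def simp del: upt_Suc\<close>)
    also have "\<dots> = measure_pmf.expectation (isum_pmf P (th_law N)) (\<lambda>M'. measure_pmf.expectation (cpois (c N) (pt_law \<alpha> N)) (\<lambda>M. terms_avg N \<Phi> (M' + M)))"
      unfolding th_law_def isum_map_single by (simp add: X_def js_def del: upt_Suc)
    finally show "(\<integral>i. X (I P i) \<partial>MI) = \<dots>" .
  qed
  also have "\<dots> = measure_pmf.expectation (terms_law \<alpha> c N) (terms_avg N \<Phi>)"
    unfolding terms_law_def PP_def poisson_def cpois_def[of "\<alpha> * real N"]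
    using fb by (simp add: expectation_conv[where B=1] expectation_bind_pmf[where B=1] abs_expectation_le)
  finally show ?thesis .
qed

end

section \<open>Adding cavity sites\<close>

lemma expectation_mix:
  fixes f :: "'a \<Rightarrow> real"
  assumes "0 \<le> q" "q \<le> 1" "\<And>x. \<bar>f x\<bar> \<le> B"
  shows "measure_pmf.expectation (mix_pmf q D D') f = q * measure_pmf.expectation D f + (1 - q) * measure_pmf.expectation D' f"
  unfolding mix_pmf_def using assms by (simp add: expectation_bind_pmf[where B=B])

abbreviation cav_pmf :: "nat \<Rightarrow> nat \<Rightarrow> nat pmf" where "cav_pmf N n \<equiv> pmf_of_set {N+1..N+n}"

text \<open>For positive \<open>k\<close>, a list of \<open>k\<close> sites with exactly one cavity
  site. Placing it first loses nothing as long as the order of the list does not matter.\<close>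

definition cav_list :: "nat \<Rightarrow> nat \<Rightarrow> nat \<Rightarrow> nat list pmf" where
  "cav_list N n k = bind_pmf (cav_pmf N n) (\<lambda>i. map_pmf ((#) i) (replicate_pmf (k - 1) (site_pmf N)))"

lemma expectation_site_split:
  fixes f :: "nat \<Rightarrow> real"
  assumes "0 < N" "0 < n"
  shows "measure_pmf.expectation (site_pmf (N + n)) f =
    (1 - real n / real (N + n)) * measure_pmf.expectation (site_pmf N) f + real n / real (N + n) * measure_pmf.expectation (cav_pmf N n) f"
proof -
  have "{1..N+n} = {1..N} \<union> {N+1..N+n}" by auto
  then have "sum f {1..N+n} = sum f {1..N} + sum f {N+1..N+n}"
    by (simp only:) (rule sum.union_disjoint, auto)
  moreover have "1 - real n / real (N + n) = real N / real (N + n)" using assms by (simp add: field_simps)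
  ultimately show ?thesis
    using assms by (simp add: integral_pmf_of_set add_divide_distrib)
qed

lemma tv_site:
  assumes "0 < N" "0 < n"
  shows "tv_le (site_pmf (N + n)) (site_pmf N) (2 * (real n / real (N + n)))"
  unfolding tv_le_def
proof (intro allI impI)
  fix f :: "nat \<Rightarrow> real" assume f: "\<forall>x. \<bar>f x\<bar> \<le> 1"
  let ?x = "real n / real (N + n)" and ?B = "measure_pmf.expectation (site_pmf N) f" and ?C = "measure_pmf.expectation (cav_pmf N n) f"
  have "measure_pmf.expectation (site_pmf (N + n)) f - ?B = ?x * (?C - ?B)"
    unfolding expectation_site_split[OF assms] by (simp add: algebra_simps)
  then have "\<bar>measure_pmf.expectation (site_pmf (N + n)) f - ?B\<bar> = ?x * \<bar>?C - ?B\<bar>"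
    by (simp only: abs_mult) simp
  moreover have "\<bar>?C - ?B\<bar> \<le> 2"
    using abs_expectation_le[of f 1 "site_pmf N"] abs_expectation_le[of f 1 "cav_pmf N n"] f by fastforce
  then have "?x * \<bar>?C - ?B\<bar> \<le> ?x * 2" by (rule mult_left_mono) simp
  ultimately show "\<bar>measure_pmf.expectation (site_pmf (N + n)) f - ?B\<bar> \<le> 2 * ?x"
    by (simp only: mult.commute)
qed

text \<open>Expansion to first order in the probability x of hitting a cavity site: no hit has
  weight 1 - k x, a single hit k x, and everything else goes into the error of order x^2. Symmetry
  of \<open>f\<close> allows the single cavity site to be moved to the front.\<close>

lemma replicate_site_expansion:
  fixes f :: "nat list \<Rightarrow> real"
  assumes N: "0 < N" "0 < n" and f: "\<And>xs. \<bar>f xs\<bar> \<le> 1" and sym: "\<And>xs ys. mset xs = mset ys \<Longrightarrow> f xs = f ys"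
  defines "x \<equiv> real n / real (N + n)"
  shows "\<bar>measure_pmf.expectation (replicate_pmf k (site_pmf (N + n))) f -
     ((1 - k * x) * measure_pmf.expectation (replicate_pmf k (site_pmf N)) f + k * x * measure_pmf.expectation (cav_list N n k) f)\<bar>
     \<le> 2 * (real k)\<^sup>2 * x\<^sup>2"
  using f sym
proof (induction k arbitrary: f)
  case 0
  show ?case by simp
next
  case (Suc k)
  let ?E = measure_pmf.expectation
  let ?R = "\<lambda>k. replicate_pmf k (site_pmf (N + n))" and ?S = "\<lambda>k. replicate_pmf k (site_pmf N)"
  let ?g = "\<lambda>y. ?E (?R k) (\<lambda>xs. f (y # xs))" and ?h = "\<lambda>y. ?E (?S k) (\<lambda>xs. f (y # xs))"
  define B where "B = ?E (?S (Suc k)) f"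
  define C where "C = ?E (cav_list N n (Suc k)) f"
  have x: "0 \<le> x" "x \<le> 1" using N by (auto simp: x_def)
  note f = Suc.prems(1) and sym = Suc.prems(2)
  have b: "\<bar>?E q (\<lambda>xs. f (F xs))\<bar> \<le> 1" for q :: "nat list pmf" and F by (rule abs_expectation_le) (rule f)
  have B: "B = ?E (site_pmf N) ?h"
    unfolding B_def using f by (simp add: expectation_bind_pmf[where B=1] integral_return)
  have C: "C = ?E (cav_pmf N n) ?h"
    unfolding C_def cav_list_def using f by (simp add: expectation_bind_pmf[where B=1])
  have "?E (?R (Suc k)) f = ?E (site_pmf (N + n)) ?g"
    using f by (simp add: expectation_bind_pmf[where B=1] integral_return)
  \<comment> \<open>The first site is either old, and the induction hypothesis applies to the
    remaining k, or it is a cavity site, and the remaining k are replaced by old ones at the cost of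
    2 k x.\<close>
  then have split: "?E (?R (Suc k)) f = (1 - x) * ?E (site_pmf N) ?g + x * ?E (cav_pmf N n) ?g"
    unfolding x_def using expectation_site_split[OF N, of ?g] by simp
  have first: "\<bar>?E (site_pmf N) ?g - ((1 - k * x) * B + k * x * C)\<bar> \<le> 2 * (real k)\<^sup>2 * x\<^sup>2"
  proof -
    let ?c = "\<lambda>y. ?E (cav_list N n k) (\<lambda>xs. f (y # xs))"
    have "\<bar>?g y - ((1 - k * x) * ?h y + k * x * ?c y)\<bar> \<le> 2 * (real k)\<^sup>2 * x\<^sup>2" for y
      by (rule Suc.IH[of "\<lambda>xs. f (y # xs)"]) (auto intro: f sym)
    then have "\<bar>?E (site_pmf N) (\<lambda>y. ?g y - ((1 - k * x) * ?h y + k * x * ?c y))\<bar> \<le> 2 * (real k)\<^sup>2 * x\<^sup>2"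
      by (rule abs_expectation_le)
    moreover have "?E (site_pmf N) (\<lambda>y. ?g y - ((1 - k * x) * ?h y + k * x * ?c y)) =
      ?E (site_pmf N) ?g - ((1 - k * x) * ?E (site_pmf N) ?h + k * x * ?E (site_pmf N) ?c)"
    proof -
      have "finite {1..N}" "{1..N} \<noteq> {}" using N by auto
      then show ?thesis
        by (simp add: integral_pmf_of_set sum_subtractf sum.distrib sum_distrib_left[symmetric] diff_divide_distrib add_divide_distrib)
    qed
    \<comment> \<open>An old site followed by a list that starts with a cavity site: by symmetry the
      two heads are exchanged, which gives the law with one more site. For k = 0 the factor k hides
      that \<open>cav_list\<close> still contains one site.\<close>
    moreover have "k * x * ?E (site_pmf N) ?c = k * x * C"
    proof (cases k)
      case (Suc j)
      have "?E (site_pmf N) ?c = ?E (bind_pmf (site_pmf N) (\<lambda>y. bind_pmf (cav_pmf N n) (\<lambda>i. map_pmf (\<lambda>xs. y # i # xs) (?S j)))) f"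
        using f Suc by (simp add: cav_list_def expectation_bind_pmf[where B=1] abs_expectation_le)
      also have "\<dots> = ?E (site_pmf N) (\<lambda>y. ?E (cav_pmf N n) (\<lambda>i. ?E (?S j) (\<lambda>xs. f (y # i # xs))))"
        using f by (simp add: expectation_bind_pmf[where B=1])
      also have "(\<lambda>y i xs. f (y # i # xs)) = (\<lambda>y i xs. f (i # y # xs))"
        by (intro ext sym) simp
      then have "(\<lambda>y. ?E (cav_pmf N n) (\<lambda>i. ?E (?S j) (\<lambda>xs. f (y # i # xs)))) = (\<lambda>y. ?E (cav_pmf N n) (\<lambda>i. ?E (?S j) (\<lambda>xs. f (i # y # xs))))"
        by (auto simp: fun_eq_iff)
      also have "?E (site_pmf N) (\<lambda>y. ?E (cav_pmf N n) (\<lambda>i. ?E (?S j) (\<lambda>xs. f (i # y # xs)))) =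
         ?E (bind_pmf (site_pmf N) (\<lambda>y. bind_pmf (cav_pmf N n) (\<lambda>i. map_pmf (\<lambda>xs. i # y # xs) (?S j)))) f"
        using f by (simp add: expectation_bind_pmf[where B=1])
      also have "\<dots> = ?E (bind_pmf (cav_pmf N n) (\<lambda>i. bind_pmf (site_pmf N) (\<lambda>y. map_pmf (\<lambda>xs. i # y # xs) (?S j)))) f"
        by (subst bind_commute_pmf) simp
      also have "\<dots> = C"
        unfolding C using Suc f by (simp add: expectation_bind_pmf[where B=1] integral_return)
      finally show ?thesis by simp
    qed simp
    ultimately show ?thesis unfolding B by (simp only:)
  qed
  have second: "\<bar>?E (cav_pmf N n) ?g - C\<bar> \<le> real k * (2 * x)"
  proof -
    have "\<bar>?g y - ?h y\<bar> \<le> real k * (2 * x)" for y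
      unfolding x_def by (rule tv_leD[OF tv_le_replicate[OF tv_site[OF N]]]) (rule f)
    then have "\<bar>?E (cav_pmf N n) (\<lambda>y. ?g y - ?h y)\<bar> \<le> real k * (2 * x)"
      by (rule abs_expectation_le)
    moreover have "?E (cav_pmf N n) (\<lambda>y. ?g y - ?h y) = ?E (cav_pmf N n) ?g - ?E (cav_pmf N n) ?h"
      by (rule Bochner_Integration.integral_diff) (auto intro!: integrable_pmf_bounded[where B=1] b)
    ultimately show ?thesis unfolding C by simp
  qed
  have bB: "\<bar>B\<bar> \<le> 1" and bC: "\<bar>C\<bar> \<le> 1" unfolding B_def C_def by (rule b[of _ "\<lambda>x. x"])+
  define d1 where "d1 = ?E (site_pmf N) ?g - ((1 - k * x) * B + k * x * C)"
  define d2 where "d2 = ?E (cav_pmf N n) ?g - C"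
  \<comment> \<open>Besides the two errors, the product of the weights leaves k x^2 (B - C).
    Altogether the constant is 2 k^2 + 4 k \<le> 2 (k + 1)^2.\<close>
  have "?E (?R (Suc k)) f - ((1 - Suc k * x) * B + Suc k * x * C) = (1 - x) * d1 + x * d2 + k * x\<^sup>2 * B - k * x\<^sup>2 * C"
    unfolding split d1_def d2_def by (simp add: algebra_simps power2_eq_square)
  also have "\<bar>\<dots>\<bar> \<le> \<bar>(1 - x) * d1\<bar> + \<bar>x * d2\<bar> + \<bar>k * x\<^sup>2 * B\<bar> + \<bar>k * x\<^sup>2 * C\<bar>" by linarith
  also have "\<dots> \<le> 1 * (2 * (real k)\<^sup>2 * x\<^sup>2) + x * (real k * (2 * x)) + k * x\<^sup>2 * 1 + k * x\<^sup>2 * 1"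
    unfolding abs_mult using first second x bB bC unfolding d1_def[symmetric] d2_def[symmetric]
    by (intro add_mono mult_mono) auto
  also have "\<dots> \<le> 2 * (real (Suc k))\<^sup>2 * x\<^sup>2"
    by (simp add: algebra_simps power2_eq_square)
  finally show ?case unfolding B_def C_def .
qed

lemma set_pmf_conv: "set_pmf (conv_pmf p q) = {x + y |x y. x \<in> set_pmf p \<and> y \<in> set_pmf q}"
  unfolding conv_pmf_def by auto

lemma set_pmf_isum_subset:
  assumes "0 \<in> S" "\<And>x y. x \<in> S \<Longrightarrow> y \<in> S \<Longrightarrow> x + y \<in> S" "set_pmf D \<subseteq> S"
  shows "set_pmf (isum_pmf n D) \<subseteq> S"
  by (induction n) (use assms in \<open>auto simp: set_pmf_conv\<close>)

lemma set_pmf_cpois_subset: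
  assumes "0 \<in> S" "\<And>x y. x \<in> S \<Longrightarrow> y \<in> S \<Longrightarrow> x + y \<in> S" "set_pmf D \<subseteq> S"
  shows "set_pmf (cpois l D) \<subseteq> S"
  unfolding cpois_def using set_pmf_isum_subset[OF assms] by auto

lemma expectation_cong_pmf:
  assumes "\<And>x. x \<in> set_pmf p \<Longrightarrow> f x = g x"
  shows "measure_pmf.expectation p f = measure_pmf.expectation p (g :: _ \<Rightarrow> real)"
  by (rule integral_cong_AE) (use assms in \<open>auto simp: AE_measure_pmf_iff\<close>)

section \<open>Gibbs averages after removing or relabelling sites\<close>

definition local_fun :: "nat \<Rightarrow> ((nat \<Rightarrow> real) \<Rightarrow> real) \<Rightarrow> bool" where
  "local_fun m f \<longleftrightarrow> (\<forall>\<sigma> \<sigma>'. (\<forall>i\<in>{1..m}. \<sigma> i = \<sigma>' i) \<longrightarrow> f \<sigma> = f \<sigma>')"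

lemma abs_inv_gav_prod: "abs_inv N (\<lambda>w. \<Prod>l\<in>A. gav N w (f l))"
  unfolding abs_inv_def gav_def by (auto intro!: prod.cong arg_cong2[where f="(/)"] sum.cong)

text \<open>Each configuration of N + 1 spins consists of one of N spins and a last spin. A function
  of the first m sites does not see the last spin, so numerator and denominator both acquire the
  factor 2 from \<open>Av\<close>.\<close>

lemma gav_sum_out:
  assumes loc: "local_fun m f" "m \<le> N"
  shows "gav (Suc N) w f = gav N (sum_out N w) f"
proof -
  have bij: "bij_betw (\<lambda>(\<sigma>, \<epsilon>). \<sigma>(Suc N := \<epsilon>)) (configs N \<times> signs) (configs (Suc N))"
  proof (rule bij_betwI[where g="\<lambda>\<sigma>. (restrict \<sigma> {1..N}, \<sigma> (Suc N))"])
    show "(\<lambda>(\<sigma>, \<epsilon>). \<sigma>(Suc N := \<epsilon>)) \<in> configs N \<times> signs \<rightarrow> configs (Suc N)"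
      using upd_configs by auto
    show "(\<lambda>\<sigma>. (restrict \<sigma> {1..N}, \<sigma> (Suc N))) \<in> configs (Suc N) \<rightarrow> configs N \<times> signs"
      by (auto simp: configs_def PiE_iff)
  next
    fix x assume "x \<in> configs N \<times> signs"
    then obtain \<sigma> \<epsilon> where x: "x = (\<sigma>, \<epsilon>)" "\<sigma> \<in> configs N" by auto
    then have "restrict (\<sigma>(Suc N := \<epsilon>)) {1..N} = \<sigma>"
      by (auto simp: configs_def PiE_iff extensional_def fun_eq_iff)
    then show "(\<lambda>\<sigma>. (restrict \<sigma> {1..N}, \<sigma> (Suc N))) ((\<lambda>(\<sigma>, \<epsilon>). \<sigma>(Suc N := \<epsilon>)) x) = x"
      using x by simp
  next
    fix \<sigma> assume "\<sigma> \<in> configs (Suc N)"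
    then show "(\<lambda>(\<sigma>, \<epsilon>). \<sigma>(Suc N := \<epsilon>)) ((\<lambda>\<sigma>. (restrict \<sigma> {1..N}, \<sigma> (Suc N))) \<sigma>) = \<sigma>"
      by (auto simp: configs_def PiE_iff extensional_def fun_eq_iff le_Suc_eq)
  qed
  have key: "(\<Sum>\<sigma>\<in>configs (Suc N). \<bar>w \<sigma>\<bar> * g \<sigma>) = 2 * (\<Sum>\<sigma>\<in>configs N. \<bar>sum_out N w \<sigma>\<bar> * g \<sigma>)"
    if g: "local_fun m g" for g
  proof -
    have eq: "g (\<sigma>(Suc N := \<epsilon>)) = g \<sigma>" for \<sigma> \<epsilon>
      using g loc(2) unfolding local_fun_def by (elim allE[of _ "\<sigma>(Suc N := \<epsilon>)"] allE[of _ \<sigma>] impE) auto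
    have "(\<Sum>\<sigma>\<in>configs (Suc N). \<bar>w \<sigma>\<bar> * g \<sigma>) = (\<Sum>(\<sigma>, \<epsilon>)\<in>configs N \<times> signs. \<bar>w (\<sigma>(Suc N := \<epsilon>))\<bar> * g \<sigma>)"
      by (subst sum.reindex_bij_betw[OF bij, symmetric]) (auto simp: eq intro!: sum.cong)
    also have "\<dots> = (\<Sum>\<sigma>\<in>configs N. \<Sum>\<epsilon>\<in>signs. \<bar>w (\<sigma>(Suc N := \<epsilon>))\<bar> * g \<sigma>)"
      by (rule sum.cartesian_product[symmetric])
    also have "\<dots> = (\<Sum>\<sigma>\<in>configs N. 2 * (\<bar>sum_out N w \<sigma>\<bar> * g \<sigma>))"
    proof (rule sum.cong[OF refl])
      fix \<sigma> assume "\<sigma> \<in> configs N"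
      then have "\<bar>sum_out N w \<sigma>\<bar> = (\<Sum>\<epsilon>\<in>signs. \<bar>w (\<sigma>(Suc N := \<epsilon>))\<bar>) / 2"
        by (simp add: sum_out_def Av_def sum_nonneg)
      then show "(\<Sum>\<epsilon>\<in>signs. \<bar>w (\<sigma>(Suc N := \<epsilon>))\<bar> * g \<sigma>) = 2 * (\<bar>sum_out N w \<sigma>\<bar> * g \<sigma>)"
        unfolding sum_distrib_right[symmetric] by simp
    qed
    finally show ?thesis by (simp add: sum_distrib_left)
  qed
  show ?thesis
    unfolding gav_def key[OF loc(1)] using key[of "\<lambda>_. 1"] by (simp add: local_fun_def)
qed

lemma gav_perm:
  assumes "\<pi> permutes {1..N}"
  shows "gav N (perm_weight N \<pi> w) (\<lambda>\<sigma>. f (\<lambda>i. \<sigma> (\<pi> i))) = gav N w f"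
proof -
  note inv = permutes_inv[OF assms]
  have bij: "bij_betw (\<lambda>\<sigma> i. \<sigma> (\<pi> i)) (configs N) (configs N)"
    by (rule bij_betwI[where g="\<lambda>\<sigma> i. \<sigma> (inv \<pi> i)"])
      (auto simp: perm_configs[OF assms] perm_configs[OF inv] permutes_inverses[OF assms])
  have "(\<Sum>\<sigma>\<in>configs N. \<bar>perm_weight N \<pi> w \<sigma>\<bar> * g (\<lambda>i. \<sigma> (\<pi> i))) = (\<Sum>\<sigma>\<in>configs N. \<bar>w \<sigma>\<bar> * g \<sigma>)" for g
    by (subst sum.reindex_bij_betw[OF bij, symmetric]) (auto simp: perm_weight_def intro!: sum.cong)
  from this[of f] this[of "\<lambda>_. 1"] show ?thesis unfolding gav_def by simp
qed

lemma map_replicate_pmf: "map_pmf (map g) (replicate_pmf n u) = replicate_pmf n (map_pmf g u)"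
proof (induction n)
  case (Suc n)
  show ?case
    by (simp only: replicate_pmf.simps Suc[symmetric] map_bind_pmf bind_map_pmf map_return_pmf list.map)
qed simp

context symmetric_interaction_law
begin

definition cav_th_law :: "nat \<Rightarrow> nat \<Rightarrow> nat trm multiset pmf" where
  "cav_th_law N n = map_pmf (\<lambda>I. {#Th I#}) (cav_list N n p)"

text \<open>An interaction of the larger system contains no cavity site with probability about 1 - p
  x and one with probability about p x, where x = n / (N + n). The comparison is made after
  \<open>canon\<close>, since the expansion tests with symmetric functions.\<close>

lemma th_law_approx:
  assumes N: "0 < N" "0 < n" and small: "real p * (real n / real (N + n)) \<le> 1"
  shows "tv_le (map_pmf (image_mset canon) (th_law (N + n)))
     (map_pmf (image_mset canon) (mix_pmf (1 - real p * (real n / real (N + n))) (th_law N) (cav_th_law N n)))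
     (2 * (real p)\<^sup>2 * (real n / real (N + n))\<^sup>2)"
  unfolding tv_le_def
proof (intro allI impI)
  fix F :: "nat trm multiset \<Rightarrow> real" assume F: "\<forall>x. \<bar>F x\<bar> \<le> 1"
  let ?x = "real n / real (N + n)"
  let ?f = "\<lambda>I. F {#Th (sort I)#}"
  have sym: "?f xs = ?f ys" if "mset xs = mset ys" for xs ys
    using that by (metis properties_for_sort mset_sort sorted_sort)
  have 1: "measure_pmf.expectation (map_pmf (image_mset canon) (th_law K)) F = measure_pmf.expectation (replicate_pmf p (site_pmf K)) ?f" for K
    by (simp add: th_law_def)
  have 2: "measure_pmf.expectation (map_pmf (image_mset canon) (mix_pmf (1 - real p * ?x) (th_law N) (cav_th_law N n))) F =
     (1 - real p * ?x) * measure_pmf.expectation (replicate_pmf p (site_pmf N)) ?f + real p * ?x * measure_pmf.expectation (cav_list N n p) ?f"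
    using F small by (simp add: expectation_mix[where B=1] th_law_def cav_th_law_def)
  show "\<bar>measure_pmf.expectation (map_pmf (image_mset canon) (th_law (N + n))) F -
      measure_pmf.expectation (map_pmf (image_mset canon) (mix_pmf (1 - real p * ?x) (th_law N) (cav_th_law N n))) F\<bar>
      \<le> 2 * (real p)\<^sup>2 * ?x\<^sup>2"
    unfolding 1 2 by (rule replicate_site_expansion[OF N _ sym]) (use F in auto)
qed

lemma wf_th_law: "0 < N \<Longrightarrow> set_pmf (th_law N) \<subseteq> {M. \<forall>t\<in>#M. wf_trm N t}"
  by (auto simp: th_law_def set_replicate_pmf)

lemma wf_pt_law: "0 < N \<Longrightarrow> set_pmf (pt_law \<alpha> N) \<subseteq> {M. \<forall>t\<in>#M. wf_trm N t}"
  by (force simp: pt_law_def set_replicate_pmf)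

lemma wf_cav_th_law: "0 < N \<Longrightarrow> 0 < n \<Longrightarrow> 0 < p \<Longrightarrow> set_pmf (cav_th_law N n) \<subseteq> {M. \<forall>t\<in>#M. wf_trm (N + n) t}"
  by (force simp: cav_th_law_def cav_list_def set_replicate_pmf)

lemma wf_terms_law: "0 < N \<Longrightarrow> set_pmf (terms_law \<alpha> c N) \<subseteq> {M. \<forall>t\<in>#M. wf_trm N t}"
proof -
  assume N: "0 < N"
  have "set_pmf (cpois (\<alpha> * real N) (th_law N)) \<subseteq> {M. \<forall>t\<in>#M. wf_trm N t}"
    by (rule set_pmf_cpois_subset[OF _ _ wf_th_law[OF N]]) auto
  moreover have "set_pmf (cpois (c N) (pt_law \<alpha> N)) \<subseteq> {M. \<forall>t\<in>#M. wf_trm N t}"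
    by (rule set_pmf_cpois_subset[OF _ _ wf_pt_law[OF N]]) auto
  moreover have "x + y \<in> {M. \<forall>t\<in>#M. wf_trm N t}" if "x \<in> {M. \<forall>t\<in>#M. wf_trm N t}" "y \<in> {M. \<forall>t\<in>#M. wf_trm N t}" for x y
    using that by auto
  ultimately show ?thesis unfolding terms_law_def set_pmf_conv by blast
qed

lemma wf_trm_mono: "wf_trm N t \<Longrightarrow> N \<le> N' \<Longrightarrow> wf_trm N' t"
  by (cases t) force+

lemma wf_trm_sites: "wf_trm N t \<Longrightarrow> set_trm t \<subseteq> {1..N}"
  by (cases t) auto

lemma expectation_canon:
  assumes g: "good N \<Phi>" and wf: "set_pmf q \<subseteq> {M. \<forall>t\<in>#M. wf_trm N t}"
  shows "measure_pmf.expectation (map_pmf (image_mset canon) q) (terms_avg N \<Phi>) = measure_pmf.expectation q (terms_avg N \<Phi>)"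
  unfolding integral_map_pmf by (rule expectation_cong_pmf) (use wf in \<open>auto intro!: terms_avg_canon g\<close>)

text \<open>Sites are uniform and independent, so relabelling them preserves the law of the terms.
  This is the exchangeability of the rows in finite volume.\<close>

lemma map_terms_law_perm:
  assumes \<pi>: "\<pi> permutes {1..N}" and N: "0 < N"
  shows "map_pmf (image_mset (map_trm \<pi>)) (terms_law \<alpha> c N) = terms_law \<alpha> c N"
proof -
  have site: "map_pmf \<pi> (site_pmf N) = site_pmf N"
    using \<pi> N by (intro map_pmf_of_set_bij_betw permutes_imp_bij) auto
  have rep: "map_pmf (map \<pi>) (replicate_pmf k (site_pmf N)) = replicate_pmf k (site_pmf N)" for k
    by (simp only: map_replicate_pmf site)
  have th: "map_pmf (image_mset (map_trm \<pi>)) (th_law N) = th_law N"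
  proof -
    have "map_pmf (image_mset (map_trm \<pi>)) (th_law N) = map_pmf (\<lambda>I. {#Th I#}) (map_pmf (map \<pi>) (replicate_pmf p (site_pmf N)))"
      by (simp add: th_law_def map_pmf_comp)
    then show ?thesis by (simp only: rep th_law_def)
  qed
  have pt: "map_pmf (image_mset (map_trm \<pi>)) (pt_law \<alpha> N) = pt_law \<alpha> N"
  proof -
    have "map_pmf (image_mset (map_trm \<pi>)) (pt_law \<alpha> N) = map_pmf (\<lambda>Js. {#Pt Js#}) (map_pmf (map (map \<pi>))
       (bind_pmf (poisson_pmf (\<alpha> * real p)) (\<lambda>q. replicate_pmf q (replicate_pmf (p - 1) (site_pmf N)))))"
      by (simp add: pt_law_def map_pmf_comp)
    then show ?thesis by (simp only: map_bind_pmf map_replicate_pmf rep site pt_law_def)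
  qed
  show ?thesis
    by (simp add: terms_law_def map_conv_pmf map_cpois th pt)
qed

lemma expectation_perm:
  assumes g: "good N \<Phi>" and \<pi>: "\<pi> permutes {1..N}" and N: "0 < N"
  shows "measure_pmf.expectation (terms_law \<alpha> c N) (terms_avg N (\<lambda>w. \<Phi> (perm_weight N \<pi> w))) = measure_pmf.expectation (terms_law \<alpha> c N) (terms_avg N \<Phi>)"
proof -
  have "measure_pmf.expectation (terms_law \<alpha> c N) (terms_avg N \<Phi>) = measure_pmf.expectation (map_pmf (image_mset (map_trm \<pi>)) (terms_law \<alpha> c N)) (terms_avg N \<Phi>)"
    by (simp add: map_terms_law_perm[OF \<pi> N])
  then show ?thesis by (simp add: terms_avg_perm[OF g \<pi>])
qed

end

text \<open>Rates of at least 1 make the factor 1 / sqrt b harmless and leave the bare difference of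
  the rates. This suits c_N, whose increments tend to 0.\<close>

lemma cpois_rate_close:
  assumes "1 \<le> a" "1 \<le> b"
  shows "tv_le (cpois a D) (cpois b D) \<bar>a - b\<bar>"
proof -
  have *: "tv_le (cpois a D) (cpois b D) (a - b)" if "1 \<le> b" "b \<le> a" for a b
  proof -
    have "tv_le (cpois (b + (a - b)) D) (cpois b D) ((a - b) / sqrt b)"
      using that by (intro cpois_smoothing_rate) auto
    moreover have "(a - b) / sqrt b \<le> (a - b) / 1"
      using that by (intro divide_left_mono) auto
    ultimately show ?thesis by (auto intro: tv_le_mono)
  qed
  show ?thesis
  proof (cases "b \<le> a")
    case True
    then show ?thesis using *[of b a] assms by simp
  next
    case False
    then show ?thesis using *[of a b] assms by (auto intro: tv_le_sym simp: abs_if)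
  qed
qed

section \<open>Comparing the systems with N and N + n sites\<close>

locale cavity_model = symmetric_interaction_law +
  fixes \<alpha> :: real and c :: "nat \<Rightarrow> real"
  assumes p_ge: "2 \<le> p" and \<alpha>_pos: "0 < \<alpha>"
    and c_at_top: "filterlim c at_top sequentially"
    and c_small: "(\<lambda>N. c N / real N) \<longlonglongrightarrow> 0"
    and c_slow: "(\<lambda>N. \<bar>c (Suc N) - c N\<bar>) \<longlonglongrightarrow> 0"
begin

abbreviation terms :: "nat \<Rightarrow> nat trm multiset pmf" where "terms \<equiv> terms_law \<alpha> c"

text \<open>The interactions that touch cavity sites. Their rate is the total rate \<alpha> (N + n)
  times the probability p n / (N + n). For n = 0 there is no uniform law on the empty set of cavity
  sites, so this case is set by hand.\<close>

definition cav_law :: "nat \<Rightarrow> nat \<Rightarrow> nat trm multiset pmf" where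
  "cav_law N n = (if n = 0 then return_pmf {#} else cpois (\<alpha> * real p * real n) (cav_th_law N n))"

lemma c_diff: "(\<lambda>N. \<bar>c (N + n) - c N\<bar>) \<longlonglongrightarrow> 0"
proof (induction n)
  case (Suc n)
  have "(\<lambda>N. \<bar>c (Suc (N + n)) - c (N + n)\<bar> + \<bar>c (N + n) - c N\<bar>) \<longlonglongrightarrow> 0 + 0"
    by (intro tendsto_add Suc LIMSEQ_ignore_initial_segment[OF c_slow])
  then have "(\<lambda>N. \<bar>c (Suc (N + n)) - c (N + n)\<bar> + \<bar>c (N + n) - c N\<bar>) \<longlonglongrightarrow> 0" by simp
  then show ?case
    by (rule Lim_null_comparison[rotated]) (auto intro!: always_eventually)
qed simp

text \<open>A perturbation term has \<alpha> p (p - 1) sites on average, each of which is a cavity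
  site with probability n / (N + n); the factor 2 is that of \<open>tv_site\<close>.\<close>

lemma pt_law_approx:
  assumes N: "0 < N" "0 < n"
  shows "tv_le (pt_law \<alpha> (N + n)) (pt_law \<alpha> N) (\<alpha> * real p * (real (p - 1) * (2 * (real n / real (N + n)))))"
proof -
  have l: "0 < \<alpha> * real p" using \<alpha>_pos p_ge by simp
  let ?e = "real (p - 1) * (2 * (real n / real (N + n)))"
  let ?r = "\<lambda>N q. replicate_pmf q (replicate_pmf (p - 1) (site_pmf N))"
  have "tv_le (bind_pmf (poisson_pmf (\<alpha> * real p)) (?r (N + n))) (bind_pmf (poisson_pmf (\<alpha> * real p)) (?r N))
    (measure_pmf.expectation (poisson_pmf (\<alpha> * real p)) (\<lambda>q. real q * ?e))"
    by (rule tv_le_bind_right[OF tv_le_replicate[OF tv_le_replicate[OF tv_site[OF N]]]])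
      (simp add: poisson_moments[OF l])
  also have "measure_pmf.expectation (poisson_pmf (\<alpha> * real p)) (\<lambda>q. real q * ?e) = \<alpha> * real p * ?e"
    by (simp add: poisson_moments[OF l])
  finally show ?thesis unfolding pt_law_def by (rule tv_le_map)
qed

text \<open>Thinning splits the interactions of the large system into those without and those with
  one cavity site. There are four errors: \<open>e1\<close> from the first-order expansion in the
  number of cavity sites, \<open>e2\<close> from the change of the rate of the interactions without
  cavity site, \<open>e3\<close> from perturbation terms with a cavity site, and \<open>e4\<close>
  from the change of c.\<close>

lemma cavity_approx:
  assumes n: "0 < n"
  shows "\<exists>e. e \<longlonglongrightarrow> 0 \<and> (\<forall>\<^sub>F N in sequentially. tv_le (map_pmf (image_mset canon) (terms (N + n)))
    (map_pmf (image_mset canon) (conv_pmf (terms N) (cav_law N n))) (e N))"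
proof -
  let ?h = "map_pmf (image_mset canon)"
  define e1 where "e1 = (\<lambda>N. 2 * \<alpha> * (real p)\<^sup>2 * (real n)\<^sup>2 * inverse (real (N + n)))"
  define e2 where "e2 = (\<lambda>N. \<alpha> * real n * (real p - 1) / sqrt (\<alpha> * (real N + (real n - real p * real n))))"
  define e3 where "e3 = (\<lambda>N. 2 * \<alpha> * real p * real (p - 1) * real n * (c (N + n) / real (N + n)))"
  define e4 where "e4 = (\<lambda>N. \<bar>c (N + n) - c N\<bar>)"
  have l1: "e1 \<longlonglongrightarrow> 0"
    unfolding e1_def by (intro tendsto_mult_right_zero LIMSEQ_ignore_initial_segment[OF lim_inverse_n])
  have lin: "filterlim (\<lambda>N. \<alpha> * (real N + (real n - real p * real n))) at_top sequentially"
    using \<alpha>_pos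
    by (intro filterlim_tendsto_pos_mult_at_top[OF tendsto_const]) 
      (auto intro!: filterlim_at_top_add_at_top filterlim_tendsto_add_at_top filterlim_real_sequentially simp: add.commute[of "real _"])
  have l2: "e2 \<longlonglongrightarrow> 0"
    unfolding e2_def by (intro real_tendsto_divide_at_top[OF tendsto_const] filterlim_compose[OF sqrt_at_top lin])
  have l3: "e3 \<longlonglongrightarrow> 0"
    unfolding e3_def by (intro tendsto_mult_right_zero LIMSEQ_ignore_initial_segment[OF c_small])
  have l4: "e4 \<longlonglongrightarrow> 0" unfolding e4_def by (rule c_diff)
  let ?e = "\<lambda>N. (e1 N + e2 N) + (e3 N + e4 N)"
  have "?e \<longlonglongrightarrow> (0 + 0) + (0 + 0)" by (intro tendsto_add l1 l2 l3 l4)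
  then have lim: "?e \<longlonglongrightarrow> 0" by simp
  have ev1: "\<forall>\<^sub>F N in sequentially. 1 \<le> c N"
    using c_at_top unfolding filterlim_at_top by blast
  then have ev2: "\<forall>\<^sub>F N in sequentially. 1 \<le> c (N + n)" by (rule eventually_all_ge_at_top[THEN eventually_mono, of "\<lambda>N. 1 \<le> c N"]) auto
  have ev3: "\<forall>\<^sub>F N in sequentially. p * n < N" by (rule eventually_gt_at_top)
  have "\<forall>\<^sub>F N in sequentially. tv_le (?h (terms (N + n))) (?h (conv_pmf (terms N) (cav_law N n))) (?e N)"
    using ev1 ev2 ev3
  proof eventually_elim
    case (elim N)
    have N: "0 < N" using elim by simp
    define x where "x = real n / real (N + n)"
    have pn: "real p * real n < real N" using elim(3) by (metis of_nat_less_iff of_nat_mult)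
    have px: "real p * x < 1" using pn N n by (simp add: x_def divide_less_eq)
    \<comment> \<open>The rate \<alpha> (N + n) splits into b for interactions with a cavity site
      and a for the others. Here a lies below \<alpha> N by the constant \<alpha> n (p - 1), the
      numerator of \<open>e2\<close>; it is positive because N > p n.\<close>
    define a where "a = \<alpha> * (real N + (real n - real p * real n))"
    define b where "b = \<alpha> * real p * real n"
    have a: "0 < a" and b: "0 < b" using pn \<alpha>_pos n p_ge by (auto simp: a_def b_def)
    have ab: "a + b = \<alpha> * real (N + n)" by (simp add: a_def b_def algebra_simps)
    have q: "a / (a + b) = 1 - real p * x"
    proof -
      have "x * real (N + n) = real n" using N by (simp add: x_def)
      moreover have "\<alpha> * K * (1 - real p * x) = \<alpha> * K - \<alpha> * real p * (x * K)" for K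
        by (simp add: algebra_simps)
      ultimately have key: "\<alpha> * real (N + n) * (1 - real p * x) = \<alpha> * real (N + n) - \<alpha> * real p * real n"
        by (simp only:)
      then have "a = (a + b) * (1 - real p * x)"
        unfolding ab key by (simp add: a_def algebra_simps)
      then show ?thesis using a b by (simp add: nonzero_divide_eq_eq mult.commute)
    qed
    have A1: "tv_le (cpois (a + b) (?h (th_law (N + n)))) (cpois (a + b) (?h (mix_pmf (a / (a + b)) (th_law N) (cav_th_law N n)))) (e1 N)"
    proof (rule tv_le_mono)
      show "tv_le (cpois (a + b) (?h (th_law (N + n)))) (cpois (a + b) (?h (mix_pmf (a / (a + b)) (th_law N) (cav_th_law N n)))) ((a + b) * (2 * (real p)\<^sup>2 * x\<^sup>2))"
        unfolding q unfolding x_def using px a b by (intro tv_le_cpois th_law_approx N n) (auto simp: x_def)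
      show "(a + b) * (2 * (real p)\<^sup>2 * x\<^sup>2) \<le> e1 N"
      proof -
        have "\<alpha> * K * (2 * (real p)\<^sup>2 * (real n / K)\<^sup>2) = 2 * \<alpha> * (real p)\<^sup>2 * (real n)\<^sup>2 * inverse K"
          if "K \<noteq> 0" for K
          using that by (simp add: field_simps power2_eq_square)
        then show ?thesis unfolding ab e1_def x_def using N by (metis add_gr_0 of_nat_0_less_iff less_irrefl order_refl)
      qed
    qed
    have A2: "?h (cpois (a + b) (mix_pmf (a / (a + b)) (th_law N) (cav_th_law N n))) =
       conv_pmf (cpois a (?h (th_law N))) (cpois b (?h (cav_th_law N n)))"
      by (simp add: cpois_mix[OF a b] map_conv_pmf map_cpois)
    have A3: "tv_le (cpois a (?h (th_law N))) (cpois (\<alpha> * real N) (?h (th_law N))) (e2 N)"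
    proof -
      have "0 \<le> \<alpha> * real n * (real p - 1)" using \<alpha>_pos p_ge by simp
      from cpois_smoothing_rate[OF a this, of "?h (th_law N)"]
      have "tv_le (cpois (\<alpha> * real N) (?h (th_law N))) (cpois a (?h (th_law N))) (e2 N)"
        by (simp add: a_def e2_def algebra_simps)
      then show ?thesis by (rule tv_le_sym)
    qed
    have A: "tv_le (cpois (\<alpha> * real (N + n)) (?h (th_law (N + n)))) (conv_pmf (cpois (\<alpha> * real N) (?h (th_law N))) (?h (cav_law N n))) (e1 N + e2 N)"
    proof (rule tv_le_trans)
      show "tv_le (cpois (\<alpha> * real (N + n)) (?h (th_law (N + n)))) (conv_pmf (cpois a (?h (th_law N))) (cpois b (?h (cav_th_law N n)))) (e1 N)"
        using A1 unfolding ab[symmetric] A2[symmetric] by (simp add: map_cpois)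
      have "tv_le (conv_pmf (cpois a (?h (th_law N))) (cpois b (?h (cav_th_law N n)))) (conv_pmf (cpois (\<alpha> * real N) (?h (th_law N))) (cpois b (?h (cav_th_law N n)))) (e2 N + 0)"
        by (intro tv_le_conv A3) simp
      then show "tv_le (conv_pmf (cpois a (?h (th_law N))) (cpois b (?h (cav_th_law N n)))) (conv_pmf (cpois (\<alpha> * real N) (?h (th_law N))) (?h (cav_law N n))) (e2 N)"
        using n by (simp add: cav_law_def b_def map_cpois)
    qed
    have B: "tv_le (cpois (c (N + n)) (?h (pt_law \<alpha> (N + n)))) (cpois (c N) (?h (pt_law \<alpha> N))) (e3 N + e4 N)"
    proof (rule tv_le_trans)
      have "tv_le (cpois (c (N + n)) (?h (pt_law \<alpha> (N + n)))) (cpois (c (N + n)) (?h (pt_law \<alpha> N)))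
         (c (N + n) * (\<alpha> * real p * (real (p - 1) * (2 * (real n / real (N + n))))))"
        using elim by (intro tv_le_cpois tv_le_map pt_law_approx N n) auto
      then show "tv_le (cpois (c (N + n)) (?h (pt_law \<alpha> (N + n)))) (cpois (c (N + n)) (?h (pt_law \<alpha> N))) (e3 N)"
        by (simp add: e3_def ac_simps)
      show "tv_le (cpois (c (N + n)) (?h (pt_law \<alpha> N))) (cpois (c N) (?h (pt_law \<alpha> N))) (e4 N)"
        unfolding e4_def using elim by (intro cpois_rate_close) auto
    qed
    have "?h (terms (N + n)) = conv_pmf (cpois (\<alpha> * real (N + n)) (?h (th_law (N + n)))) (cpois (c (N + n)) (?h (pt_law \<alpha> (N + n))))"
      by (simp add: terms_law_def map_conv_pmf map_cpois)
    moreover have "?h (conv_pmf (terms N) (cav_law N n)) =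
      conv_pmf (conv_pmf (cpois (\<alpha> * real N) (?h (th_law N))) (?h (cav_law N n))) (cpois (c N) (?h (pt_law \<alpha> N)))"
      by (simp add: terms_law_def map_conv_pmf map_cpois conv_pmf_ac)
    ultimately show ?case using tv_le_conv[OF A B] by simp
  qed
  then show ?thesis using lim by blast
qed

lemma wf_cav_law: "0 < N \<Longrightarrow> set_pmf (cav_law N n) \<subseteq> {M. \<forall>t\<in>#M. wf_trm (N + n) t}"
proof (cases "n = 0")
  case False
  assume N: "0 < N"
  have "set_pmf (cpois (\<alpha> * real p * real n) (cav_th_law N n)) \<subseteq> {M. \<forall>t\<in>#M. wf_trm (N + n) t}"
    by (rule set_pmf_cpois_subset[OF _ _ wf_cav_th_law[OF N]]) (use False p_ge in auto)
  then show ?thesis using False by (simp add: cav_law_def)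
qed (auto simp: cav_law_def)

lemma wf_terms: "0 < N \<Longrightarrow> M \<in> set_pmf (terms N) \<Longrightarrow> t \<in># M \<Longrightarrow> wf_trm N t"
  using wf_terms_law[of N \<alpha> c] by blast

text \<open>\<open>\<Phi>\<close> may vary with N, since observed sites are placed relative to N.
  Passing to \<open>canon\<close> changes neither expectation, because all terms involved are well
  formed.\<close>

lemma expectation_cavity_approx:
  assumes g: "\<And>N. good (N + n) (\<Phi> N)"
  shows "(\<lambda>N. measure_pmf.expectation (terms (N + n)) (terms_avg (N + n) (\<Phi> N)) -
     measure_pmf.expectation (conv_pmf (terms N) (cav_law N n)) (terms_avg (N + n) (\<Phi> N))) \<longlonglongrightarrow> 0"
proof (cases "n = 0")
  case True
  have "conv_pmf (terms N) (cav_law N n) = terms N" for N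
    using True conv_pmf_return(2)[of "terms N"] by (simp add: cav_law_def)
  then show ?thesis using True by simp
next
  case False
  then obtain e where e: "e \<longlonglongrightarrow> 0" "\<forall>\<^sub>F N in sequentially. tv_le (map_pmf (image_mset canon) (terms (N + n)))
    (map_pmf (image_mset canon) (conv_pmf (terms N) (cav_law N n))) (e N)"
    using cavity_approx[of n] by auto
  show ?thesis
  proof (rule Lim_null_comparison[OF _ e(1)])
    show "\<forall>\<^sub>F N in sequentially. norm (measure_pmf.expectation (terms (N + n)) (terms_avg (N + n) (\<Phi> N)) -
     measure_pmf.expectation (conv_pmf (terms N) (cav_law N n)) (terms_avg (N + n) (\<Phi> N))) \<le> e N"
      using e(2) eventually_gt_at_top[of 0]
    proof eventually_elim
      case (elim N)
      have 1: "set_pmf (terms (N + n)) \<subseteq> {M. \<forall>t\<in>#M. wf_trm (N + n) t}"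
        using elim by (intro wf_terms_law) auto
      have 2: "set_pmf (conv_pmf (terms N) (cav_law N n)) \<subseteq> {M. \<forall>t\<in>#M. wf_trm (N + n) t}"
      proof -
        have "\<forall>M\<in>set_pmf (cav_law N n). \<forall>t\<in>#M. wf_trm (N + n) t"
          using wf_cav_law[OF elim(2), of n] by blast
        moreover have "\<forall>M\<in>set_pmf (terms N). \<forall>t\<in>#M. wf_trm (N + n) t"
          using wf_terms[OF elim(2)] wf_trm_mono[of N _ "N + n"] by auto
        ultimately show ?thesis unfolding set_pmf_conv by auto
      qed
      show ?case
        unfolding expectation_canon[OF g 1, symmetric] expectation_canon[OF g 2, symmetric] real_norm_def
        by (rule tv_leD[OF elim(1)]) (rule abs_terms_avg_le[OF g])
    qed
  qed
qed

text \<open>A single cavity site has Poisson(\<alpha> p) many interactions, all containing site N +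
  1. Summing out its spin turns them together into one perturbation term, whose law is exactly
  \<open>pt_law\<close>; this explains the form of the perturbation in the Hamiltonian.\<close>

lemma expectation_one_cavity:
  assumes g: "good N \<Phi>" and inv: "abs_inv N \<Phi>" and N: "0 < N"
  shows "measure_pmf.expectation (conv_pmf (terms N) (cav_law N 1)) (terms_avg (Suc N) (\<lambda>w. \<Phi> (sum_out N w))) =
    measure_pmf.expectation (conv_pmf (terms N) (pt_law \<alpha> N)) (terms_avg N \<Phi>)"
proof -
  let ?r = "\<lambda>q. replicate_pmf q (replicate_pmf (p - 1) (site_pmf N))"
  have "cav_th_law N 1 = map_pmf (\<lambda>J. {#Th (Suc N # J)#}) (replicate_pmf (p - 1) (site_pmf N))"
    by (simp add: cav_th_law_def cav_list_def pmf_of_set_singleton bind_return_pmf map_pmf_comp)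
  then have cav: "cav_law N 1 = bind_pmf (poisson_pmf (\<alpha> * real p)) (\<lambda>q. map_pmf (\<lambda>Js. mset (map (\<lambda>J. Th (Suc N # J)) Js)) (?r q))"
    by (simp add: cav_law_def cpois_def isum_map_single)
  have pt: "pt_law \<alpha> N = bind_pmf (poisson_pmf (\<alpha> * real p)) (\<lambda>q. map_pmf (\<lambda>Js. {#Pt Js#}) (?r q))"
    by (simp add: pt_law_def map_bind_pmf)
  note b1 = abs_terms_avg_le[OF good_sum_out[OF g]] and b2 = abs_terms_avg_le[OF g]
  have "measure_pmf.expectation (conv_pmf (terms N) (cav_law N 1)) (terms_avg (Suc N) (\<lambda>w. \<Phi> (sum_out N w))) =
    measure_pmf.expectation (terms N) (\<lambda>M. measure_pmf.expectation (poisson_pmf (\<alpha> * real p)) (\<lambda>q. measure_pmf.expectation (?r q)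
      (\<lambda>Js. terms_avg (Suc N) (\<lambda>w. \<Phi> (sum_out N w)) (M + image_mset (\<lambda>J. Th (Suc N # J)) (mset Js)))))"
    unfolding cav using b1 by (simp add: expectation_conv[where B=1] expectation_bind_pmf[where B=1])
  also have "\<dots> = measure_pmf.expectation (terms N) (\<lambda>M. measure_pmf.expectation (poisson_pmf (\<alpha> * real p)) (\<lambda>q. measure_pmf.expectation (?r q)
      (\<lambda>Js. terms_avg N \<Phi> (M + {#Pt Js#}))))"
  proof (intro expectation_cong_pmf terms_avg_cavity[OF g inv])
    fix M q Js J assume "Js \<in> set_pmf (?r q)" "J \<in> set Js"
    then have "J \<in> set_pmf (replicate_pmf (p - 1) (site_pmf N))" by (auto simp: set_replicate_pmf)
    then show "set J \<subseteq> {1..N}" using N by (auto simp: set_replicate_pmf)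
  next
    fix M t assume "M \<in> set_pmf (terms N)" "t \<in># M"
    then show "set_trm t \<subseteq> {1..N}" using wf_terms[OF N] wf_trm_sites by blast
  qed
  also have "\<dots> = measure_pmf.expectation (conv_pmf (terms N) (pt_law \<alpha> N)) (terms_avg N \<Phi>)"
    unfolding pt using b2 by (simp add: expectation_conv[where B=1] expectation_bind_pmf[where B=1])
  finally show ?thesis .
qed

text \<open>One more perturbation term is hard to notice among Poisson(c_N) many; the bound vanishes
  in the limit because c_N tends to infinity.\<close>

lemma tv_terms_pt: "0 < c N \<Longrightarrow> tv_le (conv_pmf (terms N) (pt_law \<alpha> N)) (terms N) (1 / sqrt (c N))"
  unfolding terms_law_def using tv_le_conv[OF tv_le_refl[of 0] cpois_smoothing, of "c N" "cpois (\<alpha> * real N) (th_law N)" "pt_law \<alpha> N"]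
  by (simp add: conv_pmf_ac)

lemma tv_terms_th: "0 < N \<Longrightarrow> tv_le (conv_pmf (terms N) (isum_pmf r (th_law N))) (terms N) (real r / sqrt (\<alpha> * real N))"
  unfolding terms_law_def using tv_le_conv[OF cpois_smoothing_isum[of "\<alpha> * real N" r "th_law N"] tv_le_refl[of 0 "cpois (c N) (pt_law \<alpha> N)"]] \<alpha>_pos
  by (simp add: conv_pmf_ac)

text \<open>For functions bounded by 1 this is, by \<open>disorder_expectation\<close>, the
  expectation of a product of Gibbs averages, that is, a moment of the replicas.\<close>

definition prod_avg :: "nat \<Rightarrow> 'l set \<Rightarrow> ('l \<Rightarrow> (nat \<Rightarrow> real) \<Rightarrow> real) \<Rightarrow> real" where
  "prod_avg N A f = measure_pmf.expectation (terms N) (terms_avg N (\<lambda>w. \<Prod>l\<in>A. gav N w (f l)))"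

text \<open>The last site acts like one extra perturbation term, which is then absorbed by
  smoothing; hence consecutive system sizes have nearly the same moments.\<close>

lemma prod_avg_Suc:
  assumes b: "\<And>l \<sigma> N. l \<in> A \<Longrightarrow> \<sigma> \<in> configs N \<Longrightarrow> m \<le> N \<Longrightarrow> \<bar>f l \<sigma>\<bar> \<le> 1" and loc: "\<And>l. l \<in> A \<Longrightarrow> local_fun m (f l)"
  shows "(\<lambda>N. prod_avg (Suc N) A f - prod_avg N A f) \<longlonglongrightarrow> 0"
proof -
  \<comment> \<open>For N < m nothing bounds the functions on configurations of N sites. Setting
    \<open>\<Phi>\<close> to 0 there keeps it \<open>good\<close> for all N.\<close>
  define \<Phi> where "\<Phi> = (\<lambda>N w. if m \<le> N then \<Prod>l\<in>A. gav N w (f l) else 0)"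
  have g: "good N (\<Phi> N)" for N
    by (cases "m \<le> N") (auto simp: \<Phi>_def good_zero intro!: good_gav_prod b)
  have inv: "abs_inv N (\<Phi> N)" for N
    by (cases "m \<le> N") (auto simp: \<Phi>_def abs_inv_gav_prod, simp add: abs_inv_def)
  have lim1: "(\<lambda>N. measure_pmf.expectation (terms (N + 1)) (terms_avg (N + 1) (\<lambda>w. \<Phi> N (sum_out N w))) -
     measure_pmf.expectation (conv_pmf (terms N) (cav_law N 1)) (terms_avg (N + 1) (\<lambda>w. \<Phi> N (sum_out N w)))) \<longlonglongrightarrow> 0"
    by (rule expectation_cavity_approx) (simp add: good_sum_out g)
  have lim2: "(\<lambda>N. measure_pmf.expectation (conv_pmf (terms N) (pt_law \<alpha> N)) (terms_avg N (\<Phi> N)) - measure_pmf.expectation (terms N) (terms_avg N (\<Phi> N))) \<longlonglongrightarrow> 0"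
  proof (rule Lim_null_comparison)
    show "\<forall>\<^sub>F N in sequentially. norm (measure_pmf.expectation (conv_pmf (terms N) (pt_law \<alpha> N)) (terms_avg N (\<Phi> N)) - measure_pmf.expectation (terms N) (terms_avg N (\<Phi> N)))
      \<le> 1 / sqrt (c N)"
      using c_at_top[THEN filterlim_at_top_dense[THEN iffD1, rule_format], of 0]
      by eventually_elim (auto intro!: tv_leD tv_terms_pt abs_terms_avg_le g)
    show "(\<lambda>N. 1 / sqrt (c N)) \<longlonglongrightarrow> 0"
      by (intro real_tendsto_divide_at_top[OF tendsto_const] filterlim_compose[OF sqrt_at_top c_at_top])
  qed
  have "(\<lambda>N. prod_avg (Suc N) A f - prod_avg N A f) \<longlonglongrightarrow> 0 + 0"
  proof (rule Lim_transform_eventually[OF tendsto_add[OF lim1 lim2]])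
    show "\<forall>\<^sub>F N in sequentially. measure_pmf.expectation (terms (N + 1)) (terms_avg (N + 1) (\<lambda>w. \<Phi> N (sum_out N w))) -
     measure_pmf.expectation (conv_pmf (terms N) (cav_law N 1)) (terms_avg (N + 1) (\<lambda>w. \<Phi> N (sum_out N w))) +
     (measure_pmf.expectation (conv_pmf (terms N) (pt_law \<alpha> N)) (terms_avg N (\<Phi> N)) - measure_pmf.expectation (terms N) (terms_avg N (\<Phi> N))) =
     prod_avg (Suc N) A f - prod_avg N A f"
      using eventually_ge_at_top[of m] eventually_gt_at_top[of 0]
    proof eventually_elim
      case (elim N)
      have "\<Phi> N = (\<lambda>w. \<Prod>l\<in>A. gav N w (f l))" using elim by (simp add: \<Phi>_def)
      moreover have "(\<lambda>w. \<Prod>l\<in>A. gav N (sum_out N w) (f l)) = (\<lambda>w. \<Prod>l\<in>A. gav (Suc N) w (f l))"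
        using elim by (intro ext prod.cong refl gav_sum_out[symmetric, OF loc]) auto
      ultimately show ?case
        using expectation_one_cavity[OF g[of N] inv[of N] elim(2)] by (simp add: prod_avg_def)
    qed
  qed
  then show ?thesis by simp
qed

lemma prod_avg_add:
  assumes b: "\<And>l \<sigma> N. l \<in> A \<Longrightarrow> \<sigma> \<in> configs N \<Longrightarrow> m \<le> N \<Longrightarrow> \<bar>f l \<sigma>\<bar> \<le> 1" and loc: "\<And>l. l \<in> A \<Longrightarrow> local_fun m (f l)"
  shows "(\<lambda>N. prod_avg (N + n) A f - prod_avg N A f) \<longlonglongrightarrow> 0"
proof (induction n)
  case (Suc n)
  have "(\<lambda>N. (prod_avg (Suc (N + n)) A f - prod_avg (N + n) A f) + (prod_avg (N + n) A f - prod_avg N A f)) \<longlonglongrightarrow> 0 + 0"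
    by (intro tendsto_add Suc LIMSEQ_ignore_initial_segment[OF prod_avg_Suc[OF b loc]])
  then show ?case by simp
qed simp

lemma prod_avg_perm:
  assumes b: "\<And>l \<sigma>. l \<in> A \<Longrightarrow> \<sigma> \<in> configs N \<Longrightarrow> \<bar>f l \<sigma>\<bar> \<le> 1" and \<pi>: "\<pi> permutes {1..N}" and N: "0 < N"
  shows "prod_avg N A (\<lambda>l \<sigma>. f l (\<lambda>i. \<sigma> (\<pi> i))) = prod_avg N A f"
proof -
  have g: "good N (\<lambda>w. \<Prod>l\<in>A. gav N w (\<lambda>\<sigma>. f l (\<lambda>i. \<sigma> (\<pi> i))))"
    by (rule good_gav_prod, rule b, assumption, rule perm_configs[OF \<pi>])
  show ?thesis
  proof -
    have "(\<lambda>w. \<Prod>l\<in>A. gav N (perm_weight N \<pi> w) (\<lambda>\<sigma>. f l (\<lambda>i. \<sigma> (\<pi> i)))) = (\<lambda>w. \<Prod>l\<in>A. gav N w (f l))"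
      by (simp only: gav_perm[OF \<pi>, where f="f _"])
    then show ?thesis
      unfolding prod_avg_def using expectation_perm[OF g \<pi> N, of \<alpha> c] by (simp only:)
  qed
qed

end

section \<open>Random sites may be replaced by fixed distinct sites\<close>

text \<open>Both lists are completed to enumerations of \<open>S\<close>; matching equal positions
  gives the permutation.\<close>

lemma ex_permutes_map:
  assumes S: "finite S" and xs: "distinct xs" "set xs \<subseteq> S" and ys: "distinct ys" "set ys \<subseteq> S"
    and len: "length xs = length ys"
  shows "\<exists>\<pi>. \<pi> permutes S \<and> map \<pi> xs = ys"
proof -
  obtain xs' ys' where xs': "set xs' = S - set xs" "distinct xs'" and ys': "set ys' = S - set ys" "distinct ys'"
    using finite_distinct_list[of "S - set xs"] finite_distinct_list[of "S - set ys"] S by auto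
  let ?X = "xs @ xs'" and ?Y = "ys @ ys'"
  have X: "distinct ?X" "set ?X = S" and Y: "distinct ?Y" "set ?Y = S"
    using xs xs' ys ys' by auto
  have lenXY: "length ?X = length ?Y"
    using X Y by (metis distinct_card)
  have bX: "bij_betw (nth ?X) {..<length ?X} S" and bY: "bij_betw (nth ?Y) {..<length ?X} S"
    using bij_betw_nth[OF X(1) refl X(2)[symmetric]] bij_betw_nth[OF Y(1) refl Y(2)[symmetric]] lenXY by auto
  let ?inv = "the_inv_into {..<length ?X} (nth ?X)"
  define \<pi> where "\<pi> = (\<lambda>x. if x \<in> S then ?Y ! (?inv x) else x)"
  have "bij_betw (nth ?Y \<circ> ?inv) S S"
    by (rule bij_betw_trans[OF bij_betw_the_inv_into[OF bX] bY])
  then have "bij_betw \<pi> S S"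
    by (subst bij_betw_cong[of S \<pi> "nth ?Y \<circ> ?inv"]) (auto simp: \<pi>_def)
  then have 1: "\<pi> permutes S" by (rule bij_imp_permutes) (simp add: \<pi>_def)
  have "\<pi> (xs ! i) = ys ! i" if i: "i < length xs" for i
  proof -
    have "xs ! i = ?X ! i" "ys ! i = ?Y ! i" using i len by (auto simp: nth_append)
    moreover have "?inv (?X ! i) = i"
      using i bX by (intro the_inv_into_f_f) (auto simp: bij_betw_def)
    moreover have "xs ! i \<in> S" using i xs by auto
    ultimately show ?thesis by (simp add: \<pi>_def)
  qed
  then have "map \<pi> xs = ys" using len by (intro nth_equalityI) auto
  with 1 show ?thesis by blast
qed

text \<open>A union bound: a newly drawn site hits one of at most K + card A forbidden sites with
  probability at most (K + card A) / N, and the induction adds these up.\<close>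

lemma prob_not_distinct:
  fixes A :: "nat set"
  assumes N: "0 < N" and A: "finite A"
  shows "measure_pmf.expectation (replicate_pmf K (site_pmf N)) (\<lambda>xs. if distinct xs \<and> set xs \<inter> A = {} then 0 else 1)
    \<le> real (K * (K + card A)) / real N"
proof (induction K)
  case (Suc K)
  let ?bad = "\<lambda>xs. if distinct xs \<and> set xs \<inter> A = {} then 0 else 1 :: real"
  let ?R = "replicate_pmf K (site_pmf N)"
  have b: "\<bar>?bad xs\<bar> \<le> 1" for xs by simp
  \<comment> \<open>The order of the draws is changed so that the head is drawn last and can be
    tested against the list already fixed.\<close>
  have "replicate_pmf (Suc K) (site_pmf N) = bind_pmf ?R (\<lambda>xs. bind_pmf (site_pmf N) (\<lambda>x. return_pmf (x # xs)))"
    by (simp only: replicate_pmf.simps) (rule bind_commute_pmf)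
  then have "measure_pmf.expectation (replicate_pmf (Suc K) (site_pmf N)) ?bad =
    measure_pmf.expectation ?R (\<lambda>xs. measure_pmf.expectation (site_pmf N) (\<lambda>x. ?bad (x # xs)))"
    using b by (simp only: expectation_bind_pmf[where B=1] integral_return)
      (simp add: integral_return del: distinct.simps)
  also have "\<dots> \<le> measure_pmf.expectation ?R (\<lambda>xs. ?bad xs + real (K + card A) / real N)"
  proof (rule integral_mono_AE)
    show "integrable (measure_pmf ?R) (\<lambda>xs. measure_pmf.expectation (site_pmf N) (\<lambda>x. ?bad (x # xs)))"
      by (rule integrable_pmf_bounded[where B=1], rule abs_expectation_le) simp
    show "integrable (measure_pmf ?R) (\<lambda>xs. ?bad xs + real (K + card A) / real N)"
      by (rule Bochner_Integration.integrable_add) (auto intro!: integrable_pmf_bounded[where B=1])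
    show "AE xs in measure_pmf ?R. measure_pmf.expectation (site_pmf N) (\<lambda>x. ?bad (x # xs)) \<le> ?bad xs + real (K + card A) / real N"
    proof (rule AE_pmfI)
      fix xs assume "xs \<in> set_pmf ?R"
      then have len: "length xs = K" by (simp add: set_replicate_pmf)
      let ?B = "A \<union> set xs"
      have "measure_pmf.expectation (site_pmf N) (\<lambda>x. ?bad (x # xs)) \<le> measure_pmf.expectation (site_pmf N) (\<lambda>x. ?bad xs + indicator ?B x)"
        by (intro integral_mono integrable_pmf_bounded[where B=2]) (auto simp: indicator_def)
      also have "\<dots> = ?bad xs + measure_pmf.expectation (site_pmf N) (indicator ?B)"
        by (subst Bochner_Integration.integral_add) (auto intro!: integrable_pmf_bounded[where B=1] simp: indicator_def)
      also have "measure_pmf.expectation (site_pmf N) (indicator ?B) = (\<Sum>x\<in>{1..N}. indicator ?B x) / real N"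
        using N by (subst integral_pmf_of_set) auto
      also have "(\<Sum>x\<in>{1..N}. indicator B x) = real (card ({1..N} \<inter> B))" for B
      proof -
        have "(\<Sum>x\<in>{1..N}. indicator B x :: real) = (\<Sum>x\<in>{1..N} \<inter> B. 1)"
          by (simp add: indicator_def of_bool_def sum.inter_restrict[symmetric])
        then show ?thesis by simp
      qed
      also have "card ({1..N} \<inter> ?B) \<le> K + card A"
      proof -
        have "card ({1..N} \<inter> ?B) \<le> card ?B" using A by (intro card_mono) auto
        also have "\<dots> \<le> card A + card (set xs)" by (rule card_Un_le)
        also have "card (set xs) \<le> K" using len card_length by blast
        finally show ?thesis by simp
      qed
      then have "real (card ({1..N} \<inter> ?B)) / real N \<le> real (K + card A) / real N"
        by (intro divide_right_mono) simp_all
      finally show "measure_pmf.expectation (site_pmf N) (\<lambda>x. ?bad (x # xs)) \<le> ?bad xs + real (K + card A) / real N"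
        by simp
    qed
  qed
  also have "\<dots> = measure_pmf.expectation ?R ?bad + real (K + card A) / real N"
    by (subst Bochner_Integration.integral_add) (auto intro!: integrable_pmf_bounded[where B=1])
  also have "\<dots> \<le> real (K * (K + card A)) / real N + real (K + card A) / real N"
    using Suc by simp
  also have "\<dots> = real (Suc K * (K + card A)) / real N"
    by (simp add: add_divide_distrib[symmetric])
  also have "\<dots> \<le> real (Suc K * (Suc K + card A)) / real N"
    by (intro divide_right_mono) (simp_all only: of_nat_le_iff of_nat_0_le_iff mult_le_mono2 add_le_mono le_SucI order_refl)
  finally show ?case .
qed simp

text \<open>
  A slot \<open>(K, J)\<close> stands for a term \<open>Th (K @ J')\<close> with prescribed sites \<open>K\<close> and random sites
  \<open>J'\<close>; the list \<open>J\<close> is the deterministic replacement for \<open>J'\<close>.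
\<close>
type_synonym slot = "nat list \<times> nat list"

primrec slots_law :: "nat \<Rightarrow> slot list \<Rightarrow> nat trm multiset pmf" where
  "slots_law N [] = return_pmf {#}"
| "slots_law N (e # es) = conv_pmf (map_pmf (\<lambda>J. {#Th (fst e @ J)#}) (replicate_pmf (length (snd e)) (site_pmf N))) (slots_law N es)"

definition slots_fixed :: "slot list \<Rightarrow> nat trm multiset" where
  "slots_fixed es = mset (map (\<lambda>(K, J). Th (K @ J)) es)"

text \<open>One long i.i.d. list of sites serves all slots, so that collisions and permutations can
  be treated for all random sites at once.\<close>

primrec slots_fill :: "slot list \<Rightarrow> nat list \<Rightarrow> nat trm multiset" where
  "slots_fill [] xs = {#}"
| "slots_fill (e # es) xs = add_mset (Th (fst e @ take (length (snd e)) xs)) (slots_fill es (drop (length (snd e)) xs))"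

lemma slots_law_append: "slots_law N (es @ es') = conv_pmf (slots_law N es) (slots_law N es')"
  using conv_pmf_return(1)[of "slots_law N es'"] by (induction es) (auto simp: conv_pmf_assoc)

lemma slots_law_fill:
  "slots_law N es = map_pmf (slots_fill es) (replicate_pmf (length (concat (map snd es))) (site_pmf N))"
proof (induction es)
  case (Cons e es)
  let ?a = "length (snd e)" and ?b = "length (concat (map snd es))"
  have "slots_law N (e # es) = bind_pmf (replicate_pmf ?a (site_pmf N)) (\<lambda>xs. bind_pmf (replicate_pmf ?b (site_pmf N))
     (\<lambda>ys. return_pmf (add_mset (Th (fst e @ xs)) (slots_fill es ys))))"
    unfolding slots_law.simps Cons.IH by (simp add: conv_pmf_def bind_map_pmf)
  also have "\<dots> = bind_pmf (replicate_pmf ?a (site_pmf N)) (\<lambda>xs. bind_pmf (replicate_pmf ?b (site_pmf N))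
     (\<lambda>ys. return_pmf (slots_fill (e # es) (xs @ ys))))"
    by (intro bind_pmf_cong refl) (auto simp: set_replicate_pmf)
  also have "\<dots> = map_pmf (slots_fill (e # es)) (replicate_pmf (?a + ?b) (site_pmf N))"
    by (simp only: replicate_pmf_distrib map_bind_pmf map_return_pmf)
  finally show ?case by (simp only: list.map concat.simps length_append)
qed simp

lemma slots_fill_fixed: "slots_fill es (concat (map snd es)) = slots_fixed es"
  by (induction es) (auto simp: slots_fixed_def case_prod_beta)

lemma slots_fill_map:
  assumes "\<And>e i. e \<in> set es \<Longrightarrow> i \<in> set (fst e) \<Longrightarrow> \<pi> i = i"
  shows "slots_fill es (map \<pi> xs) = image_mset (map_trm \<pi>) (slots_fill es xs)"
  using assms
proof (induction es arbitrary: xs)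
  case (Cons e es)
  have "map \<pi> (fst e) = fst e" by (intro map_idI Cons.prems[of e]) auto
  moreover have "slots_fill es (map \<pi> xs) = image_mset (map_trm \<pi>) (slots_fill es xs)" for xs
    by (rule Cons.IH) (rule Cons.prems, auto)
  ultimately show ?case by (simp add: take_map drop_map)
qed simp

text \<open>If the drawn sites are distinct and avoid \<open>A\<close>, a permutation fixing
  \<open>A\<close> carries the sites in \<open>es\<close> to the drawn ones, and \<open>G\<close>
  does not notice. Otherwise the difference is at most 2, which is the factor in the bound. The
  sites in the first components lie above N, so the permutation leaves them alone.\<close>

lemma slots_replace:
  fixes G :: "nat trm multiset \<Rightarrow> real"
  assumes N: "0 < N" and G: "\<And>M. \<bar>G M\<bar> \<le> 1" and A: "finite A"
    and inv: "\<And>\<pi> M. \<pi> permutes ({1..N} - A) \<Longrightarrow> G (image_mset (map_trm \<pi>) M) = G M"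
    and pre: "\<And>e i. e \<in> set es \<Longrightarrow> i \<in> set (fst e) \<Longrightarrow> N < i"
    and dist: "distinct (concat (map snd es))" "set (concat (map snd es)) \<subseteq> {1..N} - A"
  defines "K \<equiv> length (concat (map snd es))"
  shows "\<bar>measure_pmf.expectation (slots_law N es) G - G (slots_fixed es)\<bar> \<le> 2 * (real (K * (K + card A)) / real N)"
proof -
  let ?R = "replicate_pmf K (site_pmf N)"
  let ?js = "concat (map snd es)"
  let ?bad = "\<lambda>xs. if distinct xs \<and> set xs \<inter> A = {} then 0 else 1 :: real"
  have "measure_pmf.expectation (slots_law N es) G = measure_pmf.expectation ?R (\<lambda>xs. G (slots_fill es xs))"
    by (simp add: slots_law_fill K_def)
  then have "\<bar>measure_pmf.expectation (slots_law N es) G - G (slots_fixed es)\<bar> =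
    \<bar>measure_pmf.expectation ?R (\<lambda>xs. G (slots_fill es xs) - G (slots_fixed es))\<bar>"
    using G by (subst Bochner_Integration.integral_diff) (auto intro!: integrable_pmf_bounded[where B=1])
  also have "\<dots> \<le> measure_pmf.expectation ?R (\<lambda>xs. \<bar>G (slots_fill es xs) - G (slots_fixed es)\<bar>)"
    by (rule integral_abs_bound)
  also have b2: "\<bar>G M - G M'\<bar> \<le> 2" for M M' using G[of M] G[of M'] by linarith
  have "measure_pmf.expectation ?R (\<lambda>xs. \<bar>G (slots_fill es xs) - G (slots_fixed es)\<bar>) \<le> measure_pmf.expectation ?R (\<lambda>xs. 2 * ?bad xs)"
  proof (rule integral_mono_AE)
    show "integrable (measure_pmf ?R) (\<lambda>xs. \<bar>G (slots_fill es xs) - G (slots_fixed es)\<bar>)"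
      using b2 by (intro integrable_pmf_bounded[where B=2]) auto
    show "integrable (measure_pmf ?R) (\<lambda>xs. 2 * ?bad xs)" by (rule integrable_pmf_bounded[where B=2]) auto
    show "AE xs in measure_pmf ?R. \<bar>G (slots_fill es xs) - G (slots_fixed es)\<bar> \<le> 2 * ?bad xs"
    proof (rule AE_pmfI)
      fix xs assume xs: "xs \<in> set_pmf ?R"
      then have len: "length xs = length ?js" "set xs \<subseteq> {1..N}"
        using N by (auto simp: set_replicate_pmf K_def)
      show "\<bar>G (slots_fill es xs) - G (slots_fixed es)\<bar> \<le> 2 * ?bad xs"
      proof (cases "distinct xs \<and> set xs \<inter> A = {}")
        case True
        then have "distinct xs" "set xs \<subseteq> {1..N} - A" using len by auto
        from ex_permutes_map[OF _ dist this len(1)[symmetric]]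
        obtain \<pi> where \<pi>: "\<pi> permutes ({1..N} - A)" "map \<pi> ?js = xs"
          by auto
        have fixed: "\<pi> i = i" if "e \<in> set es" "i \<in> set (fst e)" for e i
          using pre[OF that] by (intro permutes_not_in[OF \<pi>(1)]) auto
        have "slots_fill es xs = image_mset (map_trm \<pi>) (slots_fixed es)"
          using slots_fill_map[of es \<pi> ?js, OF fixed] \<pi>(2) slots_fill_fixed[of es] by simp
        then show ?thesis using inv[OF \<pi>(1)] by simp
      qed (use b2 in auto)
    qed
  qed
  also have "\<dots> = 2 * measure_pmf.expectation ?R ?bad" by simp
  also have "\<dots> \<le> 2 * (real (K * (K + card A)) / real N)"
    using prob_not_distinct[OF N A, of K] by simp
  finally show ?thesis using \<open>\<bar>measure_pmf.expectation (slots_law N es) G - G (slots_fixed es)\<bar> = _\<close>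
    \<open>\<bar>measure_pmf.expectation ?R (\<lambda>xs. G (slots_fill es xs) - G (slots_fixed es))\<bar> \<le> _\<close> by linarith
qed

lemma isum_slots:
  assumes "\<And>e. e \<in> set es \<Longrightarrow> fst e = K \<and> length (snd e) = k"
  shows "isum_pmf (length es) (map_pmf (\<lambda>J. {#Th (K @ J)#}) (replicate_pmf k (site_pmf N))) = slots_law N es"
  using assms by (induction es) auto

text \<open>An injective coding of multi-indices by positive sites, odd for the family without hat
  and even for the family with hat. Disjoint rows of one array then play the parts of v and
  v-hat.\<close>

definition site_code :: "nat list \<Rightarrow> nat" where "site_code I = 2 * to_nat I + 1"
definition site_code_hat :: "nat list \<Rightarrow> nat" where "site_code_hat I = 2 * to_nat I + 2"

lemma inj_site_code: "inj site_code" and inj_site_code_hat: "inj site_code_hat"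
  by (auto simp: inj_on_def site_code_def site_code_hat_def)

lemma site_code_neq: "site_code I \<noteq> site_code_hat J"
  unfolding site_code_def site_code_hat_def by presburger

text \<open>The slots mirror the sums A_i: the k-th interaction of the cavity site N + i uses the
  codes of [j, i, k] with 1 \<le> j < p.\<close>

definition cav_slots :: "nat \<Rightarrow> nat \<Rightarrow> nat \<Rightarrow> (nat \<Rightarrow> nat) \<Rightarrow> slot list" where
  "cav_slots p N n P = concat (map (\<lambda>i. map (\<lambda>k. ([N + i], map (\<lambda>j. site_code [j, i, k]) [1..<p])) [1..<Suc (P i)]) [1..<Suc n])"

definition hat_slots :: "nat \<Rightarrow> nat \<Rightarrow> slot list" where
  "hat_slots p r = map (\<lambda>k. ([], map (\<lambda>j. site_code_hat [j, k]) [1..<Suc p])) [1..<Suc r]"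

lemma distinct_concat_map:
  assumes "distinct xs" "\<And>x. x \<in> set xs \<Longrightarrow> distinct (f x)"
    "\<And>x y. x \<in> set xs \<Longrightarrow> y \<in> set xs \<Longrightarrow> x \<noteq> y \<Longrightarrow> set (f x) \<inter> set (f y) = {}"
  shows "distinct (concat (map f xs))"
  using assms
proof (induction xs)
  case (Cons a xs)
  have "set (f a) \<inter> set (f x) = {}" if "x \<in> set xs" for x
    using Cons.prems(1) that by (intro Cons.prems(3)) auto
  then show ?case using Cons by auto
qed simp

lemma slots_sites:
  "distinct (concat (map snd (cav_slots p N n P @ hat_slots p r)))"
  "set (concat (map snd (cav_slots p N n P @ hat_slots p r))) \<subseteq>
    site_code ` {[j, i, k] |j i k. j < p \<and> i \<le> n \<and> k \<le> P i} \<union> site_code_hat ` {[j, k] |j k. j \<le> p \<and> k \<le> r}"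
proof -
  have 1: "concat (map snd (cav_slots p N n P)) = concat (map (\<lambda>i. concat (map (\<lambda>k. map (\<lambda>j. site_code [j, i, k]) [1..<p]) [1..<Suc (P i)])) [1..<Suc n])"
  proof -
    have "concat (map snd (concat xss)) = concat (map (\<lambda>xs. concat (map snd xs)) xss)" for xss :: "slot list list"
      by (induction xss) auto
    then show ?thesis by (simp add: cav_slots_def comp_def del: upt_Suc)
  qed
  have 2: "concat (map snd (hat_slots p r)) = concat (map (\<lambda>k. map (\<lambda>j. site_code_hat [j, k]) [1..<Suc p]) [1..<Suc r])"
    by (simp add: hat_slots_def comp_def del: upt_Suc)
  have i1: "site_code [j, i, k] = site_code [j', i', k'] \<longleftrightarrow> j = j' \<and> i = i' \<and> k = k'" for i j k i' j' k'
    using inj_site_code by (auto dest: injD)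
  have i2: "site_code_hat [j, k] = site_code_hat [j', k'] \<longleftrightarrow> j = j' \<and> k = k'" for j k j' k'
    using inj_site_code_hat by (auto dest: injD)
  have d1: "distinct (concat (map snd (cav_slots p N n P)))" unfolding 1
  proof (intro distinct_concat_map)
    fix i k assume "k \<in> set [1..<Suc (P i)]"
    show "distinct (map (\<lambda>j. site_code [j, i, k]) [1..<p])" by (simp add: distinct_map inj_on_def i1)
  next
    fix i k k' assume "k \<noteq> (k' :: nat)"
    then show "set (map (\<lambda>j. site_code [j, i, k]) [1..<p]) \<inter> set (map (\<lambda>j. site_code [j, i, k']) [1..<p]) = {}" by (auto simp: i1)
  next
    fix i i' assume "i \<noteq> (i' :: nat)"
    then show "set (concat (map (\<lambda>k. map (\<lambda>j. site_code [j, i, k]) [1..<p]) [1..<Suc (P i)])) \<inter>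
      set (concat (map (\<lambda>k. map (\<lambda>j. site_code [j, i', k]) [1..<p]) [1..<Suc (P i')])) = {}"
      by (auto simp: i1 simp del: upt_Suc)
  qed (rule distinct_upt)+
  have d2: "distinct (concat (map snd (hat_slots p r)))" unfolding 2
  proof (intro distinct_concat_map)
    fix k
    show "distinct (map (\<lambda>j. site_code_hat [j, k]) [1..<Suc p])" by (simp add: distinct_map inj_on_def i2 del: upt_Suc)
  next
    fix k k' assume "k \<noteq> (k' :: nat)"
    then show "set (map (\<lambda>j. site_code_hat [j, k]) [1..<Suc p]) \<inter> set (map (\<lambda>j. site_code_hat [j, k']) [1..<Suc p]) = {}"
      by (auto simp: i2 simp del: upt_Suc)
  qed (rule distinct_upt)
  have s1: "set (concat (map snd (cav_slots p N n P))) \<subseteq> site_code ` {[j, i, k] |j i k. j < p \<and> i \<le> n \<and> k \<le> P i}"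
  proof
    fix x assume "x \<in> set (concat (map snd (cav_slots p N n P)))"
    then obtain i k j where "i \<in> {1..<Suc n}" "k \<in> {1..<Suc (P i)}" "j \<in> {1..<p}" "x = site_code [j, i, k]"
      unfolding 1 by (auto simp del: upt_Suc)
    then show "x \<in> site_code ` {[j, i, k] |j i k. j < p \<and> i \<le> n \<and> k \<le> P i}" by fastforce
  qed
  have s2: "set (concat (map snd (hat_slots p r))) \<subseteq> site_code_hat ` {[j, k] |j k. j \<le> p \<and> k \<le> r}"
  proof
    fix x assume "x \<in> set (concat (map snd (hat_slots p r)))"
    then obtain k j where "k \<in> {1..<Suc r}" "j \<in> {1..<Suc p}" "x = site_code_hat [j, k]"
      unfolding 2 by (auto simp del: upt_Suc)
    then show "x \<in> site_code_hat ` {[j, k] |j k. j \<le> p \<and> k \<le> r}" by fastforce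
  qed
  show "set (concat (map snd (cav_slots p N n P @ hat_slots p r))) \<subseteq>
    site_code ` {[j, i, k] |j i k. j < p \<and> i \<le> n \<and> k \<le> P i} \<union> site_code_hat ` {[j, k] |j k. j \<le> p \<and> k \<le> r}"
    unfolding map_append concat_append set_append using s1 s2 by (rule Un_mono)
  have "set (concat (map snd (cav_slots p N n P))) \<inter> set (concat (map snd (hat_slots p r))) = {}"
  proof -
    have "set (concat (map snd (cav_slots p N n P))) \<subseteq> range site_code" using s1 by blast
    moreover have "set (concat (map snd (hat_slots p r))) \<subseteq> range site_code_hat" using s2 by blast
    moreover have "range site_code \<inter> range site_code_hat = {}" using site_code_neq by auto
    ultimately show ?thesis by blast
  qed
  with d1 d2 show "distinct (concat (map snd (cav_slots p N n P @ hat_slots p r)))"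
    by simp
qed

context cavity_model
begin

definition one_cav :: "nat \<Rightarrow> nat \<Rightarrow> nat trm multiset pmf" where
  "one_cav N i = map_pmf (\<lambda>J. {#Th ([i] @ J)#}) (replicate_pmf (p - 1) (site_pmf N))"

text \<open>A uniform choice among n + 1 cavity sites is a mixture of a uniform choice among the
  first n and of the last site, with weights n / (n + 1) and 1 / (n + 1). Poisson splitting detaches
  the interactions of the last site as an independent sum of rate \<alpha> p.\<close>

lemma cav_law_Suc: "cav_law N (Suc n) = conv_pmf (cav_law N n) (cpois (\<alpha> * real p) (one_cav N (N + Suc n)))"
proof -
  have cav: "cav_th_law N k = bind_pmf (cav_pmf N k) (one_cav N)" for k
    by (simp add: cav_th_law_def cav_list_def one_cav_def[abs_def] map_bind_pmf map_pmf_comp)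
  show ?thesis
  proof (cases "n = 0")
    case True
    then show ?thesis
      using conv_pmf_return(1)[of "cpois (\<alpha> * real p) (one_cav N (Suc N))"]
      by (simp add: cav_law_def cav pmf_of_set_singleton bind_return_pmf)
  next
    case False
    define a b where "a = \<alpha> * real p * real n" and "b = \<alpha> * real p"
    have ab: "0 < a" "0 < b" using False \<alpha>_pos p_ge by (auto simp: a_def b_def)
    have q: "a / (a + b) = real n / real (Suc n)"
    proof -
      have "a / (a + b) = (b * real n) / (b * real (Suc n))" by (simp add: a_def b_def algebra_simps)
      then show ?thesis using ab by simp
    qed
    have "cav_pmf N (Suc n) = mix_pmf (real n / real (Suc n)) (cav_pmf N n) (return_pmf (N + Suc n))"
    proof (rule pmf_eqI)
      fix x
      have "pmf (mix_pmf (real n / real (Suc n)) (cav_pmf N n) (return_pmf (N + Suc n))) x =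
        real n / real (Suc n) * pmf (cav_pmf N n) x + (1 - real n / real (Suc n)) * pmf (return_pmf (N + Suc n)) x"
        unfolding mix_pmf_def pmf_bind by (subst integral_bernoulli_pmf) (auto simp: field_simps)
      also have "1 - real n / real (Suc n) = 1 / real (Suc n)" by (simp add: field_simps)
      also have "real n / real (Suc n) * pmf (cav_pmf N n) x + 1 / real (Suc n) * pmf (return_pmf (N + Suc n)) x = pmf (cav_pmf N (Suc n)) x"
        using False by (auto simp: indicator_def pmf_of_set)
      finally show "pmf (cav_pmf N (Suc n)) x = pmf (mix_pmf (real n / real (Suc n)) (cav_pmf N n) (return_pmf (N + Suc n))) x" ..
    qed
    then have "cav_th_law N (Suc n) = mix_pmf (a / (a + b)) (cav_th_law N n) (one_cav N (N + Suc n))"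
      unfolding cav q mix_pmf_def by (simp add: bind_assoc_pmf) (intro bind_pmf_cong refl, simp add: bind_return_pmf)
    moreover have "\<alpha> * real p * real (Suc n) = a + b" by (simp add: a_def b_def algebra_simps)
    ultimately show ?thesis using False cpois_mix[OF ab] by (simp add: cav_law_def a_def b_def)
  qed
qed

lemma cav_slots_Suc:
  "cav_slots p N (Suc n) P = cav_slots p N n P @ map (\<lambda>k. ([N + Suc n], map (\<lambda>j. site_code [j, Suc n, k]) [1..<p])) [1..<Suc (P (Suc n))]"
  unfolding cav_slots_def by (subst upt_Suc_append) (auto simp del: upt_Suc)

lemma cav_slots_cong: "(\<And>i. i \<in> {1..n} \<Longrightarrow> P i = P' i) \<Longrightarrow> cav_slots p N n P = cav_slots p N n P'"
  unfolding cav_slots_def by (intro arg_cong[where f=concat] map_cong) (auto simp del: upt_Suc)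

text \<open>Only P 1, ..., P n matter, and a list of n natural numbers takes countably many
  values.\<close>

lemma measurable_cav_slots:
  "(\<lambda>P. h (cav_slots p N n P) :: real) \<in> borel_measurable (PiM UNIV (\<lambda>_. measure_pmf u))"
proof -
  have "(\<lambda>P. h (cav_slots p N n P)) = (\<lambda>P. (\<lambda>xs. h (cav_slots p N n (\<lambda>i. xs ! (i - 1)))) (map P [1..<Suc n]))"
  proof
    fix P :: "nat \<Rightarrow> nat"
    have "cav_slots p N n P = cav_slots p N n (\<lambda>i. map P [1..<Suc n] ! (i - 1))"
      by (rule cav_slots_cong) (auto simp: nth_map simp del: upt_Suc)
    then show "h (cav_slots p N n P) = (\<lambda>xs. h (cav_slots p N n (\<lambda>i. xs ! (i - 1)))) (map P [1..<Suc n])" by simp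
  qed
  also have "\<dots> \<in> borel_measurable (PiM UNIV (\<lambda>_. measure_pmf u))"
    by (rule measurable_compose[OF measurable_map_list]) (auto intro: measurable_PiM_pmf_component)
  finally show ?thesis .
qed

text \<open>The numbers of interactions of the cavity sites become coordinates of one infinite
  i.i.d. Poisson family, as in the outer randomness of the theorem. The induction resamples
  coordinate n + 1.\<close>

lemma expectation_cav_law:
  fixes F :: "nat trm multiset \<Rightarrow> real"
  assumes F: "\<And>M. \<bar>F M\<bar> \<le> 1"
  shows "measure_pmf.expectation (cav_law N n) F =
    (\<integral>P. measure_pmf.expectation (slots_law N (cav_slots p N n P)) F \<partial>PiM UNIV (\<lambda>_. measure_pmf (poisson_pmf (\<alpha> * real p))))"
  using F
proof (induction n arbitrary: F)
  case 0
  interpret prob_space "PiM UNIV (\<lambda>_::nat. measure_pmf (poisson_pmf (\<alpha> * real p)))" by (intro prob_space_PiM prob_space_measure_pmf)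
  show ?case by (simp add: cav_law_def cav_slots_def prob_space)
next
  case (Suc n)
  let ?u = "poisson_pmf (\<alpha> * real p)"
  let ?P = "PiM (UNIV::nat set) (\<lambda>_. measure_pmf ?u)"
  let ?E = measure_pmf.expectation
  note F = Suc.prems
  have sl: "slots_law N (cav_slots p N (Suc n) P) = conv_pmf (slots_law N (cav_slots p N n P)) (isum_pmf (P (Suc n)) (one_cav N (N + Suc n)))" for P
  proof -
    let ?es = "map (\<lambda>k. ([N + Suc n], map (\<lambda>j. site_code [j, Suc n, k]) [1..<p])) [1..<Suc (P (Suc n))]"
    have "isum_pmf (length ?es) (one_cav N (N + Suc n)) = slots_law N ?es"
      unfolding one_cav_def by (rule isum_slots) (auto simp del: upt_Suc)
    then show ?thesis by (simp add: cav_slots_Suc slots_law_append del: upt_Suc)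
  qed
  let ?g = "\<lambda>es x. ?E (conv_pmf (slots_law N es) (isum_pmf x (one_cav N (N + Suc n)))) F"
  have gb: "\<bar>?g es x\<bar> \<le> 1" for es x by (rule abs_expectation_le) (rule F)
  have m: "(\<lambda>P. ?g (cav_slots p N n P) (P (Suc n))) \<in> borel_measurable ?P"
    by (rule measurable_compose_countable[where g="\<lambda>P. P (Suc n)" and f="\<lambda>x P. ?g (cav_slots p N n P) x"])
      (auto intro: measurable_cav_slots measurable_PiM_pmf_component)
  have "(\<integral>P. ?E (slots_law N (cav_slots p N (Suc n) P)) F \<partial>?P) = (\<integral>P. ?g (cav_slots p N n P) (P (Suc n)) \<partial>?P)"
    unfolding sl ..
  also have "\<dots> = (\<integral>P'. \<integral>P. ?g (cav_slots p N n (\<lambda>i\<in>UNIV. if i \<in> {Suc n} then P' i else P i)) ((\<lambda>i\<in>UNIV. if i \<in> {Suc n} then P' i else P i) (Suc n)) \<partial>?P \<partial>?P)"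
    by (rule integral_PiM_merge[where c=1, OF _ m]) (rule prob_space_measure_pmf gb)+
  also have "\<dots> = (\<integral>P'. \<integral>P. ?g (cav_slots p N n P) (P' (Suc n)) \<partial>?P \<partial>?P)"
  proof -
    have "cav_slots p N n (\<lambda>i\<in>UNIV. if i \<in> {Suc n} then P' i else P i) = cav_slots p N n P" for P P' :: "nat \<Rightarrow> nat"
      by (rule cav_slots_cong) auto
    then show ?thesis by (simp only: restrict_apply UNIV_I if_True singletonI)
  qed
  also have "\<dots> = (\<integral>P'. ?E (conv_pmf (cav_law N n) (isum_pmf (P' (Suc n)) (one_cav N (N + Suc n)))) F \<partial>?P)"
  proof (rule Bochner_Integration.integral_cong[OF refl])
    fix P'
    let ?F = "\<lambda>M. ?E (isum_pmf (P' (Suc n)) (one_cav N (N + Suc n))) (\<lambda>M'. F (M + M'))"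
    have "?E (conv_pmf D (isum_pmf (P' (Suc n)) (one_cav N (N + Suc n)))) F = ?E D ?F" for D
      using F by (simp add: expectation_conv[where B=1])
    then show "(\<integral>P. ?g (cav_slots p N n P) (P' (Suc n)) \<partial>?P) = ?E (conv_pmf (cav_law N n) (isum_pmf (P' (Suc n)) (one_cav N (N + Suc n)))) F"
      using Suc.IH[of ?F] F by (simp add: abs_expectation_le)
  qed
  also have "\<dots> = ?E ?u (\<lambda>x. ?E (conv_pmf (cav_law N n) (isum_pmf x (one_cav N (N + Suc n)))) F)"
    by (rule integral_PiM_component) (auto intro: prob_space_measure_pmf)
  also have "\<dots> = ?E (cav_law N (Suc n)) F"
    unfolding cav_law_Suc cpois_def conv_bind_right using F by (subst expectation_bind_pmf[where B=1]) auto
  finally show ?case by simp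
qed

lemma isum_th_law: "isum_pmf r (th_law N) = slots_law N (hat_slots p r)"
proof -
  have "isum_pmf (length (hat_slots p r)) (map_pmf (\<lambda>J. {#Th ([] @ J)#}) (replicate_pmf p (site_pmf N))) = slots_law N (hat_slots p r)"
    by (rule isum_slots) (auto simp: hat_slots_def simp del: upt_Suc)
  then show ?thesis by (simp add: hat_slots_def th_law_def del: upt_Suc)
qed

end

section \<open>Replica averages and their limits\<close>

text \<open>The multilinear interpolation of \<open>f\<close> from the discrete cube: for signs the
  product is the indicator of \<epsilon> = y. It turns a function of spins into a polynomial in real
  variables, since finite-dimensional convergence is tested with continuous functions of real
  arrays.\<close>

definition multilin :: "nat \<Rightarrow> ((nat \<Rightarrow> real) \<Rightarrow> real) \<Rightarrow> (nat \<Rightarrow> real) \<Rightarrow> real" where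
  "multilin m f y = (\<Sum>\<epsilon>\<in>configs m. f \<epsilon> * (\<Prod>i\<in>{1..m}. (1 + \<epsilon> i * y i) / 2))"

lemma multilin_eq:
  assumes loc: "local_fun m f" and y: "\<And>i. i \<in> {1..m} \<Longrightarrow> y i \<in> signs"
  shows "multilin m f y = f y"
proof -
  define y' where "y' = restrict y {1..m}"
  have y': "y' \<in> configs m" using y by (auto simp: y'_def configs_def)
  have z: "(\<Prod>i\<in>{1..m}. (1 + \<epsilon> i * y i) / 2) = (if \<epsilon> = y' then 1 else 0)" if \<epsilon>: "\<epsilon> \<in> configs m" for \<epsilon>
  proof (cases "\<epsilon> = y'")
    case True
    have "(1 + \<epsilon> i * y i) / 2 = 1" if "i \<in> {1..m}" for i
      using True that y[OF that] by (auto simp: y'_def signs_def)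
    then show ?thesis using True by simp
  next
    case False
    then obtain i where i: "\<epsilon> i \<noteq> y' i" by auto
    then have im: "i \<in> {1..m}" using \<epsilon> y' unfolding configs_def by (metis PiE_arb)
    then have "\<epsilon> i \<in> signs" "y i \<in> signs" "\<epsilon> i \<noteq> y i" using \<epsilon> y i by (auto simp: configs_def PiE_iff y'_def)
    then have "(1 + \<epsilon> i * y i) / 2 = 0" by (auto simp: signs_def)
    then have "(\<Prod>i\<in>{1..m}. (1 + \<epsilon> i * y i) / 2) = 0" using im by (intro prod_zero) auto
    then show ?thesis using False by simp
  qed
  have "multilin m f y = (\<Sum>\<epsilon>\<in>configs m. if \<epsilon> = y' then f \<epsilon> else 0)"
    unfolding multilin_def by (intro sum.cong refl) (simp only: z, simp)
  also have "\<dots> = f y'" using y' by simp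
  also have "f y' = f y" using loc unfolding local_fun_def y'_def by (metis restrict_apply')
  finally show ?thesis .
qed

lemma measurable_multilin:
  assumes "\<And>i. i \<in> {1..m} \<Longrightarrow> (\<lambda>x. Y x i) \<in> borel_measurable M"
  shows "(\<lambda>x. multilin m f (Y x)) \<in> borel_measurable M"
  unfolding multilin_def
  by (intro borel_measurable_sum borel_measurable_times borel_measurable_prod borel_measurable_divide
      borel_measurable_add borel_measurable_const assms)

definition clip :: "real \<Rightarrow> real" where "clip x = max (-1) (min 1 x)"

lemma clip_signs: "x \<in> signs \<Longrightarrow> clip x = x"
  by (auto simp: clip_def signs_def)

lemma abs_multilin_clip:
  assumes "\<And>\<epsilon>. \<epsilon> \<in> configs m \<Longrightarrow> \<bar>f \<epsilon>\<bar> \<le> 1"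
  shows "\<bar>multilin m f (\<lambda>i. clip (y i))\<bar> \<le> real (card (configs m))"
proof -
  have f1: "\<bar>(1 + \<epsilon> i * clip (y i)) / 2\<bar> \<le> 1" if "\<epsilon> \<in> configs m" "i \<in> {1..m}" for \<epsilon> i
  proof -
    have "\<epsilon> i \<in> signs" using that by (auto simp: configs_def PiE_iff)
    then show ?thesis by (auto simp: signs_def clip_def)
  qed
  have "\<bar>multilin m f (\<lambda>i. clip (y i))\<bar> \<le> (\<Sum>\<epsilon>\<in>configs m. 1)"
    unfolding multilin_def
  proof (rule order_trans[OF sum_abs], rule sum_mono)
    fix \<epsilon> assume \<epsilon>: "\<epsilon> \<in> configs m"
    have "\<bar>\<Prod>i\<in>{1..m}. (1 + \<epsilon> i * clip (y i)) / 2\<bar> \<le> 1"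
      unfolding abs_prod by (rule prod_le_1) (use f1[OF \<epsilon>] in auto)
    then show "\<bar>f \<epsilon> * (\<Prod>i\<in>{1..m}. (1 + \<epsilon> i * clip (y i)) / 2)\<bar> \<le> 1"
      unfolding abs_mult using assms[OF \<epsilon>] by (intro mult_le_one) auto
  qed
  then show ?thesis by simp
qed

lemma borel_clip [measurable]: "clip \<in> borel_measurable borel"
  unfolding clip_def by measurable

text \<open>A bounded continuous function of the array that is the product over replicas of the
  \<open>f l\<close>, for local \<open>f l\<close>, whenever the entries are signs. Boundedness
  comes from \<open>clip\<close>, since arrays have arbitrary real entries.\<close>

definition test_fun :: "nat \<Rightarrow> nat \<Rightarrow> (nat \<Rightarrow> (nat \<Rightarrow> real) \<Rightarrow> real) \<Rightarrow> (nat \<times> nat \<Rightarrow> real) \<Rightarrow> real" where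
  "test_fun m Q f s = (\<Prod>l\<in>{1..Q}. multilin m (f l) (\<lambda>i. clip (s (i, l))))"

lemma abs_test_fun:
  assumes "\<And>l \<epsilon>. l \<in> {1..Q} \<Longrightarrow> \<epsilon> \<in> configs m \<Longrightarrow> \<bar>f l \<epsilon>\<bar> \<le> 1"
  shows "\<bar>test_fun m Q f s\<bar> \<le> real (card (configs m)) ^ Q"
proof -
  have "\<bar>test_fun m Q f s\<bar> \<le> (\<Prod>l\<in>{1..Q}. real (card (configs m)))"
    unfolding test_fun_def abs_prod by (intro prod_mono conjI abs_ge_zero abs_multilin_clip assms)
  then show ?thesis by simp
qed

lemma test_fun_restrict: "test_fun m Q f (restrict s ({1..m} \<times> {1..Q})) = test_fun m Q f s"
  unfolding test_fun_def multilin_def by (intro prod.cong sum.cong refl arg_cong2[where f="(*)"]) simp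

lemma test_fun_continuous:
  "continuous_map (product_topology (\<lambda>_. euclideanreal) ({1..m} \<times> {1..Q})) euclideanreal (test_fun m Q f)"
proof -
  let ?X = "product_topology (\<lambda>_. euclideanreal) ({1..m} \<times> {1..Q})"
  have clip: "continuous_map ?X euclideanreal (\<lambda>s. clip (s (i, l)))" if "i \<in> {1..m}" "l \<in> {1..Q}" for i l
  proof -
    have "continuous_map ?X euclideanreal (\<lambda>s. s (i, l))"
      using that by (intro continuous_map_product_projection) auto
    moreover have "continuous_map euclideanreal euclideanreal clip"
      by (simp add: clip_def[abs_def] continuous_intros)
    ultimately have "continuous_map ?X euclideanreal (clip \<circ> (\<lambda>s. s (i, l)))"
      by (rule continuous_map_compose)
    then show ?thesis by (simp add: comp_def)
  qed
  have "continuous_map ?X euclideanreal (\<lambda>s. \<Prod>l\<in>{1..Q}. \<Sum>\<epsilon>\<in>configs m. f l \<epsilon> * (\<Prod>i\<in>{1..m}. (1 / 2) * (1 + \<epsilon> i * clip (s (i, l)))))"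
    by (intro continuous_map_prod continuous_map_sum continuous_map_real_mult_left continuous_map_add
        continuous_map_const[THEN iffD2] finite_configs finite_atLeastAtMost clip) auto
  then show ?thesis by (simp add: test_fun_def[abs_def] multilin_def)
qed

section \<open>Replicas of a finite system and their limit\<close>

lemma prob_gibbs: "prob_space (gibbs p N d)"
  and sets_gibbs: "sets (gibbs p N d) = sets (count_space (configs N))"
  and integral_gibbs: "(\<integral>\<sigma>. f \<sigma> \<partial>gibbs p N d) = gav N (wt p N d) f"
proof -
  have Z: "0 < partition_fun p N d" unfolding partition_fun_def by (auto intro: sum_pos)
  then have "emeasure (gibbs p N d) (configs N) = ennreal (\<Sum>\<sigma>\<in>configs N. exp (neg_H p d \<sigma>) / partition_fun p N d)"
    unfolding gibbs_def by (subst emeasure_point_measure_finite) (auto intro!: sum_ennreal)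
  also have "(\<Sum>\<sigma>\<in>configs N. exp (neg_H p d \<sigma>) / partition_fun p N d) = 1"
    using Z by (simp add: sum_divide_distrib[symmetric] partition_fun_def)
  finally show "prob_space (gibbs p N d)"
    by (intro prob_spaceI) (simp add: gibbs_def space_point_measure)
  show "sets (gibbs p N d) = sets (count_space (configs N))" by (simp add: gibbs_def sets_point_measure)
  have "(\<integral>\<sigma>. f \<sigma> \<partial>gibbs p N d) = (\<Sum>\<sigma>\<in>configs N. exp (neg_H p d \<sigma>) / partition_fun p N d * f \<sigma>)"
    unfolding gibbs_def using Z by (subst lebesgue_integral_point_measure_finite) auto
  also have "\<dots> = gav N (wt p N d) f"
    unfolding gav_def wt_def partition_fun_def by (simp add: sum_divide_distrib cong: sum.cong)
  finally show "(\<integral>\<sigma>. f \<sigma> \<partial>gibbs p N d) = gav N (wt p N d) f" .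
qed

lemma measurable_replica_array:
  "replica_array N \<in> PiM {1..} (\<lambda>_. count_space (configs N)) \<rightarrow>\<^sub>M arrays"
proof -
  have "(\<lambda>s. \<lambda>il\<in>array_idx. if fst il \<le> N then s (snd il) (fst il) else 0) \<in> PiM {1..} (\<lambda>_. count_space (configs N)) \<rightarrow>\<^sub>M arrays"
    unfolding arrays_def
  proof (rule measurable_restrict)
    fix il :: "nat \<times> nat" assume "il \<in> array_idx"
    then have l: "snd il \<in> {1..}" by (auto simp: array_idx_def)
    have "(\<lambda>s. s (snd il) (fst il)) \<in> borel_measurable (PiM {1..} (\<lambda>_. count_space (configs N)))"
      by (rule measurable_compose[OF measurable_component_singleton[OF l], where g="\<lambda>\<sigma>. \<sigma> (fst il)"]) simp
    then show "(\<lambda>s. if fst il \<le> N then s (snd il) (fst il) else 0) \<in> borel_measurable (PiM {1..} (\<lambda>_. count_space (configs N)))"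
      by simp
  qed
  moreover have "replica_array N = (\<lambda>s. \<lambda>il\<in>array_idx. if fst il \<le> N then s (snd il) (fst il) else 0)"
    by (auto simp: replica_array_def fun_eq_iff restrict_def)
  ultimately show ?thesis by simp
qed

context interaction_law
begin

text \<open>Measurability of the kernel is checked on cylinders, where the product measure is a
  finite product of Gibbs probabilities, each a measurable function of the disorder.\<close>

lemma measurable_gibbs_PiM:
  "(\<lambda>d. \<Pi>\<^sub>M l\<in>{1..}. gibbs p N d) \<in> disorder_law L p \<alpha> c N \<rightarrow>\<^sub>M subprob_algebra (PiM ({1..}::nat set) (\<lambda>_. count_space (configs N)))"
proof (rule measurable_subprob_algebra_generated[OF sets_PiM Int_stable_prod_algebra prod_algebra_sets_into_space])
  fix d
  interpret prob_space "\<Pi>\<^sub>M l\<in>{1::nat..}. gibbs p N d" by (intro prob_space_PiM prob_gibbs)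
  show "subprob_space (\<Pi>\<^sub>M l\<in>{1::nat..}. gibbs p N d)" by unfold_locales
  show "sets (\<Pi>\<^sub>M l\<in>{1::nat..}. gibbs p N d) = sets (PiM {1..} (\<lambda>_. count_space (configs N)))"
    by (intro sets_PiM_cong refl sets_gibbs)
next
  have em: "(\<lambda>d. emeasure (gibbs p N d) X) \<in> borel_measurable (disorder_law L p \<alpha> c N)" if "X \<subseteq> configs N" for X
  proof -
    have "(\<lambda>d. emeasure (gibbs p N d) X) = (\<lambda>d. \<Sum>\<sigma>\<in>X. ennreal (exp (neg_H p d \<sigma>) / partition_fun p N d))"
      unfolding gibbs_def using that by (subst emeasure_point_measure_finite) auto
    also have "\<dots> \<in> borel_measurable (disorder_law L p \<alpha> c N)"
      unfolding partition_fun_def by measurable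
    finally show ?thesis .
  qed
  have ps: "prob_space (\<Pi>\<^sub>M l\<in>{1::nat..}. gibbs p N d)" for d by (intro prob_space_PiM prob_gibbs)
  {
    fix A assume "A \<in> prod_algebra {1::nat..} (\<lambda>_. count_space (configs N))"
    then obtain J E where A: "A = prod_emb {1..} (\<lambda>_. count_space (configs N)) J (Pi\<^sub>E J E)"
      and J: "finite J" "J \<subseteq> {1..}" and E': "\<And>j. j \<in> J \<Longrightarrow> E j \<in> sets (count_space (configs N))"
      by (elim prod_algebraE) blast
    have E: "\<And>j. j \<in> J \<Longrightarrow> E j \<subseteq> configs N" using E' by simp
    have sp: "space (gibbs p N d) = configs N" for d by (simp add: gibbs_def space_point_measure)
    have "emeasure (\<Pi>\<^sub>M l\<in>{1..}. gibbs p N d) A = (\<Prod>j\<in>J. emeasure (gibbs p N d) (E j))" for d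
    proof -
      have "A = prod_emb {1..} (\<lambda>_. gibbs p N d) J (Pi\<^sub>E J E)" unfolding A prod_emb_def by (simp add: sp)
      then show ?thesis using J E by (simp add: emeasure_PiM_emb prob_gibbs sets_gibbs)
    qed
    then show "(\<lambda>d. emeasure (\<Pi>\<^sub>M l\<in>{1..}. gibbs p N d) A) \<in> borel_measurable (disorder_law L p \<alpha> c N)"
      using em E J by simp
  }
  have "emeasure (\<Pi>\<^sub>M l\<in>{1::nat..}. gibbs p N d) (\<Pi>\<^sub>E l\<in>{1..}. space (count_space (configs N))) = 1" for d
  proof -
    have "(\<Pi>\<^sub>E l\<in>{1::nat..}. space (count_space (configs N))) = space (\<Pi>\<^sub>M l\<in>{1::nat..}. gibbs p N d)"
      by (simp add: space_PiM gibbs_def space_point_measure)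
    then show ?thesis using prob_space.emeasure_space_1[OF ps] by simp
  qed
  then show "(\<lambda>d. emeasure (\<Pi>\<^sub>M l\<in>{1::nat..}. gibbs p N d) (\<Pi>\<^sub>E l\<in>{1..}. space (count_space (configs N)))) \<in> borel_measurable (disorder_law L p \<alpha> c N)"
    by simp
qed

lemma integral_array_law:
  fixes g :: "(nat \<times> nat \<Rightarrow> real) \<Rightarrow> real"
  assumes g: "g \<in> borel_measurable arrays" and b: "\<And>x. \<bar>g x\<bar> \<le> B"
  shows "(\<integral>s. g s \<partial>array_law L p \<alpha> c N) = (\<integral>d. \<integral>s. g (replica_array N s) \<partial>(\<Pi>\<^sub>M l\<in>{1..}. gibbs p N d) \<partial>disorder_law L p \<alpha> c N)"
proof -
  interpret D: prob_space "disorder_law L p \<alpha> c N" by (rule prob_disorder)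
  let ?K = "\<lambda>d. distr (\<Pi>\<^sub>M l\<in>{1..}. gibbs p N d) arrays (replica_array N)"
  have K: "?K \<in> disorder_law L p \<alpha> c N \<rightarrow>\<^sub>M subprob_algebra arrays"
    by (rule measurable_compose[OF measurable_gibbs_PiM measurable_distr[OF measurable_replica_array]])
  have meas: "replica_array N \<in> (\<Pi>\<^sub>M l\<in>{1..}. gibbs p N d) \<rightarrow>\<^sub>M arrays" for d
    using measurable_replica_array by (subst measurable_cong_sets[OF sets_PiM_cong[OF refl sets_gibbs] refl])
  have "(\<integral>s. g s \<partial>array_law L p \<alpha> c N) = (\<integral>d. \<integral>s. g s \<partial>?K d \<partial>disorder_law L p \<alpha> c N)"
    unfolding array_law_def
  proof (rule integral_bind[where K=arrays and B=B and B'=1])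
    show "AE d in disorder_law L p \<alpha> c N. emeasure (?K d) (space (?K d)) \<le> ennreal 1"
    proof (rule AE_I2)
      fix d
      interpret P: prob_space "\<Pi>\<^sub>M l\<in>{1::nat..}. gibbs p N d" by (intro prob_space_PiM prob_gibbs)
      interpret prob_space "?K d" by (rule P.prob_space_distr[OF meas])
      show "emeasure (?K d) (space (?K d)) \<le> ennreal 1" using emeasure_space_1 by simp
    qed
  qed (use g b K in \<open>auto simp: D.finite_measure_axioms\<close>)
  also have "\<dots> = (\<integral>d. \<integral>s. g (replica_array N s) \<partial>(\<Pi>\<^sub>M l\<in>{1..}. gibbs p N d) \<partial>disorder_law L p \<alpha> c N)"
    by (intro Bochner_Integration.integral_cong refl integral_distr meas g)
  finally show ?thesis .
qed

text \<open>Given the disorder the replicas are independent, so a product over replicas integrates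
  to a product of Gibbs averages.\<close>

lemma integral_test_fun:
  assumes loc: "\<And>l. l \<in> {1..Q} \<Longrightarrow> local_fun m (f l)" and m: "m \<le> N"
    and b: "\<And>l \<epsilon>. l \<in> {1..Q} \<Longrightarrow> \<epsilon> \<in> configs m \<Longrightarrow> \<bar>f l \<epsilon>\<bar> \<le> 1"
  shows "(\<integral>s. test_fun m Q f s \<partial>array_law L p \<alpha> c N) = (\<integral>d. (\<Prod>l\<in>{1..Q}. gav N (wt p N d) (f l)) \<partial>disorder_law L p \<alpha> c N)"
proof -
  have comp: "(\<lambda>s. s (i, l)) \<in> borel_measurable arrays" if "i \<in> {1..m}" "l \<in> {1..Q}" for i l
    unfolding arrays_def using that by (intro measurable_component_singleton) (auto simp: array_idx_def)
  have meas: "test_fun m Q f \<in> borel_measurable arrays"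
    unfolding test_fun_def
    by (intro borel_measurable_prod measurable_multilin measurable_compose[OF comp borel_clip])
  have "(\<integral>s. test_fun m Q f (replica_array N s) \<partial>(\<Pi>\<^sub>M l\<in>{1..}. gibbs p N d)) = (\<Prod>l\<in>{1..Q}. gav N (wt p N d) (f l))" for d
  proof -
    \<comment> \<open>Cutting off outside the configurations gives functions bounded by 1
      everywhere, as \<open>integral_PiM_prod\<close> asks, without changing the integrals.\<close>
    define h where "h = (\<lambda>l \<sigma>. if l \<in> {1..Q} \<and> \<sigma> \<in> configs N then f l \<sigma> else 0)"
    have hb: "\<bar>h l \<sigma>\<bar> \<le> 1" for l \<sigma>
    proof (cases "l \<in> {1..Q} \<and> \<sigma> \<in> configs N")
      case True
      have "restrict \<sigma> {1..m} \<in> configs m" using True m by (auto simp: configs_def PiE_iff)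
      moreover have "f l (restrict \<sigma> {1..m}) = f l \<sigma>"
        using loc[of l] True unfolding local_fun_def by (metis restrict_apply')
      ultimately show ?thesis using b[of l "restrict \<sigma> {1..m}"] True by (simp add: h_def)
    qed (auto simp: h_def)
    have "(\<integral>s. test_fun m Q f (replica_array N s) \<partial>(\<Pi>\<^sub>M l\<in>{1..}. gibbs p N d)) =
      (\<integral>s. (\<Prod>l\<in>{1..Q}. h l (s l)) \<partial>(\<Pi>\<^sub>M l\<in>{1..}. gibbs p N d))"
    proof (rule Bochner_Integration.integral_cong[OF refl])
      fix s assume s: "s \<in> space (\<Pi>\<^sub>M l\<in>{1::nat..}. gibbs p N d)"
      show "test_fun m Q f (replica_array N s) = (\<Prod>l\<in>{1..Q}. h l (s l))"
        unfolding test_fun_def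
      proof (rule prod.cong[OF refl])
        fix l assume l: "l \<in> {1..Q}"
        have sl: "s l \<in> configs N" using s l by (auto simp: space_PiM PiE_iff gibbs_def space_point_measure)
        have sg: "s l i \<in> signs" if "i \<in> {1..m}" for i using sl that m by (auto simp: configs_def PiE_iff)
        have "multilin m (f l) (\<lambda>i. clip (replica_array N s (i, l))) = multilin m (f l) (\<lambda>i. s l i)"
        proof -
          have "clip (replica_array N s (i, l)) = s l i" if "i \<in> {1..m}" for i
            using that l m clip_signs[OF sg[OF that]] by (auto simp: replica_array_def array_idx_def)
          then show ?thesis unfolding multilin_def by (intro sum.cong refl arg_cong2[where f="(*)"] prod.cong) auto
        qed
        also have "\<dots> = f l (s l)" by (rule multilin_eq[OF loc[OF l] sg])
        finally show "multilin m (f l) (\<lambda>i. clip (replica_array N s (i, l))) = h l (s l)"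
          using l sl by (simp add: h_def)
      qed
    qed
    also have "\<dots> = (\<Prod>l\<in>{1..Q}. \<integral>\<sigma>. h l \<sigma> \<partial>gibbs p N d)"
    proof (rule integral_PiM_prod)
      show "h l \<in> borel_measurable (gibbs p N d)" for l
        by (simp add: measurable_cong_sets[OF sets_gibbs refl])
    qed (use hb in \<open>auto intro: prob_gibbs\<close>)
    also have "\<dots> = (\<Prod>l\<in>{1..Q}. gav N (wt p N d) (f l))"
      by (intro prod.cong refl) (simp add: integral_gibbs gav_def h_def)
    finally show ?thesis .
  qed
  then show ?thesis
    using integral_array_law[OF meas abs_test_fun[OF b], where c=c and \<alpha>=\<alpha> and N=N] by simp
qed

text \<open>Finite-dimensional convergence needs bounded continuous test functions of the array.
  \<open>test_fun\<close> is one, and on the finite system it reduces to Gibbs averages once m \<le>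
  N.\<close>

lemma replica_limit:
  assumes conv: "fdd_converges (\<lambda>k. array_law L p \<alpha> c (S k)) \<mu>" and S: "strict_mono S" and rep: "represents \<sigma> \<mu>"
    and loc: "\<And>l. l \<in> {1..Q} \<Longrightarrow> local_fun m (f l)"
    and b: "\<And>l \<epsilon>. l \<in> {1..Q} \<Longrightarrow> \<epsilon> \<in> configs m \<Longrightarrow> \<bar>f l \<epsilon>\<bar> \<le> 1"
  shows "(\<lambda>k. \<integral>d. (\<Prod>l\<in>{1..Q}. gav (S k) (wt p (S k) d) (f l)) \<partial>disorder_law L p \<alpha> c (S k))
    \<longlonglongrightarrow> (\<integral>\<omega>. test_fun m Q f (spin_array \<sigma> \<omega>) \<partial>seeds)"
proof -
  let ?F = "{1..m} \<times> {1..Q}"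
  have F: "finite ?F" "?F \<subseteq> array_idx" by (auto simp: array_idx_def)
  have bd: "bounded (test_fun m Q f ` (\<Pi>\<^sub>E il\<in>?F. UNIV))"
    unfolding bounded_iff using abs_test_fun[OF b] by (intro exI[of _ "real (card (configs m)) ^ Q"]) auto
  have lim: "(\<lambda>k. \<integral>s. test_fun m Q f s \<partial>array_law L p \<alpha> c (S k)) \<longlonglongrightarrow> (\<integral>s. test_fun m Q f s \<partial>\<mu>)"
    using conv[unfolded fdd_converges_def, rule_format, of ?F "test_fun m Q f"] F test_fun_continuous bd
    by (simp add: test_fun_restrict[unfolded One_nat_def])
  have comp: "(\<lambda>s. s (i, l)) \<in> borel_measurable arrays" if "i \<in> {1..m}" "l \<in> {1..Q}" for i l
    unfolding arrays_def using that by (intro measurable_component_singleton) (auto simp: array_idx_def)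
  have meas: "test_fun m Q f \<in> borel_measurable arrays"
    unfolding test_fun_def
    by (intro borel_measurable_prod measurable_multilin measurable_compose[OF comp borel_clip])
  have \<mu>: "\<mu> = distr seeds arrays (spin_array \<sigma>)" using rep by (simp add: represents_def)
  have sa: "spin_array \<sigma> \<in> seeds \<rightarrow>\<^sub>M arrays"
  proof -
    have \<sigma>[measurable]: "\<sigma> \<in> borel_measurable (unif01 \<Otimes>\<^sub>M unif01 \<Otimes>\<^sub>M unif01 \<Otimes>\<^sub>M unif01)"
      using rep by (simp add: represents_def)
    have "(\<lambda>z. \<lambda>il\<in>array_idx. \<sigma> (fst z, fst (snd z) (snd il), fst (snd (snd z)) (fst il), snd (snd (snd z)) il)) \<in> seeds \<rightarrow>\<^sub>M arrays"
      unfolding arrays_def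
    proof (rule measurable_restrict)
      fix il :: "nat \<times> nat" assume il[measurable]: "il \<in> array_idx"
      then have [measurable]: "snd il \<in> {1..}" "fst il \<in> {1..}" by (auto simp: array_idx_def)
      show "(\<lambda>z. \<sigma> (fst z, fst (snd z) (snd il), fst (snd (snd z)) (fst il), snd (snd (snd z)) il)) \<in> borel_measurable seeds"
        unfolding seeds_def by measurable
    qed
    moreover have "spin_array \<sigma> = (\<lambda>z. \<lambda>il\<in>array_idx. \<sigma> (fst z, fst (snd z) (snd il), fst (snd (snd z)) (fst il), snd (snd (snd z)) il))"
      by (rule ext) (auto simp: split_beta' split: prod.splits)
    ultimately show ?thesis by simp
  qed
  have "(\<integral>s. test_fun m Q f s \<partial>\<mu>) = (\<integral>\<omega>. test_fun m Q f (spin_array \<sigma> \<omega>) \<partial>seeds)"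
    unfolding \<mu> by (rule integral_distr[OF sa meas])
  with lim have lim: "(\<lambda>k. \<integral>s. test_fun m Q f s \<partial>array_law L p \<alpha> c (S k)) \<longlonglongrightarrow> (\<integral>\<omega>. test_fun m Q f (spin_array \<sigma> \<omega>) \<partial>seeds)"
    by simp
  show ?thesis
  proof (rule Lim_transform_eventually[OF lim])
    show "\<forall>\<^sub>F k in sequentially. (\<integral>s. test_fun m Q f s \<partial>array_law L p \<alpha> c (S k)) =
      (\<integral>d. (\<Prod>l\<in>{1..Q}. gav (S k) (wt p (S k) d) (f l)) \<partial>disorder_law L p \<alpha> c (S k))"
      using eventually_ge_at_top[of m]
    proof eventually_elim
      case (elim k)
      then have mk: "m \<le> S k" using seq_suble[OF S, of k] by simp
      show ?case by (rule integral_test_fun[OF loc mk b])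
    qed
  qed
qed

end

text \<open>On [\<delta>, 1] the function 1 / t^q is a uniform limit of polynomials, so convergence
  of the integrals of A T^i gives that of A / T^q. The underlying spaces may differ; only integrals
  are compared.\<close>

lemma ratio_limit:
  fixes A T :: "nat \<Rightarrow> 'a \<Rightarrow> real" and A' T' :: "'b \<Rightarrow> real"
  assumes M: "\<And>k. prob_space (M k)" and N: "prob_space N"
    and meas: "\<And>k. A k \<in> borel_measurable (M k)" "\<And>k. T k \<in> borel_measurable (M k)"
      "A' \<in> borel_measurable N" "T' \<in> borel_measurable N"
    and A: "\<And>k x. x \<in> space (M k) \<Longrightarrow> \<bar>A k x\<bar> \<le> 1" "\<And>x. x \<in> space N \<Longrightarrow> \<bar>A' x\<bar> \<le> 1"
    and T: "\<And>k x. x \<in> space (M k) \<Longrightarrow> T k x \<in> {\<delta>..1}" "\<And>x. x \<in> space N \<Longrightarrow> T' x \<in> {\<delta>..1}"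
    and \<delta>: "0 < \<delta>"
    and lim: "\<And>i. (\<lambda>k. \<integral>x. A k x * T k x ^ i \<partial>M k) \<longlonglongrightarrow> (\<integral>x. A' x * T' x ^ i \<partial>N)"
  shows "(\<lambda>k. \<integral>x. A k x / T k x ^ q \<partial>M k) \<longlonglongrightarrow> (\<integral>x. A' x / T' x ^ q \<partial>N)"
proof (rule LIMSEQ_I)
  fix e :: real assume e: "0 < e"
  have cont: "continuous_on {\<delta>..1} (\<lambda>t. 1 / t ^ q)"
    using \<delta> by (intro continuous_intros) auto
  \<comment> \<open>The accuracy e / 4 is spent three times: for the sequence, for the limit, and
    for the distance between the two polynomial expressions.\<close>
  obtain g where g: "real_polynomial_function g" "\<And>t. t \<in> {\<delta>..1} \<Longrightarrow> \<bar>1 / t ^ q - g t\<bar> < e / 4"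
    using Stone_Weierstrass_real_polynomial_function[of "{\<delta>..1}" "\<lambda>t. 1 / t ^ q" "e / 4"] cont e
    by (metis compact_Icc divide_pos_pos zero_less_numeral)
  then obtain a n where ga: "g = (\<lambda>x. \<Sum>i\<le>n. a i * x ^ i)"
    unfolding real_polynomial_function_iff_sum by blast
  have main: "\<bar>(\<integral>x. B x / R x ^ q \<partial>K) - (\<Sum>i\<le>n. a i * (\<integral>x. B x * R x ^ i \<partial>K))\<bar> \<le> e / 4"
    if K: "prob_space K" and m: "B \<in> borel_measurable K" "R \<in> borel_measurable K"
      and B: "\<And>x. x \<in> space K \<Longrightarrow> \<bar>B x\<bar> \<le> 1" and R: "\<And>x. x \<in> space K \<Longrightarrow> R x \<in> {\<delta>..1}" for K :: "'c measure" and B R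
  proof -
    interpret K: prob_space K by fact
    note [measurable] = m
    have i1: "integrable K (\<lambda>x. B x * R x ^ i)" for i
    proof (rule K.integrable_const_bound[where B=1])
      show "AE x in K. norm (B x * R x ^ i) \<le> 1"
      proof (rule AE_I2)
        fix x assume x: "x \<in> space K"
        have "\<bar>R x ^ i\<bar> \<le> 1" using R[OF x] \<delta> by (simp add: power_le_one)
        then show "norm (B x * R x ^ i) \<le> 1" using B[OF x] by (simp add: abs_mult mult_le_one)
      qed
    qed measurable
    have bd: "\<bar>B x / R x ^ q - (\<Sum>i\<le>n. a i * (B x * R x ^ i))\<bar> \<le> e / 4" if x: "x \<in> space K" for x
    proof -
      have "B x / R x ^ q - (\<Sum>i\<le>n. a i * (B x * R x ^ i)) = B x * (1 / R x ^ q - g (R x))"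
        unfolding ga by (simp add: right_diff_distrib sum_distrib_left ac_simps)
      also have "\<bar>\<dots>\<bar> \<le> 1 * (e / 4)"
        unfolding abs_mult using B[OF x] g(2)[OF R[OF x]] by (intro mult_mono) auto
      finally show ?thesis by simp
    qed
    have i2: "integrable K (\<lambda>x. \<Sum>i\<le>n. a i * (B x * R x ^ i))" using i1 by simp
    have i3: "integrable K (\<lambda>x. B x / R x ^ q - (\<Sum>i\<le>n. a i * (B x * R x ^ i)))"
      by (rule K.integrable_const_bound[where B="e / 4"]) (use bd in auto)
    from Bochner_Integration.integrable_add[OF i3 i2] have i4: "integrable K (\<lambda>x. B x / R x ^ q)" by simp
    have "(\<integral>x. B x / R x ^ q \<partial>K) - (\<Sum>i\<le>n. a i * (\<integral>x. B x * R x ^ i \<partial>K)) =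
      (\<integral>x. B x / R x ^ q - (\<Sum>i\<le>n. a i * (B x * R x ^ i)) \<partial>K)"
      using i1 i2 i4 by (simp add: Bochner_Integration.integral_diff Bochner_Integration.integral_sum)
    also have "\<bar>\<dots>\<bar> \<le> (\<integral>x. \<bar>B x / R x ^ q - (\<Sum>i\<le>n. a i * (B x * R x ^ i))\<bar> \<partial>K)" by (rule integral_abs_bound)
    also have "\<dots> \<le> (\<integral>x. e / 4 \<partial>K)" using i3 bd by (intro integral_mono_AE) auto
    finally show ?thesis by (simp add: K.prob_space)
  qed
  have "(\<lambda>k. \<Sum>i\<le>n. a i * (\<integral>x. A k x * T k x ^ i \<partial>M k)) \<longlonglongrightarrow> (\<Sum>i\<le>n. a i * (\<integral>x. A' x * T' x ^ i \<partial>N))"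
    by (intro tendsto_sum tendsto_mult tendsto_const lim)
  from LIMSEQ_D[OF this, of "e / 4"] e obtain k0 where k0: "\<And>k. k0 \<le> k \<Longrightarrow>
    \<bar>(\<Sum>i\<le>n. a i * (\<integral>x. A k x * T k x ^ i \<partial>M k)) - (\<Sum>i\<le>n. a i * (\<integral>x. A' x * T' x ^ i \<partial>N))\<bar> < e / 4"
    by (auto simp: real_norm_def)
  have "norm ((\<integral>x. A k x / T k x ^ q \<partial>M k) - (\<integral>x. A' x / T' x ^ q \<partial>N)) < e" if k: "k0 \<le> k" for k
    using main[OF M meas(1,2) A(1) T(1), of k] main[OF N meas(3,4) A(2) T(2)] k0[OF k] e
    unfolding real_norm_def by linarith
  then show "\<exists>k0. \<forall>k\<ge>k0. norm ((\<integral>x. A k x / T k x ^ q \<partial>M k) - (\<integral>x. A' x / T' x ^ q \<partial>N)) < e"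
    by blast
qed

section \<open>Replica averages in the limit\<close>

lemma prob_unif01: "prob_space unif01"
  unfolding unif01_def by (rule prob_space_restrict_space) auto

lemma space_unif01: "space unif01 = {0..1}"
  by (simp add: unif01_def space_restrict_space)

text \<open>The columns of an array of i.i.d. variables are independent sequences; the induction
  resamples column Q + 1.\<close>

lemma integral_PiM_columns:
  fixes k :: "nat \<Rightarrow> (nat \<Rightarrow> 'a) \<Rightarrow> real"
  assumes M: "prob_space M" and k: "\<And>l. k l \<in> borel_measurable (PiM {1..} (\<lambda>_. M))" and b: "\<And>l \<xi>. \<bar>k l \<xi>\<bar> \<le> 1"
  shows "(\<integral>x. (\<Prod>l\<in>{1..Q}. k l (\<lambda>i\<in>{1..}. x (i, l))) \<partial>PiM array_idx (\<lambda>_. M)) = (\<Prod>l\<in>{1..Q}. \<integral>\<xi>. k l \<xi> \<partial>PiM {1..} (\<lambda>_. M))"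
proof (induction Q)
  case 0
  interpret prob_space "PiM array_idx (\<lambda>_. M)" using M by (intro prob_space_PiM)
  show ?case by (simp add: prob_space)
next
  case (Suc Q)
  let ?X = "PiM array_idx (\<lambda>_. M)"
  have col: "(\<lambda>x. \<lambda>i\<in>{1..}. x (i, l)) \<in> ?X \<rightarrow>\<^sub>M PiM {1..} (\<lambda>_. M)" if "1 \<le> l" for l
    by (rule measurable_restrict) (use that in \<open>auto simp: array_idx_def intro!: measurable_component_singleton\<close>)
  have m: "(\<lambda>x. \<Prod>l\<in>{1..Q}. k l (\<lambda>i\<in>{1..}. x (i, l))) \<in> borel_measurable ?X" for Q
    by (intro borel_measurable_prod measurable_compose[OF col k]) auto
  have b': "\<bar>\<Prod>l\<in>{1..Q}. k l (F l)\<bar> \<le> 1" for Q F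
    unfolding abs_prod by (rule prod_le_1) (use b in auto)
  have "(\<integral>x. (\<Prod>l\<in>{1..Suc Q}. k l (\<lambda>i\<in>{1..}. x (i, l))) \<partial>?X) =
    (\<integral>x'. \<integral>x. (\<Prod>l\<in>{1..Suc Q}. k l (\<lambda>i\<in>{1..}. (\<lambda>il\<in>array_idx. if il \<in> UNIV \<times> {Suc Q} then x' il else x il) (i, l))) \<partial>?X \<partial>?X)"
    by (rule integral_PiM_merge[OF M m b'])
  also have "\<dots> = (\<integral>x'. \<integral>x. (\<Prod>l\<in>{1..Q}. k l (\<lambda>i\<in>{1..}. x (i, l))) * k (Suc Q) (\<lambda>i\<in>{1..}. x' (i, Suc Q)) \<partial>?X \<partial>?X)"
  proof (intro Bochner_Integration.integral_cong refl)
    fix x x' :: "nat \<times> nat \<Rightarrow> 'a"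
    have "(\<lambda>i\<in>{1..}. (\<lambda>il\<in>array_idx. if il \<in> UNIV \<times> {Suc Q} then x' il else x il) (i, Suc Q)) = (\<lambda>i\<in>{1..}. x' (i, Suc Q))"
      by (rule restrict_ext) (auto simp: array_idx_def)
    moreover have "(\<lambda>i\<in>{1..}. (\<lambda>il\<in>array_idx. if il \<in> UNIV \<times> {Suc Q} then x' il else x il) (i, l)) = (\<lambda>i\<in>{1..}. x (i, l))" if "l \<in> {1..Q}" for l
      by (rule restrict_ext) (use that in \<open>auto simp: array_idx_def\<close>)
    moreover from this have "(\<Prod>l\<in>{1..Q}. k l (\<lambda>i\<in>{1..}. (\<lambda>il\<in>array_idx. if il \<in> UNIV \<times> {Suc Q} then x' il else x il) (i, l))) =
       (\<Prod>l\<in>{1..Q}. k l (\<lambda>i\<in>{1..}. x (i, l)))"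
      by (intro prod.cong refl) (simp only:)
    moreover have "(\<Prod>l\<in>{1..Suc Q}. F l) = (\<Prod>l\<in>{1..Q}. F l) * F (Suc Q)" for F :: "nat \<Rightarrow> real"
      by simp
    ultimately show "(\<Prod>l\<in>{1..Suc Q}. k l (\<lambda>i\<in>{1..}. (\<lambda>il\<in>array_idx. if il \<in> UNIV \<times> {Suc Q} then x' il else x il) (i, l))) =
       (\<Prod>l\<in>{1..Q}. k l (\<lambda>i\<in>{1..}. x (i, l))) * k (Suc Q) (\<lambda>i\<in>{1..}. x' (i, Suc Q))"
      by (simp only:)
  qed
  also have "\<dots> = (\<Prod>l\<in>{1..Q}. \<integral>\<xi>. k l \<xi> \<partial>PiM {1..} (\<lambda>_. M)) * (\<integral>x'. k (Suc Q) (\<lambda>i\<in>{1..}. x' (i, Suc Q)) \<partial>?X)"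
    unfolding Suc[symmetric] by simp
  also have "(\<integral>x'. k (Suc Q) (\<lambda>i\<in>{1..}. x' (i, Suc Q)) \<partial>?X) = (\<integral>\<xi>. k (Suc Q) \<xi> \<partial>PiM {1..} (\<lambda>_. M))"
    by (rule integral_PiM_reindex[OF M _ _ k]) (auto simp: inj_on_def array_idx_def)
  finally show ?case by simp
qed

lemma abs_clip: "\<bar>clip x\<bar> \<le> 1"
  by (simp add: clip_def abs_le_iff)

lemma clip_eq: "\<bar>x\<bar> \<le> 1 \<Longrightarrow> clip x = x"
  by (auto simp: clip_def abs_le_iff)

locale spin_function =
  fixes \<sigma> :: "real \<times> real \<times> real \<times> real \<Rightarrow> real"
  assumes \<sigma>_meas [measurable]: "\<sigma> \<in> borel_measurable (unif01 \<Otimes>\<^sub>M unif01 \<Otimes>\<^sub>M unif01 \<Otimes>\<^sub>M unif01)"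
    and \<sigma>_signs: "\<sigma> ` ({0..1} \<times> {0..1} \<times> {0..1} \<times> {0..1}) \<subseteq> signs"
begin

definition unif_seq :: "(nat \<Rightarrow> real) measure" where "unif_seq = PiM {1..} (\<lambda>_. unif01)"

lemma prob_unif_seq: "prob_space unif_seq"
  unfolding unif_seq_def by (intro prob_space_PiM prob_unif01)

lemma unif_seq_component [measurable]: "i \<in> {1..} \<Longrightarrow> (\<lambda>v. v i) \<in> unif_seq \<rightarrow>\<^sub>M unif01"
  unfolding unif_seq_def by (rule measurable_component_singleton)

lemma sigma_in_signs:
  assumes "w \<in> space unif01" "u \<in> space unif01" "v \<in> space unif_seq" "x \<in> space unif_seq" "i \<in> {1..}"
  shows "\<sigma> (w, u, v i, x i) \<in> signs"
proof -
  have "v i \<in> {0..1}" "x i \<in> {0..1}" using assms by (auto simp: unif_seq_def space_PiM PiE_iff space_unif01)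
  then show ?thesis using \<sigma>_signs assms by (auto simp: space_unif01)
qed

text \<open>Interpolating and clipping gives a value that is bounded by 1 and measurable for every
  \<open>f\<close>, while \<open>sval_eq\<close> recovers \<open>f\<close> itself when it is local
  and bounded by 1 on signs.\<close>

definition sval :: "nat \<Rightarrow> ((nat \<Rightarrow> real) \<Rightarrow> real) \<Rightarrow> real \<Rightarrow> real \<Rightarrow> (nat \<Rightarrow> real) \<Rightarrow> (nat \<Rightarrow> real) \<Rightarrow> real" where
  "sval m f w u v x = clip (multilin m f (\<lambda>i. \<sigma> (w, u, v i, x i)))"

text \<open>The counterpart of \<open>gav\<close> in the limit: the conditional expectation over the
  variables u and x of one replica, given w and v.\<close>

definition savg :: "nat \<Rightarrow> ((nat \<Rightarrow> real) \<Rightarrow> real) \<Rightarrow> real \<Rightarrow> (nat \<Rightarrow> real) \<Rightarrow> real" where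
  "savg m f w v = (\<integral>x. \<integral>u. sval m f w u v x \<partial>unif01 \<partial>unif_seq)"

lemma abs_sval: "\<bar>sval m f w u v x\<bar> \<le> 1"
  by (simp add: sval_def abs_clip)

lemma measurable_sval:
  assumes [measurable]: "W \<in> M \<rightarrow>\<^sub>M unif01" "U \<in> M \<rightarrow>\<^sub>M unif01" "V \<in> M \<rightarrow>\<^sub>M unif_seq" "X \<in> M \<rightarrow>\<^sub>M unif_seq"
  shows "(\<lambda>z. sval m f (W z) (U z) (V z) (X z)) \<in> borel_measurable M"
  unfolding sval_def
proof (rule measurable_compose[OF measurable_multilin borel_clip])
  fix i assume "i \<in> {1..m}"
  then have [measurable]: "i \<in> {1..}" by simp
  show "(\<lambda>x. \<sigma> (W x, U x, V x i, X x i)) \<in> borel_measurable M" by measurable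
qed

lemma sval_eq:
  assumes "w \<in> space unif01" "u \<in> space unif01" "v \<in> space unif_seq" "x \<in> space unif_seq"
    and loc: "local_fun m f" and b: "\<And>y. (\<And>i. i \<in> {1..m} \<Longrightarrow> y i \<in> signs) \<Longrightarrow> \<bar>f y\<bar> \<le> 1"
  shows "sval m f w u v x = f (\<lambda>i. \<sigma> (w, u, v i, x i))"
proof -
  have s: "\<sigma> (w, u, v i, x i) \<in> signs" if "i \<in> {1..m}" for i using that assms by (intro sigma_in_signs) auto
  show ?thesis unfolding sval_def using multilin_eq[OF loc, of "\<lambda>i. \<sigma> (w, u, v i, x i)"] s b clip_eq by simp
qed

lemma integral_sval:
  "\<bar>\<integral>u. sval m f w u v x \<partial>unif01\<bar> \<le> 1" "\<bar>savg m f w v\<bar> \<le> 1"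
proof -
  show "\<bar>\<integral>u. sval m f w u v x \<partial>unif01\<bar> \<le> 1" for x
    by (rule prob_space.abs_integral_bounded[OF prob_unif01]) (simp add: sval_def abs_clip)
  then show "\<bar>savg m f w v\<bar> \<le> 1"
    unfolding savg_def by (rule prob_space.abs_integral_bounded[OF prob_unif_seq])
qed

lemma measurable_savg [measurable]: "(\<lambda>(w, v). savg m f w v) \<in> borel_measurable (unif01 \<Otimes>\<^sub>M unif_seq)"
proof -
  interpret U: prob_space unif01 by (rule prob_unif01)
  interpret V: prob_space unif_seq by (rule prob_unif_seq)
  have "(\<lambda>z. sval m f (fst (fst (fst z))) (snd z) (snd (fst (fst z))) (snd (fst z))) \<in> borel_measurable (((unif01 \<Otimes>\<^sub>M unif_seq) \<Otimes>\<^sub>M unif_seq) \<Otimes>\<^sub>M unif01)"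
    by (rule measurable_sval) measurable
  then have [measurable]: "(\<lambda>(y, u). sval m f (fst (fst y)) u (snd (fst y)) (snd y)) \<in> borel_measurable (((unif01 \<Otimes>\<^sub>M unif_seq) \<Otimes>\<^sub>M unif_seq) \<Otimes>\<^sub>M unif01)"
    by (simp add: case_prod_beta)
  show ?thesis unfolding savg_def case_prod_beta by measurable
qed

text \<open>Given w and v, the pairs formed by u_l and column l of x are i.i.d. in l. Hence a
  product over replicas integrates to a product of conditional averages.\<close>

lemma seeds_test_fun:
  assumes loc: "\<And>l. l \<in> {1..Q} \<Longrightarrow> local_fun m (f l)"
    and b: "\<And>l y. l \<in> {1..Q} \<Longrightarrow> (\<And>i. i \<in> {1..m} \<Longrightarrow> y i \<in> signs) \<Longrightarrow> \<bar>f l y\<bar> \<le> 1"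
  shows "(\<integral>\<omega>. test_fun m Q f (spin_array \<sigma> \<omega>) \<partial>seeds) = (\<integral>z. (\<Prod>l\<in>{1..Q}. savg m (f l) (fst z) (snd z)) \<partial>(unif01 \<Otimes>\<^sub>M unif_seq))"
proof -
  define PU where "PU = PiM ({1..}::nat set) (\<lambda>_. unif01)"
  define X where "X = PiM array_idx (\<lambda>_. unif01)"
  have prob: "prob_space unif01" "prob_space PU" "prob_space unif_seq" "prob_space X"
    unfolding PU_def X_def by (intro prob_space_PiM prob_unif01 prob_unif_seq)+
  have prs: "prob_space (unif_seq \<Otimes>\<^sub>M X)" "prob_space (PU \<Otimes>\<^sub>M (unif_seq \<Otimes>\<^sub>M X))" by (intro pair_prob prob)+
  have seeds: "seeds = unif01 \<Otimes>\<^sub>M (PU \<Otimes>\<^sub>M (unif_seq \<Otimes>\<^sub>M X))"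
    by (simp add: seeds_def PU_def unif_seq_def X_def)
  define G where "G = (\<lambda>z :: real \<times> (nat \<Rightarrow> real) \<times> (nat \<Rightarrow> real) \<times> (nat \<times> nat \<Rightarrow> real). \<Prod>l\<in>{1..Q}.
     sval m (f l) (fst z) (fst (snd z) l) (fst (snd (snd z))) (\<lambda>i\<in>{1..}. snd (snd (snd z)) (i, l)))"
  have Gb: "\<bar>G z\<bar> \<le> 1" for z unfolding G_def abs_prod by (rule prod_le_1) (simp add: sval_def abs_clip)
  have col: "(\<lambda>x. \<lambda>i\<in>{1..}. x (i, l)) \<in> X \<rightarrow>\<^sub>M unif_seq" if "l \<in> {1..Q}" for l
    unfolding X_def unif_seq_def by (rule measurable_restrict) (use that in \<open>auto simp: array_idx_def intro!: measurable_component_singleton\<close>)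
  have G: "G \<in> borel_measurable (unif01 \<Otimes>\<^sub>M (PU \<Otimes>\<^sub>M (unif_seq \<Otimes>\<^sub>M X)))"
    unfolding G_def
  proof (rule borel_measurable_prod)
    fix l assume l: "l \<in> {1..Q}"
    then have [measurable]: "l \<in> {1..}" by simp
    note [measurable] = col[OF l]
    have [measurable]: "(\<lambda>u. u l) \<in> PU \<rightarrow>\<^sub>M unif01" unfolding PU_def by measurable
    show "(\<lambda>z. sval m (f l) (fst z) (fst (snd z) l) (fst (snd (snd z))) (\<lambda>i\<in>{1..}. snd (snd (snd z)) (i, l)))
       \<in> borel_measurable (unif01 \<Otimes>\<^sub>M (PU \<Otimes>\<^sub>M (unif_seq \<Otimes>\<^sub>M X)))"
    proof (rule measurable_sval)
      show "(\<lambda>z. \<lambda>i\<in>{1..}. snd (snd (snd z)) (i, l)) \<in> unif01 \<Otimes>\<^sub>M PU \<Otimes>\<^sub>M unif_seq \<Otimes>\<^sub>M X \<rightarrow>\<^sub>M unif_seq"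
        by (rule measurable_compose[OF _ col[OF l]]) measurable
    qed measurable
  qed
  have "(\<integral>\<omega>. test_fun m Q f (spin_array \<sigma> \<omega>) \<partial>seeds) = (\<integral>\<omega>. G \<omega> \<partial>seeds)"
  proof (rule Bochner_Integration.integral_cong[OF refl])
    fix \<omega> assume \<omega>: "\<omega> \<in> space seeds"
    obtain w u v x where z: "\<omega> = (w, u, v, x)" by (cases \<omega>) auto
    have sp: "w \<in> space unif01" "v \<in> space unif_seq" "\<And>l. l \<in> {1..Q} \<Longrightarrow> u l \<in> space unif01"
      "\<And>l. l \<in> {1..Q} \<Longrightarrow> (\<lambda>i\<in>{1..}. x (i, l)) \<in> space unif_seq"
      using \<omega> unfolding z seeds by (auto simp: space_pair_measure PU_def X_def unif_seq_def space_PiM PiE_iff array_idx_def)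
    show "test_fun m Q f (spin_array \<sigma> \<omega>) = G \<omega>"
      unfolding test_fun_def G_def z fst_conv snd_conv
    proof (rule prod.cong[OF refl])
      fix l assume l: "l \<in> {1..Q}"
      have s: "\<sigma> (w, u l, v i, (\<lambda>i\<in>{1..}. x (i, l)) i) \<in> signs" if "i \<in> {1..m}" for i
        using that by (intro sigma_in_signs sp l) auto
      have "multilin m (f l) (\<lambda>i. clip (spin_array \<sigma> (w, u, v, x) (i, l))) = multilin m (f l) (\<lambda>i. \<sigma> (w, u l, v i, (\<lambda>i\<in>{1..}. x (i, l)) i))"
      proof -
        have "clip (spin_array \<sigma> (w, u, v, x) (i, l)) = \<sigma> (w, u l, v i, (\<lambda>i\<in>{1..}. x (i, l)) i)" if "i \<in> {1..m}" for i
          using that l clip_signs[OF s[OF that]] by (auto simp: array_idx_def)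
        then show ?thesis unfolding multilin_def by (intro sum.cong refl arg_cong2[where f="(*)"] prod.cong) auto
      qed
      also have "\<dots> = clip \<dots>"
        using multilin_eq[OF loc[OF l] s] b[OF l s] by (simp add: clip_eq)
      finally show "multilin m (f l) (\<lambda>i. clip (spin_array \<sigma> (w, u, v, x) (i, l))) = sval m (f l) w (u l) v (\<lambda>i\<in>{1..}. x (i, l))"
        unfolding sval_def .
    qed
  qed
  also have "\<dots> = (\<integral>w. \<integral>r. G (w, r) \<partial>(PU \<Otimes>\<^sub>M (unif_seq \<Otimes>\<^sub>M X)) \<partial>unif01)"
    unfolding seeds by (rule Fubini_abs_le_1) (use prob prs G Gb in auto)
  also have "\<dots> = (\<integral>w. \<integral>v. (\<Prod>l\<in>{1..Q}. savg m (f l) w v) \<partial>unif_seq \<partial>unif01)"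
  proof (rule Bochner_Integration.integral_cong[OF refl])
    fix w assume w: "w \<in> space unif01"
    have G1: "(\<lambda>r. G (w, r)) \<in> borel_measurable (PU \<Otimes>\<^sub>M (unif_seq \<Otimes>\<^sub>M X))"
      using G w by (rule measurable_compose_Pair1[rotated])
    define H where "H = (\<lambda>s. \<integral>u. G (w, u, s) \<partial>PU)"
    have H: "H \<in> borel_measurable (unif_seq \<Otimes>\<^sub>M X)" unfolding H_def
      by (rule Fubini_abs_le_1(4)) (use prob prs Gb G1 in auto)
    have Hb: "\<bar>H s\<bar> \<le> 1" for s unfolding H_def by (rule prob_space.abs_integral_bounded[OF prob(2)]) (rule Gb)
    have "(\<integral>r. G (w, r) \<partial>(PU \<Otimes>\<^sub>M (unif_seq \<Otimes>\<^sub>M X))) = (\<integral>s. H s \<partial>(unif_seq \<Otimes>\<^sub>M X))"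
      unfolding H_def by (rule Fubini_abs_le_1) (use prob prs G1 Gb in auto)
    also have "\<dots> = (\<integral>v. \<integral>x. H (v, x) \<partial>X \<partial>unif_seq)"
      by (rule Fubini_abs_le_1) (use prob H Hb in auto)
    also have "\<dots> = (\<integral>v. (\<Prod>l\<in>{1..Q}. savg m (f l) w v) \<partial>unif_seq)"
    proof (rule Bochner_Integration.integral_cong[OF refl])
      fix v assume v: "v \<in> space unif_seq"
      have "H (v, x) = (\<Prod>l\<in>{1..Q}. \<integral>u. sval m (f l) w u v (\<lambda>i\<in>{1..}. x (i, l)) \<partial>unif01)" if x: "x \<in> space X" for x
        unfolding H_def G_def PU_def fst_conv snd_conv
      proof (rule integral_PiM_prod)
        fix l assume "l \<in> {1..Q}"
        then have "(\<lambda>i\<in>{1..}. x (i, l)) \<in> space unif_seq" using measurable_space[OF col x] by simp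
        then show "(\<lambda>u. sval m (f l) w u v (\<lambda>i\<in>{1..}. x (i, l))) \<in> borel_measurable unif01"
          using w v by (intro measurable_sval) auto
      qed (auto simp: sval_def abs_clip prob_unif01)
      then have "(\<integral>x. H (v, x) \<partial>X) = (\<integral>x. (\<Prod>l\<in>{1..Q}. \<integral>u. sval m (f l) w u v (\<lambda>i\<in>{1..}. x (i, l)) \<partial>unif01) \<partial>X)"
        by (intro Bochner_Integration.integral_cong refl)
      also have "\<dots> = (\<Prod>l\<in>{1..Q}. savg m (f l) w v)"
        unfolding X_def savg_def unif_seq_def
      proof (rule integral_PiM_columns[OF prob_unif01, of "\<lambda>l \<xi>. \<integral>u. sval m (f l) w u v \<xi> \<partial>unif01"])
        fix l
        interpret U: prob_space unif01 by (rule prob_unif01)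
        have "(\<lambda>z. sval m (f l) w (snd z) v (fst z)) \<in> borel_measurable (unif_seq \<Otimes>\<^sub>M unif01)"
          using w v by (intro measurable_sval) auto
        then have [measurable]: "(\<lambda>(\<xi>, u). sval m (f l) w u v \<xi>) \<in> borel_measurable (unif_seq \<Otimes>\<^sub>M unif01)"
          by (simp add: case_prod_beta)
        show "(\<lambda>\<xi>. \<integral>u. sval m (f l) w u v \<xi> \<partial>unif01) \<in> borel_measurable (PiM {1..} (\<lambda>_. unif01))"
          unfolding unif_seq_def[symmetric] by measurable
      qed (rule integral_sval)
      finally show "(\<integral>x. H (v, x) \<partial>X) = (\<Prod>l\<in>{1..Q}. savg m (f l) w v)" .
    qed
    finally show "(\<integral>r. G (w, r) \<partial>(PU \<Otimes>\<^sub>M (unif_seq \<Otimes>\<^sub>M X))) = (\<integral>v. (\<Prod>l\<in>{1..Q}. savg m (f l) w v) \<partial>unif_seq)" .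
  qed
  also have "\<dots> = (\<integral>z. (\<Prod>l\<in>{1..Q}. savg m (f l) (fst z) (snd z)) \<partial>(unif01 \<Otimes>\<^sub>M unif_seq))"
  proof -
    have "(\<lambda>z. \<Prod>l\<in>{1..Q}. savg m (f l) (fst z) (snd z)) \<in> borel_measurable (unif01 \<Otimes>\<^sub>M unif_seq)"
      using measurable_savg by (intro borel_measurable_prod) (simp add: case_prod_beta)
    moreover have "\<bar>\<Prod>l\<in>{1..Q}. savg m (f l) (fst z) (snd z)\<bar> \<le> 1" for z
      unfolding abs_prod by (rule prod_le_1) (simp add: integral_sval)
    ultimately show ?thesis by (subst Fubini_abs_le_1(1)[OF prob(1,3)]) auto
  qed
  finally show ?thesis .
qed

end

text \<open>The convergence of replica averages is assumed directly instead of membership in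
  \<open>limit_laws\<close>: it will be used for the centered interaction, whose replica averages
  coincide with the original ones.\<close>

locale spin_limit = interaction_law + spin_function +
  fixes S :: "nat \<Rightarrow> nat" and \<alpha> :: real and c :: "nat \<Rightarrow> real"
  assumes S: "strict_mono S"
    and replica_conv: "\<And>Q m f. (\<And>l. l \<in> {1..Q} \<Longrightarrow> local_fun m (f l)) \<Longrightarrow>
      (\<And>l \<epsilon>. l \<in> {1..Q} \<Longrightarrow> \<epsilon> \<in> configs m \<Longrightarrow> \<bar>f l \<epsilon>\<bar> \<le> 1) \<Longrightarrow>
      (\<lambda>k. \<integral>d. (\<Prod>l\<in>{1..Q}. gav (S k) (wt p (S k) d) (f l)) \<partial>disorder_law L p \<alpha> c (S k))
      \<longlonglongrightarrow> (\<integral>\<omega>. test_fun m Q f (spin_array \<sigma> \<omega>) \<partial>seeds)"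
begin

lemma gav_wt_range:
  assumes "\<And>\<sigma>'. \<sigma>' \<in> configs N \<Longrightarrow> g \<sigma>' \<in> {a..b}"
  shows "gav N (wt p N d) g \<in> {a..b}"
proof -
  let ?Z = "\<Sum>\<sigma>\<in>configs N. \<bar>wt p N d \<sigma>\<bar>"
  have Z: "0 < ?Z" by (intro sum_pos) (auto simp: wt_def)
  have "(\<Sum>\<sigma>\<in>configs N. \<bar>wt p N d \<sigma>\<bar> * a) \<le> (\<Sum>\<sigma>\<in>configs N. \<bar>wt p N d \<sigma>\<bar> * g \<sigma>)"
    "(\<Sum>\<sigma>\<in>configs N. \<bar>wt p N d \<sigma>\<bar> * g \<sigma>) \<le> (\<Sum>\<sigma>\<in>configs N. \<bar>wt p N d \<sigma>\<bar> * b)"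
    using assms by (auto intro!: sum_mono mult_left_mono)
  then have "?Z * a \<le> (\<Sum>\<sigma>\<in>configs N. \<bar>wt p N d \<sigma>\<bar> * g \<sigma>)" "(\<Sum>\<sigma>\<in>configs N. \<bar>wt p N d \<sigma>\<bar> * g \<sigma>) \<le> ?Z * b"
    unfolding sum_distrib_right[symmetric] by auto
  moreover have "s / z \<in> {a..b}" if "z * a \<le> s" "s \<le> z * b" "0 < z" for s z :: real
    using that by (simp add: le_divide_eq divide_le_eq mult.commute)
  ultimately show ?thesis unfolding gav_def using Z by blast
qed

lemma configs_signs: "\<sigma>' \<in> configs N \<Longrightarrow> i \<in> {1..N} \<Longrightarrow> \<sigma>' i \<in> signs"
  by (auto simp: configs_def PiE_iff)

lemma replica_limit_savg:
  fixes f :: "nat \<Rightarrow> (nat \<Rightarrow> real) \<Rightarrow> real" and Q :: nat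
  assumes loc: "\<And>l. l \<in> {1..Q} \<Longrightarrow> local_fun m (f l)"
    and b: "\<And>l y. l \<in> {1..Q} \<Longrightarrow> (\<And>i. i \<in> {1..m} \<Longrightarrow> y i \<in> signs) \<Longrightarrow> \<bar>f l y\<bar> \<le> 1"
  shows "(\<lambda>k. \<integral>d. (\<Prod>l\<in>{1..Q}. gav (S k) (wt p (S k) d) (f l)) \<partial>disorder_law L p \<alpha> c (S k))
    \<longlonglongrightarrow> (\<integral>z. (\<Prod>l\<in>{1..Q}. savg m (f l) (fst z) (snd z)) \<partial>(unif01 \<Otimes>\<^sub>M unif_seq))"
proof -
  have "(\<integral>\<omega>. test_fun m Q f (spin_array \<sigma> \<omega>) \<partial>seeds) = (\<integral>z. (\<Prod>l\<in>{1..Q}. savg m (f l) (fst z) (snd z)) \<partial>(unif01 \<Otimes>\<^sub>M unif_seq))"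
    by (rule seeds_test_fun) (use loc b in auto)
  moreover have "(\<lambda>k. \<integral>d. (\<Prod>l\<in>{1..Q}. gav (S k) (wt p (S k) d) (f l)) \<partial>disorder_law L p \<alpha> c (S k))
    \<longlonglongrightarrow> (\<integral>\<omega>. test_fun m Q f (spin_array \<sigma> \<omega>) \<partial>seeds)"
    by (rule replica_conv) (use loc b configs_signs in auto)
  ultimately show ?thesis by (simp only:)
qed

text \<open>Multiplying by the i-th power of the denominator amounts to adding i replicas that all
  carry \<open>g\<close>, so the mixed moments are replica averages again;
  \<open>ratio_limit\<close> then performs the division.\<close>

lemma ratio_replica_limit:
  assumes loc: "\<And>l. l \<in> {1..q} \<Longrightarrow> local_fun m (f l)" "local_fun m g"
    and b: "\<And>l y. l \<in> {1..q} \<Longrightarrow> (\<And>i. i \<in> {1..m} \<Longrightarrow> y i \<in> signs) \<Longrightarrow> \<bar>f l y\<bar> \<le> 1"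
    and g: "\<And>y. (\<And>i. i \<in> {1..m} \<Longrightarrow> y i \<in> signs) \<Longrightarrow> g y \<in> {\<delta>..1}" and \<delta>: "0 < \<delta>"
  shows "(\<lambda>k. \<integral>d. (\<Prod>l\<in>{1..q}. gav (S k) (wt p (S k) d) (f l)) / gav (S k) (wt p (S k) d) g ^ q \<partial>disorder_law L p \<alpha> c (S k))
    \<longlonglongrightarrow> (\<integral>z. (\<Prod>l\<in>{1..q}. savg m (f l) (fst z) (snd z)) / savg m g (fst z) (snd z) ^ q \<partial>(unif01 \<Otimes>\<^sub>M unif_seq))"
proof -
  \<comment> \<open>The sequence is shifted so that every system has at least m sites and the bounds
    on \<open>f\<close> and \<open>g\<close> hold without exception.\<close>
  have ev: "m \<le> S (k + m)" for k using seq_suble[OF S, of "k + m"] by simp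
  have gb: "(\<And>i. i \<in> {1..m} \<Longrightarrow> y i \<in> signs) \<Longrightarrow> \<bar>g y\<bar> \<le> 1" for y using g[of y] \<delta> by fastforce
  interpret U: prob_space unif01 by (rule prob_unif01)
  interpret V: prob_space unif_seq by (rule prob_unif_seq)
  let ?N = "\<lambda>k. S (k + m)"
  have m1: "(\<lambda>d. gav (?N k) (wt p (?N k) d) h) \<in> borel_measurable (disorder_law L p \<alpha> c (?N k))" for k h
    by (rule measurable_compose[OF measurable_wt measurable_gav])
  have m2: "(\<lambda>z. savg m h (fst z) (snd z)) \<in> borel_measurable (unif01 \<Otimes>\<^sub>M unif_seq)" for h
    using measurable_savg[of m h] by (simp add: case_prod_beta)
  have "(\<lambda>k. \<integral>d. (\<Prod>l\<in>{1..q}. gav (?N k) (wt p (?N k) d) (f l)) / gav (?N k) (wt p (?N k) d) g ^ q \<partial>disorder_law L p \<alpha> c (?N k))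
    \<longlonglongrightarrow> (\<integral>z. (\<Prod>l\<in>{1..q}. savg m (f l) (fst z) (snd z)) / savg m g (fst z) (snd z) ^ q \<partial>(unif01 \<Otimes>\<^sub>M unif_seq))"
  proof (rule ratio_limit[where \<delta>=\<delta>])
    show "prob_space (disorder_law L p \<alpha> c (?N k))" for k by (rule prob_disorder)
    show "prob_space (unif01 \<Otimes>\<^sub>M unif_seq)" by (intro pair_prob prob_unif01 prob_unif_seq)
    show "\<bar>\<Prod>l\<in>{1..q}. gav (?N k) (wt p (?N k) d) (f l)\<bar> \<le> 1" for k d
      unfolding abs_prod
    proof (intro prod_le_1 conjI abs_ge_zero abs_gav_le)
      fix l \<sigma>' assume l: "l \<in> {1..q}" and \<sigma>': "\<sigma>' \<in> configs (?N k)"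
      show "\<bar>f l \<sigma>'\<bar> \<le> 1"
      proof (rule b[OF l])
        fix i assume "i \<in> {1..m}"
        then show "\<sigma>' i \<in> signs" using ev[of k] by (intro configs_signs[OF \<sigma>']) auto
      qed
    qed simp
    show "\<bar>\<Prod>l\<in>{1..q}. savg m (f l) (fst z) (snd z)\<bar> \<le> 1" for z
      unfolding abs_prod by (rule prod_le_1) (simp add: integral_sval)
    show "gav (?N k) (wt p (?N k) d) g \<in> {\<delta>..1}" for k d
    proof (rule gav_wt_range, rule g)
      fix \<sigma>' i assume "\<sigma>' \<in> configs (?N k)" "i \<in> {1..m}"
      then show "\<sigma>' i \<in> signs" using ev[of k] by (auto intro: configs_signs)
    qed
    show "savg m g (fst z) (snd z) \<in> {\<delta>..1}" if z: "z \<in> space (unif01 \<Otimes>\<^sub>M unif_seq)" for z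
    proof -
      have w: "fst z \<in> space unif01" and v: "snd z \<in> space unif_seq" using z by (auto simp: space_pair_measure)
      have sv: "sval m g (fst z) u (snd z) x \<in> {\<delta>..1}" if "u \<in> space unif01" "x \<in> space unif_seq" for u x
        using sval_eq[OF w that(1) v that(2) loc(2) gb] g sigma_in_signs[OF w that(1) v that(2)] by simp
      have su: "(\<integral>u. sval m g (fst z) u (snd z) x \<partial>unif01) \<in> {\<delta>..1}" if x: "x \<in> space unif_seq" for x
      proof -
        have i: "integrable unif01 (\<lambda>u. sval m g (fst z) u (snd z) x)"
          by (rule U.integrable_const_bound[where B=1]) (use w v x in \<open>auto intro!: measurable_sval simp: abs_sval\<close>)
        have "(\<integral>u. \<delta> \<partial>unif01) \<le> (\<integral>u. sval m g (fst z) u (snd z) x \<partial>unif01)"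
          using i sv x by (intro integral_mono) auto
        moreover have "(\<integral>u. sval m g (fst z) u (snd z) x \<partial>unif01) \<le> (\<integral>u. 1 \<partial>unif01)"
          using i sv x by (intro integral_mono) auto
        ultimately show ?thesis by (simp add: U.prob_space)
      qed
      have "(\<lambda>zz. sval m g (fst z) (snd zz) (snd z) (fst zz)) \<in> borel_measurable (unif_seq \<Otimes>\<^sub>M unif01)"
        using w v by (intro measurable_sval) auto
      then have [measurable]: "(\<lambda>(\<xi>, u). sval m g (fst z) u (snd z) \<xi>) \<in> borel_measurable (unif_seq \<Otimes>\<^sub>M unif01)"
        by (simp add: case_prod_beta)
      have i: "integrable unif_seq (\<lambda>x. \<integral>u. sval m g (fst z) u (snd z) x \<partial>unif01)"
        by (rule V.integrable_const_bound[where B=1]) (auto simp: integral_sval)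
      have "(\<integral>x. \<delta> \<partial>unif_seq) \<le> savg m g (fst z) (snd z)" "savg m g (fst z) (snd z) \<le> (\<integral>x. 1 \<partial>unif_seq)"
        unfolding savg_def using i su by (intro integral_mono; simp)+
      then show ?thesis by (simp add: V.prob_space)
    qed
    fix i
    let ?f = "\<lambda>l. if l \<le> q then f l else g"
    have split: "(\<Prod>l\<in>{1..q+i}. h (?f l)) = (\<Prod>l\<in>{1..q}. h (f l)) * h g ^ i" for h :: "((nat \<Rightarrow> real) \<Rightarrow> real) \<Rightarrow> real"
    proof -
      have "{1..q+i} = {1..q} \<union> {q+1..q+i}" by auto
      then have "(\<Prod>l\<in>{1..q+i}. h (?f l)) = (\<Prod>l\<in>{1..q}. h (?f l)) * (\<Prod>l\<in>{q+1..q+i}. h (?f l))"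
        by (simp only:) (rule prod.union_disjoint, auto)
      also have "(\<Prod>l\<in>{q+1..q+i}. h (?f l)) = (\<Prod>l\<in>{q+1..q+i}. h g)" by (intro prod.cong) auto
      finally show ?thesis by simp
    qed
    have "(\<lambda>k. \<integral>d. (\<Prod>l\<in>{1..q+i}. gav (S k) (wt p (S k) d) (?f l)) \<partial>disorder_law L p \<alpha> c (S k))
      \<longlonglongrightarrow> (\<integral>z. (\<Prod>l\<in>{1..q+i}. savg m (?f l) (fst z) (snd z)) \<partial>(unif01 \<Otimes>\<^sub>M unif_seq))"
      by (rule replica_limit_savg) (use loc b gb in auto)
    then show "(\<lambda>k. \<integral>d. (\<Prod>l\<in>{1..q}. gav (?N k) (wt p (?N k) d) (f l)) * gav (?N k) (wt p (?N k) d) g ^ i \<partial>disorder_law L p \<alpha> c (?N k))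
      \<longlonglongrightarrow> (\<integral>z. (\<Prod>l\<in>{1..q}. savg m (f l) (fst z) (snd z)) * savg m g (fst z) (snd z) ^ i \<partial>(unif01 \<Otimes>\<^sub>M unif_seq))"
      unfolding split[of "gav _ _"] split[of "\<lambda>h. savg m h _ _"] by (rule LIMSEQ_ignore_initial_segment)
  qed (use m1 m2 \<delta> in \<open>auto intro!: borel_measurable_prod\<close>)
  then show ?thesis by (rule LIMSEQ_offset)
qed

end

section \<open>The cavity functionals of a finite system\<close>

definition merge_config :: "nat \<Rightarrow> nat \<Rightarrow> (nat \<Rightarrow> real) \<Rightarrow> (nat \<Rightarrow> real) \<Rightarrow> nat \<Rightarrow> real" where
  "merge_config N n \<sigma> \<epsilon> = (\<lambda>i\<in>{1..N+n}. if i \<le> N then \<sigma> i else \<epsilon> (i - N))"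

lemma merge_configs:
  assumes "\<sigma> \<in> configs N" "\<epsilon> \<in> configs n"
  shows "merge_config N n \<sigma> \<epsilon> \<in> configs (N + n)"
  unfolding configs_def merge_config_def
proof (rule restrict_PiE_iff[THEN iffD2], rule ballI)
  fix i assume i: "i \<in> {1..N + n}"
  show "(if i \<le> N then \<sigma> i else \<epsilon> (i - N)) \<in> signs"
  proof (cases "i \<le> N")
    case False
    then have "i - N \<in> {1..n}" using i by auto
    then show ?thesis using assms(2) False by (auto simp: configs_def)
  qed (use i assms(1) in \<open>auto simp: configs_def\<close>)
qed

lemma sum_configs_add:
  fixes G :: "(nat \<Rightarrow> real) \<Rightarrow> real"
  shows "(\<Sum>\<tau>\<in>configs (N + n). G \<tau>) = (\<Sum>\<sigma>\<in>configs N. \<Sum>\<epsilon>\<in>configs n. G (merge_config N n \<sigma> \<epsilon>))"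
proof -
  have bij: "bij_betw (\<lambda>(\<sigma>, \<epsilon>). merge_config N n \<sigma> \<epsilon>) (configs N \<times> configs n) (configs (N + n))"
  proof (rule bij_betwI[where g="\<lambda>\<tau>. (restrict \<tau> {1..N}, \<lambda>i\<in>{1..n}. \<tau> (N + i))"])
    show "(\<lambda>(\<sigma>, \<epsilon>). merge_config N n \<sigma> \<epsilon>) \<in> configs N \<times> configs n \<rightarrow> configs (N + n)"
      using merge_configs by auto
    show "(\<lambda>\<tau>. (restrict \<tau> {1..N}, \<lambda>i\<in>{1..n}. \<tau> (N + i))) \<in> configs (N + n) \<rightarrow> configs N \<times> configs n"
      by (auto simp: configs_def PiE_iff)
  next
    fix x assume "x \<in> configs N \<times> configs n"
    then obtain \<sigma> \<epsilon> where x: "x = (\<sigma>, \<epsilon>)" "\<sigma> \<in> configs N" "\<epsilon> \<in> configs n" by auto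
    have "restrict (merge_config N n \<sigma> \<epsilon>) {1..N} = \<sigma>"
      using x(2) by (auto simp: configs_def merge_config_def PiE_iff extensional_def fun_eq_iff)
    moreover have "(\<lambda>i\<in>{1..n}. merge_config N n \<sigma> \<epsilon> (N + i)) = \<epsilon>"
      using x(3) by (auto simp: configs_def merge_config_def PiE_iff extensional_def fun_eq_iff)
    ultimately show "(\<lambda>\<tau>. (restrict \<tau> {1..N}, \<lambda>i\<in>{1..n}. \<tau> (N + i))) ((\<lambda>(\<sigma>, \<epsilon>). merge_config N n \<sigma> \<epsilon>) x) = x"
      using x(1) by simp
  next
    fix \<tau> assume "\<tau> \<in> configs (N + n)"
    then show "(\<lambda>(\<sigma>, \<epsilon>). merge_config N n \<sigma> \<epsilon>) ((\<lambda>\<tau>. (restrict \<tau> {1..N}, \<lambda>i\<in>{1..n}. \<tau> (N + i))) \<tau>) = \<tau>"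
      by (auto simp: configs_def merge_config_def PiE_iff extensional_def fun_eq_iff)
  qed
  have "(\<Sum>\<tau>\<in>configs (N + n). G \<tau>) = (\<Sum>(\<sigma>, \<epsilon>)\<in>configs N \<times> configs n. G (merge_config N n \<sigma> \<epsilon>))"
    by (subst sum.reindex_bij_betw[OF bij, symmetric]) (simp add: case_prod_beta)
  then show ?thesis by (simp add: sum.cartesian_product)
qed

text \<open>
  The integrand of \<open>U\<^sub>l\<close> as a function of a configuration \<open>y\<close> on all sites, the multi-index
  \<open>I\<close> being located at the site \<open>site_code I\<close> (without hat) or \<open>site_code_hat I\<close> (with hat).
  For \<open>D = {}\<close> it is the integrand of \<open>V\<close>.
\<close>
definition cavU :: "nat \<Rightarrow> nat \<Rightarrow> nat \<Rightarrow> nat \<Rightarrow> nat set \<Rightarrow> (nat \<Rightarrow> nat) \<Rightarrow> (nat \<times> nat \<Rightarrow> interaction) \<Rightarrow> (nat \<Rightarrow> interaction) \<Rightarrow> (nat \<Rightarrow> real) \<Rightarrow> real" where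
  "cavU p n r m D P \<theta> \<theta>h y = Av (configs n) (\<lambda>\<epsilon>. (\<Prod>i\<in>D \<inter> {1..n}. \<epsilon> i) *
     exp (\<Sum>i=1..n. \<Sum>k=1..P i. \<theta> (k, i) (\<epsilon> i # map (\<lambda>j. y (site_code [j, i, k])) [1..<p])) *
     (\<Prod>i\<in>D \<inter> {n+1..m}. y (site_code [i])) *
     exp (\<Sum>k=1..r. \<theta>h k (map (\<lambda>j. y (site_code_hat [j, k])) [1..<Suc p])))"

definition sites_used :: "nat \<Rightarrow> nat \<Rightarrow> nat \<Rightarrow> nat \<Rightarrow> (nat \<Rightarrow> nat) \<Rightarrow> nat set" where
  "sites_used p n r m P = site_code ` (\<Union>j\<in>{..p}. \<Union>i\<in>{..n}. \<Union>k\<in>{..P i}. {[j, i, k]}) \<union> site_code ` ((\<lambda>i. [i]) ` {..m}) \<union>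
     site_code_hat ` (\<Union>j\<in>{..p}. \<Union>k\<in>{..r}. {[j, k]})"

definition site_bound :: "nat \<Rightarrow> nat \<Rightarrow> nat \<Rightarrow> nat \<Rightarrow> (nat \<Rightarrow> nat) \<Rightarrow> nat" where
  "site_bound p n r m P = Max (sites_used p n r m P)"

lemma site_bounds:
  shows "j \<le> p \<Longrightarrow> i \<le> n \<Longrightarrow> k \<le> P i \<Longrightarrow> site_code [j, i, k] \<in> {1..site_bound p n r m P}"
    and "i \<le> m \<Longrightarrow> site_code [i] \<in> {1..site_bound p n r m P}"
    and "j \<le> p \<Longrightarrow> k \<le> r \<Longrightarrow> site_code_hat [j, k] \<in> {1..site_bound p n r m P}"
proof -
  have fin: "finite (sites_used p n r m P)" unfolding sites_used_def by auto
  have *: "x \<le> site_bound p n r m P" if "x \<in> sites_used p n r m P" for x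
    unfolding site_bound_def using fin that by (rule Max_ge)
  have pos: "1 \<le> site_code I" "1 \<le> site_code_hat I" for I by (auto simp: site_code_def site_code_hat_def)
  show "j \<le> p \<Longrightarrow> i \<le> n \<Longrightarrow> k \<le> P i \<Longrightarrow> site_code [j, i, k] \<in> {1..site_bound p n r m P}"
    using pos by (auto intro!: * simp: sites_used_def)
  show "i \<le> m \<Longrightarrow> site_code [i] \<in> {1..site_bound p n r m P}"
    using pos by (auto intro!: * simp: sites_used_def)
  show "j \<le> p \<Longrightarrow> k \<le> r \<Longrightarrow> site_code_hat [j, k] \<in> {1..site_bound p n r m P}"
    using pos by (auto intro!: * simp: sites_used_def)
qed

lemma local_cavU: "local_fun (site_bound p n r m P) (cavU p n r m D P \<theta> \<theta>h)"
  unfolding local_fun_def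
proof (intro allI impI)
  fix y y' :: "nat \<Rightarrow> real"
  assume eq: "\<forall>i\<in>{1..site_bound p n r m P}. y i = y' i"
  have 1: "map (\<lambda>j. y (site_code [j, i, k])) [1..<p] = map (\<lambda>j. y' (site_code [j, i, k])) [1..<p]"
    if "i \<in> {1..n}" "k \<in> {1..P i}" for i k
    using that by (intro map_cong refl eq[rule_format] site_bounds) auto
  have 2: "y (site_code [i]) = y' (site_code [i])" if "i \<in> D \<inter> {n+1..m}" for i
    using that by (intro eq[rule_format] site_bounds) auto
  have 3: "map (\<lambda>j. y (site_code_hat [j, k])) [1..<Suc p] = map (\<lambda>j. y' (site_code_hat [j, k])) [1..<Suc p]"
    if "k \<in> {1..r}" for k
    using that by (intro map_cong refl eq[rule_format] site_bounds) auto
  have "(\<Sum>i=1..n. \<Sum>k=1..P i. \<theta> (k, i) (\<epsilon> i # map (\<lambda>j. y (site_code [j, i, k])) [1..<p])) =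
     (\<Sum>i=1..n. \<Sum>k=1..P i. \<theta> (k, i) (\<epsilon> i # map (\<lambda>j. y' (site_code [j, i, k])) [1..<p]))" for \<epsilon> :: "nat \<Rightarrow> real"
    by (intro sum.cong refl) (simp only: 1)
  moreover have "(\<Prod>i\<in>D \<inter> {n+1..m}. y (site_code [i])) = (\<Prod>i\<in>D \<inter> {n+1..m}. y' (site_code [i]))"
    by (intro prod.cong refl 2)
  moreover have "(\<Sum>k=1..r. \<theta>h k (map (\<lambda>j. y (site_code_hat [j, k])) [1..<Suc p])) =
    (\<Sum>k=1..r. \<theta>h k (map (\<lambda>j. y' (site_code_hat [j, k])) [1..<Suc p]))"
    by (intro sum.cong refl) (simp only: 3)
  ultimately show "cavU p n r m D P \<theta> \<theta>h y = cavU p n r m D P \<theta> \<theta>h y'"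
    unfolding cavU_def by (simp only:)
qed

lemma abs_prod_signs: "(\<And>i. i \<in> A \<Longrightarrow> y i \<in> signs) \<Longrightarrow> \<bar>\<Prod>i\<in>A. y i\<bar> = (1::real)"
  unfolding abs_prod by (intro prod.neutral) (force simp: signs_def)

lemma cavU_pos: "0 < cavU p n r m {} P \<theta> \<theta>h y"
  unfolding cavU_def Av_def
  by (intro divide_pos_pos sum_pos) (auto simp: card_gt_0_iff)

lemma abs_cavU_le:
  assumes y: "\<And>i. i \<in> {1..site_bound p n r m P} \<Longrightarrow> y i \<in> signs"
  shows "\<bar>cavU p n r m D P \<theta> \<theta>h y\<bar> \<le> cavU p n r m {} P \<theta> \<theta>h y"
proof -
  let ?W = "\<lambda>\<epsilon>. exp (\<Sum>i=1..n. \<Sum>k=1..P i. \<theta> (k, i) (\<epsilon> i # map (\<lambda>j. y (site_code [j, i, k])) [1..<p]))"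
  let ?H = "exp (\<Sum>k=1..r. \<theta>h k (map (\<lambda>j. y (site_code_hat [j, k])) [1..<Suc p]))"
  have "\<bar>\<Sum>\<epsilon>\<in>configs n. (\<Prod>i\<in>D \<inter> {1..n}. \<epsilon> i) * ?W \<epsilon> * (\<Prod>i\<in>D \<inter> {n+1..m}. y (site_code [i])) * ?H\<bar>
    \<le> (\<Sum>\<epsilon>\<in>configs n. ?W \<epsilon> * ?H)"
  proof (rule order_trans[OF sum_abs], rule sum_mono)
    fix \<epsilon> assume "\<epsilon> \<in> configs n"
    then have "\<bar>\<Prod>i\<in>D \<inter> {1..n}. \<epsilon> i\<bar> = 1" by (intro abs_prod_signs) (auto simp: configs_def PiE_iff)
    moreover have "\<bar>\<Prod>i\<in>D \<inter> {n+1..m}. y (site_code [i])\<bar> = 1"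
      by (intro abs_prod_signs y site_bounds) auto
    ultimately show "\<bar>(\<Prod>i\<in>D \<inter> {1..n}. \<epsilon> i) * ?W \<epsilon> * (\<Prod>i\<in>D \<inter> {n+1..m}. y (site_code [i])) * ?H\<bar> \<le> ?W \<epsilon> * ?H"
      by (simp only: abs_mult abs_exp_cancel mult_1_left mult_1_right order_refl)
  qed
  then show ?thesis unfolding cavU_def Av_def
    by (simp add: abs_divide divide_right_mono del: upt_Suc)
qed

text \<open>A positive function of finitely many spins takes finitely many values. The bounds depend
  on the interactions, which is why the limit is first taken for fixed ones.\<close>

lemma cavU_bounds:
  obtains \<delta> B where "0 < \<delta>" "0 < B" "\<And>y. (\<And>i. i \<in> {1..site_bound p n r m P} \<Longrightarrow> y i \<in> signs) \<Longrightarrow> cavU p n r m {} P \<theta> \<theta>h y \<in> {\<delta>..B}"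
proof -
  let ?K = "site_bound p n r m P"
  let ?S = "cavU p n r m {} P \<theta> \<theta>h ` configs ?K"
  have S: "finite ?S" "?S \<noteq> {}" by auto
  have in_S: "cavU p n r m {} P \<theta> \<theta>h y \<in> ?S" if "\<And>i. i \<in> {1..?K} \<Longrightarrow> y i \<in> signs" for y
  proof -
    have "cavU p n r m {} P \<theta> \<theta>h y = cavU p n r m {} P \<theta> \<theta>h (restrict y {1..?K})"
      using local_cavU[of p n r m P "{}" \<theta> \<theta>h] unfolding local_fun_def by (metis restrict_apply')
    moreover have "restrict y {1..?K} \<in> configs ?K" using that by (auto simp: configs_def)
    ultimately show ?thesis by blast
  qed
  have "Min ?S \<in> ?S" "Max ?S \<in> ?S" using S by (auto simp del: finite_imageI)
  then have "0 < Min ?S" "0 < Max ?S" using cavU_pos by (metis (no_types, lifting) imageE)+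
  moreover have "cavU p n r m {} P \<theta> \<theta>h y \<in> {Min ?S..Max ?S}" if "\<And>i. i \<in> {1..?K} \<Longrightarrow> y i \<in> signs" for y
    using in_S[OF that] S by simp
  ultimately show ?thesis using that by blast
qed

definition cav_pairs :: "nat \<Rightarrow> (nat \<Rightarrow> nat) \<Rightarrow> (nat \<times> nat) set" where
  "cav_pairs n P = (\<lambda>(i, k). (k, i)) ` (SIGMA i:{1..n}. {1..P i})"

lemma finite_cav_pairs [simp]: "finite (cav_pairs n P)"
  unfolding cav_pairs_def by auto

lemma prod_cav_pairs:
  fixes g :: "nat \<times> nat \<Rightarrow> real"
  shows "(\<Prod>x\<in>cav_pairs n P. exp (g x)) = exp (\<Sum>i=1..n. \<Sum>k=1..P i. g (k, i))"
proof -
  have "(\<Prod>x\<in>cav_pairs n P. exp (g x)) = exp (\<Sum>x\<in>cav_pairs n P. g x)" by (simp add: exp_sum)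
  also have "(\<Sum>x\<in>cav_pairs n P. g x) = (\<Sum>(i, k)\<in>(SIGMA i:{1..n}. {1..P i}). g (k, i))"
    unfolding cav_pairs_def by (subst sum.reindex) (auto simp: inj_on_def intro!: sum.cong)
  also have "\<dots> = (\<Sum>i=1..n. \<Sum>k=1..P i. g (k, i))"
    by (rule sum.Sigma[symmetric]) auto
  finally show ?thesis .
qed

lemma slots_fixed_cav:
  "slots_fixed (cav_slots p N n P) = image_mset (\<lambda>(k, i). Th ((N + i) # map (\<lambda>j. site_code [j, i, k]) [1..<p])) (mset_set (cav_pairs n P))"
proof -
  define prs where "prs = concat (map (\<lambda>i. map (\<lambda>k. (k, i)) [1..<Suc (P i)]) [1..<Suc n])"
  have d: "distinct prs" unfolding prs_def
  proof (rule distinct_concat_map)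
    show "distinct (map (\<lambda>k. (k, i)) [1..<Suc (P i)])" for i :: nat by (simp add: distinct_map inj_on_def del: upt_Suc)
  qed (auto simp del: upt_Suc)
  have s: "set prs = cav_pairs n P" unfolding prs_def cav_pairs_def by (force simp del: upt_Suc)
  have "cav_slots p N n P = map (\<lambda>(k, i). ([N + i], map (\<lambda>j. site_code [j, i, k]) [1..<p])) prs"
    unfolding cav_slots_def prs_def by (simp add: map_concat comp_def del: upt_Suc)
  then have "slots_fixed (cav_slots p N n P) = image_mset (\<lambda>(k, i). Th ((N + i) # map (\<lambda>j. site_code [j, i, k]) [1..<p])) (mset prs)"
    unfolding slots_fixed_def by (simp add: multiset.map_comp comp_def split_def)
  then show ?thesis using d s by (simp add: mset_set_set[symmetric])
qed

lemma slots_fixed_hat: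
  "slots_fixed (hat_slots p r) = image_mset (\<lambda>k. Th (map (\<lambda>j. site_code_hat [j, k]) [1..<Suc p])) (mset_set {1..r})"
  by (simp add: slots_fixed_def hat_slots_def atLeastLessThanSuc_atLeastAtMost comp_def del: upt_Suc)

text \<open>The place of the observed spin i in the system with N + n sites: the first n observed
  spins sit on the cavity sites, the others on the old sites that code [i].\<close>

definition cav_site :: "nat \<Rightarrow> nat \<Rightarrow> nat \<Rightarrow> nat" where
  "cav_site N n i = (if i \<le> n then N + i else site_code [i])"

definition obs :: "(nat \<Rightarrow> nat set) \<Rightarrow> nat \<Rightarrow> nat \<Rightarrow> nat \<Rightarrow> (nat \<Rightarrow> real) \<Rightarrow> real" where
  "obs C N n l \<sigma> = (\<Prod>i\<in>C l. \<sigma> (cav_site N n i))"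

text \<open>The cavity spins are summed out for each configuration of the old sites. Dividing
  numerator and denominator by the total old weight makes both Gibbs averages of the system with N
  sites, and this is where U_l and V come from.\<close>

lemma gav_cavity:
  fixes \<theta> :: "nat \<times> nat \<Rightarrow> interaction" and \<theta>h :: "nat \<Rightarrow> interaction"
  assumes C: "D \<subseteq> {1..m}" "n \<le> m" and N: "site_bound p n r m P \<le> N"
  shows "gav (N + n) (\<lambda>\<tau>\<in>configs (N + n). (\<lambda>\<tau>\<in>configs (N + n). lift_weight N n w \<tau> *
      (\<Prod>k\<in>{1..r}. exp (\<theta>h k (map \<tau> (map (\<lambda>j. site_code_hat [j, k]) [1..<Suc p]))))) \<tau> *
      (\<Prod>x\<in>cav_pairs n P. exp (\<theta> x (map \<tau> (case x of (k, i) \<Rightarrow> (N + i) # map (\<lambda>j. site_code [j, i, k]) [1..<p])))))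
      (\<lambda>\<tau>. \<Prod>i\<in>D. \<tau> (cav_site N n i)) =
    gav N w (cavU p n r m D P \<theta> \<theta>h) / gav N w (cavU p n r m {} P \<theta> \<theta>h)"
proof -
  let ?W = "\<lambda>\<tau>\<in>configs (N + n). (\<lambda>\<tau>\<in>configs (N + n). lift_weight N n w \<tau> *
      (\<Prod>k\<in>{1..r}. exp (\<theta>h k (map \<tau> (map (\<lambda>j. site_code_hat [j, k]) [1..<Suc p]))))) \<tau> *
      (\<Prod>x\<in>cav_pairs n P. exp (\<theta> x (map \<tau> (case x of (k, i) \<Rightarrow> (N + i) # map (\<lambda>j. site_code [j, i, k]) [1..<p]))))"
  let ?m = "merge_config N n"
  have mc: "?m \<sigma> \<epsilon> \<in> configs (N + n)" if "\<sigma> \<in> configs N" "\<epsilon> \<in> configs n" for \<sigma> \<epsilon>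
    using that by (rule merge_configs)
  have in_N: "?m \<sigma> \<epsilon> i = \<sigma> i" if "i \<in> {1..site_bound p n r m P}" for \<sigma> \<epsilon> i
    using that N by (auto simp: merge_config_def)
  have W: "\<bar>?W (?m \<sigma> \<epsilon>)\<bar> = \<bar>w \<sigma>\<bar> * (exp (\<Sum>i=1..n. \<Sum>k=1..P i. \<theta> (k, i) (\<epsilon> i # map (\<lambda>j. \<sigma> (site_code [j, i, k])) [1..<p])) *
     exp (\<Sum>k=1..r. \<theta>h k (map (\<lambda>j. \<sigma> (site_code_hat [j, k])) [1..<Suc p])))"
    if \<sigma>: "\<sigma> \<in> configs N" and \<epsilon>: "\<epsilon> \<in> configs n" for \<sigma> \<epsilon>
  proof -
    have r: "restrict (?m \<sigma> \<epsilon>) {1..N} = \<sigma>"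
      using \<sigma> by (auto simp: configs_def merge_config_def PiE_iff extensional_def fun_eq_iff)
    have "map (?m \<sigma> \<epsilon>) ((N + i) # map (\<lambda>j. site_code [j, i, k]) [1..<p]) = \<epsilon> i # map (\<lambda>j. \<sigma> (site_code [j, i, k])) [1..<p]"
      if "i \<in> {1..n}" "k \<in> {1..P i}" for i k
    proof -
      have "?m \<sigma> \<epsilon> (site_code [j, i, k]) = \<sigma> (site_code [j, i, k])" if "j \<in> set [1..<p]" for j
        using that \<open>i \<in> {1..n}\<close> \<open>k \<in> {1..P i}\<close> by (intro in_N site_bounds) auto
      moreover have "?m \<sigma> \<epsilon> (N + i) = \<epsilon> i" using that by (auto simp: merge_config_def)
      ultimately show ?thesis by simp
    qed
    then have "(\<Sum>i=1..n. \<Sum>k=1..P i. \<theta> (k, i) (map (?m \<sigma> \<epsilon>) ((N + i) # map (\<lambda>j. site_code [j, i, k]) [1..<p]))) =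
      (\<Sum>i=1..n. \<Sum>k=1..P i. \<theta> (k, i) (\<epsilon> i # map (\<lambda>j. \<sigma> (site_code [j, i, k])) [1..<p]))"
      by (intro sum.cong refl) (simp only:)
    moreover have "map (?m \<sigma> \<epsilon>) (map (\<lambda>j. site_code_hat [j, k]) [1..<Suc p]) = map (\<lambda>j. \<sigma> (site_code_hat [j, k])) [1..<Suc p]"
      if "k \<in> {1..r}" for k
      unfolding map_map comp_def using that by (intro map_cong refl in_N site_bounds) auto
    then have "(\<Prod>k\<in>{1..r}. exp (\<theta>h k (map (?m \<sigma> \<epsilon>) (map (\<lambda>j. site_code_hat [j, k]) [1..<Suc p])))) =
      exp (\<Sum>k=1..r. \<theta>h k (map (\<lambda>j. \<sigma> (site_code_hat [j, k])) [1..<Suc p]))"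
      unfolding exp_sum[OF finite_atLeastAtMost] by (intro prod.cong refl) (simp only:)
    ultimately have "?W (?m \<sigma> \<epsilon>) = w \<sigma> * exp (\<Sum>k=1..r. \<theta>h k (map (\<lambda>j. \<sigma> (site_code_hat [j, k])) [1..<Suc p])) *
      exp (\<Sum>i=1..n. \<Sum>k=1..P i. \<theta> (k, i) (\<epsilon> i # map (\<lambda>j. \<sigma> (site_code [j, i, k])) [1..<p]))"
      using mc[OF \<sigma> \<epsilon>] r by (simp only: restrict_apply' lift_weight_def prod_cav_pairs prod.case)
    then show ?thesis by (simp only: abs_mult abs_exp_cancel mult.assoc mult.left_commute mult.commute)
  qed
  have sum_eq: "(\<Sum>\<tau>\<in>configs (N + n). \<bar>?W \<tau>\<bar> * (\<Prod>i\<in>D. \<tau> (cav_site N n i))) =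
     real (card (configs n)) * (\<Sum>\<sigma>\<in>configs N. \<bar>w \<sigma>\<bar> * cavU p n r m D P \<theta> \<theta>h \<sigma>)"
    if D: "D \<subseteq> {1..m}" for D
  proof -
    have card: "real (card (configs n)) \<noteq> 0" by simp
    have D2: "D = (D \<inter> {1..n}) \<union> (D \<inter> {n+1..m})" using D by auto
    have "(\<Sum>\<tau>\<in>configs (N + n). \<bar>?W \<tau>\<bar> * (\<Prod>i\<in>D. \<tau> (cav_site N n i))) =
      (\<Sum>\<sigma>\<in>configs N. \<Sum>\<epsilon>\<in>configs n. \<bar>?W (?m \<sigma> \<epsilon>)\<bar> * (\<Prod>i\<in>D. ?m \<sigma> \<epsilon> (cav_site N n i)))"
      by (rule sum_configs_add)
    also have "\<dots> = (\<Sum>\<sigma>\<in>configs N. \<bar>w \<sigma>\<bar> * (real (card (configs n)) * cavU p n r m D P \<theta> \<theta>h \<sigma>))"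
    proof (rule sum.cong[OF refl])
      fix \<sigma> assume \<sigma>: "\<sigma> \<in> configs N"
      have pr: "(\<Prod>i\<in>D. ?m \<sigma> \<epsilon> (cav_site N n i)) = (\<Prod>i\<in>D \<inter> {1..n}. \<epsilon> i) * (\<Prod>i\<in>D \<inter> {n+1..m}. \<sigma> (site_code [i]))"
        for \<epsilon> :: "nat \<Rightarrow> real"
      proof -
        have "(\<Prod>i\<in>D. ?m \<sigma> \<epsilon> (cav_site N n i)) = (\<Prod>i\<in>D \<inter> {1..n}. ?m \<sigma> \<epsilon> (cav_site N n i)) * (\<Prod>i\<in>D \<inter> {n+1..m}. ?m \<sigma> \<epsilon> (cav_site N n i))"
          by (subst D2, rule prod.union_disjoint) auto
        also have "(\<Prod>i\<in>D \<inter> {1..n}. ?m \<sigma> \<epsilon> (cav_site N n i)) = (\<Prod>i\<in>D \<inter> {1..n}. \<epsilon> i)"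
          by (intro prod.cong refl) (auto simp: merge_config_def cav_site_def)
        also have "(\<Prod>i\<in>D \<inter> {n+1..m}. ?m \<sigma> \<epsilon> (cav_site N n i)) = (\<Prod>i\<in>D \<inter> {n+1..m}. \<sigma> (site_code [i]))"
        proof (intro prod.cong refl)
          fix i assume "i \<in> D \<inter> {n+1..m}"
          then show "?m \<sigma> \<epsilon> (cav_site N n i) = \<sigma> (site_code [i])"
            using in_N[OF site_bounds(2)] by (simp add: cav_site_def)
        qed
        finally show ?thesis .
      qed
      have "(\<Sum>\<epsilon>\<in>configs n. \<bar>?W (?m \<sigma> \<epsilon>)\<bar> * (\<Prod>i\<in>D. ?m \<sigma> \<epsilon> (cav_site N n i))) =
        (\<Sum>\<epsilon>\<in>configs n. \<bar>w \<sigma>\<bar> * ((\<Prod>i\<in>D \<inter> {1..n}. \<epsilon> i) *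
     exp (\<Sum>i=1..n. \<Sum>k=1..P i. \<theta> (k, i) (\<epsilon> i # map (\<lambda>j. \<sigma> (site_code [j, i, k])) [1..<p])) *
     (\<Prod>i\<in>D \<inter> {n+1..m}. \<sigma> (site_code [i])) *
     exp (\<Sum>k=1..r. \<theta>h k (map (\<lambda>j. \<sigma> (site_code_hat [j, k])) [1..<Suc p]))))"
        by (intro sum.cong refl, unfold pr, subst W[OF \<sigma>], assumption)
          (simp only: mult.assoc mult.left_commute mult.commute)
      also have "\<dots> = \<bar>w \<sigma>\<bar> * (real (card (configs n)) * cavU p n r m D P \<theta> \<theta>h \<sigma>)"
      proof -
        have "x * S = x * (K * (S / K))" if "K \<noteq> 0" for x S K :: real using that by simp
        from this[OF card] show ?thesis unfolding cavU_def Av_def sum_distrib_left[symmetric] .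
      qed
      finally show "(\<Sum>\<epsilon>\<in>configs n. \<bar>?W (?m \<sigma> \<epsilon>)\<bar> * (\<Prod>i\<in>D. ?m \<sigma> \<epsilon> (cav_site N n i))) =
        \<bar>w \<sigma>\<bar> * (real (card (configs n)) * cavU p n r m D P \<theta> \<theta>h \<sigma>)" .
    qed
    finally show ?thesis by (simp add: sum_distrib_left ac_simps)
  qed
  have card: "real (card (configs n)) \<noteq> 0" by simp
  define Z where "Z = (\<Sum>\<sigma>\<in>configs N. \<bar>w \<sigma>\<bar>)"
  define a where "a = (\<Sum>\<sigma>\<in>configs N. \<bar>w \<sigma>\<bar> * cavU p n r m D P \<theta> \<theta>h \<sigma>)"
  define b where "b = (\<Sum>\<sigma>\<in>configs N. \<bar>w \<sigma>\<bar> * cavU p n r m {} P \<theta> \<theta>h \<sigma>)"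
  have "gav (N + n) ?W (\<lambda>\<tau>. \<Prod>i\<in>D. \<tau> (cav_site N n i)) = (real (card (configs n)) * a) / (real (card (configs n)) * b)"
    using sum_eq[OF C(1)] sum_eq[of "{}"] unfolding gav_def a_def b_def
    by (simp only: prod.empty mult_1_right empty_subsetI)
  also have "\<dots> = a / b" using card by (rule mult_divide_mult_cancel_left)
  \<comment> \<open>If all weights vanish, then a is 0 as well, and both sides are 0.\<close>
  also have "\<dots> = (a / Z) / (b / Z)"
  proof (cases "Z = 0")
    case True
    then have "\<forall>\<sigma>\<in>configs N. w \<sigma> = 0"
      unfolding Z_def by (subst (asm) sum_nonneg_eq_0_iff) auto
    then have "a = 0" by (simp add: a_def)
    then show ?thesis by simp
  qed simp
  finally show ?thesis unfolding gav_def a_def b_def Z_def .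
qed

section \<open>The cavity functionals in the limit\<close>

locale cavity_functionals = interaction_law L p + spin_function \<sigma> for L p \<sigma> +
  fixes \<alpha> :: real and n r m q :: nat and C :: "nat \<Rightarrow> nat set"
  assumes nm: "n \<le> m" and C: "\<And>l. l \<in> {1..q} \<Longrightarrow> C l \<subseteq> {1..m}"
begin

abbreviation spins :: "nat \<Rightarrow> (nat \<Rightarrow> real) \<Rightarrow> real" where "spins l \<tau> \<equiv> \<Prod>i\<in>C l. \<tau> i"

lemma local_spins: "l \<in> {1..q} \<Longrightarrow> local_fun m (spins l)"
  unfolding local_fun_def using C by (auto intro!: prod.cong)

lemma abs_spins: "l \<in> {1..q} \<Longrightarrow> (\<And>i. i \<in> {1..m} \<Longrightarrow> y i \<in> signs) \<Longrightarrow> \<bar>spins l y\<bar> \<le> 1"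
  using abs_prod_signs[of "C l" y] C by force

abbreviation pois_prod :: "(nat \<Rightarrow> nat) measure" where
  "pois_prod \<equiv> PiM UNIV (\<lambda>_. measure_pmf (poisson_pmf (\<alpha> * real p)))"

abbreviation pair_law :: "((nat \<Rightarrow> interaction) \<times> (nat \<times> nat \<Rightarrow> interaction)) measure" where
  "pair_law \<equiv> PiM UNIV (\<lambda>_. L) \<Otimes>\<^sub>M PiM UNIV (\<lambda>_. L)"

lemma prob_pair_law: "prob_space pair_law"
  by (intro pair_prob prob_PiM_L)

text \<open>U_l read on a single sequence of rows, with the multi-indices sitting at their codes;
  for \<open>D = {}\<close> it is V. The pair \<open>t\<close> lists the hatted interactions
  first.\<close>

definition savgU :: "nat set \<Rightarrow> (nat \<Rightarrow> nat) \<Rightarrow> (nat \<Rightarrow> interaction) \<times> (nat \<times> nat \<Rightarrow> interaction) \<Rightarrow> real \<Rightarrow> (nat \<Rightarrow> real) \<Rightarrow> real" where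
  "savgU D P t w v = (\<integral>x. \<integral>u. cavU p n r m D P (snd t) (fst t) (\<lambda>i. \<sigma> (w, u, v i, x i)) \<partial>unif01 \<partial>unif_seq)"

definition lim_ratio :: "(nat \<Rightarrow> nat) \<Rightarrow> (nat \<Rightarrow> interaction) \<times> (nat \<times> nat \<Rightarrow> interaction) \<Rightarrow> real" where
  "lim_ratio P t = (\<integral>z. (\<Prod>l\<in>{1..q}. savgU (C l) P t (fst z) (snd z)) / savgU {} P t (fst z) (snd z) ^ q \<partial>(unif01 \<Otimes>\<^sub>M unif_seq))"

end

section \<open>The cavity equation along the subsequence\<close>

locale cavity_limit = cavity_model L p \<alpha> c + spin_limit L p \<sigma> S \<alpha> c + cavity_functionals L p \<sigma> \<alpha> n r m q C
  for L p \<alpha> c \<sigma> S n r m q C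
begin

text \<open>The threshold enters \<open>Phi\<close> and must not depend on the random counts. Even
  with zero counts it exceeds the codes of all [i] with i \<le> m, which are the only old sites that
  are observed.\<close>

definition N0 :: nat where "N0 = Suc (max m (site_bound p n r m (\<lambda>_. 0)))"

definition Phi :: "nat \<Rightarrow> ((nat \<Rightarrow> real) \<Rightarrow> real) \<Rightarrow> real" where
  "Phi N w = (if N0 \<le> N then \<Prod>l\<in>{1..q}. gav (N + n) w (obs C N n l) else 0)"

lemma cav_site_range:
  assumes "N0 \<le> N" "i \<in> {1..m}" shows "cav_site N n i \<in> {1..N + n}"
  using assms site_bounds(2)[of i m p n r "\<lambda>_. 0"] by (auto simp: cav_site_def N0_def)

lemma abs_obs:
  assumes N: "N0 \<le> N" and l: "l \<in> {1..q}" and \<tau>: "\<tau> \<in> configs (N + n)"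
  shows "\<bar>obs C N n l \<tau>\<bar> \<le> 1"
proof -
  have "\<bar>\<Prod>i\<in>C l. \<tau> (cav_site N n i)\<bar> = 1"
  proof (rule abs_prod_signs)
    fix i assume "i \<in> C l"
    then have "i \<in> {1..m}" using C[OF l] by auto
    then show "\<tau> (cav_site N n i) \<in> signs" using cav_site_range[OF N] \<tau> by (auto simp: configs_def)
  qed
  then show ?thesis by (simp add: obs_def)
qed

lemma good_Phi: "good (N + n) (Phi N)"
proof (cases "N0 \<le> N")
  case True
  then have "Phi N = (\<lambda>w. \<Prod>l\<in>{1..q}. gav (N + n) w (obs C N n l))" by (auto simp: Phi_def fun_eq_iff)
  moreover have "good (N + n) (\<lambda>w. \<Prod>l\<in>{1..q}. gav (N + n) w (obs C N n l))"
    by (rule good_gav_prod) (rule abs_obs[OF True])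
  ultimately show ?thesis by simp
next
  case False
  then have "Phi N = (\<lambda>_. 0)" by (auto simp: Phi_def fun_eq_iff)
  then show ?thesis by (simp add: good_zero)
qed

lemma cav_site_inj: "N0 \<le> N \<Longrightarrow> inj_on (cav_site N n) {1..m}"
proof (rule inj_onI)
  fix i j assume N: "N0 \<le> N" and ij: "i \<in> {1..m}" "j \<in> {1..m}" "cav_site N n i = cav_site N n j"
  have b: "site_code [i] \<le> N" if "i \<in> {1..m}" for i
    using site_bounds(2)[of i m p n r "\<lambda>_. 0"] that N by (auto simp: N0_def)
  have "site_code [i] = site_code [j] \<longleftrightarrow> i = j" using inj_site_code by (auto dest: injD)
  then show "i = j" using ij b[OF ij(1)] b[OF ij(2)] by (auto simp: cav_site_def split: if_splits)
qed

text \<open>By exchangeability the spins at sites 1, ..., m may be replaced by those at the places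
  \<open>cav_site\<close>, the first n of which are the cavity sites.\<close>

lemma prod_avg_spins:
  assumes N: "N0 \<le> N"
  shows "prod_avg (N + n) {1..q} spins = measure_pmf.expectation (terms (N + n)) (terms_avg (N + n) (Phi N))"
proof -
  let ?xs = "[1..<Suc m]" and ?ys = "map (cav_site N n) [1..<Suc m]"
  have mN: "m \<le> N" "0 < N" using N by (auto simp: N0_def)
  have ys: "distinct ?ys" using cav_site_inj[OF N] by (simp add: distinct_map atLeastLessThanSuc_atLeastAtMost del: upt_Suc)
  have sys: "set ?ys \<subseteq> {1..N + n}" using cav_site_range[OF N] by (auto simp del: upt_Suc)
  have sxs: "set ?xs \<subseteq> {1..N + n}" using mN by (auto simp del: upt_Suc)
  obtain \<pi> where \<pi>: "\<pi> permutes {1..N + n}" "map \<pi> ?xs = ?ys"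
    using ex_permutes_map[OF finite_atLeastAtMost distinct_upt sxs ys sys] by auto
  have \<pi>i: "\<pi> i = cav_site N n i" if "i \<in> {1..m}" for i
    using \<pi>(2) that by (simp del: upt_Suc)
  have "prod_avg (N + n) {1..q} (\<lambda>l \<tau>. spins l (\<lambda>i. \<tau> (\<pi> i))) = prod_avg (N + n) {1..q} spins"
  proof (rule prod_avg_perm[OF _ \<pi>(1)])
    fix l \<tau> assume "l \<in> {1..q}" "\<tau> \<in> configs (N + n)"
    then show "\<bar>spins l \<tau>\<bar> \<le> 1" using mN by (intro abs_spins) (auto simp: configs_def)
  qed (use mN in simp)
  moreover have "prod_avg (N + n) {1..q} (\<lambda>l \<tau>. spins l (\<lambda>i. \<tau> (\<pi> i))) = measure_pmf.expectation (terms (N + n)) (terms_avg (N + n) (Phi N))"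
  proof -
    have "(\<lambda>w. \<Prod>l\<in>{1..q}. gav (N + n) w (\<lambda>\<tau>. spins l (\<lambda>i. \<tau> (\<pi> i)))) = Phi N"
    proof
      fix w
      have "(\<lambda>\<tau>. spins l (\<lambda>i. \<tau> (\<pi> i))) = obs C N n l" if "l \<in> {1..q}" for l
        using C[OF that] \<pi>i by (auto simp: obs_def fun_eq_iff intro!: prod.cong)
      then show "(\<Prod>l\<in>{1..q}. gav (N + n) w (\<lambda>\<tau>. spins l (\<lambda>i. \<tau> (\<pi> i)))) = Phi N w"
        using N by (simp only: Phi_def if_True) (intro prod.cong refl, simp only:)
    qed
    then show ?thesis unfolding prod_avg_def by simp
  qed
  ultimately show ?thesis by simp
qed

text \<open>Additional terms \<open>M0\<close> are frozen while the terms of the system with N sites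
  are averaged out. This is the function \<open>G\<close> to which \<open>slots_replace\<close> is
  applied.\<close>

definition Psi :: "nat \<Rightarrow> nat trm multiset \<Rightarrow> real" where
  "Psi N M0 = measure_pmf.expectation (terms N) (\<lambda>M. terms_avg (N + n) (Phi N) (M + M0))"

lemma terms_avg_Phi_bound: "\<bar>terms_avg (N + n) (Phi N) M\<bar> \<le> 1"
  by (rule abs_terms_avg_le[OF good_Phi])

lemma Psi_bound: "\<bar>Psi N M\<bar> \<le> 1"
  unfolding Psi_def by (rule abs_expectation_le) (rule terms_avg_Phi_bound)

abbreviation all_slots :: "nat \<Rightarrow> (nat \<Rightarrow> nat) \<Rightarrow> slot list" where
  "all_slots N P \<equiv> cav_slots p N n P @ hat_slots p r"

text \<open>Given the counts, the cavity interactions and the r additional interactions become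
  slots, and the old terms stay inside \<open>Psi\<close>.\<close>

lemma expectation_slots:
  "measure_pmf.expectation (conv_pmf (conv_pmf (terms N) (isum_pmf r (th_law N))) (cav_law N n)) (terms_avg (N + n) (Phi N)) =
    (\<integral>P. measure_pmf.expectation (slots_law N (all_slots N P)) (Psi N) \<partial>pois_prod)"
proof -
  let ?E = measure_pmf.expectation
  note fb = terms_avg_Phi_bound and pb = Psi_bound
  define F where "F = (\<lambda>M1. ?E (slots_law N (hat_slots p r)) (\<lambda>M2. Psi N (M1 + M2)))"
  have Fb: "\<bar>F M\<bar> \<le> 1" for M unfolding F_def by (rule abs_expectation_le) (rule pb)
  have "conv_pmf (conv_pmf (terms N) (isum_pmf r (th_law N))) (cav_law N n) =
    conv_pmf (cav_law N n) (conv_pmf (slots_law N (hat_slots p r)) (terms N))"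
    by (simp only: isum_th_law conv_pmf_ac)
  then have "?E (conv_pmf (conv_pmf (terms N) (isum_pmf r (th_law N))) (cav_law N n)) (terms_avg (N + n) (Phi N)) =
    ?E (cav_law N n) (\<lambda>M1. ?E (slots_law N (hat_slots p r)) (\<lambda>M2. ?E (terms N) (\<lambda>M. terms_avg (N + n) (Phi N) (M1 + (M2 + M)))))"
    using fb by (simp add: expectation_conv[where B=1])
  also have "\<dots> = ?E (cav_law N n) F"
    unfolding F_def Psi_def by (simp only: add.assoc add.commute add.left_commute)
  also have "\<dots> = (\<integral>P. ?E (slots_law N (cav_slots p N n P)) F \<partial>pois_prod)"
    by (rule expectation_cav_law[OF Fb])
  also have "\<dots> = (\<integral>P. ?E (slots_law N (all_slots N P)) (Psi N) \<partial>pois_prod)"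
    unfolding F_def slots_law_append using pb by (simp add: expectation_conv[where B=1])
  finally show ?thesis .
qed

abbreviation marked :: "nat set" where "marked \<equiv> site_code ` ((\<lambda>i. [i]) ` {..m})"

text \<open>Relabelling old sites changes neither the law of the old terms nor, as long as the
  marked sites stay fixed, the observed spins.\<close>

lemma Psi_perm:
  assumes N: "N0 \<le> N" and \<pi>: "\<pi> permutes ({1..N} - marked)"
  shows "Psi N (image_mset (map_trm \<pi>) M) = Psi N M"
proof -
  have N_pos: "0 < N" using N by (simp add: N0_def)
  have \<pi>1: "\<pi> permutes {1..N}" and \<pi>2: "\<pi> permutes {1..N + n}"
    using \<pi> by (auto elim: permutes_subset)
  have fixed: "\<pi> (cav_site N n i) = cav_site N n i" if "i \<in> {1..m}" for i
    using that by (intro permutes_not_in[OF \<pi>]) (auto simp: cav_site_def)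
  have "Phi N (perm_weight (N + n) \<pi> w) = Phi N w" for w
  proof -
    have "gav (N + n) (perm_weight (N + n) \<pi> w) (obs C N n l) = gav (N + n) w (obs C N n l)" if l: "l \<in> {1..q}" for l
    proof -
      have "obs C N n l (\<lambda>i. \<tau> (\<pi> i)) = obs C N n l \<tau>" for \<tau>
        unfolding obs_def using C[OF l] fixed by (intro prod.cong refl) (auto simp: subset_iff)
      then show ?thesis using gav_perm[OF \<pi>2, of w "obs C N n l"] by simp
    qed
    then show ?thesis by (simp add: Phi_def)
  qed
  then have FFp: "terms_avg (N + n) (Phi N) (image_mset (map_trm \<pi>) M') = terms_avg (N + n) (Phi N) M'" for M'
    using terms_avg_perm[OF good_Phi \<pi>2] by simp
  have "Psi N (image_mset (map_trm \<pi>) M) =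
     measure_pmf.expectation (map_pmf (image_mset (map_trm \<pi>)) (terms N)) (\<lambda>M'. terms_avg (N + n) (Phi N) (M' + image_mset (map_trm \<pi>) M))"
    unfolding map_terms_law_perm[OF \<pi>1 N_pos] Psi_def ..
  also have "\<dots> = measure_pmf.expectation (terms N) (\<lambda>M'. terms_avg (N + n) (Phi N) (image_mset (map_trm \<pi>) (M' + M)))"
    by simp
  also have "\<dots> = Psi N M" unfolding FFp Psi_def ..
  finally show ?thesis .
qed

lemma all_slots_indep: "map snd (all_slots N P) = map snd (all_slots N' P)"
  by (simp add: cav_slots_def map_concat comp_def del: upt_Suc)

text \<open>For fixed counts the number K of random sites does not depend on N, so the collision
  probability is of order 1 / N.\<close>

lemma slots_Psi_limit:
  "(\<lambda>N. measure_pmf.expectation (slots_law N (all_slots N P)) (Psi N) - Psi N (slots_fixed (all_slots N P))) \<longlonglongrightarrow> 0"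
proof -
  define K where "K = length (concat (map snd (all_slots 0 P)))"
  have K: "length (concat (map snd (all_slots N P))) = K" for N
    unfolding K_def using all_slots_indep[of N P 0] by simp
  show ?thesis
  proof (rule Lim_null_comparison)
    show "(\<lambda>N. 2 * (real (K * (K + card marked)) / real N)) \<longlonglongrightarrow> 0"
      by (intro tendsto_mult_right_zero lim_const_over_n)
    show "\<forall>\<^sub>F N in sequentially. norm (measure_pmf.expectation (slots_law N (all_slots N P)) (Psi N) - Psi N (slots_fixed (all_slots N P)))
       \<le> 2 * (real (K * (K + card marked)) / real N)"
      using eventually_ge_at_top[of N0] eventually_ge_at_top[of "site_bound p n r m P"]
    proof eventually_elim
      case (elim N)
      have N_pos: "0 < N" using elim by (simp add: N0_def)
      have sub: "set (concat (map snd (all_slots N P))) \<subseteq> {1..N} - marked"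
      proof
        fix x assume "x \<in> set (concat (map snd (all_slots N P)))"
        then consider (a) j i k where "x = site_code [j, i, k]" "j < p" "i \<le> n" "k \<le> P i"
          | (b) j k where "x = site_code_hat [j, k]" "j \<le> p" "k \<le> r"
          using slots_sites(2)[of p N n P r] by blast
        then show "x \<in> {1..N} - marked"
        proof cases
          case a
          then have "x \<in> {1..N}" using site_bounds(1)[of j p i n k P r m] elim by auto
          moreover have "x \<notin> marked" using a(1) inj_site_code by (auto dest: injD)
          ultimately show ?thesis by simp
        next
          case b
          then have "x \<in> {1..N}" using site_bounds(3)[of j p k r n m P] elim by auto
          moreover have "x \<notin> marked" using b(1) site_code_neq by (metis imageE)
          ultimately show ?thesis by simp
        qed
      qed
      have pre: "N < i" if "e \<in> set (all_slots N P)" "i \<in> set (fst e)" for e i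
        using that by (auto simp: cav_slots_def hat_slots_def simp del: upt_Suc)
      have "finite marked" by simp
      from slots_replace[OF N_pos Psi_bound this Psi_perm[OF elim(1)] pre slots_sites(1) sub]
      show ?case by (simp only: K real_norm_def)
    qed
  qed
qed

definition ratio :: "nat \<Rightarrow> (nat \<Rightarrow> nat) \<Rightarrow> (nat \<Rightarrow> interaction) \<times> (nat \<times> nat \<Rightarrow> interaction) \<Rightarrow> ((nat \<Rightarrow> real) \<Rightarrow> real) \<Rightarrow> real" where
  "ratio N P t w = (\<Prod>l\<in>{1..q}. gav N w (cavU p n r m (C l) P (snd t) (fst t))) / gav N w (cavU p n r m {} P (snd t) (fst t)) ^ q"

definition cavW :: "nat \<Rightarrow> (nat \<Rightarrow> nat) \<Rightarrow> (nat \<Rightarrow> interaction) \<times> (nat \<times> nat \<Rightarrow> interaction) \<Rightarrow> ((nat \<Rightarrow> real) \<Rightarrow> real) \<Rightarrow> (nat \<Rightarrow> real) \<Rightarrow> real" where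
  "cavW N P t w = (\<lambda>\<tau>\<in>configs (N + n). (\<lambda>\<tau>\<in>configs (N + n). lift_weight N n w \<tau> *
      (\<Prod>k\<in>{1..r}. exp (fst t k (map \<tau> (map (\<lambda>j. site_code_hat [j, k]) [1..<Suc p]))))) \<tau> *
      (\<Prod>x\<in>cav_pairs n P. exp (snd t x (map \<tau> (case x of (k, i) \<Rightarrow> (N + i) # map (\<lambda>j. site_code [j, i, k]) [1..<p])))))"

text \<open>Each of the q replicas contributes its own copy of the denominator, whence the power
  V^q.\<close>

lemma Phi_cavW:
  assumes "N0 \<le> N" "site_bound p n r m P \<le> N"
  shows "Phi N (cavW N P t w) = ratio N P t w"
proof -
  have "Phi N (cavW N P t w) = (\<Prod>l\<in>{1..q}. gav N w (cavU p n r m (C l) P (snd t) (fst t)) / gav N w (cavU p n r m {} P (snd t) (fst t)))"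
    unfolding Phi_def using assms(1)
    by (simp only: if_True) (intro prod.cong refl, simp only: cavW_def obs_def[abs_def] gav_cavity[OF C nm assms(2)])
  then show ?thesis by (simp add: ratio_def prod_dividef)
qed

lemma measurable_cavW:
  assumes W: "W \<in> M \<rightarrow>\<^sub>M weights N" and T: "T \<in> M \<rightarrow>\<^sub>M pair_law"
  shows "(\<lambda>z. cavW N P (T z) (W z)) \<in> M \<rightarrow>\<^sub>M weights (N + n)"
proof -
  have e1: "(\<lambda>z. exp (fst (T z) k xs)) \<in> borel_measurable M" for k xs
    by (rule measurable_compose[OF _ borel_measurable_exp], rule measurable_compose[OF _ measurable_eval_PiM_L], rule measurable_compose[OF T measurable_fst])
  have e2: "(\<lambda>z. exp (snd (T z) k xs)) \<in> borel_measurable M" for k xs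
    by (rule measurable_compose[OF _ borel_measurable_exp], rule measurable_compose[OF _ measurable_eval_PiM_L], rule measurable_compose[OF T measurable_snd])
  have l: "(\<lambda>z. lift_weight N n (W z) \<tau>) \<in> borel_measurable M" if "\<tau> \<in> configs (N + n)" for \<tau>
    unfolding lift_weight_def restrict_apply'[OF that]
    by (rule measurable_compose[OF W weights_component]) (rule restrict_configs[OF that])
  show ?thesis
    unfolding cavW_def
  proof (rule measurable_comp_weights)
    fix \<tau> assume \<tau>: "\<tau> \<in> configs (N + n)"
    show "(\<lambda>x. (\<lambda>\<tau>\<in>configs (N + n). lift_weight N n (W x) \<tau> *
      (\<Prod>k\<in>{1..r}. exp (fst (T x) k (map \<tau> (map (\<lambda>j. site_code_hat [j, k]) [1..<Suc p]))))) \<tau> *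
      (\<Prod>x'\<in>cav_pairs n P. exp (snd (T x) x' (map \<tau> (case x' of (k, i) \<Rightarrow> (N + i) # map (\<lambda>j. site_code [j, i, k]) [1..<p]))))) \<in> borel_measurable M"
      unfolding restrict_apply'[OF \<tau>] by (intro borel_measurable_times borel_measurable_prod e1 e2 l \<tau>)
  qed
qed

lemma measurable_Phi_cavW:
  "(\<lambda>z. Phi N (cavW N P (snd z) (wt p N (fst z)))) \<in> borel_measurable (disorder_law L p \<alpha> c N \<Otimes>\<^sub>M pair_law)"
  by (rule measurable_compose[OF measurable_cavW goodD(1)[OF good_Phi]])
    (rule measurable_compose[OF measurable_fst measurable_wt], rule measurable_snd)

lemma Phi_bound: "\<bar>Phi N w\<bar> \<le> 1"
  using good_Phi goodD(2) by blast

text \<open>With prescribed sites the additional interactions \<open>t\<close> are independent of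
  the old system. The old terms contain no cavity site, so they act below the lift, and
  \<open>disorder_expectation\<close> turns them back into the disorder of N sites.\<close>

lemma Psi_fixed:
  assumes N: "N0 \<le> N" "site_bound p n r m P \<le> N"
  shows "Psi N (slots_fixed (all_slots N P)) = (\<integral>t. \<integral>d. Phi N (cavW N P t (wt p N d)) \<partial>disorder_law L p \<alpha> c N \<partial>pair_law)"
proof -
  let ?cav = "slots_fixed (cav_slots p N n P)" and ?hat = "slots_fixed (hat_slots p r)"
  let ?M = "?hat + ?cav"
  have M: "slots_fixed (all_slots N P) = ?M" by (simp add: slots_fixed_def)
  have N_pos: "0 < N" using N by (simp add: N0_def)
  note g = good_Phi[of N]
  have st: "steps (N + n) (Phi N) ?M (lift_weight N n w) = (\<integral>t. Phi N (cavW N P t w) \<partial>pair_law)" for w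
  proof -
    let ?w1 = "\<lambda>\<theta>h. \<lambda>\<tau>\<in>configs (N + n). lift_weight N n w \<tau> * (\<Prod>k\<in>{1..r}. exp (\<theta>h k (map \<tau> (map (\<lambda>j. site_code_hat [j, k]) [1..<Suc p]))))"
    have 1: "steps (N + n) (steps (N + n) (Phi N) ?cav) ?hat (lift_weight N n w) =
      (\<integral>\<theta>h. steps (N + n) (Phi N) ?cav (?w1 \<theta>h) \<partial>PiM UNIV (\<lambda>_. L))"
      unfolding slots_fixed_hat by (rule steps_Th_set[symmetric, OF _ good_steps[OF g]]) (simp_all add: lift_weight_def)
    have cav_eq: "?cav = image_mset (\<lambda>x. Th (case x of (k, i) \<Rightarrow> (N + i) # map (\<lambda>j. site_code [j, i, k]) [1..<p])) (mset_set (cav_pairs n P))"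
      unfolding slots_fixed_cav by (intro image_mset_cong) (auto split: prod.splits)
    have 2: "steps (N + n) (Phi N) ?cav (?w1 \<theta>h) = (\<integral>\<theta>. Phi N (cavW N P (\<theta>h, \<theta>) w) \<partial>PiM UNIV (\<lambda>_. L))" for \<theta>h
      unfolding cav_eq cavW_def fst_conv snd_conv
      by (rule steps_Th_set[symmetric, OF finite_cav_pairs g]) (rule restrict_extensional)
    have m: "(\<lambda>t. Phi N (cavW N P t w)) \<in> borel_measurable pair_law"
    proof -
      \<comment> \<open>Here \<open>w\<close> is arbitrary. Its restriction lies in the space of
        weights and gives the same value, so measurability is inherited.\<close>
      have "(\<lambda>t. cavW N P t (restrict w (configs N))) \<in> pair_law \<rightarrow>\<^sub>M weights (N + n)"
        by (rule measurable_cavW) (auto simp: weights_def space_PiM)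
      moreover have "cavW N P t (restrict w (configs N)) = cavW N P t w" for t
        unfolding cavW_def lift_weight_def by (intro restrict_ext) (simp del: One_nat_def)
      ultimately show ?thesis by (intro measurable_compose[OF _ goodD(1)[OF g]]) simp
    qed
    show ?thesis
      unfolding steps_union 1 2
      by (rule Fubini_abs_le_1(1)[symmetric, OF prob_PiM_L prob_PiM_L m Phi_bound])
  qed
  have "Psi N ?M = measure_pmf.expectation (terms N) (terms_avg N (\<lambda>w. steps (N + n) (Phi N) ?M (lift_weight N n w)))"
    unfolding Psi_def
  proof (rule expectation_cong_pmf)
    fix M assume "M \<in> set_pmf (terms N)"
    then have "\<And>t. t \<in># M \<Longrightarrow> set_trm t \<subseteq> {1..N}" using wf_terms[OF N_pos] wf_trm_sites by blast
    then show "terms_avg (N + n) (Phi N) (M + ?M) = terms_avg N (\<lambda>w. steps (N + n) (Phi N) ?M (lift_weight N n w)) M"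
      unfolding terms_avg_union by (rule terms_avg_lift[OF good_steps[OF g]])
  qed
  also have "\<dots> = (\<integral>d. steps (N + n) (Phi N) ?M (lift_weight N n (wt p N d)) \<partial>disorder_law L p \<alpha> c N)"
    by (rule disorder_expectation[symmetric]) (intro good_lift good_steps g)
  also have "\<dots> = (\<integral>d. \<integral>t. Phi N (cavW N P t (wt p N d)) \<partial>pair_law \<partial>disorder_law L p \<alpha> c N)"
    unfolding st ..
  also have "\<dots> = (\<integral>t. \<integral>d. Phi N (cavW N P t (wt p N d)) \<partial>disorder_law L p \<alpha> c N \<partial>pair_law)"
    using Fubini_abs_le_1(1,2)[OF prob_disorder prob_pair_law measurable_Phi_cavW Phi_bound] by simp
  finally show ?thesis unfolding M .
qed

text \<open>Dividing by the upper bound B brings the functionals into [-1, 1] and the denominator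
  into [\<delta> / B, 1]. The q factors 1 / B in the numerator cancel against the power q.\<close>

lemma ratio_limit_fixed:
  "(\<lambda>k. \<integral>d. ratio (S k) P t (wt p (S k) d) \<partial>disorder_law L p \<alpha> c (S k)) \<longlonglongrightarrow> lim_ratio P t"
proof -
  let ?U = "\<lambda>D. cavU p n r m D P (snd t) (fst t)"
  let ?K = "site_bound p n r m P"
  obtain \<delta> B where B: "0 < \<delta>" "0 < B" "\<And>y. (\<And>i. i \<in> {1..?K} \<Longrightarrow> y i \<in> signs) \<Longrightarrow> ?U {} y \<in> {\<delta>..B}"
  proof (rule cavU_bounds[where p=p and n=n and r=r and m=m and P=P and \<theta>="snd t" and \<theta>h="fst t"])
    fix \<delta> B
    assume h: "0 < \<delta>" "0 < B" "\<And>y. (\<And>i. i \<in> {1..?K} \<Longrightarrow> y i \<in> signs) \<Longrightarrow> ?U {} y \<in> {\<delta>..B}"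
    show thesis by (rule that[OF h])
  qed
  let ?f = "\<lambda>D y. ?U D y / B"
  have loc: "local_fun ?K (?f D)" for D
    using local_cavU[of p n r m P D "snd t" "fst t"] unfolding local_fun_def by metis
  have b: "\<bar>?f D y\<bar> \<le> 1" if "\<And>i. i \<in> {1..?K} \<Longrightarrow> y i \<in> signs" for D y
    using abs_cavU_le[of p n r m P y D "snd t" "fst t", OF that] B(3)[of y, OF that] B(2)
    by (auto simp: abs_divide divide_le_eq)
  have gr: "?f {} y \<in> {\<delta> / B..1}" if "\<And>i. i \<in> {1..?K} \<Longrightarrow> y i \<in> signs" for y
    using B(3)[of y, OF that] B(2) by (auto simp: divide_right_mono divide_le_eq)
  have lim: "(\<lambda>k. \<integral>d. (\<Prod>l\<in>{1..q}. gav (S k) (wt p (S k) d) (?f (C l))) / gav (S k) (wt p (S k) d) (?f {}) ^ q \<partial>disorder_law L p \<alpha> c (S k))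
    \<longlonglongrightarrow> (\<integral>z. (\<Prod>l\<in>{1..q}. savg ?K (?f (C l)) (fst z) (snd z)) / savg ?K (?f {}) (fst z) (snd z) ^ q \<partial>(unif01 \<Otimes>\<^sub>M unif_seq))"
    by (rule ratio_replica_limit[where \<delta>="\<delta> / B"]) (use loc b gr B in auto)
  have scale: "(\<Prod>l\<in>{1..q}. x l / B) / (y / B) ^ q = (\<Prod>l\<in>{1..q}. x l) / y ^ q" for x :: "nat \<Rightarrow> real" and y
    using B(2) by (simp add: prod_dividef power_divide)
  have gav: "gav N w (?f D) = gav N w (?U D) / B" for N w D
    unfolding gav_def by (simp add: sum_divide_distrib[symmetric])
  have savg: "savg ?K (?f D) w v = savgU D P t w v / B" if w: "w \<in> space unif01" and v: "v \<in> space unif_seq" for D w v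
  proof -
    have "savg ?K (?f D) w v = (\<integral>x. \<integral>u. ?U D (\<lambda>i. \<sigma> (w, u, v i, x i)) / B \<partial>unif01 \<partial>unif_seq)"
      unfolding savg_def
      by (intro Bochner_Integration.integral_cong refl sval_eq w v loc b) auto
    then show ?thesis by (simp add: savgU_def)
  qed
  have "(\<integral>z. (\<Prod>l\<in>{1..q}. savg ?K (?f (C l)) (fst z) (snd z)) / savg ?K (?f {}) (fst z) (snd z) ^ q \<partial>(unif01 \<Otimes>\<^sub>M unif_seq)) = lim_ratio P t"
    unfolding lim_ratio_def
  proof (rule Bochner_Integration.integral_cong[OF refl])
    fix z assume "z \<in> space (unif01 \<Otimes>\<^sub>M unif_seq)"
    then have "fst z \<in> space unif01" "snd z \<in> space unif_seq" by (auto simp: space_pair_measure)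
    from savg[OF this] show "(\<Prod>l\<in>{1..q}. savg ?K (?f (C l)) (fst z) (snd z)) / savg ?K (?f {}) (fst z) (snd z) ^ q =
      (\<Prod>l\<in>{1..q}. savgU (C l) P t (fst z) (snd z)) / savgU {} P t (fst z) (snd z) ^ q"
      by (simp only: scale)
  qed
  with lim show ?thesis unfolding gav scale ratio_def by simp
qed

text \<open>Dominated convergence over the interactions. The lower bound of the denominator is not
  uniform in \<open>t\<close>, but the ratio is a value of \<open>Phi\<close> and hence bounded by
  1.\<close>

lemma Psi_fixed_limit:
  "(\<lambda>k. Psi (S k) (slots_fixed (all_slots (S k) P))) \<longlonglongrightarrow> (\<integral>t. lim_ratio P t \<partial>pair_law)"
proof -
  interpret pair_law: prob_space pair_law by (rule prob_pair_law)
  let ?K = "max N0 (site_bound p n r m P)"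
  have big: "N0 \<le> S (k + ?K)" "site_bound p n r m P \<le> S (k + ?K)" for k
    using seq_suble[OF S, of "k + ?K"] by auto
  let ?N = "\<lambda>k. S (k + ?K)"
  let ?s = "\<lambda>k t. \<integral>d. Phi (?N k) (cavW (?N k) P t (wt p (?N k) d)) \<partial>disorder_law L p \<alpha> c (?N k)"
  have m: "?s k \<in> borel_measurable pair_law" for k
    using Fubini_abs_le_1(4)[OF prob_disorder prob_pair_law measurable_Phi_cavW Phi_bound] by simp
  have pt: "(\<lambda>k. ?s k t) \<longlonglongrightarrow> lim_ratio P t" for t
    unfolding Phi_cavW[OF big] by (rule LIMSEQ_ignore_initial_segment[OF ratio_limit_fixed])
  have "(\<lambda>k. \<integral>t. ?s k t \<partial>pair_law) \<longlonglongrightarrow> (\<integral>t. lim_ratio P t \<partial>pair_law)"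
  proof (rule integral_dominated_convergence[where w="\<lambda>_. 1"])
    show "lim_ratio P \<in> borel_measurable pair_law" by (rule borel_measurable_LIMSEQ_real[OF pt m])
    show "AE t in pair_law. norm (?s k t) \<le> 1" for k
      using prob_space.abs_integral_bounded[OF prob_disorder Phi_bound] by (auto intro!: AE_I2)
  qed (use m pt in auto)
  then have "(\<lambda>k. Psi (?N k) (slots_fixed (all_slots (?N k) P))) \<longlonglongrightarrow> (\<integral>t. lim_ratio P t \<partial>pair_law)"
    by (simp only: Psi_fixed[OF big])
  then show ?thesis by (rule LIMSEQ_offset)
qed

lemma slots_limit:
  "(\<lambda>k. \<integral>P. measure_pmf.expectation (slots_law (S k) (all_slots (S k) P)) (Psi (S k)) \<partial>pois_prod)
    \<longlonglongrightarrow> (\<integral>P. \<integral>t. lim_ratio P t \<partial>pair_law \<partial>pois_prod)"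
proof -
  interpret P: prob_space pois_prod by (intro prob_space_PiM prob_space_measure_pmf)
  let ?s = "\<lambda>k P. measure_pmf.expectation (slots_law (S k) (all_slots (S k) P)) (Psi (S k))"
  have m: "?s k \<in> borel_measurable pois_prod" for k
    using measurable_cav_slots[of "\<lambda>es. measure_pmf.expectation (slots_law (S k) (es @ hat_slots p r)) (Psi (S k))"] by simp
  have pt: "(\<lambda>k. ?s k P) \<longlonglongrightarrow> (\<integral>t. lim_ratio P t \<partial>pair_law)" for P
  proof -
    have "(\<lambda>k. (?s k P - Psi (S k) (slots_fixed (all_slots (S k) P))) + Psi (S k) (slots_fixed (all_slots (S k) P))) \<longlonglongrightarrow> 0 + (\<integral>t. lim_ratio P t \<partial>pair_law)"
      by (intro tendsto_add Psi_fixed_limit LIMSEQ_subseq_LIMSEQ[OF slots_Psi_limit S, unfolded comp_def])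
    then show ?thesis by simp
  qed
  show ?thesis
  proof (rule integral_dominated_convergence[where w="\<lambda>_. 1"])
    show "(\<lambda>P. \<integral>t. lim_ratio P t \<partial>pair_law) \<in> borel_measurable pois_prod" by (rule borel_measurable_LIMSEQ_real[OF pt m])
    show "AE P in pois_prod. norm (?s k P) \<le> 1" for k
      by (intro AE_I2) (simp add: abs_expectation_le Psi_bound)
  qed (use m pt in auto)
qed

lemma prod_avg_limit:
  "(\<lambda>k. prod_avg (S k) {1..q} spins) \<longlonglongrightarrow> (\<integral>\<omega>. test_fun m q spins (spin_array \<sigma> \<omega>) \<partial>seeds)"
proof -
  have lim: "(\<lambda>k. \<integral>d. (\<Prod>l\<in>{1..q}. gav (S k) (wt p (S k) d) (spins l)) \<partial>disorder_law L p \<alpha> c (S k))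
    \<longlonglongrightarrow> (\<integral>\<omega>. test_fun m q spins (spin_array \<sigma> \<omega>) \<partial>seeds)"
    by (rule replica_conv[OF local_spins]) (auto intro!: abs_spins configs_signs)
  show ?thesis
  proof (rule Lim_transform_eventually[OF lim])
    show "\<forall>\<^sub>F k in sequentially. (\<integral>d. (\<Prod>l\<in>{1..q}. gav (S k) (wt p (S k) d) (spins l)) \<partial>disorder_law L p \<alpha> c (S k)) = prod_avg (S k) {1..q} spins"
      using eventually_ge_at_top[of m]
    proof eventually_elim
      case (elim k)
      then have mk: "m \<le> S k" using seq_suble[OF S, of k] by simp
      have "good (S k) (\<lambda>w. \<Prod>l\<in>{1..q}. gav (S k) w (spins l))"
      proof (rule good_gav_prod)
        fix l \<tau> assume "l \<in> {1..q}" "\<tau> \<in> configs (S k)"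
        then show "\<bar>spins l \<tau>\<bar> \<le> 1" using mk by (intro abs_spins) (auto intro: configs_signs)
      qed
      then show ?case unfolding prod_avg_def by (rule disorder_expectation)
    qed
  qed
qed

theorem cavity_equation:
  "(\<integral>\<omega>. test_fun m q spins (spin_array \<sigma> \<omega>) \<partial>seeds) = (\<integral>P. \<integral>t. lim_ratio P t \<partial>pair_law \<partial>pois_prod)"
proof -
  let ?A = "\<lambda>N. prod_avg N {1..q} spins"
  let ?X = "\<lambda>N. measure_pmf.expectation (conv_pmf (terms N) (cav_law N n)) (terms_avg (N + n) (Phi N))"
  let ?Y = "\<lambda>N. measure_pmf.expectation (conv_pmf (conv_pmf (terms N) (isum_pmf r (th_law N))) (cav_law N n)) (terms_avg (N + n) (Phi N))"
  have 1: "(\<lambda>N. ?A (N + n) - ?A N) \<longlonglongrightarrow> 0"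
  proof (rule prod_avg_add[where m=m])
    fix l \<tau> N assume "l \<in> {1..q}" "\<tau> \<in> configs N" "m \<le> N"
    then show "\<bar>spins l \<tau>\<bar> \<le> 1" by (intro abs_spins) (auto intro: configs_signs)
  qed (rule local_spins)
  have 2: "(\<lambda>N. ?A (N + n) - ?X N) \<longlonglongrightarrow> 0"
  proof (rule Lim_transform_eventually[OF expectation_cavity_approx[OF good_Phi]])
    show "\<forall>\<^sub>F N in sequentially. measure_pmf.expectation (terms (N + n)) (terms_avg (N + n) (Phi N)) - ?X N = ?A (N + n) - ?X N"
      using eventually_ge_at_top[of N0] by eventually_elim (simp only: prod_avg_spins)
  qed
  have 3: "(\<lambda>N. ?Y N - ?X N) \<longlonglongrightarrow> 0"
  proof (rule Lim_null_comparison)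
    show "\<forall>\<^sub>F N in sequentially. norm (?Y N - ?X N) \<le> real r / sqrt (\<alpha> * real N) + 0"
      using eventually_gt_at_top[of 0]
    proof eventually_elim
      case (elim N)
      show ?case unfolding real_norm_def
        by (rule tv_leD[OF tv_le_conv[OF tv_terms_th[OF elim] tv_le_refl]]) (simp_all add: terms_avg_Phi_bound)
    qed
    have "filterlim (\<lambda>N. \<alpha> * real N) at_top sequentially"
      by (rule filterlim_tendsto_pos_mult_at_top[OF tendsto_const \<alpha>_pos filterlim_real_sequentially])
    then have "(\<lambda>N. real r / sqrt (\<alpha> * real N)) \<longlonglongrightarrow> 0"
      by (intro real_tendsto_divide_at_top[OF tendsto_const] filterlim_compose[OF sqrt_at_top])
    then show "(\<lambda>N. real r / sqrt (\<alpha> * real N) + 0) \<longlonglongrightarrow> 0" by simp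
  qed
  \<comment> \<open>The chain runs from the moments of N sites over those of N + n sites and the
    cavity description \<open>?X\<close> to \<open>?Y\<close>, which has r more interactions; each
    link is a null sequence.\<close>
  have "(\<lambda>N. ((?Y N - ?X N) - (?A (N + n) - ?X N)) + (?A (N + n) - ?A N)) \<longlonglongrightarrow> (0 - 0) + 0"
    by (intro tendsto_add tendsto_diff 1 2 3)
  then have YA: "(\<lambda>N. ?Y N - ?A N) \<longlonglongrightarrow> 0" by simp
  have "(\<lambda>k. (?Y (S k) - ?A (S k)) + ?A (S k)) \<longlonglongrightarrow> 0 + (\<integral>\<omega>. test_fun m q spins (spin_array \<sigma> \<omega>) \<partial>seeds)"
    by (intro tendsto_add prod_avg_limit LIMSEQ_subseq_LIMSEQ[OF YA S, unfolded comp_def])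
  then have "(\<lambda>k. ?Y (S k)) \<longlonglongrightarrow> (\<integral>\<omega>. test_fun m q spins (spin_array \<sigma> \<omega>) \<partial>seeds)" by simp
  then show ?thesis unfolding expectation_slots using slots_limit LIMSEQ_unique by blast
qed

end

section \<open>From sites to multi-indices\<close>

lemma integral_pair_assoc:
  fixes g :: "'x \<times> 'y \<times> 'z \<Rightarrow> real"
  assumes p: "prob_space A" "prob_space B" "prob_space D"
    and g: "g \<in> borel_measurable (A \<Otimes>\<^sub>M (B \<Otimes>\<^sub>M D))" and b: "\<And>z. \<bar>g z\<bar> \<le> 1"
  shows "(\<integral>z. g z \<partial>(A \<Otimes>\<^sub>M (B \<Otimes>\<^sub>M D))) = (\<integral>z. g (fst (fst z), snd (fst z), snd z) \<partial>((A \<Otimes>\<^sub>M B) \<Otimes>\<^sub>M D))"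
    and "(\<lambda>z. g (fst (fst z), snd (fst z), snd z)) \<in> borel_measurable ((A \<Otimes>\<^sub>M B) \<Otimes>\<^sub>M D)"
proof -
  note Fub = Fubini_abs_le_1
  note pr = p pair_prob[OF p(1,2)] pair_prob[OF p(2,3)]
  interpret D: prob_space D by (rule p(3))
  let ?h = "\<lambda>z. g (fst (fst z), snd (fst z), snd z)"
  show h: "?h \<in> borel_measurable ((A \<Otimes>\<^sub>M B) \<Otimes>\<^sub>M D)"
    by (rule measurable_compose[OF _ g]) measurable
  then have k: "(\<lambda>y. \<integral>z. ?h (y, z) \<partial>D) \<in> borel_measurable (A \<Otimes>\<^sub>M B)"
    by measurable
  have kb: "\<bar>\<integral>z. ?h (y, z) \<partial>D\<bar> \<le> 1" for y
    by (rule D.abs_integral_bounded) (rule b)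
  have "(\<integral>z. g z \<partial>(A \<Otimes>\<^sub>M (B \<Otimes>\<^sub>M D))) = (\<integral>x. \<integral>r. g (x, r) \<partial>(B \<Otimes>\<^sub>M D) \<partial>A)"
    by (rule Fub(1)[OF pr(1,5) g b])
  also have "\<dots> = (\<integral>x. \<integral>y. \<integral>z. g (x, y, z) \<partial>D \<partial>B \<partial>A)"
  proof (rule Bochner_Integration.integral_cong[OF refl])
    fix x assume x: "x \<in> space A"
    show "(\<integral>r. g (x, r) \<partial>(B \<Otimes>\<^sub>M D)) = (\<integral>y. \<integral>z. g (x, y, z) \<partial>D \<partial>B)"
      by (rule Fub(1)[OF pr(2,3) Fub(3)[OF pr(1,5) g b x] b])
  qed
  also have "\<dots> = (\<integral>y. \<integral>z. ?h (y, z) \<partial>D \<partial>(A \<Otimes>\<^sub>M B))"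
    using Fub(1)[OF pr(1,2) k kb] by simp
  also have "\<dots> = (\<integral>z. ?h z \<partial>((A \<Otimes>\<^sub>M B) \<Otimes>\<^sub>M D))"
    by (rule Fub(1)[OF pr(4,3) h b, symmetric])
  finally show "(\<integral>z. g z \<partial>(A \<Otimes>\<^sub>M (B \<Otimes>\<^sub>M D))) = (\<integral>z. ?h z \<partial>((A \<Otimes>\<^sub>M B) \<Otimes>\<^sub>M D))" .
qed

text \<open>The outer randomness lists w and the v before counts and interactions, whereas the limit
  was computed with counts and interactions fixed first. Boundedness permits the exchange.\<close>

lemma integral_pair_reorder:
  fixes g :: "'w \<times> 'v \<times> 'v \<times> 'p \<times> 't \<times> 'h \<Rightarrow> real"
  assumes p: "prob_space A" "prob_space B" "prob_space D" "prob_space E" "prob_space F"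
    and g: "g \<in> borel_measurable (A \<Otimes>\<^sub>M B \<Otimes>\<^sub>M B \<Otimes>\<^sub>M D \<Otimes>\<^sub>M E \<Otimes>\<^sub>M F)" and b: "\<And>z. \<bar>g z\<bar> \<le> 1"
  shows "(\<integral>z. g z \<partial>(A \<Otimes>\<^sub>M B \<Otimes>\<^sub>M B \<Otimes>\<^sub>M D \<Otimes>\<^sub>M E \<Otimes>\<^sub>M F)) =
    (\<integral>P. \<integral>t. \<integral>w. \<integral>v. g (w, fst v, snd v, P, snd t, fst t) \<partial>(B \<Otimes>\<^sub>M B) \<partial>A \<partial>(F \<Otimes>\<^sub>M E) \<partial>D)"
proof -
  note Fub = Fubini_abs_le_1
  let ?S = "D \<Otimes>\<^sub>M (E \<Otimes>\<^sub>M F)"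
  have pr: "prob_space (E \<Otimes>\<^sub>M F)" "prob_space ?S" "prob_space (B \<Otimes>\<^sub>M B)" "prob_space (F \<Otimes>\<^sub>M E)"
    "prob_space (A \<Otimes>\<^sub>M (B \<Otimes>\<^sub>M B))" "prob_space (B \<Otimes>\<^sub>M ?S)"
    by (intro pair_prob p)+
  let ?X = "A \<Otimes>\<^sub>M (B \<Otimes>\<^sub>M B)"
  interpret X: prob_space ?X by (rule pr)
  define f where "f = (\<lambda>z. g (fst (fst z), fst (snd (fst z)), snd (snd (fst z)), snd z))"
  have f: "f \<in> borel_measurable (?X \<Otimes>\<^sub>M ?S)"
    unfolding f_def by (rule measurable_compose[OF _ g]) measurable
  have fb: "\<bar>f z\<bar> \<le> 1" for z unfolding f_def by (rule b)
  define k where "k = (\<lambda>s. \<integral>x. f (x, s) \<partial>?X)"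
  have k: "k \<in> borel_measurable ?S" unfolding k_def by (rule Fub(4)[OF pr(5,2) f fb])
  have kb: "\<bar>k s\<bar> \<le> 1" for s unfolding k_def by (rule X.abs_integral_bounded) (rule fb)
  have "(\<integral>z. g z \<partial>(A \<Otimes>\<^sub>M B \<Otimes>\<^sub>M B \<Otimes>\<^sub>M D \<Otimes>\<^sub>M E \<Otimes>\<^sub>M F)) = (\<integral>w. \<integral>r. g (w, r) \<partial>(B \<Otimes>\<^sub>M (B \<Otimes>\<^sub>M ?S)) \<partial>A)"
    by (rule Fub(1)[OF p(1) pair_prob[OF p(2) pr(6)] g b])
  also have "\<dots> = (\<integral>w. \<integral>z. f ((w, fst z), snd z) \<partial>((B \<Otimes>\<^sub>M B) \<Otimes>\<^sub>M ?S) \<partial>A)"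
  proof (rule Bochner_Integration.integral_cong[OF refl])
    fix w assume w: "w \<in> space A"
    show "(\<integral>r. g (w, r) \<partial>(B \<Otimes>\<^sub>M (B \<Otimes>\<^sub>M ?S))) = (\<integral>z. f ((w, fst z), snd z) \<partial>((B \<Otimes>\<^sub>M B) \<Otimes>\<^sub>M ?S))"
      unfolding f_def fst_conv snd_conv
      by (rule integral_pair_assoc(1)[OF p(2,2) pr(2) Fub(3)[OF p(1) pair_prob[OF p(2) pr(6)] g b w] b])
  qed
  also have "\<dots> = (\<integral>z. f ((fst z, fst (snd z)), snd (snd z)) \<partial>(A \<Otimes>\<^sub>M ((B \<Otimes>\<^sub>M B) \<Otimes>\<^sub>M ?S)))"
  proof -
    have m: "(\<lambda>z. f ((fst z, fst (snd z)), snd (snd z))) \<in> borel_measurable (A \<Otimes>\<^sub>M ((B \<Otimes>\<^sub>M B) \<Otimes>\<^sub>M ?S))"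
      by (rule measurable_compose[OF _ f]) measurable
    show ?thesis using Fub(1)[OF p(1) pair_prob[OF pr(3,2)] m fb] by simp
  qed
  also have "\<dots> = (\<integral>z. f z \<partial>(?X \<Otimes>\<^sub>M ?S))"
  proof -
    have m: "(\<lambda>z. f ((fst z, fst (snd z)), snd (snd z))) \<in> borel_measurable (A \<Otimes>\<^sub>M ((B \<Otimes>\<^sub>M B) \<Otimes>\<^sub>M ?S))"
      by (rule measurable_compose[OF _ f]) measurable
    show ?thesis using integral_pair_assoc(1)[OF p(1) pr(3,2) m fb] by simp
  qed
  also have "\<dots> = (\<integral>s. k s \<partial>?S)" unfolding k_def by (rule Fub(2)[OF pr(5,2) f fb])
  also have "\<dots> = (\<integral>P. \<integral>s. k (P, s) \<partial>(E \<Otimes>\<^sub>M F) \<partial>D)" by (rule Fub(1)[OF p(3) pr(1) k kb])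
  also have "\<dots> = (\<integral>P. \<integral>t. k (P, snd t, fst t) \<partial>(F \<Otimes>\<^sub>M E) \<partial>D)"
  proof (rule Bochner_Integration.integral_cong[OF refl])
    fix P assume P: "P \<in> space D"
    have m: "(\<lambda>s. k (P, s)) \<in> borel_measurable (E \<Otimes>\<^sub>M F)" by (rule Fub(3)[OF p(3) pr(1) k kb P])
    have m': "(\<lambda>t. k (P, snd t, fst t)) \<in> borel_measurable (F \<Otimes>\<^sub>M E)"
      by (rule measurable_compose[OF _ m, where f="\<lambda>t. (snd t, fst t)"]) measurable
    show "(\<integral>s. k (P, s) \<partial>(E \<Otimes>\<^sub>M F)) = (\<integral>t. k (P, snd t, fst t) \<partial>(F \<Otimes>\<^sub>M E))"
      unfolding Fub(2)[OF p(4,5) m kb] using Fub(1)[OF p(5,4) m' kb] by simp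
  qed
  also have "\<dots> = (\<integral>P. \<integral>t. \<integral>w. \<integral>v. g (w, fst v, snd v, P, snd t, fst t) \<partial>(B \<Otimes>\<^sub>M B) \<partial>A \<partial>(F \<Otimes>\<^sub>M E) \<partial>D)"
  proof (intro Bochner_Integration.integral_cong[OF refl])
    fix P t assume "P \<in> space D" "t \<in> space (F \<Otimes>\<^sub>M E)"
    then have s: "(P, snd t, fst t) \<in> space ?S" by (auto simp: space_pair_measure)
    have m: "(\<lambda>x. f (x, P, snd t, fst t)) \<in> borel_measurable ?X"
      by (rule measurable_compose[OF measurable_Pair2'[OF s] f])
    show "k (P, snd t, fst t) = (\<integral>w. \<integral>v. g (w, fst v, snd v, P, snd t, fst t) \<partial>(B \<Otimes>\<^sub>M B) \<partial>A)"
      unfolding k_def Fub(1)[OF p(1) pr(3) m fb] by (simp add: f_def)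
  qed
  finally show ?thesis .
qed

abbreviation codes :: "(nat \<Rightarrow> real) \<Rightarrow> (nat list \<Rightarrow> real) \<times> (nat list \<Rightarrow> real)" where
  "codes v \<equiv> (\<lambda>I. v (site_code I), \<lambda>I. v (site_code_hat I))"

text \<open>Both families are put back into one sequence. Positions that code no multi-index receive
  0, a value in [0, 1] that does not affect the functionals.\<close>

definition decode :: "(nat list \<Rightarrow> real) \<times> (nat list \<Rightarrow> real) \<Rightarrow> nat \<Rightarrow> real" where
  "decode y = (\<lambda>i\<in>{1..}. if i \<in> range site_code then fst y (inv site_code i)
     else if i \<in> range site_code_hat then snd y (inv site_code_hat i) else 0)"

lemma site_code_pos: "site_code I \<in> {1..}" "site_code_hat I \<in> {1..}"
  by (simp_all add: site_code_def site_code_hat_def)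

lemma decode_code [simp]: "decode y (site_code I) = fst y I" "decode y (site_code_hat I) = snd y I"
proof -
  have "site_code_hat I \<notin> range site_code" using site_code_neq by (metis imageE)
  then show "decode y (site_code I) = fst y I" "decode y (site_code_hat I) = snd y I"
    unfolding decode_def using site_code_pos inj_site_code inj_site_code_hat by (simp_all add: inv_f_f)
qed

abbreviation unif_lists :: "(nat list \<Rightarrow> real) measure" where
  "unif_lists \<equiv> PiM UNIV (\<lambda>_. unif01)"

context spin_function
begin

lemma measurable_decode: "decode \<in> unif_lists \<Otimes>\<^sub>M unif_lists \<rightarrow>\<^sub>M unif_seq"
  unfolding unif_seq_def decode_def[abs_def]
proof (rule measurable_restrict)
  fix i :: nat
  have [measurable]: "(\<lambda>y. y I) \<in> unif_lists \<rightarrow>\<^sub>M unif01" for I by simp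
  have [measurable]: "(\<lambda>_. 0) \<in> unif_lists \<Otimes>\<^sub>M unif_lists \<rightarrow>\<^sub>M unif01"
    by (rule measurable_const) (simp add: space_unif01)
  show "(\<lambda>y. if i \<in> range site_code then fst y (inv site_code i)
     else if i \<in> range site_code_hat then snd y (inv site_code_hat i) else 0) \<in> unif_lists \<Otimes>\<^sub>M unif_lists \<rightarrow>\<^sub>M unif01"
    by (cases "i \<in> range site_code"; cases "i \<in> range site_code_hat") simp_all
qed

lemma measurable_codes: "codes \<in> unif_seq \<rightarrow>\<^sub>M unif_lists \<Otimes>\<^sub>M unif_lists"
proof -
  have "(\<lambda>v I. v (f I)) \<in> unif_seq \<rightarrow>\<^sub>M unif_lists" if f: "\<And>I. f I \<in> {1..}" for f
  proof -
    have "(\<lambda>v. \<lambda>I\<in>UNIV. v (f I)) \<in> unif_seq \<rightarrow>\<^sub>M unif_lists"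
      by (intro measurable_restrict unif_seq_component f)
    then show ?thesis by (simp add: restrict_def)
  qed
  then show ?thesis using site_code_pos by (intro measurable_Pair) blast+
qed

text \<open>The two codings select disjoint sets of positions, so the selected values form two
  independent families of uniform variables.\<close>

lemma integral_codes:
  fixes h :: "(nat list \<Rightarrow> real) \<times> (nat list \<Rightarrow> real) \<Rightarrow> real"
  assumes h: "h \<in> borel_measurable (unif_lists \<Otimes>\<^sub>M unif_lists)"
  shows "(\<integral>y. h y \<partial>(unif_lists \<Otimes>\<^sub>M unif_lists)) = (\<integral>v. h (codes v) \<partial>unif_seq)"
proof -
  have "range site_code \<inter> range site_code_hat = {}" using site_code_neq by auto
  then have "distr unif_seq (unif_lists \<Otimes>\<^sub>M unif_lists) codes = unif_lists \<Otimes>\<^sub>M unif_lists"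
    using distr_PiM_split[OF prob_unif01, of site_code UNIV "{1..}" site_code_hat UNIV]
      inj_site_code inj_site_code_hat site_code_pos
    unfolding unif_seq_def by (simp add: Pi_def restrict_def)
  then have "(\<integral>y. h y \<partial>(unif_lists \<Otimes>\<^sub>M unif_lists)) = (\<integral>y. h y \<partial>distr unif_seq (unif_lists \<Otimes>\<^sub>M unif_lists) codes)"
    by simp
  also have "\<dots> = (\<integral>v. h (codes v) \<partial>unif_seq)"
    by (rule integral_distr[OF measurable_codes h])
  finally show ?thesis .
qed

end

text \<open>For sign vectors this is the indicator that y agrees with \<epsilon> on the sites 1,
  ..., K.\<close>

definition ind :: "nat \<Rightarrow> (nat \<Rightarrow> real) \<Rightarrow> (nat \<Rightarrow> real) \<Rightarrow> real" where
  "ind K \<epsilon> y = (\<Prod>i\<in>{1..K}. (1 + \<epsilon> i * y i) / 2)"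

lemma local_ind: "local_fun K (ind K \<epsilon>)"
  by (auto simp: local_fun_def ind_def intro!: prod.cong)

lemma ind_range:
  assumes "\<epsilon> \<in> configs K" "\<And>i. i \<in> {1..K} \<Longrightarrow> y i \<in> signs"
  shows "ind K \<epsilon> y \<in> {0..1}"
proof -
  have "(1 + \<epsilon> i * y i) / 2 \<in> {0..1}" if "i \<in> {1..K}" for i
  proof -
    have "\<epsilon> i \<in> signs" "y i \<in> signs" using assms that by (auto simp: configs_def PiE_iff)
    then show ?thesis by (auto simp: signs_def)
  qed
  then show ?thesis unfolding ind_def by (auto intro!: prod_nonneg prod_le_1)
qed

context cavity_functionals
begin

lemma cavU_cong:
  "codes y = codes y' \<Longrightarrow> cavU p n r m D P \<theta> \<theta>h y = cavU p n r m D P \<theta> \<theta>h y'"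
  by (simp add: cavU_def fun_eq_iff)

abbreviation "cU D P t \<equiv> cavU p n r m D P (snd t) (fst t)"
abbreviation "bnd P \<equiv> site_bound p n r m P"

text \<open>Expanding over the finitely many local configurations separates the interactions, which
  enter through the coefficients, from the spins. Joint measurability then reduces to that of the
  factors.\<close>

lemma cavU_sigma:
  assumes "w \<in> space unif01" "u \<in> space unif01" "v \<in> space unif_seq" "x \<in> space unif_seq"
  shows "cU D P t (\<lambda>i. \<sigma> (w, u, v i, x i)) =
    (\<Sum>\<epsilon>\<in>configs (bnd P). cU D P t \<epsilon> * sval (bnd P) (ind (bnd P) \<epsilon>) w u v x)"
proof -
  let ?y = "\<lambda>i. \<sigma> (w, u, v i, x i)"
  have s: "?y i \<in> signs" if "i \<in> {1..bnd P}" for i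
    using that assms by (intro sigma_in_signs) auto
  have "cU D P t ?y = multilin (bnd P) (cU D P t) ?y"
    by (rule multilin_eq[OF local_cavU s, symmetric])
  also have "\<dots> = (\<Sum>\<epsilon>\<in>configs (bnd P). cU D P t \<epsilon> * sval (bnd P) (ind (bnd P) \<epsilon>) w u v x)"
    unfolding multilin_def
  proof (intro sum.cong refl arg_cong2[where f="(*)"])
    fix \<epsilon> assume \<epsilon>: "\<epsilon> \<in> configs (bnd P)"
    have "sval (bnd P) (ind (bnd P) \<epsilon>) w u v x = ind (bnd P) \<epsilon> ?y"
      by (rule sval_eq[OF assms local_ind]) (use ind_range[OF \<epsilon>] in force)
    then show "(\<Prod>i\<in>{1..bnd P}. (1 + \<epsilon> i * ?y i) / 2) = sval (bnd P) (ind (bnd P) \<epsilon>) w u v x"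
      by (simp only: ind_def)
  qed
  finally show ?thesis .
qed

definition U_comb :: "nat set \<Rightarrow> (nat \<Rightarrow> nat) \<Rightarrow> ((nat \<Rightarrow> interaction) \<times> (nat \<times> nat \<Rightarrow> interaction)) \<times> real \<times> (nat \<Rightarrow> real) \<Rightarrow> real" where
  "U_comb D P z = (\<Sum>\<epsilon>\<in>configs (bnd P). cU D P (fst z) \<epsilon> * savg (bnd P) (ind (bnd P) \<epsilon>) (fst (snd z)) (snd (snd z)))"

lemma savgU_U_comb:
  assumes w: "w \<in> space unif01" and v: "v \<in> space unif_seq"
  shows "savgU D P t w v = U_comb D P (t, w, v)"
proof -
  interpret U: prob_space unif01 by (rule prob_unif01)
  interpret V: prob_space unif_seq by (rule prob_unif_seq)
  let ?s = "\<lambda>\<epsilon>. sval (bnd P) (ind (bnd P) \<epsilon>) w"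
  have j: "(\<lambda>z. ?s \<epsilon> (snd z) v (fst z)) \<in> borel_measurable (unif_seq \<Otimes>\<^sub>M unif01)" for \<epsilon>
    using w v by (intro measurable_sval) auto
  then have j': "(\<lambda>(x, u). ?s \<epsilon> u v x) \<in> borel_measurable (unif_seq \<Otimes>\<^sub>M unif01)" for \<epsilon>
    by (simp add: case_prod_beta)
  have i1: "integrable unif01 (\<lambda>u. ?s \<epsilon> u v x)" if "x \<in> space unif_seq" for \<epsilon> x
    using w v that by (intro U.integrable_const_bound[where B=1] measurable_sval) (auto simp: abs_sval)
  have i2: "integrable unif_seq (\<lambda>x. \<integral>u. ?s \<epsilon> u v x \<partial>unif01)" for \<epsilon>
  proof (rule V.integrable_const_bound[where B=1])
    show "(\<lambda>x. \<integral>u. ?s \<epsilon> u v x \<partial>unif01) \<in> borel_measurable unif_seq"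
      using j' by (rule U.borel_measurable_lebesgue_integral)
  qed (simp add: integral_sval)
  have "savgU D P t w v = (\<integral>x. \<integral>u. (\<Sum>\<epsilon>\<in>configs (bnd P). cU D P t \<epsilon> * ?s \<epsilon> u v x) \<partial>unif01 \<partial>unif_seq)"
    unfolding savgU_def by (intro Bochner_Integration.integral_cong refl cavU_sigma w v)
  also have "\<dots> = (\<integral>x. (\<Sum>\<epsilon>\<in>configs (bnd P). cU D P t \<epsilon> * (\<integral>u. ?s \<epsilon> u v x \<partial>unif01)) \<partial>unif_seq)"
    using i1 by (intro Bochner_Integration.integral_cong refl) (simp add: Bochner_Integration.integral_sum)
  also have "\<dots> = U_comb D P (t, w, v)"
    using i2 by (simp add: Bochner_Integration.integral_sum U_comb_def savg_def)
  finally show ?thesis .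
qed

lemma savg_ind_nonneg:
  assumes w: "w \<in> space unif01" and v: "v \<in> space unif_seq" and \<epsilon>: "\<epsilon> \<in> configs K"
  shows "0 \<le> savg K (ind K \<epsilon>) w v"
  unfolding savg_def
proof (intro integral_nonneg_AE AE_I2)
  fix x u assume x: "x \<in> space unif_seq" and u: "u \<in> space unif01"
  have "sval K (ind K \<epsilon>) w u v x = ind K \<epsilon> (\<lambda>i. \<sigma> (w, u, v i, x i))"
    by (rule sval_eq[OF w u v x local_ind]) (use ind_range[OF \<epsilon>] in force)
  moreover have "\<dots> \<in> {0..1}"
    by (rule ind_range[OF \<epsilon>]) (use sigma_in_signs[OF w u v x] in auto)
  ultimately show "0 \<le> sval K (ind K \<epsilon>) w u v x" by simp
qed

lemma U_comb_le:
  assumes w: "w \<in> space unif01" and v: "v \<in> space unif_seq"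
  shows "\<bar>U_comb D P (t, w, v)\<bar> \<le> U_comb {} P (t, w, v)"
  unfolding U_comb_def fst_conv snd_conv
proof (rule order_trans[OF sum_abs], rule sum_mono)
  fix \<epsilon> assume \<epsilon>: "\<epsilon> \<in> configs (bnd P)"
  have "\<bar>cU D P t \<epsilon>\<bar> \<le> cU {} P t \<epsilon>"
    by (rule abs_cavU_le) (use \<epsilon> in \<open>auto simp: configs_def PiE_iff\<close>)
  then show "\<bar>cU D P t \<epsilon> * savg (bnd P) (ind (bnd P) \<epsilon>) w v\<bar> \<le> cU {} P t \<epsilon> * savg (bnd P) (ind (bnd P) \<epsilon>) w v"
    using savg_ind_nonneg[OF w v \<epsilon>] by (simp add: abs_mult mult_right_mono)
qed

text \<open>A version of the ratio that is bounded by 1 everywhere and jointly measurable, as the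
  Fubini lemmas require. By \<open>U_comb_le\<close> the clipping is inactive for w and v in their
  spaces.\<close>

definition clipped_ratio where
  "clipped_ratio P z = clip ((\<Prod>l\<in>{1..q}. U_comb (C l) P z) / U_comb {} P z ^ q)"

lemma clipped_ratio_eq:
  assumes w: "w \<in> space unif01" and v: "v \<in> space unif_seq"
  shows "clipped_ratio P (t, w, v) = (\<Prod>l\<in>{1..q}. savgU (C l) P t w v) / savgU {} P t w v ^ q"
proof -
  have "\<bar>\<Prod>l\<in>{1..q}. U_comb (C l) P (t, w, v)\<bar> \<le> (\<Prod>l\<in>{1..q}. U_comb {} P (t, w, v))"
    unfolding abs_prod using U_comb_le[OF w v] by (intro prod_mono) auto
  then have "\<bar>\<Prod>l\<in>{1..q}. U_comb (C l) P (t, w, v)\<bar> \<le> U_comb {} P (t, w, v) ^ q" by simp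
  moreover have "\<bar>x / y\<bar> \<le> 1" if "\<bar>x\<bar> \<le> y" for x y :: real
    using that by (cases "y = 0") (auto simp: abs_divide divide_le_eq)
  ultimately have "\<bar>(\<Prod>l\<in>{1..q}. U_comb (C l) P (t, w, v)) / U_comb {} P (t, w, v) ^ q\<bar> \<le> 1" by blast
  then show ?thesis unfolding clipped_ratio_def savgU_U_comb[OF w v] by (rule clip_eq)
qed

lemma abs_clipped_ratio: "\<bar>clipped_ratio P z\<bar> \<le> 1"
  unfolding clipped_ratio_def by (rule abs_clip)

lemma measurable_U_comb: "U_comb D P \<in> borel_measurable (pair_law \<Otimes>\<^sub>M (unif01 \<Otimes>\<^sub>M unif_seq))"
proof -
  have e1: "(\<lambda>t. fst t k xs) \<in> borel_measurable pair_law" for k xs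
    by (rule measurable_compose[OF measurable_fst measurable_eval_PiM_L])
  have e2: "(\<lambda>t. snd t k xs) \<in> borel_measurable pair_law" for k xs
    by (rule measurable_compose[OF measurable_snd measurable_eval_PiM_L])
  have c: "(\<lambda>t. cU D P t \<epsilon>) \<in> borel_measurable pair_law" for \<epsilon>
    unfolding cavU_def Av_def
    by (intro borel_measurable_divide borel_measurable_sum borel_measurable_times borel_measurable_const
        measurable_compose[OF _ borel_measurable_exp] e1 e2)
  have s: "(\<lambda>z. savg K f (fst z) (snd z)) \<in> borel_measurable (unif01 \<Otimes>\<^sub>M unif_seq)" for K f
    using measurable_savg[of K f] by (simp add: case_prod_beta)
  show ?thesis
    unfolding U_comb_def[abs_def]
    by (intro borel_measurable_sum borel_measurable_times measurable_compose[OF measurable_fst c]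
        measurable_compose[OF measurable_snd s])
qed

lemma U_comb_cong: "(\<And>i. i \<le> n \<Longrightarrow> P i = P' i) \<Longrightarrow> U_comb D P = U_comb D P'"
proof -
  assume eq: "\<And>i. i \<le> n \<Longrightarrow> P i = P' i"
  then have "bnd P = bnd P'" unfolding site_bound_def sites_used_def by simp
  moreover have "cU D P t = cU D P' t" for t
    unfolding cavU_def[abs_def] using eq by simp
  ultimately show "U_comb D P = U_comb D P'" unfolding U_comb_def[abs_def] by simp
qed

lemma measurable_clipped_ratio: "(\<lambda>z. clipped_ratio (fst z) (snd z)) \<in> borel_measurable (pois_prod \<Otimes>\<^sub>M (pair_law \<Otimes>\<^sub>M (unif01 \<Otimes>\<^sub>M unif_seq)))"
proof -
  let ?M = "pair_law \<Otimes>\<^sub>M (unif01 \<Otimes>\<^sub>M unif_seq)"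
  \<comment> \<open>The ratio depends on the counts only up to index n, so it is glued from
    countably many values of a finite list. Index 0 is carried along so that positions and indices
    agree.\<close>
  let ?Q = "\<lambda>xs i. if i \<le> n then xs ! i else 0"
  have clipped_ratio: "clipped_ratio P = clipped_ratio (?Q (map P [0..<Suc n]))" for P
  proof -
    have "U_comb D P = U_comb D (?Q (map P [0..<Suc n]))" for D
      by (rule U_comb_cong) (simp del: upt_Suc)
    then show ?thesis unfolding clipped_ratio_def[abs_def] by simp
  qed
  have l: "(\<lambda>z. map (fst z) [0..<Suc n]) \<in> pois_prod \<Otimes>\<^sub>M ?M \<rightarrow>\<^sub>M count_space UNIV"
    by (rule measurable_map_list) (rule measurable_compose[OF measurable_fst measurable_PiM_pmf_component])
  have m: "(\<lambda>z. clipped_ratio (?Q xs) (snd z)) \<in> borel_measurable (pois_prod \<Otimes>\<^sub>M ?M)" for xs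
    unfolding clipped_ratio_def
    by (intro measurable_compose[OF _ borel_clip] borel_measurable_divide borel_measurable_prod borel_measurable_power
        measurable_compose[OF measurable_snd measurable_U_comb])
  show ?thesis
    by (subst clipped_ratio) (rule measurable_compose_countable[OF m l])
qed

lemma savgU_cong: "codes v = codes v' \<Longrightarrow> savgU D P t w v = savgU D P t w v'"
  unfolding savgU_def by (intro Bochner_Integration.integral_cong refl cavU_cong) (simp add: fun_eq_iff)

text \<open>The inner integral over u, x and x-hat becomes one over u and a single sequence by
  \<open>integral_codes\<close>. The integrand \<open>G\<close> is replaced by its expansion
  \<open>G'\<close>, whose measurability is known.\<close>

lemma cavity_U_eq:
  assumes w: "w \<in> space unif01" and v: "v \<in> space unif_lists" "vh \<in> space unif_lists"
  shows "cavity_U p n r m \<sigma> D (w, v, vh, P, \<theta>, \<theta>h) = savgU D P (\<theta>h, \<theta>) w (decode (v, vh))"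
    and "cavity_V p n r \<sigma> (w, v, vh, P, \<theta>, \<theta>h) = savgU {} P (\<theta>h, \<theta>) w (decode (v, vh))"
proof -
  let ?LL = "unif_lists \<Otimes>\<^sub>M unif_lists"
  have prob_LL: "prob_space ?LL" by (intro pair_prob prob_space_PiM prob_unif01)
  interpret U: prob_space unif01 by (rule prob_unif01)
  define d where "d = decode (v, vh)"
  have d: "d \<in> space unif_seq" unfolding d_def
    by (rule measurable_space[OF measurable_decode]) (use v in \<open>simp add: space_pair_measure\<close>)
  define G where "G = (\<lambda>D u y. cU D P (\<theta>h, \<theta>) (\<lambda>i. \<sigma> (w, u, d i, decode y i)))"
  define G' where "G' = (\<lambda>D u y. \<Sum>\<epsilon>\<in>configs (bnd P). cU D P (\<theta>h, \<theta>) \<epsilon> * sval (bnd P) (ind (bnd P) \<epsilon>) w u d (decode y))"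
  have GG: "G D u y = G' D u y" if "u \<in> space unif01" "y \<in> space ?LL" for D u y
    unfolding G_def G'_def using that measurable_space[OF measurable_decode that(2)]
    by (intro cavU_sigma w d)
  have m: "(\<lambda>z. G' D (fst z) (snd z)) \<in> borel_measurable (unif01 \<Otimes>\<^sub>M ?LL)" for D
    unfolding G'_def
  proof (intro borel_measurable_sum borel_measurable_times borel_measurable_const measurable_sval)
    show "(\<lambda>z. decode (snd z)) \<in> unif01 \<Otimes>\<^sub>M ?LL \<rightarrow>\<^sub>M unif_seq"
      by (rule measurable_compose[OF measurable_snd measurable_decode])
  qed (use w d in auto)
  have mswap: "(\<lambda>y. \<integral>u. G' D u y \<partial>unif01) \<in> borel_measurable ?LL" for D
  proof -
    have "(\<lambda>z. G' D (snd z) (fst z)) \<in> borel_measurable (?LL \<Otimes>\<^sub>M unif01)"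
      using measurable_compose[OF measurable_pair_swap'[of ?LL unif01] m[of D]] by (simp add: case_prod_beta)
    then have "(\<lambda>(y, u). G' D u y) \<in> borel_measurable (?LL \<Otimes>\<^sub>M unif01)" by (simp add: case_prod_beta)
    then show ?thesis by (rule U.borel_measurable_lebesgue_integral)
  qed
  have b: "\<bar>G' D u y\<bar> \<le> (\<Sum>\<epsilon>\<in>configs (bnd P). \<bar>cU D P (\<theta>h, \<theta>) \<epsilon>\<bar>)" for D u y
    unfolding G'_def
  proof (rule order_trans[OF sum_abs], rule sum_mono)
    fix \<epsilon>
    show "\<bar>cU D P (\<theta>h, \<theta>) \<epsilon> * sval (bnd P) (ind (bnd P) \<epsilon>) w u d (decode y)\<bar> \<le> \<bar>cU D P (\<theta>h, \<theta>) \<epsilon>\<bar>"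
      unfolding abs_mult using mult_left_mono[OF abs_sval abs_ge_zero] by (metis mult.right_neutral)
  qed
  have main: "(\<integral>y. G D (fst y) (snd y) \<partial>inner_law) = savgU D P (\<theta>h, \<theta>) w d" for D
  proof -
    have "(\<integral>y. G D (fst y) (snd y) \<partial>inner_law) = (\<integral>y. G' D (fst y) (snd y) \<partial>(unif01 \<Otimes>\<^sub>M ?LL))"
      unfolding inner_law_def by (intro Bochner_Integration.integral_cong refl GG) (auto simp: space_pair_measure)
    also have "\<dots> = (\<integral>y. \<integral>u. G' D (fst (u, y)) (snd (u, y)) \<partial>unif01 \<partial>?LL)"
      by (rule bounded_Fubini(2)[OF prob_unif01 prob_LL m b])
    also have "\<dots> = (\<integral>x. \<integral>u. G' D u (codes x) \<partial>unif01 \<partial>unif_seq)"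
      unfolding fst_conv snd_conv by (rule integral_codes[OF mswap])
    also have "\<dots> = savgU D P (\<theta>h, \<theta>) w d"
      unfolding savgU_def
    proof (intro Bochner_Integration.integral_cong refl)
      fix x u assume x: "x \<in> space unif_seq" and u: "u \<in> space unif01"
      have "G' D u (codes x) = G D u (codes x)"
        using GG[OF u measurable_space[OF measurable_codes x]] by simp
      also have "\<dots> = cU D P (\<theta>h, \<theta>) (\<lambda>i. \<sigma> (w, u, d i, x i))"
        unfolding G_def by (rule cavU_cong) simp
      finally show "G' D u (codes x) = cU D P (\<theta>h, \<theta>) (\<lambda>i. \<sigma> (w, u, d i, x i))" .
    qed
    finally show ?thesis .
  qed
  show "cavity_U p n r m \<sigma> D (w, v, vh, P, \<theta>, \<theta>h) = savgU D P (\<theta>h, \<theta>) w (decode (v, vh))"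
    unfolding main[symmetric, unfolded d_def] cavity_U_def
    by (intro Bochner_Integration.integral_cong refl)
      (simp add: G_def d_def cavU_def split_paired_all del: upt_Suc)
  show "cavity_V p n r \<sigma> (w, v, vh, P, \<theta>, \<theta>h) = savgU {} P (\<theta>h, \<theta>) w (decode (v, vh))"
    unfolding main[symmetric, unfolded d_def] cavity_V_def
    by (intro Bochner_Integration.integral_cong refl)
      (simp add: G_def d_def cavU_def split_paired_all del: upt_Suc)
qed

text \<open>After reordering, counts and interactions are fixed, and the integral over w, v and
  v-hat becomes one over w and a single sequence, which is \<open>lim_ratio\<close>.\<close>

theorem outer_cavity:
  "(\<integral>z. (\<Prod>l=1..q. cavity_U p n r m \<sigma> (C l) z) / cavity_V p n r \<sigma> z ^ q \<partial>outer_law L p \<alpha>) =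
    (\<integral>P. \<integral>t. lim_ratio P t \<partial>pair_law \<partial>pois_prod)"
proof -
  let ?LL = "unif_lists \<Otimes>\<^sub>M unif_lists"
  define g :: "outer \<Rightarrow> real" where
    "g = (\<lambda>(w, v, vh, P, \<theta>, \<theta>h). clipped_ratio P ((\<theta>h, \<theta>), w, decode (v, vh)))"
  have outer: "outer_law L p \<alpha> = unif01 \<Otimes>\<^sub>M unif_lists \<Otimes>\<^sub>M unif_lists \<Otimes>\<^sub>M pois_prod \<Otimes>\<^sub>M PiM UNIV (\<lambda>_. L) \<Otimes>\<^sub>M PiM UNIV (\<lambda>_. L)"
    unfolding outer_law_def poisson_def by (simp only: mult.commute)
  have pl: "prob_space unif_lists" "prob_space pois_prod"
    by (intro prob_space_PiM prob_unif01 prob_space_measure_pmf)+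
  have g: "g \<in> borel_measurable (unif01 \<Otimes>\<^sub>M unif_lists \<Otimes>\<^sub>M unif_lists \<Otimes>\<^sub>M pois_prod \<Otimes>\<^sub>M PiM UNIV (\<lambda>_. L) \<Otimes>\<^sub>M PiM UNIV (\<lambda>_. L))"
  proof -
    note [measurable] = measurable_decode
    have "(\<lambda>z. (fst (snd (snd (snd z))), ((snd (snd (snd (snd (snd z)))), fst (snd (snd (snd (snd z))))), fst z, decode (fst (snd z), fst (snd (snd z))))))
      \<in> unif01 \<Otimes>\<^sub>M unif_lists \<Otimes>\<^sub>M unif_lists \<Otimes>\<^sub>M pois_prod \<Otimes>\<^sub>M PiM UNIV (\<lambda>_. L) \<Otimes>\<^sub>M PiM UNIV (\<lambda>_. L) \<rightarrow>\<^sub>M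
        pois_prod \<Otimes>\<^sub>M (pair_law \<Otimes>\<^sub>M (unif01 \<Otimes>\<^sub>M unif_seq))"
      by measurable
    from measurable_compose[OF this measurable_clipped_ratio] show ?thesis by (simp add: g_def case_prod_beta)
  qed
  have gb: "\<bar>g z\<bar> \<le> 1" for z unfolding g_def case_prod_beta by (rule abs_clipped_ratio)
  have "(\<integral>z. (\<Prod>l=1..q. cavity_U p n r m \<sigma> (C l) z) / cavity_V p n r \<sigma> z ^ q \<partial>outer_law L p \<alpha>) = (\<integral>z. g z \<partial>outer_law L p \<alpha>)"
  proof (rule Bochner_Integration.integral_cong[OF refl])
    fix z assume z: "z \<in> space (outer_law L p \<alpha>)"
    obtain w v vh P \<theta> \<theta>h where ze: "z = (w, v, vh, P, \<theta>, \<theta>h)" by (cases z) auto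
    have sp: "w \<in> space unif01" "v \<in> space unif_lists" "vh \<in> space unif_lists"
      using z unfolding ze outer by (auto simp: space_pair_measure)
    have d: "decode (v, vh) \<in> space unif_seq"
      by (rule measurable_space[OF measurable_decode]) (use sp in \<open>simp add: space_pair_measure\<close>)
    show "(\<Prod>l=1..q. cavity_U p n r m \<sigma> (C l) z) / cavity_V p n r \<sigma> z ^ q = g z"
      unfolding ze g_def prod.case cavity_U_eq[OF sp] clipped_ratio_eq[OF sp(1) d] ..
  qed
  also have "\<dots> = (\<integral>P. \<integral>t. \<integral>w. \<integral>y. g (w, fst y, snd y, P, snd t, fst t) \<partial>?LL \<partial>unif01 \<partial>pair_law \<partial>pois_prod)"
    unfolding outer by (rule integral_pair_reorder[OF prob_unif01 pl prob_PiM_L prob_PiM_L g gb])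
  also have "\<dots> = (\<integral>P. \<integral>t. lim_ratio P t \<partial>pair_law \<partial>pois_prod)"
  proof (intro Bochner_Integration.integral_cong refl)
    fix P t assume P: "P \<in> space pois_prod" and t: "t \<in> space pair_law"
    have prv: "prob_space (unif01 \<Otimes>\<^sub>M unif_seq)" by (rule pair_prob[OF prob_unif01 prob_unif_seq])
    have m: "(\<lambda>z. clipped_ratio P (t, z)) \<in> borel_measurable (unif01 \<Otimes>\<^sub>M unif_seq)"
    proof -
      have "(\<lambda>z. (P, t, z)) \<in> unif01 \<Otimes>\<^sub>M unif_seq \<rightarrow>\<^sub>M pois_prod \<Otimes>\<^sub>M (pair_law \<Otimes>\<^sub>M (unif01 \<Otimes>\<^sub>M unif_seq))"
        using P t by (intro measurable_Pair measurable_const) auto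
      from measurable_compose[OF this measurable_clipped_ratio] show ?thesis by simp
    qed
    have "(\<integral>w. \<integral>y. g (w, fst y, snd y, P, snd t, fst t) \<partial>?LL \<partial>unif01) = (\<integral>w. \<integral>y. clipped_ratio P (t, w, decode y) \<partial>?LL \<partial>unif01)"
      by (simp add: g_def)
    also have "\<dots> = (\<integral>w. \<integral>v. clipped_ratio P (t, w, v) \<partial>unif_seq \<partial>unif01)"
    proof (rule Bochner_Integration.integral_cong[OF refl])
      fix w assume w: "w \<in> space unif01"
      have mw: "(\<lambda>v. clipped_ratio P (t, w, v)) \<in> borel_measurable unif_seq"
        by (rule Fubini_abs_le_1(3)[OF prob_unif01 prob_unif_seq m abs_clipped_ratio w])
      have "(\<integral>y. clipped_ratio P (t, w, decode y) \<partial>?LL) = (\<integral>v. clipped_ratio P (t, w, decode (codes v)) \<partial>unif_seq)"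
        by (rule integral_codes[OF measurable_compose[OF measurable_decode mw]])
      also have "\<dots> = (\<integral>v. clipped_ratio P (t, w, v) \<partial>unif_seq)"
      proof (rule Bochner_Integration.integral_cong[OF refl])
        fix v assume v: "v \<in> space unif_seq"
        have "decode (codes v) \<in> space unif_seq"
          by (rule measurable_space[OF measurable_decode measurable_space[OF measurable_codes v]])
        moreover have "savgU D P t w (decode (codes v)) = savgU D P t w v" for D
          by (rule savgU_cong) simp
        ultimately show "clipped_ratio P (t, w, decode (codes v)) = clipped_ratio P (t, w, v)"
          using clipped_ratio_eq[OF w] v by simp
      qed
      finally show "(\<integral>y. clipped_ratio P (t, w, decode y) \<partial>?LL) = (\<integral>v. clipped_ratio P (t, w, v) \<partial>unif_seq)" .
    qed
    also have "\<dots> = (\<integral>z. clipped_ratio P (t, z) \<partial>(unif01 \<Otimes>\<^sub>M unif_seq))"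
      by (rule Fubini_abs_le_1(1)[OF prob_unif01 prob_unif_seq m abs_clipped_ratio, symmetric])
    also have "\<dots> = lim_ratio P t"
      unfolding lim_ratio_def
    proof (rule Bochner_Integration.integral_cong[OF refl])
      fix z assume "z \<in> space (unif01 \<Otimes>\<^sub>M unif_seq)"
      then have "fst z \<in> space unif01" "snd z \<in> space unif_seq" by (auto simp: space_pair_measure)
      from clipped_ratio_eq[OF this, of P t] show "clipped_ratio P (t, z) =
        (\<Prod>l\<in>{1..q}. savgU (C l) P t (fst z) (snd z)) / savgU {} P t (fst z) (snd z) ^ q" by simp
    qed
    finally show "(\<integral>w. \<integral>y. g (w, fst y, snd y, P, snd t, fst t) \<partial>?LL \<partial>unif01) = lim_ratio P t" .
  qed
  finally show ?thesis .
qed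

lemma measurable_lim_ratio: "lim_ratio P \<in> borel_measurable pair_law"
proof -
  interpret W: prob_space "unif01 \<Otimes>\<^sub>M unif_seq" by (rule pair_prob[OF prob_unif01 prob_unif_seq])
  have "(\<lambda>z. (P, z)) \<in> pair_law \<Otimes>\<^sub>M (unif01 \<Otimes>\<^sub>M unif_seq) \<rightarrow>\<^sub>M pois_prod \<Otimes>\<^sub>M (pair_law \<Otimes>\<^sub>M (unif01 \<Otimes>\<^sub>M unif_seq))"
    by (intro measurable_Pair measurable_const) (auto simp: space_PiM)
  from measurable_compose[OF this measurable_clipped_ratio]
  have [measurable]: "clipped_ratio P \<in> borel_measurable (pair_law \<Otimes>\<^sub>M (unif01 \<Otimes>\<^sub>M unif_seq))" by simp
  have "lim_ratio P = (\<lambda>t. \<integral>z. clipped_ratio P (t, z) \<partial>(unif01 \<Otimes>\<^sub>M unif_seq))"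
    unfolding lim_ratio_def
    by (intro ext Bochner_Integration.integral_cong refl) (auto simp: space_pair_measure clipped_ratio_eq)
  also have "\<dots> \<in> borel_measurable pair_law" by measurable
  finally show ?thesis .
qed

end

context cavity_limit
begin

theorem replica_moments:
  "(\<integral>\<omega>. (\<Prod>l=1..q. \<Prod>i\<in>C l. spin_array \<sigma> \<omega> (i, l)) \<partial>seeds) =
    (\<integral>z. (\<Prod>l=1..q. cavity_U p n r m \<sigma> (C l) z) / cavity_V p n r \<sigma> z ^ q \<partial>outer_law L p \<alpha>)"
proof -
  have "(\<integral>\<omega>. (\<Prod>l=1..q. \<Prod>i\<in>C l. spin_array \<sigma> \<omega> (i, l)) \<partial>seeds) = (\<integral>\<omega>. test_fun m q spins (spin_array \<sigma> \<omega>) \<partial>seeds)"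
  proof (rule Bochner_Integration.integral_cong[OF refl])
    fix \<omega> assume \<omega>: "\<omega> \<in> space seeds"
    obtain w u v x where z: "\<omega> = (w, u, v, x)" by (cases \<omega>) auto
    have s: "spin_array \<sigma> \<omega> (i, l) \<in> signs" if "i \<in> {1..}" "l \<in> {1..}" for i l
    proof -
      have "w \<in> {0..1}" "u l \<in> {0..1}" "v i \<in> {0..1}" "x (i, l) \<in> {0..1}"
        using \<omega> that unfolding z seeds_def
        by (auto simp: space_pair_measure space_PiM PiE_iff array_idx_def space_unif01)
      moreover have "spin_array \<sigma> \<omega> (i, l) = \<sigma> (w, u l, v i, x (i, l))"
        using that by (simp add: z array_idx_def)
      ultimately show ?thesis using \<sigma>_signs by auto
    qed
    show "(\<Prod>l=1..q. \<Prod>i\<in>C l. spin_array \<sigma> \<omega> (i, l)) = test_fun m q spins (spin_array \<sigma> \<omega>)"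
      unfolding test_fun_def
    proof (rule prod.cong[OF refl])
      fix l assume l: "l \<in> {1..q}"
      have c: "clip (spin_array \<sigma> \<omega> (i, l)) = spin_array \<sigma> \<omega> (i, l)" if "i \<in> {1..m}" for i
        using that l by (intro clip_signs s) auto
      have "multilin m (spins l) (\<lambda>i. clip (spin_array \<sigma> \<omega> (i, l))) = spins l (\<lambda>i. clip (spin_array \<sigma> \<omega> (i, l)))"
      proof (rule multilin_eq[OF local_spins[OF l]])
        fix i assume i: "i \<in> {1..m}"
        show "clip (spin_array \<sigma> \<omega> (i, l)) \<in> signs"
          unfolding c[OF i] using i l by (intro s) auto
      qed
      also have "\<dots> = (\<Prod>i\<in>C l. spin_array \<sigma> \<omega> (i, l))"
        using C[OF l] c by (intro prod.cong refl) auto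
      finally show "(\<Prod>i\<in>C l. spin_array \<sigma> \<omega> (i, l)) = multilin m (spins l) (\<lambda>i. clip (spin_array \<sigma> \<omega> (i, l)))" ..
    qed
  qed
  then show ?thesis unfolding cavity_equation outer_cavity .
qed

end

section \<open>Centering the interaction\<close>

lemma distr_PiM_map:
  assumes M: "prob_space M" and f [measurable]: "f \<in> M \<rightarrow>\<^sub>M N"
  shows "distr (PiM I (\<lambda>_. M)) (PiM I (\<lambda>_. distr M N f)) (\<lambda>\<omega>. \<lambda>i\<in>I. f (\<omega> i)) = PiM I (\<lambda>_. distr M N f)"
    (is "?L = PiM I (\<lambda>_. ?D)")
proof (rule measure_eqI_PiM_infinite[symmetric, OF refl])
  interpret M: prob_space M by fact
  have D: "prob_space ?D" by (rule M.prob_space_distr[OF f])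
  interpret D: prob_space "PiM I (\<lambda>_. ?D)" by (intro prob_space_PiM D)
  show "finite_measure (PiM I (\<lambda>_. ?D))" by unfold_locales
  let ?t = "\<lambda>\<omega>. \<lambda>i\<in>I. f (\<omega> i)"
  have t: "?t \<in> PiM I (\<lambda>_. M) \<rightarrow>\<^sub>M PiM I (\<lambda>_. ?D)" by measurable
  fix A J assume J: "finite J" "J \<subseteq> I" and A: "\<And>i. i \<in> J \<Longrightarrow> A i \<in> sets ?D"
  let ?B = "\<lambda>i. f -` A i \<inter> space M"
  have B: "?B i \<in> sets M" if "i \<in> J" for i using A[OF that] by simp
  have "?t -` prod_emb I (\<lambda>_. ?D) J (Pi\<^sub>E J A) \<inter> space (PiM I (\<lambda>_. M)) = prod_emb I (\<lambda>_. M) J (Pi\<^sub>E J ?B)"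
    using J(2) measurable_space[OF f] by (auto simp: prod_emb_def space_PiM PiE_iff extensional_def subset_iff)
  then have "?L (prod_emb I (\<lambda>_. ?D) J (Pi\<^sub>E J A)) = PiM I (\<lambda>_. M) (prod_emb I (\<lambda>_. M) J (Pi\<^sub>E J ?B))"
    using J A by (subst emeasure_distr[OF t]) (auto intro!: sets_PiM_I)
  also have "\<dots> = (\<Prod>i\<in>J. M (?B i))" using J B by (intro emeasure_PiM_emb M) auto
  also have "\<dots> = (\<Prod>i\<in>J. ?D (A i))" using A by (intro prod.cong refl) (simp add: emeasure_distr)
  also have "\<dots> = PiM I (\<lambda>_. ?D) (prod_emb I (\<lambda>_. ?D) J (Pi\<^sub>E J A))"
    using J A by (intro emeasure_PiM_emb[symmetric] D) auto
  finally show "PiM I (\<lambda>_. ?D) (prod_emb I (\<lambda>_. ?D) J (Pi\<^sub>E J A)) = ?L (prod_emb I (\<lambda>_. ?D) J (Pi\<^sub>E J A))" ..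
qed simp

definition center :: "nat \<Rightarrow> interaction \<Rightarrow> interaction" where
  "center p \<theta> = (\<lambda>xs\<in>cube p. \<theta> xs - \<theta> (replicate p 1))"

lemma center_cube: "xs \<in> cube p \<Longrightarrow> center p \<theta> xs = \<theta> xs - \<theta> (replicate p 1)"
  by (simp add: center_def)

text \<open>Centering multiplies a weight by a positive constant that depends on the interactions
  but not on the configuration. Functions with this invariance ignore it.\<close>

definition scale_inv :: "nat \<Rightarrow> (((nat \<Rightarrow> real) \<Rightarrow> real) \<Rightarrow> real) \<Rightarrow> bool" where
  "scale_inv N \<Phi> \<longleftrightarrow> (\<forall>w k. 0 < k \<longrightarrow> \<Phi> (\<lambda>\<sigma>\<in>configs N. k * w \<sigma>) = \<Phi> w)"

lemma scale_inv_gav_prod: "scale_inv N (\<lambda>w. \<Prod>l\<in>A. gav N w (f l))"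
proof -
  have "gav N (\<lambda>\<sigma>\<in>configs N. k * w \<sigma>) g = gav N w g" if "0 < k" for k w g
  proof -
    have "(\<Sum>\<sigma>\<in>configs N. \<bar>(\<lambda>\<sigma>\<in>configs N. k * w \<sigma>) \<sigma>\<bar> * g \<sigma>) = k * (\<Sum>\<sigma>\<in>configs N. \<bar>w \<sigma>\<bar> * g \<sigma>)"
      "(\<Sum>\<sigma>\<in>configs N. \<bar>(\<lambda>\<sigma>\<in>configs N. k * w \<sigma>) \<sigma>\<bar>) = k * (\<Sum>\<sigma>\<in>configs N. \<bar>w \<sigma>\<bar>)"
      unfolding sum_distrib_left using that by (auto intro!: sum.cong simp: abs_mult)
    then show ?thesis unfolding gav_def using that by simp
  qed
  then show ?thesis by (simp add: scale_inv_def)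
qed

text \<open>In a perturbation term the constants of all its interactions leave the average over the
  auxiliary spin as one common factor.\<close>

lemma bweight_center:
  assumes t: "wf_term p N t" and p: "0 < p"
  obtains k where "0 < k" "\<And>\<sigma>. \<sigma> \<in> configs N \<Longrightarrow> bweight t (\<lambda>i. center p (\<theta> i)) \<sigma> = k * bweight t \<theta> \<sigma>"
proof (cases t)
  case (Th I)
  let ?k = "exp (- \<theta> 0 (replicate p 1))"
  have "bweight t (\<lambda>i. center p (\<theta> i)) \<sigma> = ?k * bweight t \<theta> \<sigma>" if "\<sigma> \<in> configs N" for \<sigma>
    using t Th that by (simp add: center_cube map_in_cube exp_diff exp_minus field_simps)
  then show ?thesis using that[of ?k] by simp
next
  case (Pt Js)
  let ?s = "\<Sum>k=1..length Js. \<theta> k (replicate p 1)"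
  have "bweight t (\<lambda>i. center p (\<theta> i)) \<sigma> = exp (- ?s) * bweight t \<theta> \<sigma>" if \<sigma>: "\<sigma> \<in> configs N" for \<sigma>
  proof -
    have "(\<Sum>k=1..length Js. center p (\<theta> k) (\<epsilon> # map \<sigma> (Js ! (k - 1)))) =
      (\<Sum>k=1..length Js. \<theta> k (\<epsilon> # map \<sigma> (Js ! (k - 1)))) - ?s" if \<epsilon>: "\<epsilon> \<in> signs" for \<epsilon>
      unfolding sum_subtractf[symmetric]
    proof (intro sum.cong refl)
      fix k assume "k \<in> {1..length Js}"
      then have "Js ! (k - 1) \<in> set Js" by (intro nth_mem) auto
      then have "map \<sigma> (Js ! (k - 1)) \<in> cube (p - 1)" using t Pt by (intro map_in_cube[OF \<sigma>]) auto
      then have "\<epsilon> # map \<sigma> (Js ! (k - 1)) \<in> cube p" using \<epsilon> p by (auto simp: cube_def)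
      then show "center p (\<theta> k) (\<epsilon> # map \<sigma> (Js ! (k - 1))) = \<theta> k (\<epsilon> # map \<sigma> (Js ! (k - 1))) - \<theta> k (replicate p 1)"
        by (rule center_cube)
    qed
    then have "(\<Sum>\<epsilon>\<in>signs. exp (\<Sum>k=1..length Js. center p (\<theta> k) (\<epsilon> # map \<sigma> (Js ! (k - 1))))) =
      (\<Sum>\<epsilon>\<in>signs. exp (- ?s) * exp (\<Sum>k=1..length Js. \<theta> k (\<epsilon> # map \<sigma> (Js ! (k - 1)))))"
      by (intro sum.cong refl) (simp only: diff_conv_add_uminus exp_add mult.commute)
    then show ?thesis unfolding Pt bweight.simps Av_def by (simp only: sum_distrib_left[symmetric] times_divide_eq_right)
  qed
  then show ?thesis using that[of "exp (- ?s)"] by simp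
qed

context interaction_law
begin

abbreviation centered :: "interaction measure" where
  "centered \<equiv> distr L (fun_space (cube p)) (center p)"

lemma measurable_center [measurable]: "center p \<in> L \<rightarrow>\<^sub>M fun_space (cube p)"
  unfolding fun_space_def center_def[abs_def]
  by (intro measurable_restrict borel_measurable_diff measurable_eval_L)

lemma interaction_law_centered: "interaction_law centered p"
  by (rule interaction_law.intro[OF L.prob_space_distr[OF measurable_center] sets_distr])

lemma measurable_PiM_center: "(\<lambda>\<theta> i. center p (\<theta> i)) \<in> PiM UNIV (\<lambda>_. L) \<rightarrow>\<^sub>M PiM UNIV (\<lambda>_. centered)"
proof -
  have "(\<lambda>\<theta>. \<lambda>i\<in>UNIV. center p (\<theta> i)) \<in> PiM UNIV (\<lambda>_. L) \<rightarrow>\<^sub>M PiM UNIV (\<lambda>_. centered)"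
    by measurable
  then show ?thesis by (simp add: restrict_UNIV)
qed

lemma PiM_centered: "distr (PiM UNIV (\<lambda>_. L)) (PiM UNIV (\<lambda>_. centered)) (\<lambda>\<theta> i. center p (\<theta> i)) = PiM UNIV (\<lambda>_. centered)"
  using distr_PiM_map[OF L_prob measurable_center, of UNIV] by (simp add: restrict_UNIV)

text \<open>Scale invariance is carried through the induction, because each operator is applied to a
  function already averaged over other terms and must ignore the constant produced by its own
  term.\<close>

lemma steps_center:
  assumes g: "good N \<Phi>" and s: "scale_inv N \<Phi>" and p: "0 < p"
    and M: "\<And>t. t \<in># M \<Longrightarrow> wf_term p N t"
  shows "fold_mset (interaction_law.step centered N) \<Phi> M = steps N \<Phi> M \<and> scale_inv N (steps N \<Phi> M)"
  using M
proof (induction M)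
  case empty
  then show ?case using s by simp
next
  case (add t M)
  interpret c: interaction_law centered p by (rule interaction_law_centered)
  let ?\<Psi> = "steps N \<Phi> M"
  have IH: "c.steps N \<Phi> M = ?\<Psi>" "scale_inv N ?\<Psi>" using add by auto
  note g' = good_steps[OF g, of M]
  have m: "(\<lambda>\<theta>. ?\<Psi> (act N t \<theta> w)) \<in> borel_measurable c.Ls" for w
    by (rule measurable_compose[OF c.measurable_act1 goodD(1)[OF g']])
  have "c.step N t ?\<Psi> w = step N t ?\<Psi> w" for w
  proof -
    have "c.step N t ?\<Psi> w = (\<integral>\<theta>. ?\<Psi> (act N t \<theta> w) \<partial>distr (PiM UNIV (\<lambda>_. L)) (PiM UNIV (\<lambda>_. centered)) (\<lambda>\<theta> i. center p (\<theta> i)))"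
      unfolding c.step_eq[OF g'] PiM_centered c.Ls_def ..
    also have "\<dots> = (\<integral>\<theta>. ?\<Psi> (act N t (\<lambda>i. center p (\<theta> i)) w) \<partial>PiM UNIV (\<lambda>_. L))"
      by (rule integral_distr[OF measurable_PiM_center m[unfolded c.Ls_def]])
    also have "\<dots> = (\<integral>\<theta>. ?\<Psi> (act N t \<theta> w) \<partial>PiM UNIV (\<lambda>_. L))"
    proof (intro Bochner_Integration.integral_cong refl)
      fix \<theta> :: "nat \<Rightarrow> interaction"
      have "wf_term p N t" using add.prems by simp
      then obtain k where k: "0 < k" "\<And>\<sigma>. \<sigma> \<in> configs N \<Longrightarrow> bweight t (\<lambda>i. center p (\<theta> i)) \<sigma> = k * bweight t \<theta> \<sigma>"
        using bweight_center[OF _ p] by metis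
      have "act N t (\<lambda>i. center p (\<theta> i)) w = (\<lambda>\<sigma>\<in>configs N. k * act N t \<theta> w \<sigma>)"
        unfolding act_def by (rule restrict_ext) (simp add: k(2))
      then show "?\<Psi> (act N t (\<lambda>i. center p (\<theta> i)) w) = ?\<Psi> (act N t \<theta> w)"
        using IH(2) k(1) by (simp add: scale_inv_def)
    qed
    finally show ?thesis unfolding step_eq[OF g'] Ls_def .
  qed
  moreover have "scale_inv N (step N t ?\<Psi>)"
    unfolding scale_inv_def
  proof (intro allI impI)
    fix w and k :: real assume k: "0 < k"
    have "act N t \<theta> (\<lambda>\<sigma>\<in>configs N. k * w \<sigma>) = (\<lambda>\<sigma>\<in>configs N. k * act N t \<theta> w \<sigma>)" for \<theta>
      by (auto simp: act_def)
    then show "step N t ?\<Psi> (\<lambda>\<sigma>\<in>configs N. k * w \<sigma>) = step N t ?\<Psi> w"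
      using IH(2) k by (simp add: step_eq[OF g'] scale_inv_def)
  qed
  ultimately show ?case by (simp only: c.steps_add steps_add IH(1) fun_eq_iff simp_thms)
qed

text \<open>The law of the terms is the same for both interaction laws. Only the averaging operators
  differ, and \<open>steps_center\<close> identifies them.\<close>

lemma disorder_centered:
  assumes sym: "symmetric_interaction_law centered p"
    and g: "good N \<Phi>" and s: "scale_inv N \<Phi>" and p: "0 < p" and N: "0 < N"
  shows "(\<integral>d. \<Phi> (wt p N d) \<partial>disorder_law centered p \<alpha> c N) = (\<integral>d. \<Phi> (wt p N d) \<partial>disorder_law L p \<alpha> c N)"
proof -
  interpret c: symmetric_interaction_law centered p by (rule sym)
  have "c.terms_avg N \<Phi> M = terms_avg N \<Phi> M" if "M \<in> set_pmf (terms_law \<alpha> c N)" for M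
  proof -
    have "wf_term p N t" if "t \<in># M" for t
      using c.wf_terms_law[OF N] that \<open>M \<in> _\<close> by blast
    then show ?thesis unfolding c.terms_avg_def terms_avg_def using steps_center[OF g s p] by simp
  qed
  then show ?thesis
    unfolding disorder_expectation[OF g] c.disorder_expectation[OF g]
    by (intro expectation_cong_pmf)
qed

end

context cavity_functionals
begin

definition center_pair :: "(nat \<Rightarrow> interaction) \<times> (nat \<times> nat \<Rightarrow> interaction) \<Rightarrow> (nat \<Rightarrow> interaction) \<times> (nat \<times> nat \<Rightarrow> interaction)" where
  "center_pair = (\<lambda>(\<theta>h, \<theta>). (\<lambda>k. center p (\<theta>h k), \<lambda>ki. center p (\<theta> ki)))"

text \<open>The constant K is the same for all sets D, so it cancels between the q factors of the
  numerator and the power q of the denominator.\<close>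

lemma cavU_center:
  assumes p: "0 < p"
  obtains K where "0 < K" "\<And>D y. (\<And>i. i \<in> {1..site_bound p n r m P} \<Longrightarrow> y i \<in> signs) \<Longrightarrow>
    cU D P (center_pair t) y = K * cU D P t y"
proof -
  let ?one = "replicate p (1::real)"
  let ?s = "\<Sum>i=1..n. \<Sum>k=1..P i. snd t (k, i) ?one" and ?sh = "\<Sum>k=1..r. fst t k ?one"
  have "cU D P (center_pair t) y = exp (- ?s - ?sh) * cU D P t y"
    if y: "\<And>i. i \<in> {1..site_bound p n r m P} \<Longrightarrow> y i \<in> signs" for D y
  proof -
    have A: "(\<Sum>i=1..n. \<Sum>k=1..P i. snd (center_pair t) (k, i) (\<epsilon> i # map (\<lambda>j. y (site_code [j, i, k])) [1..<p])) =
      (\<Sum>i=1..n. \<Sum>k=1..P i. snd t (k, i) (\<epsilon> i # map (\<lambda>j. y (site_code [j, i, k])) [1..<p])) - ?s" if \<epsilon>: "\<epsilon> \<in> configs n" for \<epsilon>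
      unfolding sum_subtractf[symmetric]
    proof (intro sum.cong refl)
      fix i k assume i: "i \<in> {1..n}" and k: "k \<in> {1..P i}"
      have "\<epsilon> i \<in> signs" using \<epsilon> i by (auto simp: configs_def)
      moreover have "y (site_code [j, i, k]) \<in> signs" if "j \<in> set [1..<p]" for j
        using that i k by (intro y site_bounds) auto
      ultimately have "\<epsilon> i # map (\<lambda>j. y (site_code [j, i, k])) [1..<p] \<in> cube p"
        using p by (auto simp: cube_def)
      then show "snd (center_pair t) (k, i) (\<epsilon> i # map (\<lambda>j. y (site_code [j, i, k])) [1..<p]) =
        snd t (k, i) (\<epsilon> i # map (\<lambda>j. y (site_code [j, i, k])) [1..<p]) - snd t (k, i) ?one"
        by (simp add: center_pair_def case_prod_beta center_cube)
    qed
    have B: "(\<Sum>k=1..r. fst (center_pair t) k (map (\<lambda>j. y (site_code_hat [j, k])) [1..<Suc p])) =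
      (\<Sum>k=1..r. fst t k (map (\<lambda>j. y (site_code_hat [j, k])) [1..<Suc p])) - ?sh"
      unfolding sum_subtractf[symmetric]
    proof (intro sum.cong refl)
      fix k assume k: "k \<in> {1..r}"
      have "y (site_code_hat [j, k]) \<in> signs" if "j \<in> set [1..<Suc p]" for j
        using that k by (intro y site_bounds) auto
      then have "map (\<lambda>j. y (site_code_hat [j, k])) [1..<Suc p] \<in> cube p"
        by (auto simp: cube_def simp del: upt_Suc)
      then show "fst (center_pair t) k (map (\<lambda>j. y (site_code_hat [j, k])) [1..<Suc p]) =
        fst t k (map (\<lambda>j. y (site_code_hat [j, k])) [1..<Suc p]) - fst t k ?one"
        by (simp add: center_pair_def case_prod_beta center_cube del: upt_Suc)
    qed
    have e: "exp (x - u) = exp (- u) * exp x" for x u :: real by (simp add: exp_diff exp_minus field_simps)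
    show ?thesis
      unfolding cavU_def Av_def times_divide_eq_right sum_distrib_left B
    proof (intro arg_cong2[where f="(/)"] sum.cong refl)
      fix \<epsilon> assume \<epsilon>: "\<epsilon> \<in> configs n"
      have "exp (- ?s - ?sh) = exp (- ?s) * exp (- ?sh)" by (simp add: exp_add[symmetric])
      then show "(\<Prod>i\<in>D \<inter> {1..n}. \<epsilon> i) *
         exp (\<Sum>i=1..n. \<Sum>k=1..P i. snd (center_pair t) (k, i) (\<epsilon> i # map (\<lambda>j. y (site_code [j, i, k])) [1..<p])) *
         (\<Prod>i\<in>D \<inter> {n+1..m}. y (site_code [i])) *
         exp ((\<Sum>k=1..r. fst t k (map (\<lambda>j. y (site_code_hat [j, k])) [1..<Suc p])) - ?sh) =
        exp (- ?s - ?sh) * ((\<Prod>i\<in>D \<inter> {1..n}. \<epsilon> i) *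
         exp (\<Sum>i=1..n. \<Sum>k=1..P i. snd t (k, i) (\<epsilon> i # map (\<lambda>j. y (site_code [j, i, k])) [1..<p])) *
         (\<Prod>i\<in>D \<inter> {n+1..m}. y (site_code [i])) *
         exp (\<Sum>k=1..r. fst t k (map (\<lambda>j. y (site_code_hat [j, k])) [1..<Suc p])))"
        by (simp only: A[OF \<epsilon>] e mult.assoc mult.left_commute mult.commute)
    qed
  qed
  then show ?thesis using that[of "exp (- ?s - ?sh)"] by simp
qed

lemma lim_ratio_center:
  assumes p: "0 < p"
  shows "lim_ratio P (center_pair t) = lim_ratio P t"
proof -
  obtain K where K: "0 < K" "\<And>D y. (\<And>i. i \<in> {1..site_bound p n r m P} \<Longrightarrow> y i \<in> signs) \<Longrightarrow>
    cU D P (center_pair t) y = K * cU D P t y"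
    using cavU_center[OF p, of P t] by metis
  have sv: "savgU D P (center_pair t) w v = K * savgU D P t w v" if w: "w \<in> space unif01" and v: "v \<in> space unif_seq" for D w v
  proof -
    have "savgU D P (center_pair t) w v = (\<integral>x. \<integral>u. K * cU D P t (\<lambda>i. \<sigma> (w, u, v i, x i)) \<partial>unif01 \<partial>unif_seq)"
      unfolding savgU_def
      by (intro Bochner_Integration.integral_cong refl K(2) sigma_in_signs w v) auto
    then show ?thesis by (simp add: savgU_def)
  qed
  show ?thesis
    unfolding lim_ratio_def
  proof (rule Bochner_Integration.integral_cong[OF refl])
    fix z assume "z \<in> space (unif01 \<Otimes>\<^sub>M unif_seq)"
    then have "fst z \<in> space unif01" "snd z \<in> space unif_seq" by (auto simp: space_pair_measure)
    from sv[OF this] show "(\<Prod>l\<in>{1..q}. savgU (C l) P (center_pair t) (fst z) (snd z)) / savgU {} P (center_pair t) (fst z) (snd z) ^ q =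
      (\<Prod>l\<in>{1..q}. savgU (C l) P t (fst z) (snd z)) / savgU {} P t (fst z) (snd z) ^ q"
      using K(1) by (simp add: prod.distrib power_mult_distrib)
  qed
qed

text \<open>A change of variables: independent centered interactions are images of the original ones
  under \<open>center_pair\<close>, which the ratio ignores.\<close>

lemma lim_ratio_centered:
  assumes p: "0 < p"
  shows "(\<integral>t. lim_ratio P t \<partial>(PiM UNIV (\<lambda>_. centered) \<Otimes>\<^sub>M PiM UNIV (\<lambda>_. centered))) = (\<integral>t. lim_ratio P t \<partial>pair_law)"
proof -
  interpret cl: interaction_law centered p by (rule interaction_law_centered)
  interpret c: cavity_functionals centered p \<sigma> \<alpha> n r m q C
    by unfold_locales (use nm C in auto)
  interpret T: prob_space "PiM (UNIV :: (nat \<times> nat) set) (\<lambda>_. centered)" by (rule cl.prob_PiM_L)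
  have sf: "sigma_finite_measure (distr (PiM (UNIV :: (nat \<times> nat) set) (\<lambda>_. L)) (PiM UNIV (\<lambda>_. centered)) (\<lambda>\<theta> i. center p (\<theta> i)))"
    unfolding PiM_centered by (rule T.sigma_finite_measure_axioms)
  have d: "distr pair_law c.pair_law center_pair = c.pair_law"
    unfolding center_pair_def
    by (rule pair_measure_distr[OF measurable_PiM_center measurable_PiM_center sf, unfolded PiM_centered, symmetric])
  have m: "center_pair \<in> pair_law \<rightarrow>\<^sub>M c.pair_law"
    unfolding center_pair_def case_prod_beta
    by (intro measurable_Pair measurable_compose[OF measurable_fst measurable_PiM_center]
        measurable_compose[OF measurable_snd measurable_PiM_center])
  have "(\<integral>t. lim_ratio P t \<partial>c.pair_law) = (\<integral>t. lim_ratio P t \<partial>distr pair_law c.pair_law center_pair)" unfolding d ..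
  also have "\<dots> = (\<integral>t. lim_ratio P (center_pair t) \<partial>pair_law)"
    by (rule integral_distr[OF m c.measurable_lim_ratio])
  finally show ?thesis unfolding lim_ratio_center[OF p] .
qed

end

text \<open>The cavity argument runs for the centered law. On the way in, its replica averages are
  those of \<open>L\<close>; on the way out, \<open>lim_ratio_centered\<close> transfers the
  averaged ratio back to \<open>L\<close>.\<close>

theorem cavity_equations:
  fixes c :: "nat \<Rightarrow> real"
  assumes L: "interaction_law L p" and sym: "symmetric_interaction_law (distr L (fun_space (cube p)) (center p)) p"
    and p: "2 \<le> p" and \<alpha>: "0 < \<alpha>"
    and c: "filterlim c at_top sequentially" "(\<lambda>N. c N / real N) \<longlonglongrightarrow> 0" "(\<lambda>N. \<bar>c (Suc N) - c N\<bar>) \<longlonglongrightarrow> 0"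
    and \<mu>: "\<mu> \<in> limit_laws L p \<alpha> c" and rep: "represents \<sigma> \<mu>"
    and nm: "n \<le> m" and C: "\<And>l. l \<in> {1..q} \<Longrightarrow> C l \<subseteq> {1..m}"
  shows "(\<integral>\<omega>. (\<Prod>l=1..q. \<Prod>i\<in>C l. spin_array \<sigma> \<omega> (i, l)) \<partial>seeds) =
    (\<integral>z. (\<Prod>l=1..q. cavity_U p n r m \<sigma> (C l) z) / cavity_V p n r \<sigma> z ^ q \<partial>outer_law L p \<alpha>)"
proof -
  interpret L: interaction_law L p by (rule L)
  interpret s: symmetric_interaction_law L.centered p by (rule sym)
  interpret sp: spin_function \<sigma> using rep by unfold_locales (auto simp: represents_def)
  interpret f: cavity_functionals L p \<sigma> \<alpha> n r m q C by unfold_locales (use nm C in auto)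
  obtain S where S: "strict_mono S" and conv: "fdd_converges (\<lambda>k. array_law L p \<alpha> c (S k)) \<mu>"
    using \<mu> by (auto simp: limit_laws_def)
  have p0: "0 < p" using p by simp
  interpret cl: cavity_limit L.centered p \<alpha> c \<sigma> S n r m q C
  proof unfold_locales
    fix Q m' :: nat and g :: "nat \<Rightarrow> (nat \<Rightarrow> real) \<Rightarrow> real"
    assume loc: "\<And>l. l \<in> {1..Q} \<Longrightarrow> local_fun m' (g l)"
      and b: "\<And>l \<epsilon>. l \<in> {1..Q} \<Longrightarrow> \<epsilon> \<in> configs m' \<Longrightarrow> \<bar>g l \<epsilon>\<bar> \<le> 1"
    show "(\<lambda>k. \<integral>d. (\<Prod>l\<in>{1..Q}. gav (S k) (wt p (S k) d) (g l)) \<partial>disorder_law L.centered p \<alpha> c (S k))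
      \<longlonglongrightarrow> (\<integral>\<omega>. test_fun m' Q g (spin_array \<sigma> \<omega>) \<partial>seeds)"
    proof (rule Lim_transform_eventually[OF L.replica_limit[OF conv S rep loc b]])
      show "\<forall>\<^sub>F k in sequentially. (\<integral>d. (\<Prod>l\<in>{1..Q}. gav (S k) (wt p (S k) d) (g l)) \<partial>disorder_law L p \<alpha> c (S k)) =
        (\<integral>d. (\<Prod>l\<in>{1..Q}. gav (S k) (wt p (S k) d) (g l)) \<partial>disorder_law L.centered p \<alpha> c (S k))"
        \<comment> \<open>The inequality is strict so that the system has at least one site even for
          m' = 0.\<close>
        using eventually_gt_at_top[of m']
      proof eventually_elim
        case (elim k)
        then have N: "m' < S k" using seq_suble[OF S, of k] by simp
        have "good (S k) (\<lambda>w. \<Prod>l\<in>{1..Q}. gav (S k) w (g l))"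
        proof (rule good_gav_prod)
          fix l \<tau> assume l: "l \<in> {1..Q}" and \<tau>: "\<tau> \<in> configs (S k)"
          have "restrict \<tau> {1..m'} \<in> configs m'" using \<tau> N by (auto simp: configs_def PiE_iff)
          moreover have "g l (restrict \<tau> {1..m'}) = g l \<tau>"
            using loc[OF l] unfolding local_fun_def by (metis restrict_apply')
          ultimately show "\<bar>g l \<tau>\<bar> \<le> 1" using b[OF l] by metis
        qed
        from L.disorder_centered[OF sym this scale_inv_gav_prod p0] N show ?case by simp
      qed
    qed
  qed (use p \<alpha> c S nm C in auto)
  have "(\<integral>\<omega>. (\<Prod>l=1..q. \<Prod>i\<in>C l. spin_array \<sigma> \<omega> (i, l)) \<partial>seeds) = (\<integral>P. \<integral>t. f.lim_ratio P t \<partial>cl.pair_law \<partial>cl.pois_prod)"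
    unfolding cl.replica_moments cl.outer_cavity ..
  also have "\<dots> = (\<integral>P. \<integral>t. f.lim_ratio P t \<partial>f.pair_law \<partial>f.pois_prod)"
    unfolding f.lim_ratio_centered[OF p0] ..
  also have "\<dots> = (\<integral>z. (\<Prod>l=1..q. cavity_U p n r m \<sigma> (C l) z) / cavity_V p n r \<sigma> z ^ q \<partial>outer_law L p \<alpha>)"
    by (rule f.outer_cavity[symmetric])
  finally show ?thesis .
qed

section \<open>Symmetry of the centered interaction\<close>

text \<open>The centered interaction in closed form: the logarithm of the quotient of exp \<theta>
  at \<open>xs\<close> and at the all-one list, in which the factor a has cancelled.\<close>

definition ratio_fun :: "nat \<Rightarrow> real \<times> (nat \<Rightarrow> real \<Rightarrow> real) \<Rightarrow> interaction" where
  "ratio_fun p z = (\<lambda>xs\<in>cube p. ln ((1 + fst z * (\<Prod>j<p. snd z j (xs ! j))) / (1 + fst z * (\<Prod>j<p. snd z j 1))))"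

lemma cube_nth: "xs \<in> cube p \<Longrightarrow> j < p \<Longrightarrow> xs ! j \<in> signs"
  by (auto simp: cube_def)

lemma one_signs: "1 \<in> signs" by (simp add: signs_def)

lemma measurable_ratio_fun:
  "ratio_fun p \<in> borel \<Otimes>\<^sub>M PiM {..<p} (\<lambda>_. fun_space signs) \<rightarrow>\<^sub>M fun_space (cube p)"
proof -
  have e: "(\<lambda>z. snd z j x) \<in> borel_measurable (borel \<Otimes>\<^sub>M PiM {..<p} (\<lambda>_. fun_space signs))" if "j < p" "x \<in> signs" for j x
  proof -
    have "(\<lambda>F. F j) \<in> PiM {..<p} (\<lambda>_. fun_space signs) \<rightarrow>\<^sub>M fun_space signs"
      using that by (intro measurable_component_singleton) auto
    moreover have "(\<lambda>h. h x) \<in> borel_measurable (fun_space signs)"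
      unfolding fun_space_def using that by (intro measurable_component_singleton)
    ultimately show ?thesis using measurable_compose[OF measurable_snd] measurable_compose by blast
  qed
  show ?thesis
    unfolding ratio_fun_def[abs_def] fun_space_def[of "cube p"]
    by (intro measurable_restrict borel_measurable_ln borel_measurable_divide borel_measurable_add borel_measurable_times
        borel_measurable_const borel_measurable_prod measurable_fst e one_signs cube_nth) auto
qed

text \<open>Permuting the arguments has the same effect as permuting the functions f_j by the
  inverse permutation, and these are i.i.d. and independent of b.\<close>

lemma symmetric_ratio_law:
  assumes B: "prob_space B" and F: "prob_space F" and sets: "sets B = sets borel" "sets F = sets (fun_space signs)"
    and L: "L0 = distr (B \<Otimes>\<^sub>M PiM {..<p} (\<lambda>_. F)) (fun_space (cube p)) (ratio_fun p)"
  shows "symmetric_interaction_law L0 p"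
proof (intro symmetric_interaction_law.intro interaction_law.intro symmetric_interaction_law_axioms.intro)
  let ?Z = "B \<Otimes>\<^sub>M PiM {..<p} (\<lambda>_. F)"
  have setsZ: "sets ?Z = sets (borel \<Otimes>\<^sub>M PiM {..<p} (\<lambda>_. fun_space signs))"
    by (intro sets_pair_measure_cong sets_PiM_cong sets refl)
  have m: "ratio_fun p \<in> ?Z \<rightarrow>\<^sub>M fun_space (cube p)"
    using measurable_ratio_fun[of p] unfolding measurable_cong_sets[OF setsZ refl] .
  interpret Z: prob_space ?Z by (intro pair_prob B prob_space_PiM F)
  interpret PF: prob_space "PiM {..<p} (\<lambda>_. F)" by (intro prob_space_PiM F)
  show "prob_space L0" unfolding L by (rule Z.prob_space_distr[OF m])
  show "sets L0 = sets (fun_space (cube p))" unfolding L by simp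
  fix \<tau> assume \<tau>: "\<tau> permutes {..<p}"
  define \<rho> where "\<rho> = inv \<tau>"
  have \<rho>: "\<rho> permutes {..<p}" unfolding \<rho>_def by (rule permutes_inv[OF \<tau>])
  have \<rho>p: "\<rho> j < p" if "j < p" for j using permutes_in_image[OF \<rho>, of j] that by simp
  have \<rho>2: "(\<lambda>F. \<lambda>j\<in>{..<p}. F (\<rho> j)) \<in> PiM {..<p} (\<lambda>_. F) \<rightarrow>\<^sub>M PiM {..<p} (\<lambda>_. F)"
    using \<rho>p by (intro measurable_restrict measurable_component_singleton) auto
  let ?P = "\<lambda>\<theta> :: interaction. \<lambda>xs\<in>cube p. \<theta> (permute_list \<tau> xs)"
  let ?T = "\<lambda>z. (fst z, \<lambda>j\<in>{..<p}. snd z (\<rho> j))"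
  have T: "?T \<in> ?Z \<rightarrow>\<^sub>M ?Z"
    by (intro measurable_Pair measurable_fst measurable_compose[OF measurable_snd \<rho>2])
  have perm: "permute_list \<tau> xs \<in> cube p" if "xs \<in> cube p" for xs
    using that \<tau> by (auto simp: cube_def)
  have P: "?P \<in> fun_space (cube p) \<rightarrow>\<^sub>M fun_space (cube p)"
    unfolding fun_space_def by (intro measurable_restrict measurable_component_singleton perm)
  have swap: "?P (ratio_fun p z) = ratio_fun p (?T z)" for z
    unfolding ratio_fun_def
  proof (rule restrict_ext)
    fix xs assume xs: "xs \<in> cube p"
    have len: "length xs = p" using xs by (simp add: cube_def)
    have "(\<Prod>j<p. snd z j (permute_list \<tau> xs ! j)) = (\<Prod>j<p. snd z j (xs ! \<tau> j))"
      using \<tau> len by (intro prod.cong refl) (simp add: permute_list_nth)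
    also have "\<dots> = (\<Prod>j<p. snd z (\<rho> j) (xs ! \<tau> (\<rho> j)))"
      using prod.permute[OF \<rho>, of "\<lambda>j. snd z j (xs ! \<tau> j)"] by (simp add: comp_def)
    also have "\<dots> = (\<Prod>j<p. snd z (\<rho> j) (xs ! j))"
      by (simp add: \<rho>_def permutes_inverses[OF \<tau>])
    finally have 1: "(\<Prod>j<p. snd z j (permute_list \<tau> xs ! j)) = (\<Prod>j<p. snd z (\<rho> j) (xs ! j))" .
    have 2: "(\<Prod>j<p. snd z j 1) = (\<Prod>j<p. snd z (\<rho> j) 1)"
      using prod.permute[OF \<rho>, of "\<lambda>j. snd z j 1"] by (simp add: comp_def)
    show "(\<lambda>xs\<in>cube p. ln ((1 + fst z * (\<Prod>j<p. snd z j (xs ! j))) / (1 + fst z * (\<Prod>j<p. snd z j 1)))) (permute_list \<tau> xs) =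
      ln ((1 + fst (?T z) * (\<Prod>j<p. snd (?T z) j (xs ! j))) / (1 + fst (?T z) * (\<Prod>j<p. snd (?T z) j 1)))"
      using perm[OF xs] by (simp add: 1 2)
  qed
  have inv: "distr ?Z ?Z ?T = ?Z"
  proof -
    have "distr (PiM {..<p} (\<lambda>_. F)) (PiM {..<p} (\<lambda>_. F)) (\<lambda>G. \<lambda>j\<in>{..<p}. G (\<rho> j)) = PiM {..<p} (\<lambda>_. F)"
      using \<rho>p by (intro distr_PiM_reindex[where M="\<lambda>_. F"] F permutes_inj_on[OF \<rho>]) auto
    moreover from this have "sigma_finite_measure (distr (PiM {..<p} (\<lambda>_. F)) (PiM {..<p} (\<lambda>_. F)) (\<lambda>G. \<lambda>j\<in>{..<p}. G (\<rho> j)))"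
      by (simp add: PF.sigma_finite_measure_axioms)
    ultimately have "?Z = distr ?Z ?Z (\<lambda>(x, y). (x, \<lambda>j\<in>{..<p}. y (\<rho> j)))"
      using pair_measure_distr[of "\<lambda>x. x" B B "\<lambda>G. \<lambda>j\<in>{..<p}. G (\<rho> j)" "PiM {..<p} (\<lambda>_. F)" "PiM {..<p} (\<lambda>_. F)"] \<rho>2
      by (simp add: distr_id2)
    then show ?thesis unfolding case_prod_beta by (rule sym)
  qed
  have "distr L0 L0 ?P = distr L0 (fun_space (cube p)) ?P"
    by (rule distr_cong) (simp_all add: L)
  also have "\<dots> = distr ?Z (fun_space (cube p)) (\<lambda>z. ?P (ratio_fun p z))"
    unfolding L using distr_distr[OF P m] by (simp add: comp_def)
  also have "\<dots> = distr ?Z (fun_space (cube p)) (ratio_fun p \<circ> ?T)"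
    unfolding swap by (simp add: comp_def)
  also have "\<dots> = distr (distr ?Z ?Z ?T) (fun_space (cube p)) (ratio_fun p)"
    by (rule distr_distr[OF m T, symmetric])
  also have "\<dots> = L0" unfolding inv L ..
  finally show "distr L0 L0 ?P = L0" .
qed

section \<open>From the hypotheses on the model to a symmetric law\<close>

context prob_space
begin

text \<open>The independence of b from the whole family makes the joint law a product of two
  factors; independence and equal laws of the f_j turn the second factor into a power of one
  law.\<close>

lemma distr_indep_copies:
  fixes b :: "'a \<Rightarrow> real" and f :: "nat \<Rightarrow> 'a \<Rightarrow> real \<Rightarrow> real"
  assumes p: "0 < p" and b: "b \<in> borel_measurable M"
    and f: "indep_vars (\<lambda>_. fun_space signs) f {..<p}"
    and copies: "\<forall>j<p. distr M (fun_space signs) (f j) = distr M (fun_space signs) (f 0)"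
    and indep: "indep_set {b -` A \<inter> space M | A. A \<in> sets borel}
      {(\<lambda>\<omega>. \<lambda>j\<in>{..<p}. f j \<omega>) -` B \<inter> space M | B. B \<in> sets (\<Pi>\<^sub>M j\<in>{..<p}. fun_space signs)}"
  shows "distr M (borel \<Otimes>\<^sub>M PiM {..<p} (\<lambda>_. fun_space signs)) (\<lambda>\<omega>. (b \<omega>, \<lambda>j\<in>{..<p}. f j \<omega>)) =
    distr M borel b \<Otimes>\<^sub>M PiM {..<p} (\<lambda>_. distr M (fun_space signs) (f 0))"
    and "(\<lambda>\<omega>. (b \<omega>, \<lambda>j\<in>{..<p}. f j \<omega>)) \<in> M \<rightarrow>\<^sub>M borel \<Otimes>\<^sub>M PiM {..<p} (\<lambda>_. fun_space signs)"
proof -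
  have fm: "f j \<in> M \<rightarrow>\<^sub>M fun_space signs" if "j \<in> {..<p}" for j
    using f that unfolding indep_vars_def by blast
  let ?X = "\<lambda>\<omega>. \<lambda>j\<in>{..<p}. f j \<omega>"
  have X: "?X \<in> M \<rightarrow>\<^sub>M PiM {..<p} (\<lambda>_. fun_space signs)" by (rule measurable_restrict[OF fm])
  show "(\<lambda>\<omega>. (b \<omega>, ?X \<omega>)) \<in> M \<rightarrow>\<^sub>M borel \<Otimes>\<^sub>M PiM {..<p} (\<lambda>_. fun_space signs)"
    by (rule measurable_Pair[OF b X])
  let ?S = "PiM {..<p} (\<lambda>_. fun_space signs)"
  interpret b: prob_space "distr M borel b" by (rule prob_space_distr[OF b])
  interpret X: prob_space "distr M ?S ?X" by (rule prob_space_distr[OF X])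
  have "distr M borel b \<Otimes>\<^sub>M distr M ?S ?X = distr M (borel \<Otimes>\<^sub>M ?S) (\<lambda>\<omega>. (b \<omega>, ?X \<omega>))"
  proof (rule pair_measure_eqI[OF b.sigma_finite_measure_axioms X.sigma_finite_measure_axioms])
    show "sets (distr M borel b \<Otimes>\<^sub>M distr M ?S ?X) = sets (distr M (borel \<Otimes>\<^sub>M ?S) (\<lambda>\<omega>. (b \<omega>, ?X \<omega>)))"
      unfolding sets_distr by (intro sets_pair_measure_cong sets_distr)
    fix A B assume "A \<in> sets (distr M borel b)" "B \<in> sets (distr M ?S ?X)"
    then have A: "A \<in> sets borel" and B: "B \<in> sets ?S" by simp_all
    have "prob ((b -` A \<inter> space M) \<inter> (?X -` B \<inter> space M)) = prob (b -` A \<inter> space M) * prob (?X -` B \<inter> space M)"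
      by (rule indep_setD[OF indep]) (use A B in blast)+
    moreover have "(\<lambda>\<omega>. (b \<omega>, ?X \<omega>)) -` (A \<times> B) \<inter> space M = (b -` A \<inter> space M) \<inter> (?X -` B \<inter> space M)"
      by blast
    ultimately show "emeasure (distr M borel b) A * emeasure (distr M ?S ?X) B =
      emeasure (distr M (borel \<Otimes>\<^sub>M ?S) (\<lambda>\<omega>. (b \<omega>, ?X \<omega>))) (A \<times> B)"
      using A B by (simp only: emeasure_distr[OF b] emeasure_distr[OF X] emeasure_distr[OF measurable_Pair[OF b X]]
          pair_measureI emeasure_eq_measure ennreal_mult'' measure_nonneg)
  qed
  then have "distr M (borel \<Otimes>\<^sub>M ?S) (\<lambda>\<omega>. (b \<omega>, ?X \<omega>)) = distr M borel b \<Otimes>\<^sub>M distr M ?S ?X" ..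
  also have "distr M (PiM {..<p} (\<lambda>_. fun_space signs)) ?X = PiM {..<p} (\<lambda>j. distr M (fun_space signs) (f j))"
    using f p by (subst (asm) indep_vars_iff_distr_eq_PiM'[OF _ fm]) auto
  also have "\<dots> = PiM {..<p} (\<lambda>_. distr M (fun_space signs) (f 0))"
    by (rule PiM_cong[OF refl]) (use copies in blast)
  finally show "distr M (borel \<Otimes>\<^sub>M PiM {..<p} (\<lambda>_. fun_space signs)) (\<lambda>\<omega>. (b \<omega>, ?X \<omega>)) =
    distr M borel b \<Otimes>\<^sub>M PiM {..<p} (\<lambda>_. distr M (fun_space signs) (f 0))" .
qed

lemma symmetric_centered:
  fixes a b :: "'a \<Rightarrow> real" and f :: "nat \<Rightarrow> 'a \<Rightarrow> real \<Rightarrow> real"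
  assumes p: "0 < p" and b: "b \<in> borel_measurable M" and \<theta>: "\<theta> \<in> M \<rightarrow>\<^sub>M fun_space (cube p)"
    and f: "indep_vars (\<lambda>_. fun_space signs) f {..<p}"
    and copies: "\<forall>j<p. distr M (fun_space signs) (f j) = distr M (fun_space signs) (f 0)"
    and indep: "indep_set {b -` A \<inter> space M | A. A \<in> sets borel}
      {(\<lambda>\<omega>. \<lambda>j\<in>{..<p}. f j \<omega>) -` B \<inter> space M | B. B \<in> sets (\<Pi>\<^sub>M j\<in>{..<p}. fun_space signs)}"
    and eq: "AE \<omega> in M. \<forall>xs\<in>cube p. exp (\<theta> \<omega> xs) = a \<omega> * (1 + b \<omega> * (\<Prod>j<p. f j \<omega> (xs ! j)))"
    and small: "AE \<omega> in M. \<forall>xs\<in>cube p. \<bar>b \<omega> * (\<Prod>j<p. f j \<omega> (xs ! j))\<bar> < 1"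
  shows "interaction_law (distr M (fun_space (cube p)) \<theta>) p"
    and "symmetric_interaction_law (distr (distr M (fun_space (cube p)) \<theta>) (fun_space (cube p)) (center p)) p"
proof -
  let ?S = "borel \<Otimes>\<^sub>M PiM {..<p} (\<lambda>_. fun_space signs)"
  let ?X = "\<lambda>\<omega>. (b \<omega>, \<lambda>j\<in>{..<p}. f j \<omega>)"
  let ?L = "distr M (fun_space (cube p)) \<theta>"
  note X = distr_indep_copies[OF p b f copies indep]
  show iL: "interaction_law ?L p"
    by (rule interaction_law.intro[OF prob_space_distr[OF \<theta>] sets_distr])
  interpret L: interaction_law ?L p by (rule iL)
  have f0: "f 0 \<in> M \<rightarrow>\<^sub>M fun_space signs" using f p unfolding indep_vars_def by blast
  have center: "center p \<in> fun_space (cube p) \<rightarrow>\<^sub>M fun_space (cube p)"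
    using L.measurable_center by simp
  have "distr ?L (fun_space (cube p)) (center p) = distr M (fun_space (cube p)) (\<lambda>\<omega>. center p (\<theta> \<omega>))"
    using distr_distr[OF center \<theta>] by (simp add: comp_def)
  also have "\<dots> = distr M (fun_space (cube p)) (\<lambda>\<omega>. ratio_fun p (?X \<omega>))"
  proof (rule distr_cong_AE[OF refl refl])
    show "AE \<omega> in M. center p (\<theta> \<omega>) = ratio_fun p (?X \<omega>)"
      using eq small
    proof eventually_elim
      case (elim \<omega>)
      let ?u = "\<lambda>xs. 1 + b \<omega> * (\<Prod>j<p. f j \<omega> (xs ! j))"
      let ?one = "replicate p (1::real)"
      have one: "?one \<in> cube p" by (auto simp: cube_def signs_def)
      have u: "0 < ?u xs" if "xs \<in> cube p" for xs
        using elim(2)[rule_format, OF that] by (simp add: abs_less_iff)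
      show ?case
        unfolding center_def ratio_fun_def
      proof (rule restrict_ext)
        fix xs assume xs: "xs \<in> cube p"
        have e: "exp (\<theta> \<omega> xs) = a \<omega> * ?u xs" "exp (\<theta> \<omega> ?one) = a \<omega> * ?u ?one"
          using elim(1) xs one by blast+
        \<comment> \<open>An exponential never vanishes, so a differs from 0 and cancels in the
          quotient.\<close>
        have "a \<omega> \<noteq> 0" using e(1) exp_gt_zero[of "\<theta> \<omega> xs"] by auto
        then have "exp (\<theta> \<omega> xs - \<theta> \<omega> ?one) = ?u xs / ?u ?one"
          unfolding exp_diff e by simp
        then have "\<theta> \<omega> xs - \<theta> \<omega> ?one = ln (?u xs / ?u ?one)" using ln_exp by metis
        moreover have "?u ?one = 1 + b \<omega> * (\<Prod>j<p. f j \<omega> 1)" by simp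
        moreover have "?u xs = 1 + fst (?X \<omega>) * (\<Prod>j<p. snd (?X \<omega>) j (xs ! j))"
          "1 + b \<omega> * (\<Prod>j<p. f j \<omega> 1) = 1 + fst (?X \<omega>) * (\<Prod>j<p. snd (?X \<omega>) j 1)" by simp_all
        ultimately show "\<theta> \<omega> xs - \<theta> \<omega> ?one =
          ln ((1 + fst (?X \<omega>) * (\<Prod>j<p. snd (?X \<omega>) j (xs ! j))) / (1 + fst (?X \<omega>) * (\<Prod>j<p. snd (?X \<omega>) j 1)))"
          by (simp only:)
      qed
    qed
    show "(\<lambda>\<omega>. center p (\<theta> \<omega>)) \<in> M \<rightarrow>\<^sub>M fun_space (cube p)" by (rule measurable_compose[OF \<theta> center])
    show "(\<lambda>\<omega>. ratio_fun p (?X \<omega>)) \<in> M \<rightarrow>\<^sub>M fun_space (cube p)" by (rule measurable_compose[OF X(2) measurable_ratio_fun])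
  qed
  also have "\<dots> = distr (distr M ?S ?X) (fun_space (cube p)) (ratio_fun p)"
    using distr_distr[OF measurable_ratio_fun X(2)] by (simp add: comp_def)
  finally have L0: "distr ?L (fun_space (cube p)) (center p) =
    distr (distr M borel b \<Otimes>\<^sub>M PiM {..<p} (\<lambda>_. distr M (fun_space signs) (f 0))) (fun_space (cube p)) (ratio_fun p)"
    unfolding X(1) .
  show "symmetric_interaction_law (distr ?L (fun_space (cube p)) (center p)) p"
    by (rule symmetric_ratio_law[OF prob_space_distr[OF b] prob_space_distr[OF f0] _ _ L0]) simp_all
qed

end

text \<open>Without cavity sites the average runs over the single configuration of no spins, and all
  exponents are empty sums.\<close>

lemma cavity_U_trivial:
  assumes D: "D \<subseteq> {1..m}"
  shows "cavity_U p 0 0 m \<sigma> D z = (\<integral>y. (\<Prod>i\<in>D. spin \<sigma> z y [i]) \<partial>inner_law)"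
proof -
  have conf: "configs 0 = {\<lambda>_. undefined}" by (simp add: configs_def)
  have "D \<inter> {0+1..m} = D" using D by auto
  moreover have "cavity_B p 0 \<sigma> z y = 0" for y by (cases z) simp
  ultimately show ?thesis unfolding cavity_U_def Av_def conf by simp
qed

lemma cavity_V_trivial: "cavity_V p 0 0 \<sigma> z = 1"
proof -
  have conf: "configs 0 = {\<lambda>_. undefined}" by (simp add: configs_def)
  interpret prob_space inner_law
    unfolding inner_law_def by (intro pair_prob prob_space_PiM prob_unif01)
  have "cavity_B p 0 \<sigma> z y = 0" for y by (cases z) simp
  then show ?thesis unfolding cavity_V_def Av_def conf by (simp add: prob_space)
qed

theorem theorem1:
  fixes M :: "'a measure"
    and p n r m q :: nat
    and \<alpha> :: real
    and a b :: "'a \<Rightarrow> real"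
    and f :: "nat \<Rightarrow> 'a \<Rightarrow> real \<Rightarrow> real"
    and \<theta> :: "'a \<Rightarrow> real list \<Rightarrow> real"
    and c :: "nat \<Rightarrow> real"
    and L :: "(real list \<Rightarrow> real) measure"
    and \<mu> :: "(nat \<times> nat \<Rightarrow> real) measure"
    and \<sigma> :: "real \<times> real \<times> real \<times> real \<Rightarrow> real"
    and C :: "nat \<Rightarrow> nat set"
  assumes "prob_space M"
    and "p \<ge> 2" and "even p" and "\<alpha> > 0"
    and "a \<in> borel_measurable M" and "b \<in> borel_measurable M"
    and "\<theta> \<in> M \<rightarrow>\<^sub>M fun_space (cube p)"
    and "prob_space.indep_vars M (\<lambda>_. fun_space signs) f {..<p}"
    and "\<forall>j<p. distr M (fun_space signs) (f j) = distr M (fun_space signs) (f 0)"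
    and "prob_space.indep_set M
           {b -` A \<inter> space M | A. A \<in> sets borel}
           {(\<lambda>\<omega>. \<lambda>j\<in>{..<p}. f j \<omega>) -` B \<inter> space M | B.
              B \<in> sets (\<Pi>\<^sub>M j\<in>{..<p}. fun_space signs)}"
    and "AE \<omega> in M. \<forall>xs\<in>cube p. exp (\<theta> \<omega> xs) = a \<omega> * (1 + b \<omega> * (\<Prod>j<p. f j \<omega> (xs ! j)))"
    and "\<forall>k\<ge>1. integrable M (\<lambda>\<omega>. (- b \<omega>) ^ k) \<and> (\<integral>\<omega>. (- b \<omega>) ^ k \<partial>M) \<ge> 0"
    and "integrable M (\<lambda>\<omega>. \<bar>ln (a \<omega>)\<bar>)"
    and "AE \<omega> in M. \<forall>xs\<in>cube p. \<bar>b \<omega> * (\<Prod>j<p. f j \<omega> (xs ! j))\<bar> < 1"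
    and "integrable M (\<lambda>\<omega>. Min (\<theta> \<omega> ` cube p))"
    and "integrable M (\<lambda>\<omega>. Max (\<theta> \<omega> ` cube p))"
    and "filterlim c at_top sequentially"
    and "(\<lambda>N. c N / real N) \<longlonglongrightarrow> 0"
    and "(\<lambda>N. \<bar>c (Suc N) - c N\<bar>) \<longlonglongrightarrow> 0"
    and "L = distr M (fun_space (cube p)) \<theta>"
    and "\<mu> \<in> limit_laws L p \<alpha> c"
    and "represents \<sigma> \<mu>"
    and "m \<ge> 1" and "q \<ge> 1" and "n \<le> m"
    and "\<forall>l\<in>{1..q}. C l \<subseteq> {1..m}"
  shows "(\<integral>\<omega>. (\<Prod>l=1..q. \<Prod>i\<in>C l. spin_array \<sigma> \<omega> (i, l)) \<partial>seeds) =
           (\<integral>z. (\<Prod>l=1..q. \<integral>y. (\<Prod>i\<in>C l. spin \<sigma> z y [i]) \<partial>inner_law) \<partial>outer_law L p \<alpha>)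
       \<and> (\<integral>z. (\<Prod>l=1..q. \<integral>y. (\<Prod>i\<in>C l. spin \<sigma> z y [i]) \<partial>inner_law) \<partial>outer_law L p \<alpha>) =
           (\<integral>z. (\<Prod>l=1..q. cavity_U p n r m \<sigma> (C l) z) / cavity_V p n r \<sigma> z ^ q \<partial>outer_law L p \<alpha>)"
proof -
  have p: "0 < p" using \<open>p \<ge> 2\<close> by simp
  note laws = prob_space.symmetric_centered[OF \<open>prob_space M\<close> p assms(6-11,14), folded \<open>L = _\<close>]
  have C: "C l \<subseteq> {1..m}" if "l \<in> {1..q}" for l using assms(26) that by blast
  have moments: "(\<integral>\<omega>. (\<Prod>l=1..q. \<Prod>i\<in>C l. spin_array \<sigma> \<omega> (i, l)) \<partial>seeds) =
    (\<integral>z. (\<Prod>l=1..q. cavity_U p n' r' m \<sigma> (C l) z) / cavity_V p n' r' \<sigma> z ^ q \<partial>outer_law L p \<alpha>)" if "n' \<le> m" for n' r'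
    by (rule cavity_equations[OF laws assms(2,4,17-19,21,22) that C])
  \<comment> \<open>For n = r = 0 the right-hand side of \<open>moments\<close> is the middle
    expression of the theorem, so both equalities follow from instances of
    \<open>moments\<close>.\<close>
  have "(\<Prod>l=1..q. cavity_U p 0 0 m \<sigma> (C l) z) / cavity_V p 0 0 \<sigma> z ^ q =
    (\<Prod>l=1..q. \<integral>y. (\<Prod>i\<in>C l. spin \<sigma> z y [i]) \<partial>inner_law)" for z
    unfolding cavity_V_trivial by (simp only: power_one div_by_1) (intro prod.cong refl cavity_U_trivial C)
  then show ?thesis using moments[of 0 0] moments[of n r] \<open>n \<le> m\<close> by simp
qed

end
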